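(* Let $\bar p>2$. Assume the following. (1) Exponential family. (a) There exist continuous functions $\phi:\Theta\to\mathbb{R}$, $\psi:\Theta\to\mathbb{R}^d$ and $S:\mathbb{X}\times\mathbb{X}\times\mathbb{Y}\to\mathbb{R}^d$ such that $\log m_\theta(x,x')+\log g_\theta(x',y)=\phi(\theta)+\langle S(x,x',y),\psi(\theta)\rangle$ for all $\theta,x,x',y$. (b) There is an open set $\mathcal{S}\subset\mathbb{R}^d$ containing the convex hull of $S(\mathbb{X}\times\mathbb{X}\times\mathbb{Y})$. (c) There is a continuous function $\bar\theta:\mathcal{S}\to\Theta$ such that for every $s\in\mathcal{S}$, $\bar\theta(s)$ is the unique maximizer over $\Theta$ of $\theta\mapsto\phi(\theta)+\langle s,\psi(\theta)\rangle$. (2) Strong mixing. There exist $\sigma_-,\sigma_+$ with $0<\sigma_-\le m_\theta(x,x')\le\sigma_+$ for all $(x,x')\in\mathbb{X}^2$, $\theta\in\Theta$. (3) Moments. $\mathbb{E}\big[\sup_{(x,x')\in\mathbb{X}^2}|S(x,x',Y_0)|^{\bar p}\big]<\infty$. (4) Observations. (a) $\mathbf{Y}$ is stationary and there exist $C_0\in[0,1)$ and $\beta\in(0,1)$ with $\beta^{\mathbf{Y}}(n)\le C_0\beta^n$ for all $n\ge0$. (b) $\mathbb{E}[|\log b_-(Y_0)|+|\log b_+(Y_0)|]<\infty$, where $b_-(y)=\inf_{\theta\in\Theta}\int g_\theta(x,y)\lambda(\mathrm{d}x)$ and $b_+(y)=\sup_{\theta\in\Theta}\int g_\theta(x,y)\lambda(\mathrm{d}x)$.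 (5) Block sizes. There exist $c>0$ and $a>1$ with $\tau_n=\lfloor cn^a\rfloor$ for all $n\ge1$. (6) Monte Carlo error. There exists $b\ge(a+1)/(2a)$ such that $\|S_n-\widetilde S_n\|_{\bar p}=O(\tau_{n+1}^{-b})$. (7) Stable fixed point. $\theta_\star\in\Theta$ satisfies $\bar\theta(\bar{\mathrm S}(\theta_\star))=\theta_\star$; $\bar{\mathrm S}$ and $\bar\theta$ are twice continuously differentiable on $\Theta$ and $\mathcal{S}$ respectively; and there exists $0<\gamma<1$ such that the spectral radius of the Jacobian $\nabla_s(\bar{\mathrm S}\circ\bar\theta)$ at $s=\bar{\mathrm S}(\theta_\star)$ is lower than $\gamma$. Then for any $p\in(2,\bar p)$, $$\sqrt{\tau_n}\,[\theta_n-\theta_\star]\,\mathbf{1}_{\lim_n\theta_n=\theta_\star}=O_{\mathrm{L}_p}(1)+\frac{1}{\sqrt{\tau_n}}\,O_{\mathrm{L}_{p/2}}(1)\,O_{\mathrm{a.s.}}(1).$$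
   Context: For random variables $Z_n$: $Z_n=O_{\mathrm{L}_p}(1)$ means $\sup_n\mathbb{E}[|Z_n|^p]<\infty$, and $Z_n=O_{\mathrm{a.s.}}(1)$ means $\sup_n|Z_n|<\infty$ $\mathbb{P}$-a.s. An identity such as $X_n=O_{\mathrm{L}_p}(1)+\epsilon_n\,O_{\mathrm{L}_{p/2}}(1)\,O_{\mathrm{a.s.}}(1)$ means $X_n=U_n+\epsilon_nV_nA_n$ for some sequences with $U_n=O_{\mathrm{L}_p}(1)$, $V_n=O_{\mathrm{L}_{p/2}}(1)$ and $A_n=O_{\mathrm{a.s.}}(1)$. Model. $\Theta$ is a compact subset of $\mathbb{R}^{d_\theta}$; $(\mathbb{X},\mathcal{X})$ and $(\mathbb{Y},\mathcal{Y})$ are general state spaces with their $\sigma$-fields (and topologies, with respect to which continuity is understood); $\lambda$ is a finite measure on $(\mathbb{X},\mathcal{X})$ and $\mu$ a $\sigma$-finite measure on $(\mathbb{Y},\mathcal{Y})$. For $\theta\in\Theta$, $m_\theta(x,\cdot)$ is a Markov transition density with respect to $\lambda$ and $g_\theta(x,\cdot)$ is a transition density from $\mathbb{X}$ to $\mathbb{Y}$ with respect to $\mu$. Observations. $\mathbf{Y}=\{Y_k\}_{k\in\mathbb{Z}}$ is a $\mathbb{Y}$-valued process on a probability space $(\Omega,\mathcal{F},\mathbb{P})$, not necessarily the observation process of a hidden Markov model with state transition density $m_\theta$ and observation density $g_\theta$ for some $\theta\in\Theta$; $\mathbb{E}$ is expectation under $\mathbb{P}$ and $\|Z\|_p=(\mathbb{E}|Z|^p)^{1/p}$.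 With $\mathcal{F}^{\mathbf{Y}}_k=\sigma(Y_u,u\le k)$ and $\mathcal{G}^{\mathbf{Y}}_k=\sigma(Y_u,u\ge k)$, the $\beta$-mixing coefficients are $\beta^{\mathbf{Y}}(n)=\sup_{u\in\mathbb{Z}}\mathbb{E}\big[\operatorname{ess\,sup}_{B\in\mathcal{G}^{\mathbf{Y}}_{u+n}}|\mathbb{P}(B|\mathcal{F}^{\mathbf{Y}}_u)-\mathbb{P}(B)|\big]$. Smoothing. For a probability distribution $\chi$ on $\mathbb{X}$, integers $r<s\le t$, $\mathbf{y}\in\mathbb{Y}^{\mathbb{Z}}$ and a function $h$ on $\mathbb{X}^2\times\mathbb{Y}$, $$\Phi^{\chi,r}_{\theta,s,t}(h,\mathbf{y})=\frac{\int\chi(\mathrm{d}x_r)\prod_{i=r}^{t-1}\{m_\theta(x_i,x_{i+1})g_\theta(x_{i+1},y_{i+1})\}\,h(x_{s-1},x_s,y_s)\,\lambda(\mathrm{d}x_{r+1:t})}{\int\chi(\mathrm{d}x_r)\prod_{i=r}^{t-1}\{m_\theta(x_i,x_{i+1})g_\theta(x_{i+1},y_{i+1})\}\,\lambda(\mathrm{d}x_{r+1:t})}.$$ For integers $T\ge 0$, $\tau\ge1$: $\bar S^{\chi,T}_\tau(\theta,\mathbf{Y})=\frac1\tau\sum_{t=T+1}^{T+\tau}\Phi^{\chi,T}_{\theta,t,T+\tau}(S,\mathbf{Y})$. Under hypotheses (1)-(4), $\Phi^{\chi,-\tau-1}_{\theta,0,\tau}(S,\mathbf{Y})$ converges $\mathbb{P}$-a.s.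 as $\tau\to\infty$ to a random variable $\mathsf{S}(\theta,\mathbf{Y})$ not depending on $\chi$, and $\bar{\mathrm S}(\theta):=\mathbb{E}[\mathsf{S}(\theta,\mathbf{Y})]$. Block Online EM (BOEM) algorithm with Monte Carlo approximation. $\{\tau_n\}_{n\ge1}$ is the sequence of block sizes (positive integers), $T_0=0$, $T_n=\sum_{k=1}^n\tau_k$, $\{\chi_n\}_{n\ge0}$ are probability distributions on $\mathbb{X}$. Given $\theta_0\in\Theta$, for $n\ge0$: $S_n=\bar S^{\chi_n,T_n}_{\tau_{n+1}}(\theta_n,\mathbf{Y})$, $\widetilde S_n$ is an $\mathcal{S}$-valued Monte Carlo approximation of $S_n$, and $\theta_{n+1}=\bar\theta(\widetilde S_n)$. There is a nondecreasing family of $\sigma$-algebras $\mathcal{H}_{T_n}$ (generated by the simulation random variables), independent of $\mathbf{Y}$, such that with $\widetilde{\mathcal F}_{T_n}=\sigma(\mathcal{F}^{\mathbf{Y}}_{T_n},\mathcal{H}_{T_n})$, $\theta_n$ is $\widetilde{\mathcal F}_{T_n}$-measurable and $\widetilde S_n$ is $\widetilde{\mathcal F}_{T_{n+1}}$-measurable. *)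

theory Defs
  imports
    "HOL-Probability.Probability"
    "HOL-Library.Landau_Symbols"
    "Jordan_Normal_Form.Spectral_Radius"
begin

section \<open>Regularity and spectral radius\<close>

text \<open>On a set that need not be open (such as a compact parameter set), twice continuous
  differentiability means existence of a \<open>C\<^sup>2\<close> extension to an open neighbourhood; for an open
  set this is the usual notion.\<close>

definition twice_continuously_differentiable_on ::
    "('a::euclidean_space \<Rightarrow> 'b::euclidean_space) \<Rightarrow> 'a set \<Rightarrow> bool" where
  "twice_continuously_differentiable_on f A \<longleftrightarrow>
     (\<exists>U F F' F''. open U \<and> A \<subseteq> U \<and> (\<forall>x\<in>A. F x = f x) \<and>
        (\<forall>x\<in>U. (F has_derivative blinfun_apply (F' x)) (at x)) \<and>
        (\<forall>x\<in>U. (F' has_derivative blinfun_apply (F'' x)) (at x)) \<and>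
        continuous_on U (F'' :: 'a \<Rightarrow> 'a \<Rightarrow>\<^sub>L 'a \<Rightarrow>\<^sub>L 'b))"

text \<open>A square matrix over a finite index type is turned into a complex matrix with indices
  \<open>0, \<dots>, d - 1\<close>, so that the spectral radius is the largest modulus of a complex eigenvalue;
  the enumeration of the index type is immaterial.\<close>

definition complex_mat_of :: "real^'d^'d \<Rightarrow> complex mat" where
  "complex_mat_of A = Matrix.mat CARD('d) CARD('d)
     (\<lambda>(i, j). complex_of_real (vec_nth (vec_nth A (from_nat_into UNIV i)) (from_nat_into UNIV j)))"

definition jacobian_matrix :: "(real^'d \<Rightarrow> real^'d) \<Rightarrow> real^'d \<Rightarrow> real^'d^'d" where
  "jacobian_matrix f s = matrix (frechet_derivative f (at s))"


section \<open>Stochastic boundedness\<close>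

definition Lp_norm :: "'w measure \<Rightarrow> real \<Rightarrow> ('w \<Rightarrow> 'v::euclidean_space) \<Rightarrow> real" where
  "Lp_norm P p Z = (\<integral>\<omega>. norm (Z \<omega>) powr p \<partial>P) powr (1 / p)"

text \<open>Sequences of random variables are indexed by \<open>n \<ge> 1\<close>; the value at \<open>0\<close> is irrelevant.\<close>

definition bigO_Lp :: "'w measure \<Rightarrow> real \<Rightarrow> (nat \<Rightarrow> 'w \<Rightarrow> 'v::euclidean_space) \<Rightarrow> bool" where
  "bigO_Lp P p Z \<longleftrightarrow> (\<forall>n\<ge>1. Z n \<in> borel_measurable P) \<and>
     (SUP n\<in>{1..}. \<integral>\<^sup>+\<omega>. ennreal (norm (Z n \<omega>) powr p) \<partial>P) < \<infinity>"

definition bigO_as :: "'w measure \<Rightarrow> (nat \<Rightarrow> 'w \<Rightarrow> 'v::euclidean_space) \<Rightarrow> bool" where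
  "bigO_as P Z \<longleftrightarrow> (\<forall>n\<ge>1. Z n \<in> borel_measurable P) \<and>
     (AE \<omega> in P. bdd_above ((\<lambda>n. norm (Z n \<omega>)) ` {1..}))"


section \<open>Observations and mixing\<close>

definition sigma_obs ::
    "'w measure \<Rightarrow> 'y measure \<Rightarrow> (int \<Rightarrow> 'w \<Rightarrow> 'y) \<Rightarrow> int set \<Rightarrow> 'w measure" where
  "sigma_obs P MY Y K =
     sigma (space P) (\<Union>k\<in>K. {Y k -` A \<inter> space P | A. A \<in> sets MY})"

text \<open>Only the \<open>\<sigma>\<close>-field of \<open>MY\<close> matters below, not its measure.\<close>

definition stationary_process ::
    "'w measure \<Rightarrow> 'y measure \<Rightarrow> (int \<Rightarrow> 'w \<Rightarrow> 'y) \<Rightarrow> bool" where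
  "stationary_process P MY Y \<longleftrightarrow>
     (\<forall>h::int. distr P (PiM UNIV (\<lambda>_. MY)) (\<lambda>\<omega> k. Y (k + h) \<omega>)
             = distr P (PiM UNIV (\<lambda>_. MY)) (\<lambda>\<omega> k. Y k \<omega>))"

text \<open>The essential supremum of a possibly uncountable family of random variables: the almost
  surely least random variable that dominates each member almost surely. (The library's
  \<^const>\<open>esssup\<close> is that of a single function.)\<close>

definition is_ess_sup_family ::
    "'w measure \<Rightarrow> 'i set \<Rightarrow> ('i \<Rightarrow> 'w \<Rightarrow> ennreal) \<Rightarrow> ('w \<Rightarrow> ennreal) \<Rightarrow> bool" where
  "is_ess_sup_family P I f Z \<longleftrightarrow>
     Z \<in> borel_measurable P \<and> (\<forall>i\<in>I. AE \<omega> in P. f i \<omega> \<le> Z \<omega>) \<and>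
     (\<forall>W\<in>borel_measurable P. (\<forall>i\<in>I. AE \<omega> in P. f i \<omega> \<le> W \<omega>) \<longrightarrow> (AE \<omega> in P. Z \<omega> \<le> W \<omega>))"

definition ess_sup_family ::
    "'w measure \<Rightarrow> 'i set \<Rightarrow> ('i \<Rightarrow> 'w \<Rightarrow> ennreal) \<Rightarrow> 'w \<Rightarrow> ennreal" where
  "ess_sup_family P I f = (SOME Z. is_ess_sup_family P I f Z)"

definition beta_mixing ::
    "'w measure \<Rightarrow> 'y measure \<Rightarrow> (int \<Rightarrow> 'w \<Rightarrow> 'y) \<Rightarrow> nat \<Rightarrow> ennreal" where
  "beta_mixing P MY Y n =
     (SUP u::int. \<integral>\<^sup>+\<omega>. ess_sup_family P (sets (sigma_obs P MY Y {u + int n..}))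
        (\<lambda>B \<omega>'. ennreal \<bar>real_cond_exp P (sigma_obs P MY Y {..u}) (indicat_real B) \<omega>' - measure P B\<bar>)
        \<omega> \<partial>P)"


section \<open>Model\<close>

definition transition_density ::
    "'a measure \<Rightarrow> 'b measure \<Rightarrow> ('a \<Rightarrow> 'b \<Rightarrow> real) \<Rightarrow> bool" where
  "transition_density MA MB k \<longleftrightarrow>
     case_prod k \<in> borel_measurable (MA \<Otimes>\<^sub>M MB) \<and>
     (\<forall>x\<in>space MA. (\<forall>z\<in>space MB. 0 \<le> k x z) \<and> (\<integral>\<^sup>+z. ennreal (k x z) \<partial>MB) = 1)"

definition prob_on :: "'x measure \<Rightarrow> 'x measure \<Rightarrow> bool" where
  "prob_on M chi \<longleftrightarrow> prob_space chi \<and> sets chi = sets M"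

text \<open>Extended logarithm \<open>[0, \<infinity>] \<rightarrow> [-\<infinity>, \<infinity>]\<close>.\<close>

definition ln_ennreal :: "ennreal \<Rightarrow> ereal" where
  "ln_ennreal u = (if u = 0 then -\<infinity> else if u = \<infinity> then \<infinity> else ereal (ln (enn2real u)))"

definition b_minus ::
    "'q set \<Rightarrow> ('q \<Rightarrow> 'x \<Rightarrow> 'y \<Rightarrow> real) \<Rightarrow> 'x measure \<Rightarrow> 'y \<Rightarrow> ennreal" where
  "b_minus \<Theta> g lam y = (INF \<theta>\<in>\<Theta>. \<integral>\<^sup>+x. ennreal (g \<theta> x y) \<partial>lam)"

definition b_plus ::
    "'q set \<Rightarrow> ('q \<Rightarrow> 'x \<Rightarrow> 'y \<Rightarrow> real) \<Rightarrow> 'x measure \<Rightarrow> 'y \<Rightarrow> ennreal" where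
  "b_plus \<Theta> g lam y = (SUP \<theta>\<in>\<Theta>. \<integral>\<^sup>+x. ennreal (g \<theta> x y) \<partial>lam)"


section \<open>Smoothing\<close>

text \<open>The measure \<open>chi(dx\<^sub>r) \<lambda>(dx\<^sub>r\<^sub>+\<^sub>1) \<dots> \<lambda>(dx\<^sub>t)\<close>.\<close>

definition path_measure :: "'x measure \<Rightarrow> 'x measure \<Rightarrow> int \<Rightarrow> int \<Rightarrow> (int \<Rightarrow> 'x) measure" where
  "path_measure lam chi r t = PiM {r..t} (\<lambda>i. if i = r then chi else lam)"

definition path_density ::
    "('q \<Rightarrow> 'x \<Rightarrow> 'x \<Rightarrow> real) \<Rightarrow> ('q \<Rightarrow> 'x \<Rightarrow> 'y \<Rightarrow> real) \<Rightarrow> 'q \<Rightarrow> int \<Rightarrow> int \<Rightarrow>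
     (int \<Rightarrow> 'y) \<Rightarrow> (int \<Rightarrow> 'x) \<Rightarrow> real" where
  "path_density m g \<theta> r t y x =
     (\<Prod>i\<in>{r..t - 1}. m \<theta> (x i) (x (i + 1)) * g \<theta> (x (i + 1)) (y (i + 1)))"

definition smoothing ::
    "('q \<Rightarrow> 'x \<Rightarrow> 'x \<Rightarrow> real) \<Rightarrow> ('q \<Rightarrow> 'x \<Rightarrow> 'y \<Rightarrow> real) \<Rightarrow> 'x measure \<Rightarrow>
     'x measure \<Rightarrow> int \<Rightarrow> 'q \<Rightarrow> int \<Rightarrow> int \<Rightarrow>
     ('x \<times> 'x \<times> 'y \<Rightarrow> 'v::euclidean_space) \<Rightarrow> (int \<Rightarrow> 'y) \<Rightarrow> 'v" where
  "smoothing m g lam chi r \<theta> s t h y =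
     (\<integral>x. path_density m g \<theta> r t y x *\<^sub>R h (x (s - 1), x s, y s) \<partial>path_measure lam chi r t)
     /\<^sub>R (\<integral>x. path_density m g \<theta> r t y x \<partial>path_measure lam chi r t)"

definition block_statistic ::
    "('q \<Rightarrow> 'x \<Rightarrow> 'x \<Rightarrow> real) \<Rightarrow> ('q \<Rightarrow> 'x \<Rightarrow> 'y \<Rightarrow> real) \<Rightarrow> 'x measure \<Rightarrow>
     ('x \<times> 'x \<times> 'y \<Rightarrow> 'v::euclidean_space) \<Rightarrow>
     'x measure \<Rightarrow> nat \<Rightarrow> nat \<Rightarrow> 'q \<Rightarrow> (int \<Rightarrow> 'y) \<Rightarrow> 'v" where
  "block_statistic m g lam S chi T \<tau> \<theta> y =
     (1 / real \<tau>) *\<^sub>R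
     (\<Sum>t\<in>{int T + 1..int T + int \<tau>}. smoothing m g lam chi (int T) \<theta> t (int T + int \<tau>) S y)"

text \<open>The almost sure limit, common to all initial distributions \<open>chi\<close>, of the two-sided smoothed
  statistic at time \<open>0\<close>; it is determined up to almost sure equality.\<close>

definition limit_statistic ::
    "('q \<Rightarrow> 'x \<Rightarrow> 'x \<Rightarrow> real) \<Rightarrow> ('q \<Rightarrow> 'x \<Rightarrow> 'y \<Rightarrow> real) \<Rightarrow> 'x measure \<Rightarrow>
     ('x \<times> 'x \<times> 'y \<Rightarrow> 'v::euclidean_space) \<Rightarrow>
     'w measure \<Rightarrow> (int \<Rightarrow> 'w \<Rightarrow> 'y) \<Rightarrow> 'q \<Rightarrow> 'w \<Rightarrow> 'v" where
  "limit_statistic m g lam S P Y \<theta> =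
     (SOME Z. Z \<in> borel_measurable P \<and>
        (\<forall>chi. prob_on lam chi \<longrightarrow>
           (AE \<omega> in P. (\<lambda>\<tau>::nat. smoothing m g lam chi (- int \<tau> - 1) \<theta> 0 (int \<tau>) S (\<lambda>k. Y k \<omega>))
                          \<longlonglongrightarrow> Z \<omega>)))"

definition mean_statistic ::
    "('q \<Rightarrow> 'x \<Rightarrow> 'x \<Rightarrow> real) \<Rightarrow> ('q \<Rightarrow> 'x \<Rightarrow> 'y \<Rightarrow> real) \<Rightarrow> 'x measure \<Rightarrow>
     ('x \<times> 'x \<times> 'y \<Rightarrow> 'v::euclidean_space) \<Rightarrow>
     'w measure \<Rightarrow> (int \<Rightarrow> 'w \<Rightarrow> 'y) \<Rightarrow> 'q \<Rightarrow> 'v" where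
  "mean_statistic m g lam S P Y \<theta> = (\<integral>\<omega>. limit_statistic m g lam S P Y \<theta> \<omega> \<partial>P)"


section \<open>Block Online EM\<close>

definition block_end :: "(nat \<Rightarrow> nat) \<Rightarrow> nat \<Rightarrow> nat" where
  "block_end \<tau> n = (\<Sum>k=1..n. \<tau> k)"

text \<open>The \<open>\<sigma>\<close>-field generated by the observations up to the end of block \<open>n\<close> and the simulation
  variables used so far, whose \<open>\<sigma>\<close>-field is \<open>H n\<close>.\<close>

definition mc_filtration ::
    "'w measure \<Rightarrow> 'y measure \<Rightarrow> (int \<Rightarrow> 'w \<Rightarrow> 'y) \<Rightarrow> (nat \<Rightarrow> 'w measure) \<Rightarrow> (nat \<Rightarrow> nat) \<Rightarrow>
     nat \<Rightarrow> 'w measure" where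
  "mc_filtration P MY Y H \<tau> n =
     sigma (space P) (sets (sigma_obs P MY Y {..int (block_end \<tau> n)}) \<union> sets (H n))"

end

(*
  Let e_n be the difference between the Monte Carlo statistic of block n and the mean statistic at theta_n,
  and let G be the composition of the mean statistic with the maximiser. The statistics then follow the
  perturbed recursion s_{n+1} = G(s_n) + e_n. Doeblin's argument makes the smoothed statistics forget distant
  observations at a geometric rate, so beta-mixing turns the terms of a block into a mixingale, and a
  Burkholder-type inequality gives norm(e_n)_p = O(tau_{n+1}^(-1/2)) uniformly over the random parameter.
  In a norm adapted to the derivative at the fixed point G is a local contraction. On paths that converge to
  the fixed point the error is therefore, from a random time on, at most a transient plus the discounted sum of
  the norm(e_k), whose rescaling by tau_n^(1/2) is bounded in L_p. The finitely many earlier terms go into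
  the O_a.s. factor.
*)

theory Submission
  imports Defs "HOL-Real_Asymp.Real_Asymp"
begin

section \<open>Moment inequalities\<close>

text \<open>Two obstacles shape the proof. First, the parameter of a block is random and depends on
  all earlier observations, so a moment bound at each fixed parameter does not suffice. Every
  conditional estimate is therefore dominated by one variable that does not depend on the parameter.
  Such a bound survives when the parameter takes finitely many values on disjoint past events, with
  a constant that ignores their number, and then passes to the limit. Secondly, the fixed point of
  the perturbed recursion must lie in \<S>, where the maximiser can be differentiated. \<S> contains
  the convex hull of the values of \<open>S\<close> but perhaps not its closure, while the mean
  statistic arises as a limit of averages. Comparing the smoothing law with a product measure closes
  this gap. The room between \<open>p\<close> and \<open>pbar\<close> pays for truncating the
  envelope of \<open>S\<close> in the mixing inequality. The growth of the blocks enters twice: it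
  makes the errors tend to 0 almost surely, so that convergence of the parameters carries over to
  the statistics, and it is only polynomial, so that the geometric discount beats the
  rescaling.\<close>

definition Lp_le :: "'a measure \<Rightarrow> real \<Rightarrow> ('a \<Rightarrow> real) \<Rightarrow> real \<Rightarrow> bool" where
  "Lp_le M p f w \<longleftrightarrow> f \<in> borel_measurable M \<and> 0 \<le> w \<and>
     (\<integral>\<^sup>+x. ennreal (\<bar>f x\<bar> powr p) \<partial>M) \<le> ennreal (w powr p)"

lemma Lp_leD:
  assumes "Lp_le M p f w"
  shows "f \<in> borel_measurable M" "0 \<le> w" "(\<integral>\<^sup>+x. ennreal (\<bar>f x\<bar> powr p) \<partial>M) \<le> ennreal (w powr p)"
  using assms by (auto simp: Lp_le_def)

text \<open>\<open>Lp_le\<close> bounds a nonnegative integral, since the Bochner integral of a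
  non-integrable function is 0 and a bound on it would say nothing. Here finiteness is turned back
  into integrability.\<close>

lemma Lp_le_integrable:
  assumes "Lp_le M p f w"
  shows "integrable M (\<lambda>x. \<bar>f x\<bar> powr p)" "(\<integral>x. \<bar>f x\<bar> powr p \<partial>M) \<le> w powr p"
proof -
  note [measurable] = Lp_leD(1)[OF assms]
  show i: "integrable M (\<lambda>x. \<bar>f x\<bar> powr p)"
    by (rule integrableI_bounded) (use Lp_leD(3)[OF assms] in \<open>auto intro: le_less_trans\<close>)
  have "ennreal (\<integral>x. \<bar>f x\<bar> powr p \<partial>M) \<le> ennreal (w powr p)"
    using Lp_leD(3)[OF assms] by (subst (asm) nn_integral_eq_integral[OF i]) auto
  then show "(\<integral>x. \<bar>f x\<bar> powr p \<partial>M) \<le> w powr p" by (simp add: ennreal_le_iff)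
qed

lemma Lp_leI_integral:
  assumes "f \<in> borel_measurable M" "0 \<le> w" "integrable M (\<lambda>x. \<bar>f x\<bar> powr p)"
    "(\<integral>x. \<bar>f x\<bar> powr p \<partial>M) \<le> w powr p"
  shows "Lp_le M p f w"
  unfolding Lp_le_def using assms by (auto simp: nn_integral_eq_integral intro: ennreal_leI)

lemma Lp_le_mono_AE:
  assumes "Lp_le M p f w" "g \<in> borel_measurable M" "AE x in M. \<bar>g x\<bar> \<le> \<bar>f x\<bar>" "w \<le> w'" "0 < p"
  shows "Lp_le M p g w'"
proof -
  have "(\<integral>\<^sup>+x. ennreal (\<bar>g x\<bar> powr p) \<partial>M) \<le> (\<integral>\<^sup>+x. ennreal (\<bar>f x\<bar> powr p) \<partial>M)"
    using assms(3) by (intro nn_integral_mono_AE) (auto elim!: eventually_mono intro!: ennreal_leI powr_mono2 simp: assms(5) less_imp_le)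
  also have "\<dots> \<le> ennreal (w powr p)" using Lp_leD(3)[OF assms(1)] .
  also have "\<dots> \<le> ennreal (w' powr p)"
    using assms(4,5) Lp_leD(2)[OF assms(1)] by (intro ennreal_leI powr_mono2) auto
  finally show ?thesis using assms(2,4) Lp_leD(2)[OF assms(1)] by (auto simp: Lp_le_def)
qed

lemma Lp_le_cmult:
  assumes "Lp_le M p f w" "0 < p"
  shows "Lp_le M p (\<lambda>x. c * f x) (\<bar>c\<bar> * w)"
proof -
  note [measurable] = Lp_leD(1)[OF assms(1)]
  have "(\<integral>\<^sup>+x. ennreal (\<bar>c * f x\<bar> powr p) \<partial>M) = (\<integral>\<^sup>+x. ennreal (\<bar>c\<bar> powr p) * ennreal (\<bar>f x\<bar> powr p) \<partial>M)"
    by (intro nn_integral_cong) (simp add: abs_mult powr_mult ennreal_mult)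
  also have "\<dots> = ennreal (\<bar>c\<bar> powr p) * (\<integral>\<^sup>+x. ennreal (\<bar>f x\<bar> powr p) \<partial>M)"
    by (rule nn_integral_cmult) measurable
  also have "\<dots> \<le> ennreal (\<bar>c\<bar> powr p) * ennreal (w powr p)"
    by (intro mult_left_mono Lp_leD(3)[OF assms(1)]) simp
  also have "\<dots> = ennreal ((\<bar>c\<bar> * w) powr p)"
    using Lp_leD(2)[OF assms(1)] by (simp add: powr_mult ennreal_mult)
  finally show ?thesis using Lp_leD(2)[OF assms(1)] by (auto simp: Lp_le_def)
qed

text \<open>Convexity of x^p at the points a/u and b/v with weights u/(u+v) and v/(u+v). With
  \<open>u\<close> and \<open>v\<close> the two norm bounds, its integral is Minkowski's inequality.
  A zero argument is treated apart because the convexity fact lives on the open half-line.\<close>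

lemma powr_add_le_weighted:
  fixes a b u v p :: real
  assumes "0 \<le> a" "0 \<le> b" "0 < u" "0 < v" "1 \<le> p"
  shows "(a + b) powr p \<le> (u + v) powr p * (u / (u + v) * (a / u) powr p + v / (u + v) * (b / v) powr p)"
proof (cases "a = 0 \<or> b = 0")
  case True
  have zero: "c powr p \<le> (s + t) powr p * (t / (s + t) * (c / t) powr p)" if "0 \<le> c" "0 < s" "0 < t" for c s t :: real
  proof -
    have "t powr (p - 1) \<le> (s + t) powr (p - 1)" using that assms(5) by (intro powr_mono2) auto
    then have "c powr p * t powr (p - 1) \<le> c powr p * (s + t) powr (p - 1)" by (intro mult_left_mono) auto
    then have "c powr p \<le> c powr p * (s + t) powr (p - 1) / t powr (p - 1)"
      using that by (simp add: pos_le_divide_eq)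
    also have "\<dots> = (s + t) powr p * (t / (s + t) * (c / t) powr p)"
      using that by (simp add: powr_divide powr_diff)
    finally show ?thesis .
  qed
  show ?thesis using True
  proof
    assume "a = 0" then show ?thesis using zero[of b u v] assms by simp
  next
    assume "b = 0" then show ?thesis using zero[of a v u] assms by (simp add: add.commute)
  qed
next
  case False
  have cvx: "convex_on {0<..} (\<lambda>x::real. x powr p)" using powr_convex[OF assms(5)] .
  have "(u / (u + v) * (a / u) + v / (u + v) * (b / v)) powr p
      \<le> u / (u + v) * (a / u) powr p + v / (u + v) * (b / v) powr p"
  proof -
    have "1 - v / (u + v) = u / (u + v)" using assms by (simp add: field_simps)
    then show ?thesis using convex_onD[OF cvx, of "v / (u+v)" "a/u" "b/v"] assms False by simp
  qed
  moreover have "u / (u + v) * (a / u) + v / (u + v) * (b / v) = (a + b) / (u + v)"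
    using assms by (simp add: add_divide_distrib)
  moreover have "((a + b) / (u + v)) powr p = (a + b) powr p / (u + v) powr p"
    using assms by (simp add: powr_divide)
  ultimately have le: "(a + b) powr p / (u + v) powr p \<le> u / (u + v) * (a / u) powr p + v / (u + v) * (b / v) powr p"
    by metis
  have pos: "(u+v) powr p > 0" using assms by simp
  show ?thesis using iffD1[OF pos_divide_le_eq[OF pos] le] by (metis mult.commute)
qed

lemma Lp_le_zeroD:
  assumes "Lp_le M p f 0" "0 < p"
  shows "AE x in M. f x = 0"
proof -
  note [measurable] = Lp_leD(1)[OF assms(1)]
  have "(\<integral>\<^sup>+x. ennreal (\<bar>f x\<bar> powr p) \<partial>M) = 0" using Lp_leD(3)[OF assms(1)] assms(2) by simp
  then have "AE x in M. ennreal (\<bar>f x\<bar> powr p) = 0" by (subst (asm) nn_integral_0_iff_AE) auto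
  then show ?thesis by eventually_elim (auto simp: powr_eq_0_iff)
qed

text \<open>Minkowski's inequality: after integration each weighted term contributes at most its
  weight, and the weights add up to 1. A zero bound cannot be a divisor and is handled through
  almost sure vanishing.\<close>

lemma Lp_le_add:
  assumes f: "Lp_le M p f u" and g: "Lp_le M p g v" and p: "1 \<le> p"
  shows "Lp_le M p (\<lambda>x. f x + g x) (u + v)"
proof -
  note [measurable] = Lp_leD(1)[OF f] Lp_leD(1)[OF g]
  consider "u = 0" | "v = 0" | "0 < u" "0 < v" using Lp_leD(2)[OF f] Lp_leD(2)[OF g] by linarith
  then show ?thesis
  proof cases
    case 1
    have "AE x in M. f x = 0" using Lp_le_zeroD[of M p f] f 1 p by auto
    then have "AE x in M. \<bar>f x + g x\<bar> \<le> \<bar>g x\<bar>" by eventually_elim auto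
    from Lp_le_mono_AE[OF g _ this] show ?thesis using 1 p by simp
  next
    case 2
    have "AE x in M. g x = 0" using Lp_le_zeroD[of M p g] g 2 p by auto
    then have "AE x in M. \<bar>f x + g x\<bar> \<le> \<bar>f x\<bar>" by eventually_elim auto
    from Lp_le_mono_AE[OF f _ this] show ?thesis using 2 p by simp
  next
    case 3
    let ?h = "\<lambda>x. (u + v) powr p * (u / (u + v) * (\<bar>f x\<bar> / u) powr p + v / (u + v) * (\<bar>g x\<bar> / v) powr p)"
    have eq: "?h x = (u+v) powr p * (u / (u+v) / u powr p) * \<bar>f x\<bar> powr p
       + (u+v) powr p * (v / (u+v) / v powr p) * \<bar>g x\<bar> powr p" for x
      using 3 by (simp add: powr_divide algebra_simps)
    note fi = Lp_le_integrable[OF f] and gi = Lp_le_integrable[OF g]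
    have i: "integrable M ?h" unfolding eq using fi(1) gi(1) by auto
    have le: "\<bar>f x + g x\<bar> powr p \<le> ?h x" for x
    proof -
      have "\<bar>f x + g x\<bar> powr p \<le> (\<bar>f x\<bar> + \<bar>g x\<bar>) powr p" using p by (intro powr_mono2) auto
      also have "\<dots> \<le> ?h x" using powr_add_le_weighted[of "\<bar>f x\<bar>" "\<bar>g x\<bar>" u v p] 3 p by auto
      finally show ?thesis .
    qed
    have i2: "integrable M (\<lambda>x. \<bar>f x + g x\<bar> powr p)"
      by (rule Bochner_Integration.integrable_bound[OF i]) (use le in \<open>auto intro: order_trans[OF _ abs_ge_self]\<close>)
    have "(\<integral>x. \<bar>f x + g x\<bar> powr p \<partial>M) \<le> (\<integral>x. ?h x \<partial>M)"
      by (rule integral_mono[OF i2 i le])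
    also have "\<dots> = (u+v) powr p * (u / (u+v) / u powr p) * (\<integral>x. \<bar>f x\<bar> powr p \<partial>M)
        + (u+v) powr p * (v / (u+v) / v powr p) * (\<integral>x. \<bar>g x\<bar> powr p \<partial>M)"
      unfolding eq using fi(1) gi(1) by simp
    also have "\<dots> \<le> (u+v) powr p * (u / (u+v) / u powr p) * u powr p
        + (u+v) powr p * (v / (u+v) / v powr p) * v powr p"
      using fi(2) gi(2) 3 by (intro add_mono mult_left_mono) auto
    also have "\<dots> = (u+v) powr p * ((u + v) / (u+v))"
    proof -
      have "(u+v) powr p * (w / (u+v) / w powr p) * w powr p = (u+v) powr p * (w / (u+v))" if "0 < w" for w
        using that by simp
      then show ?thesis using 3 by (simp only: add_divide_distrib distrib_left)
    qed
    also have "\<dots> = (u+v) powr p" using 3 by simp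
    finally show ?thesis using i2 3 by (intro Lp_leI_integral) auto
  qed
qed

lemma Lp_le_zero: "Lp_le M p (\<lambda>x. 0) 0"
  by (auto simp: Lp_le_def)

lemma Lp_le_sum:
  assumes "finite I" "\<And>i. i \<in> I \<Longrightarrow> Lp_le M p (f i) (w i)" "1 \<le> p"
  shows "Lp_le M p (\<lambda>x. \<Sum>i\<in>I. f i x) (\<Sum>i\<in>I. w i)"
  using assms(1,2)
proof (induction I rule: finite_induct)
  case (insert i I)
  then show ?case using Lp_le_add[of M p "f i" "w i" "\<lambda>x. \<Sum>i\<in>I. f i x" "\<Sum>i\<in>I. w i"] assms(3) by simp
qed (simp add: Lp_le_zero)

text \<open>The second-order expansion behind the moment bound for martingales. If \<open>d\<close>
  is small against \<open>s\<close>, Taylor's formula applies, since after reduction to s > 0 its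
  intermediate point lies between 0 and 2 s; otherwise every term is at most a multiple of the p-th
  power of \<bar>d\<bar>. The linear term keeps its sign, so that it can vanish in conditional
  mean.\<close>

lemma powr_taylor_upper:
  fixes p :: real
  assumes p: "2 < p"
  shows "\<exists>C\<ge>1. \<forall>s d. \<bar>s + d\<bar> powr p \<le> \<bar>s\<bar> powr p + p * (sgn s * \<bar>s\<bar> powr (p - 1)) * d
    + C * (\<bar>s\<bar> powr (p - 2) * d\<^sup>2 + \<bar>d\<bar> powr p)"
proof -
  \<comment> \<open>The first entry serves large \<open>d\<close>, where \<bar>s + d\<bar> is at
    most 3 \<bar>d\<bar> and \<bar>s\<bar> at most 2 \<bar>d\<bar>; the second bounds the second
    derivative up to the point 2 s.\<close>
  define C where "C = max (3 powr p + p * 2 powr (p - 1)) (p * (p - 1) * 2 powr (p - 2))"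
  have C1: "3 powr p + p * 2 powr (p - 1) \<le> C" and C2: "p * (p - 1) * 2 powr (p - 2) \<le> C"
    unfolding C_def by auto
  have "1 \<le> 3 powr p" using p by (intro ge_one_powr_ge_zero) auto
  moreover have "0 \<le> p * 2 powr (p - 1)" using p by simp
  ultimately have C: "1 \<le> C" using C1 by linarith
  have pos: "(s + d) powr p \<le> s powr p + p * s powr (p - 1) * d + C * (s powr (p - 2) * d\<^sup>2 + \<bar>d\<bar> powr p)"
    if s: "0 < s" and d: "\<bar>d\<bar> < s / 2" for s d :: real
  proof (cases "d = 0")
    case False
    define df where "df = (\<lambda>m x::real. if m = (0::nat) then x powr p else if m = 1 then p * x powr (p - 1) else p * ((p - 1) * x powr (p - 2)))"
    have der: "\<forall>m t. m < 2 \<and> s / 2 \<le> t \<and> t \<le> 2 * s \<longrightarrow> DERIV (df m) t :> df (Suc m) t"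
    proof (intro allI impI)
      fix m :: nat and t :: real assume a: "m < 2 \<and> s / 2 \<le> t \<and> t \<le> 2 * s"
      then have t: "t > 0" using s by auto
      show "DERIV (df m) t :> df (Suc m) t"
      proof (cases "m = 0")
        case True
        have "((\<lambda>x. x powr p) has_real_derivative p * t powr (p - 1)) (at t)"
          using has_real_derivative_powr[OF t] .
        then show ?thesis using True by (simp add: df_def)
      next
        case False
        then have m: "m = 1" using a by auto
        have "((\<lambda>x. x powr (p - 1)) has_real_derivative (p - 1) * t powr (p - 1 - 1)) (at t)"
          using has_real_derivative_powr[OF t] .
        then have "((\<lambda>x. p * x powr (p - 1)) has_real_derivative p * ((p - 1) * t powr (p - 1 - 1))) (at t)"
          by (rule DERIV_cmult)
        moreover have "df m = (\<lambda>x. p * x powr (p - 1))" using m by (simp add: df_def)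
        ultimately show ?thesis using m by (simp add: df_def)
      qed
    qed
    have "\<exists>t. (if s + d < s then s + d < t \<and> t < s else s < t \<and> t < s + d) \<and>
        (s + d) powr p = (\<Sum>m<2. df m s / fact m * (s + d - s) ^ m) + df 2 t / fact 2 * (s + d - s) ^ 2"
      by (rule Taylor[OF _ _ der]) (use s d False in \<open>auto simp: df_def\<close>)
    then obtain t where t: "if s + d < s then s + d < t \<and> t < s else s < t \<and> t < s + d"
      and eq: "(s + d) powr p = (\<Sum>m<2. df m s / fact m * d ^ m) + df 2 t / 2 * d ^ 2" by auto
    have tb: "0 \<le> t" "t \<le> 2 * s" using t s d by (auto split: if_splits)
    have "(s + d) powr p = s powr p + p * s powr (p - 1) * d + df 2 t / 2 * d ^ 2"
      using eq by (simp add: df_def numeral_2_eq_2)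
    also have "df 2 t / 2 \<le> C * s powr (p - 2)"
    proof -
      have "t powr (p - 2) \<le> (2 * s) powr (p - 2)" using tb p by (intro powr_mono2) auto
      also have "\<dots> = 2 powr (p - 2) * s powr (p - 2)" using s by (simp add: powr_mult)
      finally have "p * (p - 1) * t powr (p - 2) \<le> p * (p - 1) * (2 powr (p - 2) * s powr (p - 2))"
        using p by (intro mult_left_mono) auto
      also have "\<dots> \<le> C * s powr (p - 2)" using mult_right_mono[OF C2, of "s powr (p - 2)"] by (simp add: algebra_simps)
      finally have "df 2 t \<le> C * s powr (p - 2)" by (simp add: df_def algebra_simps)
      moreover have "0 \<le> df 2 t" using p by (simp add: df_def)
      ultimately show ?thesis by linarith
    qed
    then have "df 2 t / 2 * d ^ 2 \<le> C * s powr (p - 2) * d^2" by (rule mult_right_mono) simp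
    also have "\<dots> \<le> C * (s powr (p - 2) * d\<^sup>2 + \<bar>d\<bar> powr p)" using C by (simp add: algebra_simps)
    finally show ?thesis by simp
  qed simp
  have big: "\<bar>s + d\<bar> powr p \<le> \<bar>s\<bar> powr p + p * (sgn s * \<bar>s\<bar> powr (p - 1)) * d + C * (\<bar>s\<bar> powr (p - 2) * d\<^sup>2 + \<bar>d\<bar> powr p)"
    if d: "\<bar>s\<bar> / 2 \<le> \<bar>d\<bar>" for s d :: real
  proof -
    have "\<bar>s + d\<bar> powr p \<le> (3 * \<bar>d\<bar>) powr p" using d p by (intro powr_mono2) auto
    also have "\<dots> = 3 powr p * \<bar>d\<bar> powr p" by (simp add: powr_mult)
    finally have 1: "\<bar>s + d\<bar> powr p \<le> 3 powr p * \<bar>d\<bar> powr p" .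
    have "\<bar>p * (sgn s * \<bar>s\<bar> powr (p - 1)) * d\<bar> \<le> p * \<bar>s\<bar> powr (p - 1) * \<bar>d\<bar>"
      using p by (auto simp: abs_mult sgn_if)
    also have "\<dots> \<le> p * (2 * \<bar>d\<bar>) powr (p - 1) * \<bar>d\<bar>"
      using p d by (intro mult_right_mono mult_left_mono powr_mono2) auto
    also have "\<dots> = p * 2 powr (p - 1) * \<bar>d\<bar> powr p"
      by (cases "d = 0") (auto simp: powr_mult powr_diff)
    finally have 2: "- (p * (sgn s * \<bar>s\<bar> powr (p - 1)) * d) \<le> p * 2 powr (p - 1) * \<bar>d\<bar> powr p" by linarith
    have "(3 powr p + p * 2 powr (p - 1)) * \<bar>d\<bar> powr p \<le> C * \<bar>d\<bar> powr p"
      by (rule mult_right_mono[OF C1]) simp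
    moreover have "0 \<le> C * (\<bar>s\<bar> powr (p - 2) * d\<^sup>2)" using C by simp
    moreover have "0 \<le> \<bar>s\<bar> powr p" by simp
    ultimately show ?thesis using 1 2 unfolding ring_distribs by linarith
  qed
  show ?thesis
  proof (intro exI[of _ C] conjI C allI)
    fix s d :: real
    show "\<bar>s + d\<bar> powr p \<le> \<bar>s\<bar> powr p + p * (sgn s * \<bar>s\<bar> powr (p - 1)) * d + C * (\<bar>s\<bar> powr (p - 2) * d\<^sup>2 + \<bar>d\<bar> powr p)"
    proof (cases "\<bar>s\<bar> / 2 \<le> \<bar>d\<bar>")
      case True then show ?thesis by (rule big)
    next
      case False
      show ?thesis
      proof (cases "0 < s")
        case True
        then show ?thesis using pos[of s d] False by (auto simp: abs_if split: if_splits)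
      next
        case f2: False
        have "s < 0" using f2 False by (cases "s = 0") auto
        moreover have "\<bar>s + d\<bar> = - s + - d" using calculation False by (auto simp: abs_if split: if_splits)
        ultimately show ?thesis using pos[of "-s" "-d"] False by auto
      qed
    qed
  qed
qed

text \<open>A crude Young inequality: replace both factors by the larger one.\<close>

lemma powr_mult_le_add:
  fixes x y a b p :: real
  assumes "0 \<le> x" "0 \<le> y" "0 \<le> a" "0 \<le> b" "p = a + b" "0 < p"
  shows "x powr a * y powr b \<le> x powr p + y powr p"
proof (cases "x = 0 \<or> y = 0")
  case False
  let ?m = "max x y"
  have "x powr a * y powr b \<le> ?m powr a * ?m powr b" using assms by (intro mult_mono powr_mono2) auto
  also have "\<dots> = ?m powr p" using assms(5) by (simp add: powr_add)
  also have "\<dots> \<le> x powr p + y powr p" by (auto simp: max_def)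
  finally show ?thesis .
qed (auto)

text \<open>A Burkholder-type bound by induction on the number of terms. Given the sum
  \<open>S\<close> of the first m, the linear Taylor term has mean zero because its other factor is
  \<open>F m\<close>-measurable; the remaining terms are of order m^(p/2 - 1), the order of the
  increment of m^(p/2). \<open>B\<close> is chosen before \<open>n\<close>, \<open>F\<close>,
  \<open>D\<close> and \<open>K\<close>, since all of these vary in later uses.\<close>

lemma (in prob_space) martingale_difference_Lp:
  fixes p :: real
  assumes p: "2 < p"
  shows "\<exists>B\<ge>1. \<forall>(n::nat) F D K. 0 < K \<longrightarrow> (\<forall>k. subalgebra M (F k)) \<longrightarrow> (\<forall>k. sets (F k) \<subseteq> sets (F (Suc k))) \<longrightarrow>
    (\<forall>k<n. D k \<in> borel_measurable (F (Suc k))) \<longrightarrow>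
    (\<forall>k<n. AE x in M. real_cond_exp M (F k) (D k) x = 0) \<longrightarrow>
    (\<forall>k<n. Lp_le M p (D k) K) \<longrightarrow> Lp_le M p (\<lambda>x. \<Sum>k<n. D k x) (sqrt (B * real n) * K)"
proof -
  obtain C where C: "C \<ge> 1" and taylor: "\<And>s d. \<bar>s + d\<bar> powr p \<le> \<bar>s\<bar> powr p + p * (sgn s * \<bar>s\<bar> powr (p - 1)) * d
    + C * (\<bar>s\<bar> powr (p - 2) * d\<^sup>2 + \<bar>d\<bar> powr p)" using powr_taylor_upper[OF p] by blast
  \<comment> \<open>Two unit contributions from the normalised Young inequality and one from the
    p-th moment of the new term give C (2 x + 1) with x \<ge> 1, and 4 C x covers this.\<close>
  define B where "B = 4 * C"
  have B: "B \<ge> 1" "2 * C \<le> B" using C by (auto simp: B_def)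
  show ?thesis
  proof (rule exI[of _ B], intro conjI B(1) allI impI)
    fix n :: nat and F :: "nat \<Rightarrow> 'a measure" and D :: "nat \<Rightarrow> 'a \<Rightarrow> real" and K :: real
    assume K: "0 < K" and sub: "\<forall>k. subalgebra M (F k)" and mono: "\<forall>k. sets (F k) \<subseteq> sets (F (Suc k))"
      and ad: "\<forall>k<n. D k \<in> borel_measurable (F (Suc k))"
      and mz: "\<forall>k<n. AE x in M. real_cond_exp M (F k) (D k) x = 0"
      and Lp: "\<forall>k<n. Lp_le M p (D k) K"
    have mono': "sets (F j) \<subseteq> sets (F k)" if "j \<le> k" for j k
      using that
    proof (induction k rule: dec_induct)
      case (step k)
      then show ?case using mono by blast
    qed simp
    have spF: "space (F k) = space M" for k using sub by (auto simp: subalgebra_def)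
    have Sm: "(\<lambda>x. \<Sum>k<m. D k x) \<in> borel_measurable (F m)" if "m \<le> n" for m
    proof (rule borel_measurable_sum)
      fix k assume "k \<in> {..<m}"
      then have "D k \<in> borel_measurable (F (Suc k))" "sets (F (Suc k)) \<subseteq> sets (F m)"
        using ad that mono'[of "Suc k" m] by auto
      then show "D k \<in> borel_measurable (F m)"
        using measurable_mono[of "borel" "borel" "F (Suc k)" "F m"] spF by blast
    qed
    show "Lp_le M p (\<lambda>x. \<Sum>k<n. D k x) (sqrt (B * n) * K)"
    proof -
      have "Lp_le M p (\<lambda>x. \<Sum>k<m. D k x) (sqrt (B * m) * K)" if "m \<le> n" for m
        using that
      proof (induction m)
        case 0 then show ?case by (simp add: Lp_le_zero)
      next
        case (Suc m)
        then have mn: "m < n" by simp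
        have D: "Lp_le M p (D m) K" using Lp mn by auto
        show ?case
        proof (cases "m = 0")
          case True
          have "1 * K \<le> sqrt B * K" using B K by (intro mult_right_mono) auto
          then show ?thesis using Lp_le_mono_AE[OF D, of "D m" "sqrt B * K"] Lp_leD(1)[OF D] True p by simp
        next
          case False
          define S where "S = (\<lambda>x. \<Sum>k<m. D k x)"
          define A where "A = sqrt (B * m) * K"
          have A: "0 < A" using False B K by (auto simp: A_def)
          have S: "Lp_le M p S A" using Suc unfolding S_def A_def by auto
          note [measurable] = Lp_leD(1)[OF S] Lp_leD(1)[OF D]
          note Si = Lp_le_integrable[OF S] and Di = Lp_le_integrable[OF D]
          interpret sf: finite_measure_subalgebra M "F m"
            by unfold_locales (use sub in auto)
          have SF[measurable]: "S \<in> borel_measurable (F m)" unfolding S_def using Sm mn by auto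
          let ?\<phi> = "\<lambda>x. sgn (S x) * \<bar>S x\<bar> powr (p - 1)"
          have phiF: "?\<phi> \<in> borel_measurable (F m)" by measurable
          have i1: "integrable M (\<lambda>x. ?\<phi> x * D m x)"
          proof (rule Bochner_Integration.integrable_bound[OF Bochner_Integration.integrable_add[OF Si(1) Di(1)]])
            show "AE x in M. norm (?\<phi> x * D m x) \<le> norm (\<bar>S x\<bar> powr p + \<bar>D m x\<bar> powr p)"
            proof (rule AE_I2)
              fix x
              have "norm (?\<phi> x * D m x) \<le> \<bar>S x\<bar> powr (p - 1) * \<bar>D m x\<bar> powr 1"
                by (auto simp: abs_mult sgn_if)
              also have "\<dots> \<le> \<bar>S x\<bar> powr p + \<bar>D m x\<bar> powr p"
                using p by (intro powr_mult_le_add) auto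
              finally show "norm (?\<phi> x * D m x) \<le> norm (\<bar>S x\<bar> powr p + \<bar>D m x\<bar> powr p)" by simp
            qed
          qed measurable
          have z: "(\<integral>x. ?\<phi> x * D m x \<partial>M) = 0"
          proof -
            have "(\<integral>x. ?\<phi> x * D m x \<partial>M) = (\<integral>x. ?\<phi> x * real_cond_exp M (F m) (D m) x \<partial>M)"
              by (rule sf.real_cond_exp_intg(2)[OF i1 phiF, symmetric]) measurable
            also have "\<dots> = (\<integral>x. 0 \<partial>M)"
              by (rule integral_cong_AE) (use mz mn in \<open>auto elim!: eventually_mono\<close>)
            finally show ?thesis by simp
          qed
          \<comment> \<open>Young's inequality for S / A and D / K instead of S and D: both
            quotients have p-th moment at most 1, so the bracket integrates to at most 2, and the
            prefactor carries the right order in \<open>m\<close>.\<close>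
          let ?q = "\<lambda>x. A powr (p - 2) * K\<^sup>2 * (\<bar>S x\<bar> powr p / A powr p + \<bar>D m x\<bar> powr p / K powr p)"
          have qi: "integrable M ?q" using Si(1) Di(1) by auto
          have qle: "\<bar>S x\<bar> powr (p - 2) * (D m x)\<^sup>2 \<le> ?q x" for x
          proof -
            have e: "(D m x)\<^sup>2 = \<bar>D m x\<bar> powr 2" "K\<^sup>2 = K powr 2"
              using K by (simp_all add: powr_numeral)
            have "(\<bar>S x\<bar> / A) powr (p - 2) * (\<bar>D m x\<bar> / K) powr 2 \<le> (\<bar>S x\<bar> / A) powr p + (\<bar>D m x\<bar> / K) powr p"
              using A K p by (intro powr_mult_le_add) auto
            then have "\<bar>S x\<bar> powr (p - 2) / A powr (p - 2) * (\<bar>D m x\<bar> powr 2 / K powr 2)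
               \<le> \<bar>S x\<bar> powr p / A powr p + \<bar>D m x\<bar> powr p / K powr p"
              using A K by (simp add: powr_divide)
            then have "A powr (p - 2) * K powr 2 * (\<bar>S x\<bar> powr (p - 2) / A powr (p - 2) * (\<bar>D m x\<bar> powr 2 / K powr 2))
               \<le> A powr (p - 2) * K powr 2 * (\<bar>S x\<bar> powr p / A powr p + \<bar>D m x\<bar> powr p / K powr p)"
              by (intro mult_left_mono) auto
            then show ?thesis unfolding e using A K by simp
          qed
          let ?h = "\<lambda>x. \<bar>S x\<bar> powr p + p * (?\<phi> x * D m x) + C * (?q x + \<bar>D m x\<bar> powr p)"
          have hi: "integrable M ?h" using Si(1) Di(1) i1 qi by auto
          have le: "\<bar>S x + D m x\<bar> powr p \<le> ?h x" for x
          proof -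
            have "\<bar>S x + D m x\<bar> powr p \<le> \<bar>S x\<bar> powr p + p * (?\<phi> x * D m x) + C * (\<bar>S x\<bar> powr (p - 2) * (D m x)\<^sup>2 + \<bar>D m x\<bar> powr p)"
              using taylor[of "S x" "D m x"] by (simp add: mult.assoc)
            also have "\<dots> \<le> ?h x" using qle[of x] C by (intro add_left_mono mult_left_mono add_right_mono) auto
            finally show ?thesis .
          qed
          have li: "integrable M (\<lambda>x. \<bar>S x + D m x\<bar> powr p)"
            by (rule Bochner_Integration.integrable_bound[OF hi]) (use le in \<open>auto intro: order_trans[OF _ abs_ge_self]\<close>)
          have "(\<integral>x. \<bar>S x + D m x\<bar> powr p \<partial>M) \<le> (\<integral>x. ?h x \<partial>M)"
            by (rule integral_mono[OF li hi le])
          also have "\<dots> = (\<integral>x. \<bar>S x\<bar> powr p \<partial>M) + p * (\<integral>x. ?\<phi> x * D m x \<partial>M) + C * ((\<integral>x. ?q x \<partial>M) + (\<integral>x. \<bar>D m x\<bar> powr p \<partial>M))"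
            using Si(1) Di(1) i1 qi by simp
          also have "\<dots> = (\<integral>x. \<bar>S x\<bar> powr p \<partial>M) + C * ((\<integral>x. ?q x \<partial>M) + (\<integral>x. \<bar>D m x\<bar> powr p \<partial>M))"
            by (simp add: z)
          also have "(\<integral>x. ?q x \<partial>M) = A powr (p - 2) * K\<^sup>2 * ((\<integral>x. \<bar>S x\<bar> powr p \<partial>M) / A powr p + (\<integral>x. \<bar>D m x\<bar> powr p \<partial>M) / K powr p)"
            using Si(1) Di(1) by simp
          also have "(\<integral>x. \<bar>S x\<bar> powr p \<partial>M) + C * (A powr (p - 2) * K\<^sup>2 * ((\<integral>x. \<bar>S x\<bar> powr p \<partial>M) / A powr p + (\<integral>x. \<bar>D m x\<bar> powr p \<partial>M) / K powr p) + (\<integral>x. \<bar>D m x\<bar> powr p \<partial>M))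
             \<le> A powr p + C * (A powr (p - 2) * K\<^sup>2 * (A powr p / A powr p + K powr p / K powr p) + K powr p)"
            using Si(2) Di(2) A K C by (intro add_mono mult_left_mono divide_right_mono) auto
          also have "\<dots> = A powr p + C * (2 * (A powr (p - 2) * K\<^sup>2) + K powr p)" using A K by simp
          also have "\<dots> \<le> (sqrt (B * Suc m) * K) powr p"
          proof -
            define b where "b = sqrt B"
            define r where "r = p / 2"
            have r: "r > 1" using p by (simp add: r_def)
            have b: "b powr p = B powr r" "b powr (p - 2) = B powr (r - 1)" "(0::real) \<le> b"
              using B by (auto simp: b_def r_def powr_half_sqrt[symmetric] powr_powr diff_divide_distrib)
            have sq: "sqrt (real j) powr p = real j powr r" "sqrt (real j) powr (p - 2) = real j powr (r - 1)" for j
              by (auto simp: r_def powr_half_sqrt[symmetric] powr_powr diff_divide_distrib)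
            have A1: "A powr p = B powr r * real m powr r * K powr p"
              using B K by (simp add: A_def powr_mult real_sqrt_mult b[unfolded b_def] sq)
            have Kp: "K powr (p - 2) * K\<^sup>2 = K powr p"
              using K by (simp add: powr_diff powr_numeral)
            have A2: "A powr (p - 2) * K\<^sup>2 = B powr (r - 1) * real m powr (r - 1) * K powr p"
              using B K Kp by (simp add: A_def powr_mult real_sqrt_mult b[unfolded b_def] sq mult.assoc)
            have A3: "(sqrt (B * Suc m) * K) powr p = B powr r * real (Suc m) powr r * K powr p"
              using B K sq(1)[of "Suc m"] by (simp add: powr_mult real_sqrt_mult b[unfolded b_def] del: of_nat_Suc)
            have m1: "1 \<le> real m" using False by auto
            have c1: "real m powr (r-1) \<le> real (Suc m) powr (r-1)" "1 \<le> real (Suc m) powr (r-1)" "1 \<le> real m powr (r-1)"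
              using r m1 by (auto intro!: powr_mono2 ge_one_powr_ge_zero)
            have "real (Suc m) powr r = (1 + real m) * real (Suc m) powr (r - 1)"
              by (simp add: powr_diff)
            also have "\<dots> \<ge> (1 + real m) * real m powr (r - 1)"
              using c1 by (intro mult_left_mono) auto
            also have "(1 + real m) * real m powr (r - 1) = real m powr r + real m powr (r - 1)"
              using m1 by (simp add: powr_diff field_simps)
            finally have inc: "real m powr r + real m powr (r - 1) \<le> real (Suc m) powr r" .
            have B1: "B powr r = B * B powr (r - 1)" "1 \<le> B powr (r - 1)"
              using B r ge_one_powr_ge_zero[of B "r - 1"] by (auto simp: powr_diff)
            have "C * (2 * (B powr (r - 1) * real m powr (r - 1)) + 1)
                \<le> C * (2 * (B powr (r - 1) * real m powr (r - 1)) + 2 * (B powr (r - 1) * real m powr (r - 1)))"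
            proof -
              have "1 * 1 \<le> B powr (r - 1) * real m powr (r - 1)" using B1(2) c1(3) by (intro mult_mono) auto
              then show ?thesis using C by (intro mult_left_mono add_left_mono) auto
            qed
            also have "\<dots> = B powr r * real m powr (r - 1)" unfolding B1(1) by (simp add: B_def)
            finally have "B powr r * real m powr r + C * (2 * (B powr (r - 1) * real m powr (r - 1)) + 1)
               \<le> B powr r * (real m powr r + real m powr (r - 1))" by (simp add: algebra_simps)
            also have "\<dots> \<le> B powr r * real (Suc m) powr r"
              using inc by (intro mult_left_mono) auto
            finally have "(B powr r * real m powr r + C * (2 * (B powr (r - 1) * real m powr (r - 1)) + 1)) * K powr p
               \<le> B powr r * real (Suc m) powr r * K powr p" by (intro mult_right_mono) auto
            then show ?thesis unfolding A1 A2 A3 by (simp add: algebra_simps)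
          qed
          finally have "(\<integral>x. \<bar>S x + D m x\<bar> powr p \<partial>M) \<le> (sqrt (B * Suc m) * K) powr p" .
          then have "Lp_le M p (\<lambda>x. S x + D m x) (sqrt (B * Suc m) * K)"
            using li B K by (intro Lp_leI_integral) auto
          then show ?thesis by (simp add: S_def)
        qed
      qed
      then show ?thesis by simp
    qed
  qed
qed

lemma (in prob_space) Lp_le_1_integrable:
  assumes "Lp_le M p f w" "1 \<le> p"
  shows "integrable M f"
proof (rule Bochner_Integration.integrable_bound)
  show "integrable M (\<lambda>x. 1 + \<bar>f x\<bar> powr p)" using Lp_le_integrable(1)[OF assms(1)] by auto
  show "f \<in> borel_measurable M" using Lp_leD(1)[OF assms(1)] .
  show "AE x in M. norm (f x) \<le> norm (1 + \<bar>f x\<bar> powr p)"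
  proof (rule AE_I2)
    fix x
    have "\<bar>f x\<bar> \<le> 1 + \<bar>f x\<bar> powr p"
    proof (cases "\<bar>f x\<bar> \<le> 1")
      case False
      then have "\<bar>f x\<bar> powr 1 \<le> \<bar>f x\<bar> powr p" using assms(2) by (intro powr_mono) auto
      then show ?thesis by simp
    qed (simp add: add_increasing2)
    then show "norm (f x) \<le> norm (1 + \<bar>f x\<bar> powr p)" by simp
  qed
qed

lemma sum_power_abs_le:
  fixes \<kappa> :: real
  assumes "0 < \<kappa>" "\<kappa> < 1"
  shows "(\<Sum>j\<in>{- int n..int n}. \<kappa> ^ nat \<bar>j\<bar>) \<le> 2 / (1 - \<kappa>)"
proof -
  have geo: "(\<Sum>i<m. \<kappa> ^ i) \<le> 1 / (1 - \<kappa>)" for m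
    using assms sum_le_suminf[of "\<lambda>i. \<kappa> ^ i" "{..<m}"] by (simp add: suminf_geometric summable_geometric)
  have "(\<Sum>j\<in>{- int n..int n}. \<kappa> ^ nat \<bar>j\<bar>) \<le> (\<Sum>j\<in>{- int n..0}. \<kappa> ^ nat \<bar>j\<bar>) + (\<Sum>j\<in>{0..int n}. \<kappa> ^ nat \<bar>j\<bar>)"
  proof -
    have "{- int n..int n} = {- int n..0} \<union> {0..int n}" by auto
    then show ?thesis using sum_Un2[of "{- int n..0}" "{0..int n}" "\<lambda>j. \<kappa> ^ nat \<bar>j\<bar>"] assms
      by (simp add: sum_nonneg sum.union_inter_neutral sum_Un)
  qed
  also have "(\<Sum>j\<in>{- int n..0}. \<kappa> ^ nat \<bar>j\<bar>) = (\<Sum>i<Suc n. \<kappa> ^ i)"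
    by (rule sum.reindex_bij_witness[of _ "\<lambda>i. - int i" "\<lambda>j. nat (- j)"]) auto
  also have "(\<Sum>j\<in>{0..int n}. \<kappa> ^ nat \<bar>j\<bar>) = (\<Sum>i<Suc n. \<kappa> ^ i)"
    by (rule sum.reindex_bij_witness[of _ "\<lambda>i. int i" "\<lambda>j. nat j"]) auto
  finally show ?thesis using geo[of "Suc n"] by simp
qed

text \<open>The increments \<open>E[X i | F (k+1)] - E[X i | F k]\<close> with \<open>i - k\<close> fixed are martingale differences in \<open>k\<close>;
  the sums over \<open>k\<close> are bounded separately and added up geometrically over \<open>i - k\<close>.\<close>

lemma (in prob_space) mixingale_Lp:
  fixes p \<kappa> :: real
  assumes p: "2 < p" and \<kappa>: "0 < \<kappa>" "\<kappa> < 1"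
  shows "\<exists>C>0. \<forall>(n::nat) F X K. 0 < K \<longrightarrow> (\<forall>k. subalgebra M (F k)) \<longrightarrow> (\<forall>k. sets (F k) \<subseteq> sets (F (Suc k))) \<longrightarrow>
    (\<forall>i\<in>{1..n}. integrable M (X i) \<and> X i \<in> borel_measurable (F n)) \<longrightarrow>
    (\<forall>i\<in>{1..n}. \<forall>k\<le>i. Lp_le M p (real_cond_exp M (F k) (X i)) (K * \<kappa> ^ (i - k))) \<longrightarrow>
    (\<forall>i\<in>{1..n}. \<forall>k\<in>{i..n}. Lp_le M p (\<lambda>x. X i x - real_cond_exp M (F k) (X i) x) (K * \<kappa> ^ (k - i))) \<longrightarrow>
    Lp_le M p (\<lambda>x. \<Sum>i\<in>{1..n}. X i x) (C * sqrt (real n) * K)"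
proof -
  obtain B where B: "B \<ge> 1" and mart: "\<And>(n::nat) F D K. 0 < K \<Longrightarrow> (\<forall>k. subalgebra M (F k)) \<Longrightarrow> (\<forall>k. sets (F k) \<subseteq> sets (F (Suc k))) \<Longrightarrow>
    (\<forall>k<n. D k \<in> borel_measurable (F (Suc k))) \<Longrightarrow>
    (\<forall>k<n. AE x in M. real_cond_exp M (F k) (D k) x = 0) \<Longrightarrow>
    (\<forall>k<n. Lp_le M p (D k) K) \<Longrightarrow> Lp_le M p (\<lambda>x. \<Sum>k<n. D k x) (sqrt (B * real n) * K)"
    using martingale_difference_Lp[OF p] by blast
  \<comment> \<open>The first term sums the initial projections \<open>E 0 i\<close>. In the second,
    2 / \<kappa> bounds a single increment, made of two neighbouring powers of \<kappa>, and 2 / (1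
    - \<kappa>) sums over lags of both signs.\<close>
  define C where "C = 1 / (1 - \<kappa>) + sqrt B * (2 / \<kappa>) * (2 / (1 - \<kappa>))"
  have C: "C > 0" unfolding C_def using \<kappa> B by (intro add_pos_nonneg) auto
  show ?thesis
  proof (rule exI[of _ C], intro conjI C allI impI)
    fix n :: nat and F :: "nat \<Rightarrow> 'a measure" and X :: "nat \<Rightarrow> 'a \<Rightarrow> real" and K :: real
    assume K: "0 < K" and sub: "\<forall>k. subalgebra M (F k)" and mono: "\<forall>k. sets (F k) \<subseteq> sets (F (Suc k))"
      and X: "\<forall>i\<in>{1..n}. integrable M (X i) \<and> X i \<in> borel_measurable (F n)"
      and past: "\<forall>i\<in>{1..n}. \<forall>k\<le>i. Lp_le M p (real_cond_exp M (F k) (X i)) (K * \<kappa> ^ (i - k))"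
      and fut: "\<forall>i\<in>{1..n}. \<forall>k\<in>{i..n}. Lp_le M p (\<lambda>x. X i x - real_cond_exp M (F k) (X i) x) (K * \<kappa> ^ (k - i))"
    have sf: "finite_measure_subalgebra M (F k)" for k
      by (intro finite_measure_subalgebra.intro finite_measure_subalgebra_axioms.intro) (use sub in \<open>auto intro: finite_measure_axioms\<close>)
    have sfs: "sigma_finite_subalgebra M (F k)" for k
      using finite_measure_subalgebra_is_sigma_finite[OF sf] .
    have spF: "space (F k) = space M" for k using sub by (auto simp: subalgebra_def)
    define E where "E = (\<lambda>k i. real_cond_exp M (F k) (X i))"
    have EF: "E k i \<in> borel_measurable (F k)" for k i unfolding E_def by auto
    have EFS: "E k i \<in> borel_measurable (F (Suc k))" for k i
      using measurable_mono[of "borel" "borel" "F k" "F (Suc k)"] spF mono EF by blast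
    have EM[measurable]: "E k i \<in> borel_measurable M" for k i unfolding E_def by auto
    have Eint: "integrable M (E k i)" if "i \<in> {1..n}" for k i
      unfolding E_def using sigma_finite_subalgebra.real_cond_exp_int(1)[OF sfs] X that by auto
    \<comment> \<open>The lag is j = i - (k + 1). The value 0 outside 1..n lets every lag run over
      the same times \<open>k < n\<close>.\<close>
    define D where "D = (\<lambda>j k x. if k + 1 + j \<in> {1..int n} then E (Suc k) (nat (k + 1 + j)) x - E k (nat (k + 1 + j)) x else 0)"
    have p1: "1 \<le> p" "0 < p" using p by auto
    have DL: "Lp_le M p (D j k) (2 / \<kappa> * K * \<kappa> ^ nat \<bar>j\<bar>)" if k: "k < n" for j :: int and k :: nat
    proof (cases "k + 1 + j \<in> {1..int n}")
      case False
      then have "D j k = (\<lambda>x. 0)" by (auto simp: D_def)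
      then show ?thesis using Lp_le_mono_AE[OF Lp_le_zero, of "\<lambda>x. 0" M "2 / \<kappa> * K * \<kappa> ^ nat \<bar>j\<bar>" p] p1 K \<kappa> by simp
    next
      case True
      define i where "i = nat (k + 1 + j)"
      have i: "i \<in> {1..n}" using True by (auto simp: i_def)
      have Dij: "D j k = (\<lambda>x. E (Suc k) i x - E k i x)" using True by (auto simp: D_def i_def algebra_simps)
      show ?thesis
      proof (cases "0 \<le> j")
        case True
        then have l: "Suc k \<le> i" "nat \<bar>j\<bar> = i - Suc k" using i by (auto simp: i_def)
        have a: "Lp_le M p (E (Suc k) i) (K * \<kappa> ^ (i - Suc k))" "Lp_le M p (E k i) (K * \<kappa> ^ (i - k))"
          using past i l unfolding E_def by auto
        have "Lp_le M p (\<lambda>x. E (Suc k) i x + (-1) * E k i x) (K * \<kappa> ^ (i - Suc k) + \<bar>-1\<bar> * (K * \<kappa> ^ (i - k)))"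
          by (rule Lp_le_add[OF a(1) Lp_le_cmult[OF a(2) p1(2)] p1(1)])
        then have "Lp_le M p (D j k) (K * \<kappa> ^ (i - Suc k) + K * \<kappa> ^ (i - k))" unfolding Dij by simp
        then show ?thesis
        proof (rule Lp_le_mono_AE)
          have "\<kappa> ^ (i - k) \<le> \<kappa> ^ (i - Suc k)" using \<kappa> by (intro power_decreasing) auto
          then have "K * \<kappa> ^ (i - Suc k) + K * \<kappa> ^ (i - k) \<le> 2 * (K * \<kappa> ^ (i - Suc k))" using K by simp
          also have "\<dots> \<le> (2 / \<kappa>) * (K * \<kappa> ^ (i - Suc k))"
            using K \<kappa> by (intro mult_right_mono) (auto simp: field_simps)
          finally show "K * \<kappa> ^ (i - Suc k) + K * \<kappa> ^ (i - k) \<le> 2 / \<kappa> * K * \<kappa> ^ nat \<bar>j\<bar>" by (simp add: l(2) mult.assoc)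
        qed (use p1 in \<open>auto simp: Dij\<close>)
      next
        case False
        then have l: "i \<le> k" "nat \<bar>j\<bar> = Suc k - i" "Suc k \<le> n" using i k by (auto simp: i_def)
        have a: "Lp_le M p (\<lambda>x. X i x - E (Suc k) i x) (K * \<kappa> ^ (Suc k - i))" "Lp_le M p (\<lambda>x. X i x - E k i x) (K * \<kappa> ^ (k - i))"
          using fut i l unfolding E_def by auto
        have "Lp_le M p (\<lambda>x. (X i x - E k i x) + (-1) * (X i x - E (Suc k) i x)) (K * \<kappa> ^ (k - i) + \<bar>-1\<bar> * (K * \<kappa> ^ (Suc k - i)))"
          by (rule Lp_le_add[OF a(2) Lp_le_cmult[OF a(1) p1(2)] p1(1)])
        then have "Lp_le M p (D j k) (K * \<kappa> ^ (k - i) + K * \<kappa> ^ (Suc k - i))" unfolding Dij by simp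
        then show ?thesis
        proof (rule Lp_le_mono_AE)
          have "\<kappa> ^ (Suc k - i) \<le> \<kappa> ^ (k - i)" using \<kappa> by (intro power_decreasing) auto
          then have "K * \<kappa> ^ (k - i) + K * \<kappa> ^ (Suc k - i) \<le> 2 * (K * \<kappa> ^ (k - i))" using K by simp
          also have "\<dots> = (2 / \<kappa>) * (K * \<kappa> ^ (Suc k - i))"
            using \<kappa> l(1) by (simp add: Suc_diff_le)
          finally show "K * \<kappa> ^ (k - i) + K * \<kappa> ^ (Suc k - i) \<le> 2 / \<kappa> * K * \<kappa> ^ nat \<bar>j\<bar>" by (simp add: l(2) mult.assoc)
        qed (use p1 in \<open>auto simp: Dij\<close>)
      qed
    qed
    have DS: "Lp_le M p (\<lambda>x. \<Sum>k<n. D j k x) (sqrt (B * real n) * (2 / \<kappa> * K * \<kappa> ^ nat \<bar>j\<bar>))" for j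
    proof (rule mart[OF _ sub mono])
      show "0 < 2 / \<kappa> * K * \<kappa> ^ nat \<bar>j\<bar>" using K \<kappa> by simp
      show "\<forall>k<n. D j k \<in> borel_measurable (F (Suc k))"
        unfolding D_def using EF EFS by auto
      show "\<forall>k<n. Lp_le M p (D j k) (2 / \<kappa> * K * \<kappa> ^ nat \<bar>j\<bar>)" using DL by auto
      show "\<forall>k<n. AE x in M. real_cond_exp M (F k) (D j k) x = 0"
      proof (intro allI impI)
        fix k assume "k < n"
        interpret s: finite_measure_subalgebra M "F k" by (rule sf)
        show "AE x in M. real_cond_exp M (F k) (D j k) x = 0"
        proof (cases "k + 1 + j \<in> {1..int n}")
          case False
          have "AE x in M. real_cond_exp M (F k) (\<lambda>x. 0) x = 0" by (rule s.real_cond_exp_F_meas) auto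
          moreover have "D j k = (\<lambda>x. 0)" using False by (auto simp: D_def)
          ultimately show ?thesis by simp
        next
          case True
          define i where "i = nat (k + 1 + j)"
          have i: "i \<in> {1..n}" using True by (auto simp: i_def)
          have Dij: "D j k = (\<lambda>x. E (Suc k) i x - E k i x)" using True by (auto simp: D_def i_def algebra_simps)
          have sg: "subalgebra (F (Suc k)) (F k)" using mono spF by (auto simp: subalgebra_def)
          have 1: "AE x in M. real_cond_exp M (F k) (D j k) x = real_cond_exp M (F k) (E (Suc k) i) x - real_cond_exp M (F k) (E k i) x"
            unfolding Dij by (rule s.real_cond_exp_diff) (use Eint i in auto)
          have 2: "AE x in M. real_cond_exp M (F k) (E (Suc k) i) x = E k i x"
            unfolding E_def by (rule s.real_cond_exp_nested_subalg) (use sub sg X i in auto)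
          have 3: "AE x in M. real_cond_exp M (F k) (E k i) x = E k i x"
            by (rule s.real_cond_exp_F_meas) (use Eint i EF in auto)
          show ?thesis using 1 2 3 by eventually_elim simp
        qed
      qed
    qed
    have fin: "AE x in M. \<forall>i\<in>{1..n}. E n i x = X i x"
    proof (rule AE_ball_countable')
      fix i assume i: "i \<in> {1..n}"
      show "AE x in M. E n i x = X i x" unfolding E_def
        by (rule sigma_finite_subalgebra.real_cond_exp_F_meas[OF sfs]) (use X i in auto)
    qed simp
    \<comment> \<open>Since \<open>X i\<close> is \<open>F n\<close>-measurable, it agrees almost
      surely with \<open>E n i\<close>, and telescoping over the times 0 to n leaves no
      remainder.\<close>
    let ?R = "\<lambda>x. (\<Sum>i\<in>{1..n}. E 0 i x) + (\<Sum>j\<in>{- int n..int n}. \<Sum>k<n. D j k x)"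
    have key: "(\<Sum>i\<in>{1..n}. E n i x) = ?R x" for x
    proof -
      have "E n i x = E 0 i x + (\<Sum>k<n. E (Suc k) i x - E k i x)" for i
        using sum_lessThan_telescope[of "\<lambda>k. E k i x" n] by simp
      then have "(\<Sum>i\<in>{1..n}. E n i x) = (\<Sum>i\<in>{1..n}. E 0 i x) + (\<Sum>i\<in>{1..n}. \<Sum>k<n. E (Suc k) i x - E k i x)"
        by (simp add: sum.distrib)
      also have "(\<Sum>i\<in>{1..n}. \<Sum>k<n. E (Suc k) i x - E k i x) = (\<Sum>k<n. \<Sum>i\<in>{1..n}. E (Suc k) i x - E k i x)"
        by (rule sum.swap)
      also have "\<dots> = (\<Sum>k<n. \<Sum>j\<in>{- int n..int n}. D j k x)"
      proof (rule sum.cong)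
        fix k assume k: "k \<in> {..<n}"
        have "(\<Sum>j\<in>{- int n..int n}. D j k x) = (\<Sum>j\<in>{- int k..int n - 1 - k}. D j k x)"
          by (rule sum.mono_neutral_right) (use k in \<open>auto simp: D_def\<close>)
        also have "\<dots> = (\<Sum>i\<in>{1..n}. E (Suc k) i x - E k i x)"
          by (rule sum.reindex_bij_witness[of _ "\<lambda>i. int i - 1 - int k" "\<lambda>j. nat (k + 1 + j)"])
             (use k in \<open>auto simp: D_def add_ac\<close>)
        finally show "(\<Sum>i\<in>{1..n}. E (Suc k) i x - E k i x) = (\<Sum>j\<in>{- int n..int n}. D j k x)" by simp
      qed simp
      also have "\<dots> = (\<Sum>j\<in>{- int n..int n}. \<Sum>k<n. D j k x)" by (rule sum.swap)
      finally show ?thesis .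
    qed
    have L: "Lp_le M p ?R ((\<Sum>i\<in>{1..n}. K * \<kappa> ^ i) + (\<Sum>j\<in>{- int n..int n}. sqrt (B * real n) * (2 / \<kappa> * K * \<kappa> ^ nat \<bar>j\<bar>)))"
    proof (intro Lp_le_add Lp_le_sum p1 DS)
      fix i assume i: "i \<in> {1..n}"
      then show "Lp_le M p (E 0 i) (K * \<kappa> ^ i)" using bspec[OF past i] unfolding E_def by (auto dest!: spec[of _ 0])
    qed auto
    show "Lp_le M p (\<lambda>x. \<Sum>i\<in>{1..n}. X i x) (C * sqrt (real n) * K)"
    proof (cases "n = 0")
      case False
      show ?thesis
      proof (rule Lp_le_mono_AE[OF L])
        show "(\<lambda>x. \<Sum>i\<in>{1..n}. X i x) \<in> borel_measurable M" using X by (intro borel_measurable_sum) auto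
        show "AE x in M. \<bar>\<Sum>i\<in>{1..n}. X i x\<bar> \<le> \<bar>?R x\<bar>"
          using fin
        proof eventually_elim
          case (elim x)
          then have "(\<Sum>i\<in>{1..n}. X i x) = ?R x" by (subst key[symmetric]) simp
          then show ?case by simp
        qed
        have "(\<Sum>i\<in>{1..n}. \<kappa> ^ i) \<le> (\<Sum>i. \<kappa> ^ i)"
          using \<kappa> by (intro sum_le_suminf) (auto simp: summable_geometric)
        also have "(\<Sum>i. \<kappa> ^ i) = 1 / (1 - \<kappa>)" using \<kappa> by (simp add: suminf_geometric)
        finally have "K * (\<Sum>i\<in>{1..n}. \<kappa> ^ i) \<le> K * (1 / (1 - \<kappa>))" using K by (intro mult_left_mono) auto
        also have "\<dots> \<le> K * (1 / (1 - \<kappa>)) * sqrt n"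
          using mult_left_mono[of 1 "sqrt n" "K * (1 / (1 - \<kappa>))"] K \<kappa> False by auto
        finally have 1: "(\<Sum>i\<in>{1..n}. K * \<kappa> ^ i) \<le> 1 / (1 - \<kappa>) * sqrt n * K"
          by (simp add: mult_ac sum_distrib_left)
        have "(\<Sum>j\<in>{- int n..int n}. sqrt (B * real n) * (2 / \<kappa> * K * \<kappa> ^ nat \<bar>j\<bar>))
            = sqrt (B * real n) * (2 / \<kappa>) * K * (\<Sum>j\<in>{- int n..int n}. \<kappa> ^ nat \<bar>j\<bar>)"
          by (simp add: sum_distrib_left mult.assoc)
        also have "\<dots> \<le> sqrt (B * real n) * (2 / \<kappa>) * K * (2 / (1 - \<kappa>))"
          using K \<kappa> B by (intro mult_left_mono sum_power_abs_le) auto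
        finally show "(\<Sum>i\<in>{1..n}. K * \<kappa> ^ i) + (\<Sum>j\<in>{- int n..int n}. sqrt (B * real n) * (2 / \<kappa> * K * \<kappa> ^ nat \<bar>j\<bar>)) \<le> C * sqrt (real n) * K"
          using 1 by (simp add: C_def real_sqrt_mult algebra_simps)
      qed (use p1 in auto)
    qed (simp add: Lp_le_zero)
  qed
qed

section \<open>Beta-mixing and conditional expectations\<close>

text \<open>Among suprema over countable subfamilies, maximise the integral. The union of a
  maximising sequence attains the maximum, and one more index cannot raise the integral, so that
  index is dominated almost surely. This existence gives meaning to the choice in
  \<open>ess_sup_family\<close>.\<close>

lemma (in finite_measure) ex_is_ess_sup_family:
  fixes f :: "'i \<Rightarrow> 'a \<Rightarrow> ennreal"
  assumes meas: "\<And>i. i \<in> I \<Longrightarrow> f i \<in> borel_measurable M"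
    and bnd: "\<And>i. i \<in> I \<Longrightarrow> AE x in M. f i x \<le> c" and c: "c < \<infinity>"
  shows "\<exists>Z. is_ess_sup_family M I f Z"
proof -
  define CC where "CC = {J. countable J \<and> J \<subseteq> I}"
  define \<Phi> where "\<Phi> = (\<lambda>J. \<integral>\<^sup>+x. (SUP i\<in>J. f i x) \<partial>M)"
  have ne: "CC \<noteq> {}" unfolding CC_def by auto
  have supm: "(\<lambda>x. SUP i\<in>J. f i x) \<in> borel_measurable M" if "J \<in> CC" for J
    using that meas by (intro borel_measurable_SUP) (auto simp: CC_def)
  have \<Phi>_le: "\<Phi> J \<le> c * emeasure M (space M)" if "J \<in> CC" for J
  proof -
    have "AE x in M. \<forall>i\<in>J. f i x \<le> c"
      using that bnd by (intro AE_ball_countable') (auto simp: CC_def)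
    then have "\<Phi> J \<le> (\<integral>\<^sup>+x. c \<partial>M)" unfolding \<Phi>_def
      by (intro nn_integral_mono_AE) (auto elim!: eventually_mono intro!: SUP_least)
    then show ?thesis by simp
  qed
  obtain h :: "nat \<Rightarrow> ennreal" where h: "range h \<subseteq> \<Phi> ` CC" "Sup (\<Phi> ` CC) = Sup (range h)"
    using ennreal_SUP_countable_SUP[OF ne, of \<Phi>] by auto
  then have "\<forall>n. \<exists>J\<in>CC. h n = \<Phi> J" by auto
  then obtain J where J: "\<And>n. J n \<in> CC" "\<And>n. h n = \<Phi> (J n)" by metis
  define K where "K = (\<Union>n. J n)"
  have K: "K \<in> CC" using J by (auto simp: K_def CC_def)
  have \<Phi>_mono: "\<Phi> A \<le> \<Phi> B" if "A \<subseteq> B" for A B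
    unfolding \<Phi>_def by (intro nn_integral_mono SUP_subset_mono that) auto
  have "Sup (range h) \<le> \<Phi> K"
    by (intro SUP_least) (auto simp: J(2) K_def intro!: \<Phi>_mono)
  then have max: "\<Phi> J \<le> \<Phi> K" if "J \<in> CC" for J
    using h(2) that by (metis SUP_upper order_trans)
  have fin: "\<Phi> K < \<infinity>"
  proof -
    have "c * emeasure M (space M) < \<infinity>"
      using c emeasure_finite[of "space M"] by (simp add: ennreal_mult_eq_top_iff less_top[symmetric] top_unique)
    then show ?thesis using \<Phi>_le[OF K] by (rule le_less_trans[rotated])
  qed
  let ?Z = "\<lambda>x. SUP i\<in>K. f i x"
  have Zm: "?Z \<in> borel_measurable M" by (rule supm[OF K])
  have dom: "AE x in M. f i x \<le> ?Z x" if i: "i \<in> I" for i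
  proof -
    let ?g = "\<lambda>x. SUP j\<in>insert i K. f j x"
    have iK: "insert i K \<in> CC" using K i by (auto simp: CC_def)
    have gm: "?g \<in> borel_measurable M" by (rule supm[OF iK])
    have le: "?Z x \<le> ?g x" for x by (intro SUP_subset_mono) auto
    have "(\<integral>\<^sup>+x. ?g x - ?Z x \<partial>M) = \<Phi> (insert i K) - \<Phi> K"
      unfolding \<Phi>_def by (rule nn_integral_diff[OF gm Zm]) (use fin le in \<open>auto simp: \<Phi>_def\<close>)
    also have "\<dots> = 0" using max[OF iK] fin by (intro diff_eq_0_ennreal) (auto intro: le_less_trans)
    finally have "AE x in M. ?g x - ?Z x = 0"
      using gm Zm by (subst (asm) nn_integral_0_iff_AE) auto
    then show ?thesis
    proof eventually_elim
      case (elim x)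
      have "?g x \<le> ?Z x"
        using elim by (rule ennreal_minus_eq_0)
      moreover have "f i x \<le> ?g x" by (intro SUP_upper) auto
      ultimately show ?case by (rule order_trans[rotated])
    qed
  qed
  have least: "AE x in M. ?Z x \<le> W x" if "W \<in> borel_measurable M" "\<forall>i\<in>I. AE x in M. f i x \<le> W x" for W
  proof -
    have "AE x in M. \<forall>i\<in>K. f i x \<le> W x" using K that by (intro AE_ball_countable') (auto simp: CC_def)
    then show ?thesis by eventually_elim (auto intro!: SUP_least)
  qed
  show ?thesis unfolding is_ess_sup_family_def using Zm dom least by blast
qed

lemma subalgebra_sigma_obs:
  assumes "\<And>k. k \<in> K \<Longrightarrow> Y k \<in> measurable P MY"
  shows "subalgebra P (sigma_obs P MY Y K)"
proof -
  have "(\<Union>k\<in>K. {Y k -` A \<inter> space P | A. A \<in> sets MY}) \<subseteq> sets P"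
    using assms by (auto dest: measurable_sets)
  then show ?thesis unfolding sigma_obs_def subalgebra_def
    by (metis (no_types, lifting) sets.sigma_sets_subset sets_measure_of sets.space_closed space_measure_of_conv subset_trans)
qed

lemma sets_sigma_obs_mono:
  assumes "K \<subseteq> L"
  shows "sets (sigma_obs P MY Y K) \<subseteq> sets (sigma_obs P MY Y L)"
  unfolding sigma_obs_def
  by (subst (1 2) sets_measure_of) (use assms in \<open>auto intro!: sigma_sets_mono'\<close>)

lemma measurable_sigma_obs:
  assumes "k \<in> K" "Y k \<in> space P \<rightarrow> space MY"
  shows "Y k \<in> measurable (sigma_obs P MY Y K) MY"
  unfolding measurable_def
proof (intro CollectI conjI ballI)
  show "Y k \<in> space (sigma_obs P MY Y K) \<rightarrow> space MY" using assms(2) by (simp add: sigma_obs_def space_measure_of_conv)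
  fix A assume "A \<in> sets MY"
  then show "Y k -` A \<inter> space (sigma_obs P MY Y K) \<in> sets (sigma_obs P MY Y K)"
    unfolding sigma_obs_def using assms(1) by (subst sets_measure_of) (auto intro!: sigma_sets.Basic simp: space_measure_of_conv)
qed

text \<open>Unpacks the mixing coefficient into the essential supremum itself, which serves all
  future events at once, each outside its own null set. Capping it at 1 is harmless, because
  differences of probabilities are at most 1, and it later makes the p-th moment of \<open>Z\<close>
  at most its mean.\<close>

lemma (in prob_space) beta_mixing_dominating:
  assumes Y: "\<And>k. Y k \<in> measurable M MY"
    and beta: "beta_mixing M MY Y n \<le> ennreal c" and c: "0 \<le> c"
  shows "\<exists>Z. Z \<in> borel_measurable M \<and> (\<forall>x. 0 \<le> Z x \<and> Z x \<le> 1) \<and> (\<integral>\<^sup>+x. ennreal (Z x) \<partial>M) \<le> ennreal c \<and>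
    (\<forall>B\<in>sets (sigma_obs M MY Y {u + int n..}).
       AE x in M. \<bar>real_cond_exp M (sigma_obs M MY Y {..u}) (indicat_real B) x - prob B\<bar> \<le> Z x)"
proof -
  let ?F = "sigma_obs M MY Y {..u}" and ?I = "sets (sigma_obs M MY Y {u + int n..})"
  let ?f = "\<lambda>B x. ennreal \<bar>real_cond_exp M ?F (indicat_real B) x - prob B\<bar>"
  have subF: "subalgebra M ?F" and subG: "subalgebra M (sigma_obs M MY Y {u + int n..})"
    using subalgebra_sigma_obs Y by blast+
  interpret finite_measure_subalgebra M ?F by unfold_locales (rule subF)
  have bnd: "AE x in M. \<bar>real_cond_exp M ?F (indicat_real B) x - prob B\<bar> \<le> 1" if B: "B \<in> ?I" for B
  proof -
    have BM[measurable]: "B \<in> sets M" using B subG by (auto simp: subalgebra_def)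
    have i: "integrable M (indicat_real B)" by (intro integrable_real_indicator) (auto simp: less_top[symmetric])
    have "AE x in M. 0 \<le> real_cond_exp M ?F (indicat_real B) x" by (rule real_cond_exp_pos) auto
    moreover have "AE x in M. real_cond_exp M ?F (indicat_real B) x \<le> 1"
      by (rule real_cond_exp_le_c[OF i]) (auto simp: indicator_def)
    ultimately show ?thesis
    proof eventually_elim
      case (elim x) then show ?case using prob_le_1[of B] measure_nonneg[of M B] by linarith
    qed
  qed
  have "\<exists>Z. is_ess_sup_family M ?I ?f Z"
    by (rule ex_is_ess_sup_family[where c=1]) (use bnd in \<open>auto simp: elim!: eventually_mono\<close>)
  then have ess: "is_ess_sup_family M ?I ?f (ess_sup_family M ?I ?f)"
    unfolding ess_sup_family_def by (rule someI_ex)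
  let ?Z = "ess_sup_family M ?I ?f"
  have Zm[measurable]: "?Z \<in> borel_measurable M" and dom: "\<And>B. B \<in> ?I \<Longrightarrow> AE x in M. ?f B x \<le> ?Z x"
    using ess unfolding is_ess_sup_family_def by auto
  have int: "(\<integral>\<^sup>+x. ?Z x \<partial>M) \<le> ennreal c"
    using beta unfolding beta_mixing_def by (auto dest: SUP_upper2 intro: order_trans[OF SUP_upper[of u]])
  define Z where "Z = (\<lambda>x. enn2real (min (?Z x) 1))"
  have eZ: "ennreal (Z x) = min (?Z x) 1" for x
    unfolding Z_def by (rule ennreal_enn2real) (rule le_less_trans[of _ 1], auto)
  have 1: "Z \<in> borel_measurable M" unfolding Z_def by measurable
  have 2: "0 \<le> Z x \<and> Z x \<le> 1" for x
  proof -
    have "0 \<le> Z x" by (simp add: Z_def)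
    moreover have "ennreal (Z x) \<le> ennreal 1" unfolding eZ by simp
    ultimately show ?thesis by (subst (asm) ennreal_le_iff) auto
  qed
  have "(\<integral>\<^sup>+x. ennreal (Z x) \<partial>M) \<le> (\<integral>\<^sup>+x. ?Z x \<partial>M)" by (intro nn_integral_mono) (simp add: eZ)
  then have 3: "(\<integral>\<^sup>+x. ennreal (Z x) \<partial>M) \<le> ennreal c" using int by (rule order_trans)
  have 4: "AE x in M. \<bar>real_cond_exp M ?F (indicat_real B) x - prob B\<bar> \<le> Z x" if B: "B \<in> ?I" for B
    using bnd[OF B] dom[OF B]
  proof eventually_elim
    case (elim x)
    then have "?f B x \<le> ennreal (Z x)" unfolding eZ by (simp add: ennreal_le_1)
    then show ?case by (subst (asm) ennreal_le_iff) (auto simp: Z_def)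
  qed
  show ?thesis by (rule exI[of _ Z], intro conjI allI ballI) (fact 1, fact 2[THEN conjunct1], fact 2[THEN conjunct2], fact 3, fact 4)
qed

text \<open>An indicator has only the four preimages \<open>{}\<close>, \<open>space M\<close>,
  \<open>h\<close> and its complement, so independence of the set systems yields
  \<open>indep_var\<close>, whose product rule also covers unbounded integrable
  \<open>V\<close>.\<close>

lemma (in prob_space) indep_set_integral:
  assumes ind: "indep_set (sets H) (sets G)" and G: "subalgebra M G" and h: "h \<in> sets H"
    and V: "V \<in> borel_measurable G" "integrable M V"
  shows "(\<integral>x. indicator h x * V x \<partial>M) = prob h * (\<integral>x. V x \<partial>M)"
proof -
  have hM: "h \<in> sets M" using indep_setD_ev1[OF ind] h by auto
  have "indep_var borel (indicat_real h) borel V"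
    unfolding indep_var_eq
  proof (intro conjI)
    show "random_variable borel (indicat_real h)" using hM by auto
    show "random_variable borel V" using V(2) by auto
    show "indep_set (sigma_sets (space M) {indicat_real h -` A \<inter> space M |A. A \<in> sets borel})
      (sigma_sets (space M) {V -` A \<inter> space M |A. A \<in> sets borel})"
    proof (rule indep_set_sigma_sets)
      show "indep_set {indicat_real h -` A \<inter> space M |A. A \<in> sets borel} {V -` A \<inter> space M |A. A \<in> sets borel}"
      proof (rule indep_setI)
        show "{indicat_real h -` A \<inter> space M |A. A \<in> sets borel} \<subseteq> events" using hM by (auto intro!: measurable_sets)
        show "{V -` A \<inter> space M |A. A \<in> sets borel} \<subseteq> events" using V(2) by (auto intro!: measurable_sets)
        fix a b assume "a \<in> {indicat_real h -` A \<inter> space M |A. A \<in> sets borel}" and b: "b \<in> {V -` A \<inter> space M |A. A \<in> sets borel}"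
        then obtain A where A: "a = indicat_real h -` A \<inter> space M" by auto
        have bG: "b \<in> sets G" using b V(1) G by (auto simp: subalgebra_def dest: measurable_sets)
        then have bM: "b \<in> sets M" using G by (auto simp: subalgebra_def)
        have hb: "prob (h \<inter> b) = prob h * prob b" using indep_setD[OF ind h bG] .
        have hs: "h \<subseteq> space M" "b \<subseteq> space M" using hM bM sets.sets_into_space by auto
        have "a = (if 1 \<in> A then h else {}) \<union> (if 0 \<in> A then space M - h else {})"
          unfolding A using hs by (auto simp: indicator_def of_bool_def split: if_splits)
        then have "a = {} \<or> a = space M \<or> a = h \<or> a = space M - h"
          using hs by (cases "1 \<in> A"; cases "0 \<in> A") auto
        then show "prob (a \<inter> b) = prob a * prob b"
        proof (elim disjE)
          assume a: "a = space M - h"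
          have "prob ((space M - h) \<inter> b) = prob b - prob (h \<inter> b)"
          proof -
            have "(space M - h) \<inter> b = b - h \<inter> b" using hs by auto
            then show ?thesis using hM bM by (simp add: finite_measure_Diff)
          qed
          then show ?thesis using hb prob_compl[OF hM] a by (simp add: left_diff_distrib)
        qed (use hb hs in \<open>auto simp: prob_space Int_absorb1\<close>)
      qed
      have st: "Int_stable {X -` A \<inter> space M |A. A \<in> sets (borel :: real measure)}" for X :: "'a \<Rightarrow> real"
        unfolding Int_stable_def
      proof safe
        fix A B :: "real set" assume "A \<in> sets borel" "B \<in> sets borel"
        then show "\<exists>C. X -` A \<inter> space M \<inter> (X -` B \<inter> space M) = X -` C \<inter> space M \<and> C \<in> sets borel"
          by (intro exI[of _ "A \<inter> B"]) auto
      qed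
      show "Int_stable {indicat_real h -` A \<inter> space M |A. A \<in> sets borel}" "Int_stable {V -` A \<inter> space M |A. A \<in> sets borel}"
        using st by auto
    qed
  qed
  from indep_var_lebesgue_integral[OF this _ V(2)] hM show ?thesis
    by (simp add: integrable_real_indicator less_top[symmetric])
qed

text \<open>Both sides integrate alike over the sets \<open>a \<inter> h\<close>, where independence
  factors out \<open>prob h\<close>, and these form an intersection-stable generator of the larger
  \<sigma>-field. In this way the simulation noise drops out of conditional probabilities of
  observations.\<close>

lemma (in prob_space) real_cond_exp_indep_enlarge:
  assumes ind: "indep_set (sets H) (sets G)" and G: "subalgebra M G" and H: "subalgebra M H"
    and F: "subalgebra G F" and V: "V \<in> borel_measurable G" "integrable M V"
  shows "AE x in M. real_cond_exp M (sigma (space M) (sets F \<union> sets H)) V x = real_cond_exp M F V x"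
proof -
  let ?A = "sigma (space M) (sets F \<union> sets H)"
  have spaces: "space F = space M" "space H = space M" using F G H by (auto simp: subalgebra_def)
  have subs: "sets F \<subseteq> sets M" "sets H \<subseteq> sets M" "sets F \<subseteq> sets G" using F G H by (auto simp: subalgebra_def)
  have Pw: "sets F \<union> sets H \<subseteq> Pow (space M)" using subs sets.space_closed by blast
  have sA: "sets ?A = sigma_sets (space M) (sets F \<union> sets H)" using Pw by (rule sets_measure_of)
  have subA: "subalgebra M ?A"
    unfolding subalgebra_def sA using subs sets.sigma_sets_subset[of "sets F \<union> sets H" M] by (auto simp: space_measure_of_conv)
  interpret A: finite_measure_subalgebra M ?A by unfold_locales (rule subA)
  interpret F: finite_measure_subalgebra M F by unfold_locales (use subs spaces in \<open>auto simp: subalgebra_def\<close>)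
  define g where "g = real_cond_exp M F V"
  have gF: "g \<in> borel_measurable F" unfolding g_def by simp
  have gi: "integrable M g" unfolding g_def using F.real_cond_exp_int(1)[OF V(2)] .
  have gG: "g \<in> borel_measurable G" using measurable_mono[of borel borel F G] gF F by (auto simp: subalgebra_def)
  let ?\<Pi> = "{a \<inter> h | a h. a \<in> sets F \<and> h \<in> sets H}"
  have Pistab: "Int_stable ?\<Pi>"
    unfolding Int_stable_def
  proof safe
    fix a h a' h' assume "a \<in> sets F" "h \<in> sets H" "a' \<in> sets F" "h' \<in> sets H"
    then show "\<exists>aa ha. a \<inter> h \<inter> (a' \<inter> h') = aa \<inter> ha \<and> aa \<in> sets F \<and> ha \<in> sets H"
      by (intro exI[of _ "a \<inter> a'"] exI[of _ "h \<inter> h'"]) auto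
  qed
  have PiPow: "?\<Pi> \<subseteq> Pow (space M)" using Pw by auto
  have sPi: "sigma_sets (space M) (sets F \<union> sets H) = sigma_sets (space M) ?\<Pi>"
  proof (rule sigma_sets_eqI)
    fix a assume "a \<in> sets F \<union> sets H"
    then have "a \<in> ?\<Pi>"
    proof
      assume a: "a \<in> sets F"
      have "a = a \<inter> space M" using a subs sets.sets_into_space by blast
      moreover have "space M \<in> sets H" using sets.top[of H] spaces by simp
      ultimately show ?thesis using a by blast
    next
      assume a: "a \<in> sets H"
      have "a = space M \<inter> a" using a subs sets.sets_into_space by blast
      moreover have "space M \<in> sets F" using sets.top[of F] spaces by simp
      ultimately show ?thesis using a by blast
    qed
    then show "a \<in> sigma_sets (space M) ?\<Pi>" by (rule sigma_sets.Basic)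
  next
    fix b assume "b \<in> ?\<Pi>"
    then obtain a h where b: "b = a \<inter> h" "a \<in> sets F" "h \<in> sets H" by auto
    interpret sa: sigma_algebra "space M" "sigma_sets (space M) (sets F \<union> sets H)"
      using Pw by (rule sigma_algebra_sigma_sets)
    show "b \<in> sigma_sets (space M) (sets F \<union> sets H)"
      unfolding b(1) by (rule sa.Int; rule sigma_sets.Basic) (use b in simp_all)
  qed
  have ti: "integrable M (\<lambda>x. indicator B x * W x)" if "B \<in> sets M" "integrable M W" for B and W :: "'a \<Rightarrow> real"
    using integrable_mult_indicator[OF that] by simp
  have main: "(\<integral>x. indicator B x * V x \<partial>M) = (\<integral>x. indicator B x * g x \<partial>M)" if B: "B \<in> sigma_sets (space M) ?\<Pi>" for B
    using Pistab PiPow B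
  proof (induction rule: sigma_sets_induct_disjoint)
    case (basic b)
    then obtain a h where b: "b = a \<inter> h" "a \<in> sets F" "h \<in> sets H" by auto
    have e: "indicator b x * W x = indicator h x * (indicator a x * W x)" for x and W :: "'a \<Rightarrow> real"
      by (auto simp: b indicator_def)
    have aG: "a \<in> sets G" "a \<in> sets M" using b subs by auto
    have "(\<integral>x. indicator b x * V x \<partial>M) = prob h * (\<integral>x. indicator a x * V x \<partial>M)"
      unfolding e by (rule indep_set_integral[OF ind G b(3)]) (use V aG ti in auto)
    also have "(\<integral>x. indicator a x * V x \<partial>M) = (\<integral>x. indicator a x * g x \<partial>M)"
      using F.real_cond_exp_intA[OF V(2) b(2)] by (simp add: set_lebesgue_integral_def g_def)
    also have "prob h * \<dots> = (\<integral>x. indicator b x * g x \<partial>M)"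
      unfolding e by (rule indep_set_integral[OF ind G b(3), symmetric]) (use gG gi aG ti in auto)
    finally show ?case .
  next
    case (compl B)
    have BM: "B \<in> sets M"
    proof -
      have "B \<in> sets ?A" using compl(1) unfolding sA sPi .
      then show ?thesis using subA unfolding subalgebra_def by blast
    qed
    have e: "(\<integral>x. indicator (space M - B) x * W x \<partial>M) = (\<integral>x. W x \<partial>M) - (\<integral>x. indicator B x * W x \<partial>M)" if "integrable M W" for W :: "'a \<Rightarrow> real"
    proof -
      have "(\<integral>x. indicator (space M - B) x * W x \<partial>M) = (\<integral>x. W x - indicator B x * W x \<partial>M)"
        by (rule Bochner_Integration.integral_cong) (auto simp: indicator_def)
      then show ?thesis using that ti[OF BM that] by simp
    qed
    show ?case using e[OF V(2)] e[OF gi] compl F.real_cond_exp_int(2)[OF V(2)] by (simp add: g_def)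
  next
    case (union A)
    have AM: "A i \<in> sets M" for i
    proof -
      have "A i \<in> sigma_sets (space M) ?\<Pi>" using union(2) by blast
      then have "A i \<in> sets ?A" unfolding sA sPi .
      then show ?thesis using subA unfolding subalgebra_def by blast
    qed
    have e: "(\<integral>x. indicator (\<Union>i. A i) x * W x \<partial>M) = (\<Sum>i. \<integral>x. indicator (A i) x * W x \<partial>M)" if "integrable M W" for W :: "'a \<Rightarrow> real"
    proof -
      have "(LINT x:(\<Union>i. A i)|M. W x) = (\<Sum>i. (LINT x:(A i)|M. W x))"
        by (rule lebesgue_integral_countable_add)
          (use AM union(1) ti that in \<open>auto simp: disjoint_family_on_def set_integrable_def\<close>)
      then show ?thesis by (simp add: set_lebesgue_integral_def)
    qed
    show ?case using e[OF V(2)] e[OF gi] union(3) by simp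
  qed simp
  have "AE x in M. real_cond_exp M ?A V x = g x"
  proof (rule A.real_cond_exp_charact[OF _ V(2) gi])
    fix B assume "B \<in> sets ?A"
    then have "B \<in> sigma_sets (space M) ?\<Pi>" using sA sPi by simp
    from main[OF this] show "(LINT x:B|M. V x) = (LINT x:B|M. g x)" by (simp add: set_lebesgue_integral_def)
  next
    show "g \<in> borel_measurable ?A"
    proof -
      have "sets F \<subseteq> sets ?A" unfolding sA by (auto intro: sigma_sets.Basic)
      then show ?thesis using measurable_mono[of borel borel F ?A] gF spaces by (auto simp: space_measure_of_conv)
    qed
  qed
  then show ?thesis by (simp add: g_def)
qed

lemma (in finite_measure_subalgebra) real_cond_exp_abs_diff_le:
  assumes "integrable M f" "integrable M g" "integrable M h" "AE x in M. \<bar>f x - g x\<bar> \<le> h x"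
  shows "AE x in M. \<bar>real_cond_exp M F f x - real_cond_exp M F g x\<bar> \<le> real_cond_exp M F h x"
proof -
  have "AE x in M. real_cond_exp M F f x \<le> real_cond_exp M F (\<lambda>x. g x + h x) x"
    by (rule real_cond_exp_mono) (use assms in \<open>auto elim!: eventually_mono\<close>)
  moreover have "AE x in M. real_cond_exp M F g x \<le> real_cond_exp M F (\<lambda>x. f x + h x) x"
    by (rule real_cond_exp_mono) (use assms in \<open>auto elim!: eventually_mono\<close>)
  moreover have "AE x in M. real_cond_exp M F (\<lambda>x. g x + h x) x = real_cond_exp M F g x + real_cond_exp M F h x"
    by (rule real_cond_exp_add) (use assms in auto)
  moreover have "AE x in M. real_cond_exp M F (\<lambda>x. f x + h x) x = real_cond_exp M F f x + real_cond_exp M F h x"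
    by (rule real_cond_exp_add) (use assms in auto)
  ultimately show ?thesis by eventually_elim auto
qed

text \<open>Layer-cake decomposition on a grid: the sum counts the levels m / N up to
  \<open>w\<close>, so it is \<open>w\<close> rounded down to the grid. Being an average of N
  indicators, it inherits bounds known for indicators without loss of a constant.\<close>

lemma level_average_approx:
  fixes w :: real
  assumes "0 \<le> w" "w \<le> 1" "0 < N"
  shows "\<bar>w - (\<Sum>m\<in>{1..N}. 1 / real N * of_bool (real m / real N \<le> w))\<bar> \<le> 1 / real N"
proof -
  define k where "k = nat \<lfloor>real N * w\<rfloor>"
  have k: "real k \<le> real N * w" "real N * w < real k + 1" "k \<le> N"
  proof -
    have "0 \<le> real N * w" using assms by simp
    then show "real k \<le> real N * w" "real N * w < real k + 1" unfolding k_def by (auto simp: of_nat_nat)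
    have "real N * w \<le> real N" using assms by (simp add: mult_left_le)
    then show "k \<le> N" using \<open>real k \<le> real N * w\<close> by linarith
  qed
  have "(\<Sum>m\<in>{1..N}. 1 / real N * of_bool (real m / real N \<le> w)) = (\<Sum>m\<in>{1..k}. 1 / real N)"
  proof (rule sum.mono_neutral_cong_right)
    show "\<forall>i\<in>{1..N} - {1..k}. 1 / real N * of_bool (real i / real N \<le> w) = 0"
    proof
      fix i assume "i \<in> {1..N} - {1..k}"
      then have "real i > real N * w" using k by auto
      then have "\<not> real i / real N \<le> w" using assms by (simp add: field_simps)
      then show "1 / real N * of_bool (real i / real N \<le> w) = 0" by simp
    qed
    fix i assume "i \<in> {1..k}"
    then have "real i \<le> real N * w" using k by auto
    then have "real i / real N \<le> w" using assms by (simp add: field_simps)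
    then show "1 / real N * of_bool (real i / real N \<le> w) = 1 / real N" by simp
  qed (use k in auto)
  also have "\<dots> = real k / real N" by simp
  finally have e: "(\<Sum>m\<in>{1..N}. 1 / real N * of_bool (real m / real N \<le> w)) = real k / real N" .
  have "real k / real N \<le> w" "w \<le> (real k + 1) / real N" using k assms by (simp_all add: field_simps)
  then show ?thesis unfolding e by (simp add: add_divide_distrib)
qed

text \<open>The bound \<open>Z\<close> for events passes to averages of level-set indicators by the
  triangle inequality, and \<open>W\<close> is uniformly within 1 / N of such an average. The error
  2 / N is removed along countably many N, outside one null set.\<close>

lemma (in prob_space) cond_exp_mixing_unit:
  assumes A: "subalgebra M A" and G: "subalgebra M G"
    and Z: "\<And>B. B \<in> sets G \<Longrightarrow> AE x in M. \<bar>real_cond_exp M A (indicat_real B) x - prob B\<bar> \<le> Z x"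
    and W: "W \<in> borel_measurable G" "\<And>x. 0 \<le> W x \<and> W x \<le> 1"
  shows "AE x in M. \<bar>real_cond_exp M A W x - expectation W\<bar> \<le> Z x"
proof -
  interpret finite_measure_subalgebra M A by unfold_locales (rule A)
  have WM[measurable]: "W \<in> borel_measurable M" by (rule measurable_from_subalg[OF G W(1)])
  have Wi: "integrable M W" by (rule integrable_const_bound[where B=1]) (use W(2) in auto)
  have step: "AE x in M. \<bar>real_cond_exp M A W x - expectation W\<bar> \<le> Z x + 2 / real (Suc N')" for N'
  proof -
    define N where "N = Suc N'"
    have N: "0 < N" by (simp add: N_def)
    define B where "B = (\<lambda>m. {x \<in> space M. real m / real N \<le> W x})"
    have spG: "space G = space M" using G by (auto simp: subalgebra_def)
    have BG: "B m \<in> sets G" for m unfolding B_def spG[symmetric] using W(1) by measurable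
    have BM[measurable]: "B m \<in> sets M" for m using BG G by (auto simp: subalgebra_def)
    have Bi: "integrable M (indicat_real (B m))" for m by (intro integrable_real_indicator) (auto simp: less_top[symmetric])
    define V where "V = (\<lambda>x. \<Sum>m\<in>{1..N}. 1 / real N * indicat_real (B m) x)"
    have Vi: "integrable M V" unfolding V_def using Bi by auto
    have VW: "AE x in M. \<bar>W x - V x\<bar> \<le> 1 / real N"
    proof (rule AE_I2)
      fix x assume "x \<in> space M"
      then have "V x = (\<Sum>m\<in>{1..N}. 1 / real N * of_bool (real m / real N \<le> W x))"
        unfolding V_def B_def by (intro sum.cong) (auto simp: indicator_def)
      then show "\<bar>W x - V x\<bar> \<le> 1 / real N" using level_average_approx[of "W x" N] W(2)[of x] N by auto
    qed
    have 1: "AE x in M. \<bar>real_cond_exp M A W x - real_cond_exp M A V x\<bar> \<le> 1 / real N"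
    proof -
      have "AE x in M. \<bar>real_cond_exp M A W x - real_cond_exp M A V x\<bar> \<le> real_cond_exp M A (\<lambda>x. 1 / real N) x"
        by (rule real_cond_exp_abs_diff_le[OF Wi Vi _ VW]) auto
      moreover have "AE x in M. real_cond_exp M A (\<lambda>x. 1 / real N) x = 1 / real N"
        by (rule real_cond_exp_F_meas) auto
      ultimately show ?thesis by eventually_elim auto
    qed
    have "\<bar>expectation W - expectation V\<bar> \<le> expectation (\<lambda>x. \<bar>W x - V x\<bar>)"
      using integral_abs_bound[of M "\<lambda>x. W x - V x"] Wi Vi by simp
    also have "\<dots> \<le> expectation (\<lambda>x. 1 / real N)"
      by (rule integral_mono_AE) (use Wi Vi VW in auto)
    finally have 2: "\<bar>expectation W - expectation V\<bar> \<le> 1 / real N" by (simp add: prob_space)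
    have eV: "expectation V = (\<Sum>m\<in>{1..N}. 1 / real N * prob (B m))"
      unfolding V_def using Bi by simp
    have "AE x in M. real_cond_exp M A V x = (\<Sum>m\<in>{1..N}. real_cond_exp M A (\<lambda>x. 1 / real N * indicat_real (B m) x) x)"
      unfolding V_def by (rule real_cond_exp_sum) (use Bi in auto)
    moreover have "AE x in M. \<forall>m\<in>{1..N}. real_cond_exp M A (\<lambda>x. 1 / real N * indicat_real (B m) x) x = 1 / real N * real_cond_exp M A (indicat_real (B m)) x"
      by (intro AE_ball_countable') (use Bi in auto)
    moreover have "AE x in M. \<forall>m\<in>{1..N}. \<bar>real_cond_exp M A (indicat_real (B m)) x - prob (B m)\<bar> \<le> Z x"
      by (intro AE_ball_countable') (use Z BG in auto)
    ultimately have 3: "AE x in M. \<bar>real_cond_exp M A V x - expectation V\<bar> \<le> Z x"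
    proof eventually_elim
      case (elim x)
      have "\<bar>real_cond_exp M A V x - expectation V\<bar> = \<bar>\<Sum>m\<in>{1..N}. 1 / real N * (real_cond_exp M A (indicat_real (B m)) x - prob (B m))\<bar>"
        using elim eV by (simp add: sum_subtractf right_diff_distrib diff_divide_distrib)
      also have "\<dots> \<le> (\<Sum>m\<in>{1..N}. 1 / real N * Z x)"
        using elim(3) N by (intro order_trans[OF sum_abs] sum_mono) (auto simp: abs_mult divide_right_mono)
      also have "\<dots> = Z x" using N by simp
      finally show ?case .
    qed
    show ?thesis using 1 3
    proof eventually_elim
      case (elim x) then show ?case using 2 unfolding N_def by linarith
    qed
  qed
  then have "AE x in M. \<forall>N. \<bar>real_cond_exp M A W x - expectation W\<bar> \<le> Z x + 2 / real (Suc N)"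
    by (simp add: AE_all_countable)
  then show ?thesis
  proof eventually_elim
    case (elim x)
    have "(\<lambda>N. Z x + 2 / real (Suc N)) \<longlonglongrightarrow> Z x + 0"
      by (intro tendsto_intros lim_const_over_n[THEN LIMSEQ_Suc])
    then show ?case using elim by (intro LIMSEQ_le_const[of "\<lambda>N. Z x + 2 / real (Suc N)"]) auto
  qed
qed

text \<open>Truncation at level K. The clipped function is an affine image, of slope 2 K, of a
  function with values in [0, 1]; what is cut off is at most the excess of the envelope
  \<open>V\<close> over K.\<close>

lemma (in prob_space) cond_exp_mixing:
  assumes A: "subalgebra M A" and G: "subalgebra M G"
    and Z: "\<And>B. B \<in> sets G \<Longrightarrow> AE x in M. \<bar>real_cond_exp M A (indicat_real B) x - prob B\<bar> \<le> Z x"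
    and W: "W \<in> borel_measurable G" "AE x in M. \<bar>W x\<bar> \<le> V x" and V: "integrable M V" and K: "0 < K"
  shows "AE x in M. \<bar>real_cond_exp M A W x - expectation W\<bar>
    \<le> 2 * K * Z x + real_cond_exp M A (\<lambda>x. max 0 (V x - K)) x + expectation (\<lambda>x. max 0 (V x - K))"
proof -
  interpret finite_measure_subalgebra M A by unfold_locales (rule A)
  define C where "C = (\<lambda>x. max (- K) (min K (W x)))"
  define U where "U = (\<lambda>x. 1 / (2 * K) * C x + 1 / 2)"
  have WM[measurable]: "W \<in> borel_measurable M" by (rule measurable_from_subalg[OF G W(1)])
  have Wi: "integrable M W" by (rule Bochner_Integration.integrable_bound[OF V]) (use W in auto)
  have CG: "C \<in> borel_measurable G" unfolding C_def using W(1) by measurable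
  have CM[measurable]: "C \<in> borel_measurable M" unfolding C_def by measurable
  have Cb: "\<bar>C x\<bar> \<le> K" for x using K by (auto simp: C_def)
  have Ci: "integrable M C" by (rule integrable_const_bound[where B=K]) (use Cb in auto)
  have UG: "U \<in> borel_measurable G" unfolding U_def using CG by measurable
  have Ub: "0 \<le> U x \<and> U x \<le> 1" for x
    using Cb[of x] K by (auto simp: U_def field_simps)
  have Ui: "integrable M U" unfolding U_def using Ci by auto
  have hi: "integrable M (\<lambda>x. max 0 (V x - K))"
    by (rule Bochner_Integration.integrable_bound[of M "\<lambda>x. \<bar>V x\<bar> + K"]) (use V K in auto)
  have CW: "AE x in M. \<bar>W x - C x\<bar> \<le> max 0 (V x - K)" using W(2)
    by eventually_elim (auto simp: C_def)
  have 1: "AE x in M. \<bar>real_cond_exp M A W x - real_cond_exp M A C x\<bar> \<le> real_cond_exp M A (\<lambda>x. max 0 (V x - K)) x"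
    by (rule real_cond_exp_abs_diff_le[OF Wi Ci hi CW])
  have "\<bar>expectation W - expectation C\<bar> \<le> expectation (\<lambda>x. \<bar>W x - C x\<bar>)"
    using integral_abs_bound[of M "\<lambda>x. W x - C x"] Wi Ci by simp
  also have "\<dots> \<le> expectation (\<lambda>x. max 0 (V x - K))"
    by (rule integral_mono_AE) (use Wi Ci hi CW in auto)
  finally have 2: "\<bar>expectation W - expectation C\<bar> \<le> expectation (\<lambda>x. max 0 (V x - K))" .
  have 3: "AE x in M. \<bar>real_cond_exp M A U x - expectation U\<bar> \<le> Z x"
    by (rule cond_exp_mixing_unit[OF A G Z UG Ub])
  have CU: "C = (\<lambda>x. 2 * K * U x - K)" using K by (auto simp: U_def field_simps)
  have eC: "expectation C = 2 * K * expectation U - K"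
    unfolding CU using Ui by (simp add: prob_space)
  have "AE x in M. real_cond_exp M A C x = real_cond_exp M A (\<lambda>x. 2 * K * U x) x - real_cond_exp M A (\<lambda>x. K) x"
    unfolding CU by (rule real_cond_exp_diff) (use Ui in auto)
  moreover have "AE x in M. real_cond_exp M A (\<lambda>x. 2 * K * U x) x = 2 * K * real_cond_exp M A U x"
    by (rule real_cond_exp_cmult[OF Ui])
  moreover have "AE x in M. real_cond_exp M A (\<lambda>x. K) x = K" by (rule real_cond_exp_F_meas) auto
  ultimately have 4: "AE x in M. real_cond_exp M A C x - expectation C = 2 * K * (real_cond_exp M A U x - expectation U)"
    unfolding eC by eventually_elim (simp add: algebra_simps)
  show ?thesis using 1 3 4
  proof eventually_elim
    case (elim x)
    have "\<bar>real_cond_exp M A C x - expectation C\<bar> \<le> 2 * K * Z x"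
      using elim K by (simp add: abs_mult)
    then show ?case using elim(1) 2 by linarith
  qed
qed

lemma convex_on_abs_powr:
  assumes "1 \<le> (p::real)"
  shows "convex_on UNIV (\<lambda>x::real. \<bar>x\<bar> powr p)"
proof (rule convex_onI)
  fix t x y :: real assume t: "0 < t" "t < 1"
  have "\<bar>(1 - t) *\<^sub>R x + t *\<^sub>R y\<bar> powr p \<le> ((1 - t) * \<bar>x\<bar> + t * \<bar>y\<bar>) powr p"
    using t assms abs_triangle_ineq[of "(1-t) * x" "t * y"] by (intro powr_mono2) (auto simp: abs_mult)
  also have "\<dots> \<le> (1 - t) * \<bar>x\<bar> powr p + t * \<bar>y\<bar> powr p"
    using powr_add_le_weighted[of "(1 - t) * \<bar>x\<bar>" "t * \<bar>y\<bar>" "1 - t" t p] t assms by simp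
  finally show "\<bar>(1 - t) *\<^sub>R x + t *\<^sub>R y\<bar> powr p \<le> (1 - t) * \<bar>x\<bar> powr p + t * \<bar>y\<bar> powr p" .
qed simp

lemma (in prob_space) Lp_le_cond_exp:
  assumes "subalgebra M A" "Lp_le M p f w" "1 \<le> p"
  shows "Lp_le M p (real_cond_exp M A f) w"
proof -
  interpret finite_measure_subalgebra M A by unfold_locales (rule assms(1))
  note fi = Lp_le_integrable[OF assms(2)] Lp_le_1_integrable[OF assms(2,3)]
  have J: "AE x in M. \<bar>real_cond_exp M A f x\<bar> powr p \<le> real_cond_exp M A (\<lambda>x. \<bar>f x\<bar> powr p) x"
    by (rule real_cond_exp_jensens_inequality(2)[where I=UNIV and q="\<lambda>x. \<bar>x\<bar> powr p"])
      (use fi convex_on_abs_powr[OF assms(3)] in auto)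
  have i: "integrable M (real_cond_exp M A (\<lambda>x. \<bar>f x\<bar> powr p))" using real_cond_exp_int(1)[OF fi(1)] .
  have i2: "integrable M (\<lambda>x. \<bar>real_cond_exp M A f x\<bar> powr p)"
    by (rule Bochner_Integration.integrable_bound[OF i]) (use J in \<open>auto elim!: eventually_mono\<close>)
  have "(\<integral>x. \<bar>real_cond_exp M A f x\<bar> powr p \<partial>M) \<le> (\<integral>x. real_cond_exp M A (\<lambda>x. \<bar>f x\<bar> powr p) x \<partial>M)"
    by (rule integral_mono_AE[OF i2 i J])
  also have "\<dots> = (\<integral>x. \<bar>f x\<bar> powr p \<partial>M)" by (rule real_cond_exp_int(2)[OF fi(1)])
  finally show ?thesis using fi(2) i2 Lp_leD(2)[OF assms(2)] by (intro Lp_leI_integral) auto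
qed

lemma (in prob_space) Lp_le_expectation:
  assumes "Lp_le M p f w" "1 \<le> p"
  shows "Lp_le M p (\<lambda>_. expectation f) w"
proof -
  note fi = Lp_le_integrable[OF assms(1)] Lp_le_1_integrable[OF assms]
  have "\<bar>expectation f\<bar> powr p \<le> expectation (\<lambda>x. \<bar>f x\<bar> powr p)"
    by (rule jensens_inequality[where I=UNIV and q="\<lambda>x. \<bar>x\<bar> powr p"]) (use fi convex_on_abs_powr[OF assms(2)] in auto)
  then show ?thesis using fi(2) Lp_leD(2)[OF assms(1)] by (intro Lp_leI_integral) (auto simp: prob_space)
qed

text \<open>Where V exceeds K, V^p is at most K^(p - q) V^q because p < q: surplus moments become
  decay in the truncation level.\<close>

lemma Lp_le_excess:
  assumes V: "Lp_le M q V v" and pq: "1 \<le> p" "p < q" and K: "0 < K"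
  shows "Lp_le M p (\<lambda>x. max 0 (V x - K)) (v powr (q / p) * K powr ((p - q) / p))"
proof -
  note [measurable] = Lp_leD(1)[OF V]
  have le: "\<bar>max 0 (V x - K)\<bar> powr p \<le> K powr (p - q) * \<bar>V x\<bar> powr q" for x
  proof (cases "V x \<le> K")
    case False
    have "\<bar>max 0 (V x - K)\<bar> powr p \<le> V x powr p" using False K pq by (intro powr_mono2) auto
    also have "\<dots> = V x powr (p - q) * V x powr q" using False K by (simp add: powr_add[symmetric])
    also have "\<dots> \<le> K powr (p - q) * V x powr q" using False K pq by (intro mult_right_mono powr_mono2') auto
    finally show ?thesis using False K by simp
  qed (use pq in simp)
  have "(\<integral>\<^sup>+x. ennreal (\<bar>max 0 (V x - K)\<bar> powr p) \<partial>M) \<le> (\<integral>\<^sup>+x. ennreal (K powr (p - q)) * ennreal (\<bar>V x\<bar> powr q) \<partial>M)"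
    using le by (intro nn_integral_mono) (simp add: ennreal_mult[symmetric] ennreal_leI)
  also have "\<dots> = ennreal (K powr (p - q)) * (\<integral>\<^sup>+x. ennreal (\<bar>V x\<bar> powr q) \<partial>M)"
    by (rule nn_integral_cmult) measurable
  also have "\<dots> \<le> ennreal (K powr (p - q)) * ennreal (v powr q)" by (intro mult_left_mono Lp_leD(3)[OF V]) simp
  also have "\<dots> = ennreal ((v powr (q / p) * K powr ((p - q) / p)) powr p)"
    using pq by (simp add: ennreal_mult[symmetric] powr_mult powr_powr mult.commute)
  finally show ?thesis by (auto simp: Lp_le_def)
qed

text \<open>The order of quantifiers is the point: \<open>R\<close> depends on the envelope and the
  \<sigma>-fields but not on \<open>W\<close>, hence it will bound the statistics of all parameters
  simultaneously.\<close>

lemma (in prob_space) cond_exp_mixing_Lp: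
  assumes A: "subalgebra M A" and G: "subalgebra M G"
    and Z: "\<And>B. B \<in> sets G \<Longrightarrow> AE x in M. \<bar>real_cond_exp M A (indicat_real B) x - prob B\<bar> \<le> Z x"
    and Zm: "Z \<in> borel_measurable M" "\<And>x. 0 \<le> Z x \<and> Z x \<le> 1" "(\<integral>\<^sup>+x. ennreal (Z x) \<partial>M) \<le> ennreal \<delta>" and \<delta>: "0 \<le> \<delta>"
    and V: "Lp_le M q V v" and pq: "1 \<le> p" "p < q" and K: "0 < K"
  shows "\<exists>R. Lp_le M p R (2 * K * \<delta> powr (1 / p) + 2 * (v powr (q / p) * K powr ((p - q) / p))) \<and>
     (\<forall>W. W \<in> borel_measurable G \<longrightarrow> (AE x in M. \<bar>W x\<bar> \<le> V x) \<longrightarrow>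
       (AE x in M. \<bar>real_cond_exp M A W x - expectation W\<bar> \<le> R x))"
proof -
  define h where "h = (\<lambda>x. max 0 (V x - K))"
  define R where "R = (\<lambda>x. 2 * K * Z x + real_cond_exp M A h x + expectation h)"
  define w where "w = v powr (q / p) * K powr ((p - q) / p)"
  have h: "Lp_le M p h w" unfolding h_def w_def by (rule Lp_le_excess[OF V pq K])
  have ZL: "Lp_le M p Z (\<delta> powr (1 / p))"
  proof -
    \<comment> \<open>Because \<open>Z\<close> is at most 1, its p-th moment is at most its mean,
      whence the root \<delta>^(1/p).\<close>
    have "Z x powr p \<le> Z x" for x
    proof (cases "Z x = 0")
      case False
      then have "Z x powr p \<le> Z x powr 1" using Zm(2)[of x] pq by (intro powr_mono') auto
      then show ?thesis using Zm(2)[of x] by simp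
    qed simp
    then have "(\<integral>\<^sup>+x. ennreal (\<bar>Z x\<bar> powr p) \<partial>M) \<le> (\<integral>\<^sup>+x. ennreal (Z x) \<partial>M)"
      using Zm(2) by (intro nn_integral_mono ennreal_leI) auto
    also have "\<dots> \<le> ennreal \<delta>" by (rule Zm(3))
    also have "\<delta> = (\<delta> powr (1 / p)) powr p" using \<delta> pq by (simp add: powr_powr)
    finally show ?thesis using Zm(1) by (auto simp: Lp_le_def)
  qed
  have "Lp_le M p R (\<bar>2 * K\<bar> * \<delta> powr (1 / p) + w + w)"
    unfolding R_def using pq by (intro Lp_le_add Lp_le_cmult ZL Lp_le_cond_exp[OF A h] Lp_le_expectation[OF h]) auto
  moreover have "\<bar>2 * K\<bar> * \<delta> powr (1 / p) + w + w = 2 * K * \<delta> powr (1 / p) + 2 * w" using K by simp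
  ultimately have "Lp_le M p R (2 * K * \<delta> powr (1 / p) + 2 * w)" by (simp only:)
  moreover have "AE x in M. \<bar>real_cond_exp M A W x - expectation W\<bar> \<le> R x"
    if "W \<in> borel_measurable G" "AE x in M. \<bar>W x\<bar> \<le> V x" for W
    using cond_exp_mixing[OF A G Z that Lp_le_1_integrable[OF V] K] pq by (simp add: R_def h_def)
  ultimately show ?thesis unfolding w_def by blast
qed

section \<open>Forgetting of the smoothing distributions\<close>

definition bounded_meas :: "'x measure \<Rightarrow> ('x \<Rightarrow> real) \<Rightarrow> bool" where
  "bounded_meas lam f \<longleftrightarrow> f \<in> borel_measurable lam \<and> (\<exists>c. \<forall>x. \<bar>f x\<bar> \<le> c)"

definition kernel_op :: "'x measure \<Rightarrow> (int \<Rightarrow> 'x \<Rightarrow> 'x \<Rightarrow> real) \<Rightarrow> int \<Rightarrow> ('x \<Rightarrow> real) \<Rightarrow> 'x \<Rightarrow> real" where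
  "kernel_op lam \<kappa> i f x = (\<integral>x'. \<kappa> i x x' * f x' \<partial>lam)"

text \<open>Kernel \<open>j\<close> leads from the state at time \<open>j - 1\<close> to the state
  at time \<open>j\<close>. Hence this integrates out the times \<open>i\<close> to
  \<open>i + n - 1\<close>, given the state \<open>x\<close> at time \<open>i - 1\<close>, with
  \<open>f\<close> applied to the last state.\<close>

primrec kernel_iter :: "'x measure \<Rightarrow> (int \<Rightarrow> 'x \<Rightarrow> 'x \<Rightarrow> real) \<Rightarrow> int \<Rightarrow> nat \<Rightarrow> ('x \<Rightarrow> real) \<Rightarrow> 'x \<Rightarrow> real" where
  "kernel_iter lam \<kappa> i 0 f = f"
| "kernel_iter lam \<kappa> i (Suc n) f = kernel_op lam \<kappa> i (kernel_iter lam \<kappa> (i + 1) n f)"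

lemma kernel_iter_add:
  "kernel_iter lam \<kappa> i (n + k) f = kernel_iter lam \<kappa> i n (kernel_iter lam \<kappa> (i + int n) k f)"
  by (induction n arbitrary: i) (simp_all add: algebra_simps)

lemma kernel_iter_snoc:
  "kernel_iter lam \<kappa> i (Suc n) f = kernel_iter lam \<kappa> i n (kernel_op lam \<kappa> (i + int n) f)"
  using kernel_iter_add[of lam \<kappa> i n 1 f] by simp

lemma kernel_iter_cong:
  assumes "\<And>j. i \<le> j \<Longrightarrow> j < i + int n \<Longrightarrow> \<kappa> j = \<kappa>' j"
  shows "kernel_iter lam \<kappa> i n f = kernel_iter lam \<kappa>' i n f"
  using assms
proof (induction n arbitrary: i)
  case (Suc n)
  have "kernel_iter lam \<kappa> (i + 1) n f = kernel_iter lam \<kappa>' (i + 1) n f" by (rule Suc.IH) (use Suc.prems in auto)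
  moreover have "\<kappa> i = \<kappa>' i" using Suc.prems by auto
  ultimately show ?case by (simp add: kernel_op_def fun_eq_iff)
qed simp

lemma kernel_iter_shift:
  "kernel_iter lam \<kappa> (i + d) n f = kernel_iter lam (\<lambda>j. \<kappa> (j + d)) i n f"
proof (induction n arbitrary: i)
  case (Suc n)
  then show ?case using Suc[of "i + 1"] by (simp add: kernel_op_def fun_eq_iff algebra_simps)
qed simp

locale bounded_kernels =
  fixes lam :: "'x measure" and \<kappa> :: "int \<Rightarrow> 'x \<Rightarrow> 'x \<Rightarrow> real"
  assumes finite_lam: "finite_measure lam" and space_lam: "space lam = UNIV"
    and kernel_meas: "\<And>i. (\<lambda>(x, x'). \<kappa> i x x') \<in> borel_measurable (lam \<Otimes>\<^sub>M lam)"
    and kernel_bound: "\<And>i. \<exists>c. \<forall>x x'. \<bar>\<kappa> i x x'\<bar> \<le> c"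
begin

sublocale finite_measure lam by (rule finite_lam)

lemma kernel_meas2: "(\<lambda>x'. \<kappa> i x x') \<in> borel_measurable lam"
  using measurable_compose[OF measurable_Pair1'[of x lam lam] kernel_meas[of i]] by (simp add: space_lam)

lemma bounded_meas_integrable:
  assumes "bounded_meas lam f" shows "integrable lam f"
proof -
  obtain c where "\<forall>x. \<bar>f x\<bar> \<le> c" using assms by (auto simp: bounded_meas_def)
  then show ?thesis using assms by (intro integrable_const_bound[where B=c]) (auto simp: bounded_meas_def)
qed

lemma bounded_meas_chi_integrable:
  assumes "bounded_meas lam f" "prob_on lam chi" shows "integrable chi f"
proof -
  interpret chi: prob_space chi using assms(2) by (auto simp: prob_on_def)
  have "f \<in> borel_measurable chi" using assms by (auto simp: bounded_meas_def prob_on_def cong: measurable_cong_sets)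
  moreover obtain c where "\<forall>x. \<bar>f x\<bar> \<le> c" using assms by (auto simp: bounded_meas_def)
  ultimately show ?thesis by (intro chi.integrable_const_bound[where B=c]) auto
qed

lemma bounded_meas_kernel_mult:
  assumes "bounded_meas lam f"
  shows "bounded_meas lam (\<lambda>x'. \<kappa> i x x' * f x')"
proof -
  obtain c d where c: "\<forall>x x'. \<bar>\<kappa> i x x'\<bar> \<le> c" and d: "\<forall>x. \<bar>f x\<bar> \<le> d"
    using assms kernel_bound[of i] by (auto simp: bounded_meas_def)
  then have "\<bar>\<kappa> i x x' * f x'\<bar> \<le> c * d" for x'
    unfolding abs_mult by (intro mult_mono) (auto intro: order_trans[OF abs_ge_zero])
  then show ?thesis using assms kernel_meas2[of i x] by (auto simp: bounded_meas_def)
qed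

lemma kernel_mult_integrable:
  assumes "bounded_meas lam f" shows "integrable lam (\<lambda>x'. \<kappa> i x x' * f x')"
  by (rule bounded_meas_integrable[OF bounded_meas_kernel_mult[OF assms]])

lemma bounded_meas_kernel_op:
  assumes "bounded_meas lam f"
  shows "bounded_meas lam (kernel_op lam \<kappa> i f)"
proof -
  obtain c d where c: "\<forall>x x'. \<bar>\<kappa> i x x'\<bar> \<le> c" and d: "\<forall>x. \<bar>f x\<bar> \<le> d"
    using assms kernel_bound[of i] by (auto simp: bounded_meas_def)
  have fm: "f \<in> borel_measurable lam" using assms by (auto simp: bounded_meas_def)
  have "(\<lambda>(x, x'). \<kappa> i x x' * f x') \<in> borel_measurable (lam \<Otimes>\<^sub>M lam)"
  proof -
    have "(\<lambda>z. (\<lambda>(x, x'). \<kappa> i x x') z * f (snd z)) \<in> borel_measurable (lam \<Otimes>\<^sub>M lam)"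
      by (intro borel_measurable_times kernel_meas measurable_compose[OF measurable_snd fm])
    then show ?thesis by (simp add: case_prod_beta')
  qed
  then have m: "kernel_op lam \<kappa> i f \<in> borel_measurable lam"
    unfolding kernel_op_def[abs_def] by (rule borel_measurable_lebesgue_integral)
  have "\<bar>kernel_op lam \<kappa> i f x\<bar> \<le> (\<integral>x'. c * d \<partial>lam)" for x
  proof -
    have "\<bar>kernel_op lam \<kappa> i f x\<bar> \<le> (\<integral>x'. \<bar>\<kappa> i x x' * f x'\<bar> \<partial>lam)"
      unfolding kernel_op_def by (rule integral_abs_bound)
    also have "\<dots> \<le> (\<integral>x'. c * d \<partial>lam)"
    proof (rule integral_mono)
      show "integrable lam (\<lambda>x'. \<bar>\<kappa> i x x' * f x'\<bar>)" using kernel_mult_integrable[OF assms] by auto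
      show "\<bar>\<kappa> i x x' * f x'\<bar> \<le> c * d" for x'
        unfolding abs_mult using c d by (intro mult_mono) (auto intro: order_trans[OF abs_ge_zero])
    qed auto
    finally show ?thesis .
  qed
  then show ?thesis using m unfolding bounded_meas_def by blast
qed

lemma bounded_meas_kernel_iter:
  "bounded_meas lam f \<Longrightarrow> bounded_meas lam (kernel_iter lam \<kappa> i n f)"
  by (induction n arbitrary: i) (auto intro: bounded_meas_kernel_op)

lemma kernel_op_linear:
  assumes "bounded_meas lam f" "bounded_meas lam h"
  shows "kernel_op lam \<kappa> i (\<lambda>x. a * f x + b * h x) = (\<lambda>x. a * kernel_op lam \<kappa> i f x + b * kernel_op lam \<kappa> i h x)"
proof
  fix x
  have "(\<integral>x'. \<kappa> i x x' * (a * f x' + b * h x') \<partial>lam) = (\<integral>x'. a * (\<kappa> i x x' * f x') + b * (\<kappa> i x x' * h x') \<partial>lam)"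
    by (rule Bochner_Integration.integral_cong) (auto simp: algebra_simps)
  also have "\<dots> = a * (\<integral>x'. \<kappa> i x x' * f x' \<partial>lam) + b * (\<integral>x'. \<kappa> i x x' * h x' \<partial>lam)"
    using kernel_mult_integrable[OF assms(1)] kernel_mult_integrable[OF assms(2)] by simp
  finally show "kernel_op lam \<kappa> i (\<lambda>x. a * f x + b * h x) x = a * kernel_op lam \<kappa> i f x + b * kernel_op lam \<kappa> i h x"
    by (simp add: kernel_op_def)
qed

lemma bounded_meas_linear:
  assumes "bounded_meas lam f" "bounded_meas lam h"
  shows "bounded_meas lam (\<lambda>x. a * f x + b * h x)"
proof -
  obtain c d where c: "\<forall>x. \<bar>f x\<bar> \<le> c" and d: "\<forall>x. \<bar>h x\<bar> \<le> d"
    using assms by (auto simp: bounded_meas_def)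
  have "\<bar>a * f x + b * h x\<bar> \<le> \<bar>a\<bar> * c + \<bar>b\<bar> * d" for x
  proof -
    have "\<bar>a * f x + b * h x\<bar> \<le> \<bar>a\<bar> * \<bar>f x\<bar> + \<bar>b\<bar> * \<bar>h x\<bar>"
      using abs_triangle_ineq[of "a * f x" "b * h x"] by (simp add: abs_mult)
    also have "\<dots> \<le> \<bar>a\<bar> * c + \<bar>b\<bar> * d" using c d by (intro add_mono mult_left_mono) auto
    finally show ?thesis .
  qed
  then show ?thesis using assms by (auto simp: bounded_meas_def)
qed

lemma kernel_iter_linear:
  assumes "bounded_meas lam f" "bounded_meas lam h"
  shows "kernel_iter lam \<kappa> i n (\<lambda>x. a * f x + b * h x) = (\<lambda>x. a * kernel_iter lam \<kappa> i n f x + b * kernel_iter lam \<kappa> i n h x)"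
  by (induction n arbitrary: i) (simp_all add: kernel_op_linear bounded_meas_kernel_iter assms)

lemma finite_PiM_chi_lam:
  assumes "prob_on lam chi" "finite I"
  shows "finite_measure (PiM I (\<lambda>i. if i = r then chi else lam))"
proof (rule finite_measureI)
  let ?M = "\<lambda>i. if i = r then chi else lam"
  interpret chi: prob_space chi using assms(1) by (auto simp: prob_on_def)
  interpret PM: product_sigma_finite ?M
    unfolding product_sigma_finite_def using chi.sigma_finite_measure_axioms sigma_finite_measure_axioms by simp
  have "emeasure (PiM I ?M) (space (PiM I ?M)) = (\<Prod>i\<in>I. emeasure (?M i) (space (?M i)))"
    unfolding space_PiM by (rule PM.emeasure_PiM) (use assms in auto)
  then show "emeasure (PiM I ?M) (space (PiM I ?M)) \<noteq> \<infinity>"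
    using chi.emeasure_finite emeasure_finite by (auto simp: ennreal_prod_eq_top)
qed

text \<open>Integrating out the last state by Fubini leaves the same integral over a shorter path
  with \<open>kernel_op\<close> applied to \<open>f\<close>, which is why \<open>f\<close> is
  generalised in the induction.\<close>

lemma path_integral:
  assumes chi: "prob_on lam chi" and f: "bounded_meas lam f"
  shows "(\<integral>x. (\<Prod>i\<in>{r..r + int n - 1}. \<kappa> (i + 1) (x i) (x (i + 1))) * f (x (r + int n)) \<partial>path_measure lam chi r (r + int n))
    = (\<integral>x. kernel_iter lam \<kappa> (r + 1) n f x \<partial>chi)"
  using f
proof (induction n arbitrary: f)
  let ?M = "\<lambda>i. if i = r then chi else lam"
  interpret chi: prob_space chi using chi by (auto simp: prob_on_def)
  have schi: "sets chi = sets lam" using chi by (auto simp: prob_on_def)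
  interpret PM: product_sigma_finite ?M
    unfolding product_sigma_finite_def using chi.sigma_finite_measure_axioms sigma_finite_measure_axioms by simp
  {
    case 0
    have "f \<in> borel_measurable (?M r)" using 0 schi by (auto simp: bounded_meas_def cong: measurable_cong_sets)
    from PM.product_integral_singleton[OF this] show ?case by (simp add: path_measure_def)
  next
    case (Suc n)
    define t where "t = r + int n"
    have "t + 1 \<noteq> r" by (simp add: t_def)
    have st: "r + int (Suc n) = t + 1" by (simp add: t_def)
    have ins: "{r..t + 1} = insert (t + 1) {r..t}" by (auto simp: t_def)
    have ins2: "{r..t + 1 - 1} = insert t {r..t - 1}" by (auto simp: t_def)
    let ?D = "\<lambda>x. \<Prod>i\<in>{r..t - 1}. \<kappa> (i + 1) (x i) (x (i + 1))"
    let ?F = "\<lambda>x. (\<Prod>i\<in>insert t {r..t - 1}. \<kappa> (i + 1) (x i) (x (i + 1))) * f (x (t + 1))"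
    let ?P = "PiM (insert (t + 1) {r..t}) ?M"
    have comp: "(\<lambda>x. x i) \<in> measurable ?P lam" if "i \<in> insert (t + 1) {r..t}" for i
      using measurable_component_singleton[OF that, of ?M] schi by (auto split: if_splits cong: measurable_cong_sets)
    have Fm: "?F \<in> borel_measurable ?P"
    proof (intro borel_measurable_times borel_measurable_prod)
      fix i assume i: "i \<in> insert t {r..t - 1}"
      have "(\<lambda>x. (x i, x (i + 1))) \<in> measurable ?P (lam \<Otimes>\<^sub>M lam)"
        using i by (intro measurable_Pair comp) (auto simp: t_def)
      from measurable_compose[OF this kernel_meas[of "i + 1"]]
      show "(\<lambda>x. \<kappa> (i + 1) (x i) (x (i + 1))) \<in> borel_measurable ?P" by (simp only: split)
    next
      have c1: "(\<lambda>x. x (t + 1)) \<in> measurable ?P lam" by (rule comp) blast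
      have "f \<in> borel_measurable lam" using Suc.prems by (simp only: bounded_meas_def)
      with c1 show "(\<lambda>x. f (x (t + 1))) \<in> borel_measurable ?P" by (rule measurable_compose)
    qed
    obtain c where c: "\<And>i x x'. \<bar>\<kappa> i x x'\<bar> \<le> c i" using kernel_bound by metis
    obtain d where d: "\<And>x. \<bar>f x\<bar> \<le> d" using Suc.prems by (auto simp: bounded_meas_def)
    have Fb: "\<bar>?F x\<bar> \<le> (\<Prod>i\<in>insert t {r..t - 1}. c (i + 1)) * d" for x
      unfolding abs_mult abs_prod
    proof (rule mult_mono)
      show "(\<Prod>i\<in>insert t {r..t - 1}. \<bar>\<kappa> (i + 1) (x i) (x (i + 1))\<bar>) \<le> (\<Prod>i\<in>insert t {r..t - 1}. c (i + 1))"
        by (rule prod_mono) (simp only: c abs_ge_zero simp_thms)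
      show "0 \<le> (\<Prod>i\<in>insert t {r..t - 1}. c (i + 1))"
        by (rule prod_nonneg) (rule order_trans[OF abs_ge_zero c])
      show "\<bar>f (x (t + 1))\<bar> \<le> d" by (rule d)
    qed simp
    interpret P: finite_measure ?P by (rule finite_PiM_chi_lam[OF chi]) simp
    have Fi: "integrable ?P ?F" by (rule P.integrable_const_bound[OF AE_I2 Fm]) (use Fb in auto)
    have "(\<integral>x. ?F x \<partial>?P) = (\<integral>x. (\<integral>y. ?F (x(t + 1 := y)) \<partial>?M (t + 1)) \<partial>PiM {r..t} ?M)"
      by (rule PM.product_integral_insert[OF _ _ Fi]) auto
    also have "\<dots> = (\<integral>x. ?D x * kernel_op lam \<kappa> (t + 1) f (x t) \<partial>PiM {r..t} ?M)"
    proof (rule Bochner_Integration.integral_cong[OF refl])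
      fix x
      have "?F (x(t + 1 := y)) = ?D x * (\<kappa> (t + 1) (x t) y * f y)" for y
      proof -
        have "(\<Prod>i\<in>{r..t - 1}. \<kappa> (i + 1) ((x(t + 1 := y)) i) ((x(t + 1 := y)) (i + 1))) = ?D x"
          by (rule prod.cong) auto
        then show ?thesis by (simp add: mult_ac)
      qed
      then show "(\<integral>y. ?F (x(t + 1 := y)) \<partial>?M (t + 1)) = ?D x * kernel_op lam \<kappa> (t + 1) f (x t)"
        using \<open>t + 1 \<noteq> r\<close> by (simp only: if_False integral_mult_right_zero kernel_op_def)
    qed
    also have "\<dots> = (\<integral>x. kernel_iter lam \<kappa> (r + 1) n (kernel_op lam \<kappa> (t + 1) f) x \<partial>chi)"
      using Suc.IH[OF bounded_meas_kernel_op[OF Suc.prems], of "t + 1"] by (simp add: path_measure_def t_def)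
    also have "\<dots> = (\<integral>x. kernel_iter lam \<kappa> (r + 1) (Suc n) f x \<partial>chi)"
      unfolding kernel_iter_snoc by (simp add: t_def algebra_simps)
    finally show ?case unfolding path_measure_def st ins ins2 .
  }
qed

end

text \<open>A Doeblin condition for unnormalised kernels: each is comparable, uniformly in the
  starting state, to a function of the arrival state alone. In the model \<open>G j\<close> is the
  observation density evaluated at the observation of time \<open>j\<close>. The strict inequality
  between the two bounds keeps \<open>\<rho>\<close> positive.\<close>

locale mixing_kernels = bounded_kernels +
  fixes G :: "int \<Rightarrow> 'a \<Rightarrow> real" and \<sigma>m \<sigma>p :: real
  assumes lam_nonzero: "emeasure lam (space lam) \<noteq> 0"
    and G_pos: "\<And>i x. 0 < G i x" and G_meas: "\<And>i. bounded_meas lam (G i)"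
    and \<sigma>: "0 < \<sigma>m" "\<sigma>m < \<sigma>p"
    and minor: "\<And>i x x'. \<sigma>m * G i x' \<le> \<kappa> i x x'" and major: "\<And>i x x'. \<kappa> i x x' \<le> \<sigma>p * G i x'"
begin

definition \<rho> :: real where "\<rho> = 1 - \<sigma>m / \<sigma>p"

lemma \<rho>: "0 < \<rho>" "\<rho> < 1" using \<sigma> by (auto simp: \<rho>_def field_simps)

lemma kernel_pos: "0 < \<kappa> i x x'"
  using minor[of i x' x] G_pos[of i x'] \<sigma> by (meson mult_pos_pos less_le_trans)

lemma integral_pos:
  assumes "bounded_meas lam f" "\<And>x. 0 < f x" shows "0 < (\<integral>x. f x \<partial>lam)"
  using integral_less_AE_space[of "\<lambda>_. 0" f] bounded_meas_integrable[OF assms(1)] lam_nonzero assms(2) by simp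

lemma chi_integral_pos:
  assumes "bounded_meas lam f" "\<And>x. 0 < f x" "prob_on lam chi" shows "0 < (\<integral>x. f x \<partial>chi)"
proof -
  interpret chi: prob_space chi using assms(3) by (auto simp: prob_on_def)
  show ?thesis
    using chi.integral_less_AE_space[of "\<lambda>_. 0" f] bounded_meas_chi_integrable[OF assms(1,3)] assms(2)
    by (simp add: chi.emeasure_space_1)
qed

lemma bounded_meas_G_mult:
  assumes "bounded_meas lam f" shows "bounded_meas lam (\<lambda>x. G i x * f x)"
proof -
  obtain c d where c: "\<forall>x. \<bar>G i x\<bar> \<le> c" and d: "\<forall>x. \<bar>f x\<bar> \<le> d"
    using assms G_meas[of i] by (auto simp: bounded_meas_def)
  then have "\<bar>G i x * f x\<bar> \<le> c * d" for x
    unfolding abs_mult by (intro mult_mono) (auto intro: order_trans[OF abs_ge_zero])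
  then show ?thesis using assms G_meas[of i] by (auto simp: bounded_meas_def)
qed

lemma kernel_op_bounds:
  assumes "bounded_meas lam f" "\<And>x. 0 \<le> f x"
  shows "\<sigma>m * (\<integral>x. G i x * f x \<partial>lam) \<le> kernel_op lam \<kappa> i f x" "kernel_op lam \<kappa> i f x \<le> \<sigma>p * (\<integral>x. G i x * f x \<partial>lam)"
proof -
  note Gi = bounded_meas_integrable[OF bounded_meas_G_mult[OF assms(1), of i]]
  have "\<sigma>m * (\<integral>x. G i x * f x \<partial>lam) = (\<integral>x'. \<sigma>m * (G i x' * f x') \<partial>lam)" by simp
  also have "\<dots> \<le> kernel_op lam \<kappa> i f x" unfolding kernel_op_def
  proof (rule integral_mono[OF _ kernel_mult_integrable[OF assms(1)]])
    show "\<sigma>m * (G i x' * f x') \<le> \<kappa> i x x' * f x'" for x'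
      using mult_right_mono[OF minor[of i x' x] assms(2)[of x']] by (simp only: mult.assoc)
  qed (use Gi in auto)
  finally show "\<sigma>m * (\<integral>x. G i x * f x \<partial>lam) \<le> kernel_op lam \<kappa> i f x" .
  have "kernel_op lam \<kappa> i f x \<le> (\<integral>x'. \<sigma>p * (G i x' * f x') \<partial>lam)" unfolding kernel_op_def
  proof (rule integral_mono[OF kernel_mult_integrable[OF assms(1)]])
    show "\<kappa> i x x' * f x' \<le> \<sigma>p * (G i x' * f x')" for x'
      using mult_right_mono[OF major[of i x x'] assms(2)[of x']] by (simp only: mult.assoc)
  qed (use Gi in auto)
  also have "\<dots> = \<sigma>p * (\<integral>x. G i x * f x \<partial>lam)" by simp
  finally show "kernel_op lam \<kappa> i f x \<le> \<sigma>p * (\<integral>x. G i x * f x \<partial>lam)" .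
qed

lemma kernel_op_pos:
  assumes "bounded_meas lam f" "\<And>x. 0 < f x" shows "0 < kernel_op lam \<kappa> i f x"
proof -
  have "0 < (\<integral>x. G i x * f x \<partial>lam)"
    by (rule integral_pos[OF bounded_meas_G_mult[OF assms(1)]]) (simp add: G_pos assms(2))
  then have "0 < \<sigma>m * (\<integral>x. G i x * f x \<partial>lam)" using \<sigma> by simp
  then show ?thesis using kernel_op_bounds(1)[OF assms(1), of i x] assms(2) by (meson less_imp_le less_le_trans)
qed

lemma kernel_iter_pos:
  assumes "bounded_meas lam f" "\<And>x. 0 < f x" shows "0 < kernel_iter lam \<kappa> i n f x"
  using assms(2) by (induction n arbitrary: i x) (auto intro!: kernel_op_pos bounded_meas_kernel_iter assms(1))

text \<open>Doeblin's argument in ratio form: one step contracts the range of \<open>u / v\<close> by the factor \<open>\<rho>\<close>.\<close>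

lemma ratio_contraction:
  assumes u: "bounded_meas lam u" and v: "bounded_meas lam v" "\<And>x. 0 < v x"
    and ab: "\<And>x. a * v x \<le> u x \<and> u x \<le> b * v x"
  shows "\<exists>a' b'. a \<le> a' \<and> a' \<le> b' \<and> b' \<le> b \<and> b' - a' \<le> \<rho> * (b - a) \<and>
    (\<forall>x. a' * kernel_op lam \<kappa> i v x \<le> kernel_op lam \<kappa> i u x \<and> kernel_op lam \<kappa> i u x \<le> b' * kernel_op lam \<kappa> i v x)"
proof -
  define \<epsilon> where "\<epsilon> = \<sigma>m / \<sigma>p"
  have \<epsilon>: "0 < \<epsilon>" "\<epsilon> < 1" using \<sigma> by (auto simp: \<epsilon>_def)
  let ?I = "\<lambda>f. \<integral>x. G i x * f x \<partial>lam" and ?L = "kernel_op lam \<kappa> i"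
  have Iv: "0 < ?I v" by (rule integral_pos[OF bounded_meas_G_mult[OF v(1)]]) (simp add: G_pos v(2))
  note Gu = bounded_meas_integrable[OF bounded_meas_G_mult[OF u, of i]] and Gv = bounded_meas_integrable[OF bounded_meas_G_mult[OF v(1), of i]]
  \<comment> \<open>The mean of u / v under the law with density proportional to \<open>G i\<close>
    times \<open>v\<close>. One step moves each end of the range towards \<open>c\<close> by the
    fraction \<epsilon> of its distance.\<close>
  define c where "c = ?I u / ?I v"
  have c: "a \<le> c" "c \<le> b"
  proof -
    have "a * ?I v = (\<integral>x. a * (G i x * v x) \<partial>lam)" by simp
    also have "\<dots> \<le> ?I u" using Gu Gv
    proof (intro integral_mono)
      fix x show "a * (G i x * v x) \<le> G i x * u x" using mult_left_mono[of "a * v x" "u x" "G i x"] ab[of x] G_pos[of i x] by (simp add: mult_ac)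
    qed auto
    finally show "a \<le> c" using Iv by (simp add: c_def field_simps)
    have "?I u \<le> (\<integral>x. b * (G i x * v x) \<partial>lam)" using Gu Gv
    proof (intro integral_mono)
      fix x show "G i x * u x \<le> b * (G i x * v x)" using mult_left_mono[of "u x" "b * v x" "G i x"] ab[of x] G_pos[of i x] by (simp add: mult_ac)
    qed auto
    also have "\<dots> = b * ?I v" by simp
    finally show "c \<le> b" using Iv by (simp add: c_def field_simps)
  qed
  define a' where "a' = a + \<epsilon> * (c - a)"
  define b' where "b' = b - \<epsilon> * (b - c)"
  \<comment> \<open>The majorisation is used for \<open>v\<close> and the minorisation for
    \<open>f\<close>, and the quotient of the two constants is \<epsilon>. It is applied to the
    nonnegative functions u - a v and b v - u.\<close>
  have w: "\<epsilon> * ?I f / ?I v * ?L v x \<le> ?L f x" if f: "bounded_meas lam f" "\<And>x. 0 \<le> f x" for f x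
  proof -
    have If: "0 \<le> ?I f" by (rule Bochner_Integration.integral_nonneg) (use f(2) G_pos in \<open>simp add: less_imp_le\<close>)
    have "\<epsilon> * ?I f / ?I v * ?L v x \<le> \<epsilon> * ?I f / ?I v * (\<sigma>p * ?I v)"
      using If Iv \<epsilon> kernel_op_bounds(2)[OF v(1), of i x] v(2) by (intro mult_left_mono) (auto intro: less_imp_le)
    also have "\<dots> = \<sigma>m * ?I f" using Iv \<sigma> by (simp add: \<epsilon>_def)
    also have "\<dots> \<le> ?L f x" by (rule kernel_op_bounds(1)[OF f])
    finally show ?thesis .
  qed
  have lower: "a' * ?L v x \<le> ?L u x" for x
  proof -
    let ?f = "\<lambda>x. 1 * u x + (-a) * v x"
    have f: "bounded_meas lam ?f" by (rule bounded_meas_linear[OF u v(1)])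
    have "?I ?f = (\<integral>x. G i x * u x - a * (G i x * v x) \<partial>lam)"
      by (rule Bochner_Integration.integral_cong) (auto simp: algebra_simps)
    also have "\<dots> = ?I u - a * ?I v" using Gu Gv by simp
    finally have If: "?I ?f / ?I v = c - a" using Iv by (simp add: c_def diff_divide_distrib)
    have "\<epsilon> * ?I ?f / ?I v * ?L v x \<le> ?L ?f x" by (rule w[OF f]) (use ab in \<open>simp add: algebra_simps\<close>)
    also have "?L ?f x = ?L u x - a * ?L v x" unfolding kernel_op_linear[OF u v(1)] by simp
    finally have "\<epsilon> * (?I ?f / ?I v) * ?L v x \<le> ?L u x - a * ?L v x" by (simp only: times_divide_eq_right)
    then have "\<epsilon> * (c - a) * ?L v x \<le> ?L u x - a * ?L v x" unfolding If .
    then show ?thesis unfolding a'_def distrib_right by linarith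
  qed
  have upper: "?L u x \<le> b' * ?L v x" for x
  proof -
    let ?f = "\<lambda>x. (-1) * u x + b * v x"
    have f: "bounded_meas lam ?f" by (rule bounded_meas_linear[OF u v(1)])
    have "?I ?f = (\<integral>x. b * (G i x * v x) - G i x * u x \<partial>lam)"
      by (rule Bochner_Integration.integral_cong) (auto simp: algebra_simps)
    also have "\<dots> = b * ?I v - ?I u" using Gu Gv by simp
    finally have If: "?I ?f / ?I v = b - c" using Iv by (simp add: c_def diff_divide_distrib)
    have "\<epsilon> * ?I ?f / ?I v * ?L v x \<le> ?L ?f x" by (rule w[OF f]) (use ab in \<open>simp add: algebra_simps\<close>)
    also have "?L ?f x = b * ?L v x - ?L u x" unfolding kernel_op_linear[OF u v(1)] by simp
    finally have "\<epsilon> * (?I ?f / ?I v) * ?L v x \<le> b * ?L v x - ?L u x" by (simp only: times_divide_eq_right)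
    then have "\<epsilon> * (b - c) * ?L v x \<le> b * ?L v x - ?L u x" unfolding If .
    then show ?thesis unfolding b'_def left_diff_distrib by linarith
  qed
  have "a \<le> a'" "b' \<le> b" using c \<epsilon> by (auto simp: a'_def b'_def)
  moreover have ba: "b' - a' = (1 - \<epsilon>) * (b - a)" by (simp add: a'_def b'_def algebra_simps)
  moreover have "0 \<le> (1 - \<epsilon>) * (b - a)" using c \<epsilon> by auto
  ultimately show ?thesis using lower upper by (intro exI[of _ a'] exI[of _ b']) (auto simp: \<rho>_def \<epsilon>_def)
qed

lemma ratio_contraction_iter:
  assumes u: "bounded_meas lam u" and v: "bounded_meas lam v" "\<And>x. 0 < v x"
    and ab: "\<And>x. a * v x \<le> u x \<and> u x \<le> b * v x" and "a \<le> b"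
  shows "\<exists>a' b'. a \<le> a' \<and> a' \<le> b' \<and> b' \<le> b \<and> b' - a' \<le> \<rho> ^ n * (b - a) \<and>
    (\<forall>x. a' * kernel_iter lam \<kappa> i n v x \<le> kernel_iter lam \<kappa> i n u x \<and> kernel_iter lam \<kappa> i n u x \<le> b' * kernel_iter lam \<kappa> i n v x)"
proof (induction n arbitrary: i)
  case 0 then show ?case using ab \<open>a \<le> b\<close> by (intro exI[of _ a] exI[of _ b]) auto
next
  case (Suc n)
  obtain a1 b1 where 1: "a \<le> a1" "a1 \<le> b1" "b1 \<le> b" "b1 - a1 \<le> \<rho> ^ n * (b - a)"
    "\<And>x. a1 * kernel_iter lam \<kappa> (i+1) n v x \<le> kernel_iter lam \<kappa> (i+1) n u x \<and> kernel_iter lam \<kappa> (i+1) n u x \<le> b1 * kernel_iter lam \<kappa> (i+1) n v x"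
    using Suc[of "i + 1"] by blast
  obtain a2 b2 where 2: "a1 \<le> a2" "a2 \<le> b2" "b2 \<le> b1" "b2 - a2 \<le> \<rho> * (b1 - a1)"
    "\<And>x. a2 * kernel_iter lam \<kappa> i (Suc n) v x \<le> kernel_iter lam \<kappa> i (Suc n) u x \<and> kernel_iter lam \<kappa> i (Suc n) u x \<le> b2 * kernel_iter lam \<kappa> i (Suc n) v x"
    using ratio_contraction[OF bounded_meas_kernel_iter[OF u] bounded_meas_kernel_iter[OF v(1)] kernel_iter_pos[OF v] 1(5), of i]
    by auto
  have "b2 - a2 \<le> \<rho> * (\<rho> ^ n * (b - a))" using 2(4) 1(4) \<rho> by (meson less_imp_le mult_left_mono order_trans)
  then show ?case using 1 2 by (intro exI[of _ a2] exI[of _ b2]) auto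
qed

end

text \<open>The unnormalised smoothing integral in factorised form: the kernels up to time
  \<open>s - 1\<close>, one kernel tilted by \<open>h\<close> at time \<open>s\<close>, and the
  backward function of the times \<open>s + 1\<close> to \<open>t\<close>.\<close>

definition smooth_num :: "'x measure \<Rightarrow> (int \<Rightarrow> 'x \<Rightarrow> 'x \<Rightarrow> real) \<Rightarrow> 'x measure \<Rightarrow> int \<Rightarrow> int \<Rightarrow> int \<Rightarrow> ('x \<Rightarrow> 'x \<Rightarrow> real) \<Rightarrow> real" where
  "smooth_num lam \<kappa> chi r s t h = (\<integral>x. kernel_iter lam \<kappa> (r + 1) (nat (s - 1 - r))
     (kernel_op lam (\<lambda>i x x'. \<kappa> i x x' * h x x') s (kernel_iter lam \<kappa> (s + 1) (nat (t - s)) (\<lambda>_. 1))) x \<partial>chi)"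

definition smooth_ratio :: "'x measure \<Rightarrow> (int \<Rightarrow> 'x \<Rightarrow> 'x \<Rightarrow> real) \<Rightarrow> 'x measure \<Rightarrow> int \<Rightarrow> int \<Rightarrow> int \<Rightarrow> ('x \<Rightarrow> 'x \<Rightarrow> real) \<Rightarrow> real" where
  "smooth_ratio lam \<kappa> chi r s t h = smooth_num lam \<kappa> chi r s t h / smooth_num lam \<kappa> chi r s t (\<lambda>_ _. 1)"

lemma smooth_num_shift:
  "smooth_num lam \<kappa> chi (r + d) (s + d) (t + d) h = smooth_num lam (\<lambda>j. \<kappa> (j + d)) chi r s t h"
proof -
  have e: "r + d + 1 = r + 1 + d" "s + d + 1 = s + 1 + d" "s + d - 1 - (r + d) = s - 1 - r" "t + d - (s + d) = t - s" by auto
  have "kernel_op lam (\<lambda>i x x'. \<kappa> i x x' * h x x') (s + d) f = kernel_op lam (\<lambda>i x x'. \<kappa> (i + d) x x' * h x x') s f" for f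
    by (simp add: kernel_op_def fun_eq_iff)
  then show ?thesis unfolding smooth_num_def e kernel_iter_shift by simp
qed

lemma smooth_ratio_shift:
  "smooth_ratio lam \<kappa> chi (r + d) (s + d) (t + d) h = smooth_ratio lam (\<lambda>j. \<kappa> (j + d)) chi r s t h"
  by (simp add: smooth_ratio_def smooth_num_shift)

definition bounded_meas2 :: "'x measure \<Rightarrow> ('x \<Rightarrow> 'x \<Rightarrow> real) \<Rightarrow> real \<Rightarrow> bool" where
  "bounded_meas2 lam h c \<longleftrightarrow> (\<lambda>(x, x'). h x x') \<in> borel_measurable (lam \<Otimes>\<^sub>M lam) \<and> (\<forall>x x'. \<bar>h x x'\<bar> \<le> c)"

lemma bounded_meas2_one: "bounded_meas2 lam (\<lambda>_ _. 1) 1"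
  by (simp add: bounded_meas2_def)

section \<open>Smoothing as a ratio of iterated kernels\<close>

context bounded_kernels
begin

lemma bounded_kernels_tilt_all:
  assumes "bounded_meas2 lam h c"
  shows "bounded_kernels lam (\<lambda>i x x'. \<kappa> i x x' * h x x')"
proof (rule bounded_kernels.intro[OF finite_lam space_lam])
  fix i
  have "(\<lambda>z. (\<lambda>(x, x'). \<kappa> i x x') z * (\<lambda>(x, x'). h x x') z) \<in> borel_measurable (lam \<Otimes>\<^sub>M lam)"
    using assms kernel_meas[of i] by (intro borel_measurable_times) (auto simp: bounded_meas2_def)
  then show "(\<lambda>(x, x'). \<kappa> i x x' * h x x') \<in> borel_measurable (lam \<Otimes>\<^sub>M lam)" by (simp add: case_prod_beta')
  obtain d where "\<forall>x x'. \<bar>\<kappa> i x x'\<bar> \<le> d" using kernel_bound[of i] by blast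
  then have "\<bar>\<kappa> i x x' * h x x'\<bar> \<le> d * c" for x x'
    unfolding abs_mult using assms by (intro mult_mono) (auto simp: bounded_meas2_def intro: order_trans[OF abs_ge_zero])
  then show "\<exists>c. \<forall>x x'. \<bar>\<kappa> i x x' * h x x'\<bar> \<le> c" by blast
qed

lemma bounded_kernels_tilt:
  assumes "bounded_meas2 lam h c"
  shows "bounded_kernels lam (\<kappa>(s := \<lambda>x x'. \<kappa> s x x' * h x x'))"
proof -
  interpret T: bounded_kernels lam "\<lambda>i x x'. \<kappa> i x x' * h x x'" by (rule bounded_kernels_tilt_all[OF assms])
  show ?thesis
    by (rule bounded_kernels.intro[OF finite_lam space_lam])
      (use kernel_meas T.kernel_meas kernel_bound T.kernel_bound in \<open>auto simp: fun_upd_def\<close>)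
qed

lemma bounded_meas_tilt_op:
  assumes "bounded_meas2 lam h c" "bounded_meas lam f"
  shows "bounded_meas lam (kernel_op lam (\<lambda>i x x'. \<kappa> i x x' * h x x') s f)"
  by (rule bounded_kernels.bounded_meas_kernel_op[OF bounded_kernels_tilt_all[OF assms(1)] assms(2)])

lemma bounded_meas_const: "bounded_meas lam (\<lambda>_. c)" by (auto simp: bounded_meas_def)

text \<open>With \<open>h\<close> absorbed into the kernel at time \<open>s\<close>, the weighted
  path integral becomes a plain one for modified kernels, to which \<open>path_integral\<close>
  applies. The iterates before and after \<open>s\<close> do not see the modification.\<close>

lemma smooth_num_path:
  assumes chi: "prob_on lam chi" and h: "bounded_meas2 lam h c" and rst: "r < s" "s \<le> t"
  shows "(\<integral>x. (\<Prod>i\<in>{r..t - 1}. \<kappa> (i + 1) (x i) (x (i + 1))) * h (x (s - 1)) (x s) \<partial>path_measure lam chi r t)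
    = smooth_num lam \<kappa> chi r s t h"
proof -
  define \<kappa>' where "\<kappa>' = \<kappa>(s := \<lambda>x x'. \<kappa> s x x' * h x x')"
  interpret T: bounded_kernels lam \<kappa>' unfolding \<kappa>'_def by (rule bounded_kernels_tilt[OF h])
  define n where "n = nat (t - r)"
  have t: "t = r + int n" using rst by (simp add: n_def)
  have prod: "(\<Prod>i\<in>{r..t - 1}. \<kappa>' (i + 1) (x i) (x (i + 1))) = (\<Prod>i\<in>{r..t - 1}. \<kappa> (i + 1) (x i) (x (i + 1))) * h (x (s - 1)) (x s)" for x
  proof -
    have s: "s - 1 \<in> {r..t - 1}" using rst by auto
    have "(\<Prod>i\<in>{r..t - 1}. \<kappa>' (i + 1) (x i) (x (i + 1)))
       = \<kappa>' s (x (s - 1)) (x s) * (\<Prod>i\<in>{r..t - 1} - {s - 1}. \<kappa>' (i + 1) (x i) (x (i + 1)))"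
      by (subst prod.remove[OF _ s]) auto
    also have "(\<Prod>i\<in>{r..t - 1} - {s - 1}. \<kappa>' (i + 1) (x i) (x (i + 1))) = (\<Prod>i\<in>{r..t - 1} - {s - 1}. \<kappa> (i + 1) (x i) (x (i + 1)))"
      by (rule prod.cong) (auto simp: \<kappa>'_def)
    also have "\<kappa>' s (x (s - 1)) (x s) * \<dots> = h (x (s - 1)) (x s) * (\<kappa> s (x (s - 1)) (x s) * (\<Prod>i\<in>{r..t - 1} - {s - 1}. \<kappa> (i + 1) (x i) (x (i + 1))))"
      by (simp add: \<kappa>'_def)
    also have "\<kappa> s (x (s - 1)) (x s) * (\<Prod>i\<in>{r..t - 1} - {s - 1}. \<kappa> (i + 1) (x i) (x (i + 1))) = (\<Prod>i\<in>{r..t - 1}. \<kappa> (i + 1) (x i) (x (i + 1)))"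
      using prod.remove[OF _ s, of "\<lambda>i. \<kappa> (i + 1) (x i) (x (i + 1))"] by simp
    finally show ?thesis by (simp add: mult.commute)
  qed
  have "(\<integral>x. (\<Prod>i\<in>{r..t - 1}. \<kappa>' (i + 1) (x i) (x (i + 1))) * 1 \<partial>path_measure lam chi r t) = (\<integral>x. kernel_iter lam \<kappa>' (r + 1) n (\<lambda>_. 1) x \<partial>chi)"
    using T.path_integral[OF chi T.bounded_meas_const[of 1], where r=r and n=n] unfolding t by simp
  also have "kernel_iter lam \<kappa>' (r + 1) n (\<lambda>_. 1) = kernel_iter lam \<kappa> (r + 1) (nat (s - 1 - r))
     (kernel_op lam (\<lambda>i x x'. \<kappa> i x x' * h x x') s (kernel_iter lam \<kappa> (s + 1) (nat (t - s)) (\<lambda>_. 1)))"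
  proof -
    have n: "n = nat (s - 1 - r) + Suc (nat (t - s))" using rst by (simp add: n_def)
    have e: "r + 1 + int (nat (s - 1 - r)) = s" using rst by simp
    have 1: "kernel_iter lam \<kappa>' (r + 1) (nat (s - 1 - r)) f = kernel_iter lam \<kappa> (r + 1) (nat (s - 1 - r)) f" for f
      by (rule kernel_iter_cong) (use rst in \<open>auto simp: \<kappa>'_def\<close>)
    have 2: "kernel_iter lam \<kappa>' (s + 1) (nat (t - s)) f = kernel_iter lam \<kappa> (s + 1) (nat (t - s)) f" for f
      by (rule kernel_iter_cong) (auto simp: \<kappa>'_def)
    have 3: "kernel_op lam \<kappa>' s f = kernel_op lam (\<lambda>i x x'. \<kappa> i x x' * h x x') s f" for f
      by (simp add: kernel_op_def \<kappa>'_def fun_eq_iff)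
    show ?thesis unfolding n kernel_iter_add e 1 kernel_iter.simps 2 3 ..
  qed
  finally show ?thesis by (simp add: prod smooth_num_def)
qed

lemma smooth_ratio_path:
  assumes chi: "prob_on lam chi" and h: "bounded_meas2 lam h c" and rst: "r < s" "s \<le> t"
  shows "(\<integral>x. (\<Prod>i\<in>{r..t - 1}. \<kappa> (i + 1) (x i) (x (i + 1))) * h (x (s - 1)) (x s) \<partial>path_measure lam chi r t)
     / (\<integral>x. (\<Prod>i\<in>{r..t - 1}. \<kappa> (i + 1) (x i) (x (i + 1))) \<partial>path_measure lam chi r t)
    = smooth_ratio lam \<kappa> chi r s t h"
  using smooth_num_path[OF chi h rst] smooth_num_path[OF chi bounded_meas2_one rst] by (simp add: smooth_ratio_def)

end

section \<open>Forgetting of the past and of the future\<close>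

context mixing_kernels
begin

abbreviation "tilt h \<equiv> (\<lambda>i x x'. \<kappa> i x x' * h x x')"

lemma tilt_op_bounds:
  assumes h: "bounded_meas2 lam h c" and f: "bounded_meas lam f" "\<And>x. 0 \<le> f x"
    and ab: "\<And>x x'. a \<le> h x x' \<and> h x x' \<le> b"
  shows "a * kernel_op lam \<kappa> s f x \<le> kernel_op lam (tilt h) s f x \<and> kernel_op lam (tilt h) s f x \<le> b * kernel_op lam \<kappa> s f x"
proof -
  note i = kernel_mult_integrable[OF f(1), of s x]
  have ih: "integrable lam (\<lambda>x'. tilt h s x x' * f x')"
    by (rule bounded_kernels.kernel_mult_integrable[OF bounded_kernels_tilt_all[OF h] f(1)])
  have nn: "0 \<le> \<kappa> s x x' * f x'" for x' using kernel_pos[of s x x'] f(2)[of x'] by simp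
  have "(\<integral>x'. a * (\<kappa> s x x' * f x') \<partial>lam) \<le> kernel_op lam (tilt h) s f x"
    unfolding kernel_op_def
  proof (rule integral_mono[OF _ ih])
    fix x' show "a * (\<kappa> s x x' * f x') \<le> tilt h s x x' * f x'"
      using mult_right_mono[OF conjunct1[OF ab[of x x']] nn[of x']] by (simp add: mult_ac)
  qed (use i in auto)
  moreover have "kernel_op lam (tilt h) s f x \<le> (\<integral>x'. b * (\<kappa> s x x' * f x') \<partial>lam)"
    unfolding kernel_op_def
  proof (rule integral_mono[OF ih])
    fix x' show "tilt h s x x' * f x' \<le> b * (\<kappa> s x x' * f x')"
      using mult_right_mono[OF conjunct2[OF ab[of x x']] nn[of x']] by (simp add: mult_ac)
  qed (use i in auto)
  ultimately show ?thesis by (simp add: kernel_op_def)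
qed

lemma kernel_iter_nonneg:
  "(\<And>x. 0 \<le> f x) \<Longrightarrow> 0 \<le> kernel_iter lam \<kappa> i n f x"
proof (induction n arbitrary: i x)
  case (Suc n)
  show ?case unfolding kernel_iter.simps kernel_op_def
    by (rule Bochner_Integration.integral_nonneg) (use Suc.IH[OF Suc.prems] kernel_pos in \<open>simp add: less_imp_le\<close>)
qed simp

lemma kernel_iter_ratio:
  assumes u: "bounded_meas lam u" and v: "bounded_meas lam v" and ab: "\<And>x. a * v x \<le> u x \<and> u x \<le> b * v x"
  shows "a * kernel_iter lam \<kappa> i n v x \<le> kernel_iter lam \<kappa> i n u x \<and> kernel_iter lam \<kappa> i n u x \<le> b * kernel_iter lam \<kappa> i n v x"
proof -
  have p: "0 \<le> 1 * u x + (- a) * v x" "0 \<le> (- 1) * u x + b * v x" for x using ab[of x] by auto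
  have "0 \<le> kernel_iter lam \<kappa> i n (\<lambda>x. 1 * u x + (- a) * v x) x" "0 \<le> kernel_iter lam \<kappa> i n (\<lambda>x. (- 1) * u x + b * v x) x"
    by (rule kernel_iter_nonneg, rule p)+
  then show ?thesis
    unfolding kernel_iter_linear[OF u v] by simp
qed

lemma kernel_iter_one_pos: "0 < kernel_iter lam \<kappa> i n (\<lambda>_. 1) x"
  by (rule kernel_iter_pos[OF bounded_meas_const]) simp

lemma bounded_meas_kernel_iter_one: "bounded_meas lam (kernel_iter lam \<kappa> i n (\<lambda>_. 1))"
  by (rule bounded_meas_kernel_iter[OF bounded_meas_const])

lemma tilt_1: "kernel_op lam (tilt (\<lambda>_ _. 1)) = kernel_op lam \<kappa>" by (simp add: kernel_op_def fun_eq_iff)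

lemma smooth_num_pos:
  assumes "prob_on lam chi" shows "0 < smooth_num lam \<kappa> chi r s t (\<lambda>_ _. 1)"
  unfolding smooth_num_def tilt_1
  by (intro chi_integral_pos[OF _ _ assms] bounded_meas_kernel_iter bounded_meas_kernel_op bounded_meas_kernel_iter_one kernel_iter_pos kernel_op_pos kernel_iter_one_pos)

lemma chi_integral_ratio:
  assumes "bounded_meas lam u" "bounded_meas lam v" "prob_on lam chi" "\<And>x. a * v x \<le> u x \<and> u x \<le> b * v x"
  shows "a * (\<integral>x. v x \<partial>chi) \<le> (\<integral>x. u x \<partial>chi) \<and> (\<integral>x. u x \<partial>chi) \<le> b * (\<integral>x. v x \<partial>chi)"
proof -
  note i = bounded_meas_chi_integrable[OF assms(1,3)] bounded_meas_chi_integrable[OF assms(2,3)]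
  have "(\<integral>x. a * v x \<partial>chi) \<le> (\<integral>x. u x \<partial>chi)" using i assms(4) by (intro integral_mono) auto
  moreover have "(\<integral>x. u x \<partial>chi) \<le> (\<integral>x. b * v x \<partial>chi)" using i assms(4) by (intro integral_mono) auto
  ultimately show ?thesis by simp
qed

text \<open>Seen as a function of the state at time \<open>r0\<close>, the ratio of numerator to
  denominator has passed through the contractions up to \<open>s - 1\<close> and lies in a short
  interval. Earlier steps and integration against \<open>chi\<close> only average within it. An
  interval common to all starts, instead of a difference of two, allows both the initial time and
  the initial law to vary.\<close>

lemma smooth_ratio_interval:
  assumes h: "bounded_meas2 lam h c" and "r0 < s"
  shows "\<exists>a b. - c \<le> a \<and> b \<le> c \<and> b - a \<le> 2 * c * \<rho> ^ nat (s - 1 - r0) \<and>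
    (\<forall>chi r. prob_on lam chi \<longrightarrow> r \<le> r0 \<longrightarrow> a \<le> smooth_ratio lam \<kappa> chi r s t h \<and> smooth_ratio lam \<kappa> chi r s t h \<le> b)"
proof -
  let ?B = "kernel_iter lam \<kappa> (s + 1) (nat (t - s)) (\<lambda>_. 1)"
  let ?u = "kernel_op lam (tilt h) s ?B" and ?v = "kernel_op lam \<kappa> s ?B"
  have hb: "\<And>x x'. - c \<le> h x x' \<and> h x x' \<le> c" using h by (auto simp: bounded_meas2_def abs_le_iff minus_le_iff)
  have c: "- c \<le> c" using hb by (meson order_trans)
  have u: "bounded_meas lam ?u" by (rule bounded_meas_tilt_op[OF h bounded_meas_kernel_iter_one])
  have v: "bounded_meas lam ?v" "\<And>x. 0 < ?v x" by (rule bounded_meas_kernel_op[OF bounded_meas_kernel_iter_one]) (rule kernel_op_pos[OF bounded_meas_kernel_iter_one kernel_iter_one_pos])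
  have uv: "- c * ?v x \<le> ?u x \<and> ?u x \<le> c * ?v x" for x
    by (rule tilt_op_bounds[OF h bounded_meas_kernel_iter_one _ hb]) (rule less_imp_le[OF kernel_iter_one_pos])
  let ?n = "nat (s - 1 - r0)"
  obtain a b where ab: "- c \<le> a" "a \<le> b" "b \<le> c" "b - a \<le> \<rho> ^ ?n * (c - - c)"
    "\<And>x. a * kernel_iter lam \<kappa> (r0 + 1) ?n ?v x \<le> kernel_iter lam \<kappa> (r0 + 1) ?n ?u x \<and> kernel_iter lam \<kappa> (r0 + 1) ?n ?u x \<le> b * kernel_iter lam \<kappa> (r0 + 1) ?n ?v x"
    using ratio_contraction_iter[OF u v uv c, where n = ?n and i = "r0 + 1"] by blast
  have "a \<le> smooth_ratio lam \<kappa> chi r s t h \<and> smooth_ratio lam \<kappa> chi r s t h \<le> b" if chi: "prob_on lam chi" and r: "r \<le> r0" for chi r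
  proof -
    let ?k = "nat (r0 - r)"
    have n: "nat (s - 1 - r) = ?k + ?n" "r + 1 + int ?k = r0 + 1" using r assms(2) by auto
    have it: "kernel_iter lam \<kappa> (r + 1) (nat (s - 1 - r)) f = kernel_iter lam \<kappa> (r + 1) ?k (kernel_iter lam \<kappa> (r0 + 1) ?n f)" for f
      unfolding n(1) kernel_iter_add n(2) ..
    note ub = bounded_meas_kernel_iter[OF u, where n = ?n and i = "r0 + 1"] and vb = bounded_meas_kernel_iter[OF v(1), where n = ?n and i = "r0 + 1"]
      and vp = kernel_iter_pos[OF v, where n = ?n and i = "r0 + 1"]
    obtain a1 b1 where 1: "a \<le> a1" "b1 \<le> b"
      "\<And>x. a1 * kernel_iter lam \<kappa> (r + 1) (nat (s - 1 - r)) ?v x \<le> kernel_iter lam \<kappa> (r + 1) (nat (s - 1 - r)) ?u x \<and>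
        kernel_iter lam \<kappa> (r + 1) (nat (s - 1 - r)) ?u x \<le> b1 * kernel_iter lam \<kappa> (r + 1) (nat (s - 1 - r)) ?v x"
      using ratio_contraction_iter[OF ub vb vp ab(5) ab(2), where n = ?k and i = "r + 1"] unfolding it by blast
    have "a1 * smooth_num lam \<kappa> chi r s t (\<lambda>_ _. 1) \<le> smooth_num lam \<kappa> chi r s t h \<and> smooth_num lam \<kappa> chi r s t h \<le> b1 * smooth_num lam \<kappa> chi r s t (\<lambda>_ _. 1)"
      unfolding smooth_num_def tilt_1 by (rule chi_integral_ratio[OF bounded_meas_kernel_iter[OF u] bounded_meas_kernel_iter[OF v(1)] chi 1(3)])
    moreover note D = smooth_num_pos[OF chi, of r s t]
    moreover have "a * smooth_num lam \<kappa> chi r s t (\<lambda>_ _. 1) \<le> a1 * smooth_num lam \<kappa> chi r s t (\<lambda>_ _. 1)"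
      "b1 * smooth_num lam \<kappa> chi r s t (\<lambda>_ _. 1) \<le> b * smooth_num lam \<kappa> chi r s t (\<lambda>_ _. 1)"
      using 1(1,2) D by (simp_all add: mult_right_mono)
    ultimately show ?thesis unfolding smooth_ratio_def pos_le_divide_eq[OF D] pos_divide_le_eq[OF D] by linarith
  qed
  then show ?thesis using ab by (intro exI[of _ a] exI[of _ b]) (auto simp: algebra_simps)
qed

lemma smooth_ratio_past:
  assumes h: "bounded_meas2 lam h c" and "prob_on lam chi" "prob_on lam chi'" "r \<le> r0" "r' \<le> r0" "r0 < s"
  shows "\<bar>smooth_ratio lam \<kappa> chi r s t h - smooth_ratio lam \<kappa> chi' r' s t h\<bar> \<le> 2 * c * \<rho> ^ nat (s - 1 - r0)"
proof -
  obtain a b where "b - a \<le> 2 * c * \<rho> ^ nat (s - 1 - r0)" and *: "\<And>chi r. prob_on lam chi \<Longrightarrow> r \<le> r0 \<Longrightarrow> a \<le> smooth_ratio lam \<kappa> chi r s t h \<and> smooth_ratio lam \<kappa> chi r s t h \<le> b"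
    using smooth_ratio_interval[OF h assms(6)] by blast
  then show ?thesis using *[OF assms(2,4)] *[OF assms(3,5)] by auto
qed

lemma smooth_ratio_abs_le:
  assumes h: "bounded_meas2 lam h c" and "prob_on lam chi" "r < s"
  shows "\<bar>smooth_ratio lam \<kappa> chi r s t h\<bar> \<le> c"
proof -
  obtain a b where "- c \<le> a" "b \<le> c" and *: "\<And>chi r'. prob_on lam chi \<Longrightarrow> r' \<le> r \<Longrightarrow> a \<le> smooth_ratio lam \<kappa> chi r' s t h \<and> smooth_ratio lam \<kappa> chi r' s t h \<le> b"
    using smooth_ratio_interval[OF h assms(3)] by blast
  then show ?thesis using *[OF assms(2), of r] by auto
qed

text \<open>A later horizon replaces the terminal function 1 at time \<open>t\<close> by one with
  values between \<sigma>m \<beta> and \<sigma>p \<beta>. Running back to \<open>s\<close> contracts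
  its ratio to the old backward function, so the new one is a constant multiple of the old one plus
  a small remainder, and the constant cancels in the quotient.\<close>

lemma smooth_ratio_future:
  assumes h: "bounded_meas2 lam h c" and chi: "prob_on lam chi" and "r < s" "s \<le> t" "t \<le> t'"
  shows "\<bar>smooth_ratio lam \<kappa> chi r s t' h - smooth_ratio lam \<kappa> chi r s t h\<bar> \<le> 2 * c * ((\<sigma>p - \<sigma>m) / \<sigma>m) * \<rho> ^ nat (t - s)"
proof -
  have hb: "\<And>x x'. - c \<le> h x x' \<and> h x x' \<le> c" using h by (auto simp: bounded_meas2_def abs_le_iff minus_le_iff)
  have c: "0 \<le> c" using hb[of undefined undefined] by linarith
  show ?thesis
  proof (cases "t = t'")
    case True then show ?thesis using c \<sigma> \<rho> by simp
  next
    case False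
    then have tt: "t < t'" using assms by simp
    let ?n = "nat (t - s)" and ?m = "nat (t' - t - 1)"
    let ?w = "kernel_iter lam \<kappa> (t + 2) ?m (\<lambda>_. 1)"
    let ?u0 = "kernel_op lam \<kappa> (t + 1) ?w"
    define \<beta> where "\<beta> = (\<integral>x. G (t + 1) x * ?w x \<partial>lam)"
    have \<beta>: "0 < \<beta>" unfolding \<beta>_def
      by (rule integral_pos[OF bounded_meas_G_mult[OF bounded_meas_kernel_iter_one]]) (simp add: G_pos kernel_iter_one_pos)
    have u0: "bounded_meas lam ?u0" by (rule bounded_meas_kernel_op[OF bounded_meas_kernel_iter_one])
    have one: "bounded_meas lam (\<lambda>_. 1)" "\<And>x. 0 < (\<lambda>_. 1::real) x" by (rule bounded_meas_const) simp
    have ab0: "\<sigma>m * \<beta> * (\<lambda>_. 1) x \<le> ?u0 x \<and> ?u0 x \<le> \<sigma>p * \<beta> * (\<lambda>_. 1) x" for x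
      unfolding \<beta>_def using kernel_op_bounds[OF bounded_meas_kernel_iter_one less_imp_le[OF kernel_iter_one_pos]] by simp
    have le: "\<sigma>m * \<beta> \<le> \<sigma>p * \<beta>" using \<sigma> \<beta> by simp
    define v where "v = kernel_iter lam \<kappa> (s + 1) ?n (\<lambda>_. 1)"
    define u where "u = kernel_iter lam \<kappa> (s + 1) ?n ?u0"
    have ue: "kernel_iter lam \<kappa> (s + 1) (nat (t' - s)) (\<lambda>_. 1) = u"
    proof -
      have e: "nat (t' - s) = ?n + Suc ?m" "s + 1 + int ?n = t + 1" using assms tt by auto
      show ?thesis unfolding u_def e(1) kernel_iter_add e(2) by (simp add: add.assoc)
    qed
    obtain a b where ab: "\<sigma>m * \<beta> \<le> a" "a \<le> b" "b - a \<le> \<rho> ^ ?n * (\<sigma>p * \<beta> - \<sigma>m * \<beta>)" "\<And>x. a * v x \<le> u x \<and> u x \<le> b * v x"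
      using ratio_contraction_iter[OF u0 one ab0 le, where n = ?n and i = "s + 1"] unfolding u_def v_def by blast
    have a: "0 < a" using ab(1) \<sigma> \<beta> by (meson mult_pos_pos less_le_trans)
    have bmv: "bounded_meas lam v" and bmu: "bounded_meas lam u" unfolding v_def u_def by (auto intro: bounded_meas_kernel_iter u0 one)
    \<comment> \<open>The remainder over the multiple \<open>a\<close> of \<open>v\<close>. It lies
      between 0 and (b - a) v, and its nonnegativity allows \<open>A\<close> to be bounded through
      \<open>C\<close>.\<close>
    define w where "w = (\<lambda>x. 1 * u x + (- a) * v x)"
    have bmw: "bounded_meas lam w" unfolding w_def by (rule bounded_meas_linear[OF bmu bmv])
    have wb: "0 \<le> w x" "w x \<le> (b - a) * v x" for x using ab(4)[of x] by (auto simp: w_def algebra_simps)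
    have uw: "u = (\<lambda>x. a * v x + 1 * w x)" by (simp add: w_def)
    define A where "A = (\<lambda>f. \<integral>x. kernel_iter lam \<kappa> (r + 1) (nat (s - 1 - r)) (kernel_op lam (tilt h) s f) x \<partial>chi)"
    define C where "C = (\<lambda>f. \<integral>x. kernel_iter lam \<kappa> (r + 1) (nat (s - 1 - r)) (kernel_op lam \<kappa> s f) x \<partial>chi)"
    interpret T: bounded_kernels lam "tilt h" by (rule bounded_kernels_tilt_all[OF h])
    have lin: "A (\<lambda>x. a * f x + 1 * g x) = a * A f + A g" "C (\<lambda>x. a * f x + 1 * g x) = a * C f + C g"
      if "bounded_meas lam f" "bounded_meas lam g" for f g
    proof -
      note t1 = T.bounded_meas_kernel_op[OF that(1), of s] T.bounded_meas_kernel_op[OF that(2), of s]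
      note t2 = bounded_meas_kernel_op[OF that(1), of s] bounded_meas_kernel_op[OF that(2), of s]
      show "A (\<lambda>x. a * f x + 1 * g x) = a * A f + A g"
        unfolding A_def T.kernel_op_linear[OF that] kernel_iter_linear[OF t1]
        using bounded_meas_chi_integrable[OF bounded_meas_kernel_iter[OF t1(1)] chi] bounded_meas_chi_integrable[OF bounded_meas_kernel_iter[OF t1(2)] chi] by simp
      show "C (\<lambda>x. a * f x + 1 * g x) = a * C f + C g"
        unfolding C_def kernel_op_linear[OF that] kernel_iter_linear[OF t2]
        using bounded_meas_chi_integrable[OF bounded_meas_kernel_iter[OF t2(1)] chi] bounded_meas_chi_integrable[OF bounded_meas_kernel_iter[OF t2(2)] chi] by simp
    qed
    have AC: "\<bar>A f\<bar> \<le> c * C f" if f: "bounded_meas lam f" "\<And>x. 0 \<le> f x" for f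
    proof -
      note b1 = T.bounded_meas_kernel_op[OF f(1), of s] and b2 = bounded_meas_kernel_op[OF f(1), of s]
      have p: "- c * kernel_op lam \<kappa> s f x \<le> kernel_op lam (tilt h) s f x \<and> kernel_op lam (tilt h) s f x \<le> c * kernel_op lam \<kappa> s f x" for x
        by (rule tilt_op_bounds[OF h f hb])
      note p2 = kernel_iter_ratio[OF b1 b2 p, where i = "r + 1" and n = "nat (s - 1 - r)"]
      show ?thesis
        using chi_integral_ratio[OF bounded_meas_kernel_iter[OF b1] bounded_meas_kernel_iter[OF b2] chi p2]
        unfolding A_def C_def by auto
    qed
    have Cmono: "0 \<le> C w" "C w \<le> (b - a) * C v"
    proof -
      have "0 * v x \<le> w x \<and> w x \<le> (b - a) * v x" for x using wb[of x] by simp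
      note step = kernel_iter_ratio[OF bmw bmv this, where i = s and n = 1, unfolded One_nat_def kernel_iter.simps]
      note it = kernel_iter_ratio[OF bounded_meas_kernel_op[OF bmw] bounded_meas_kernel_op[OF bmv] step, where i = "r + 1" and n = "nat (s - 1 - r)"]
      have "0 * C v \<le> C w \<and> C w \<le> (b - a) * C v" unfolding C_def
        by (rule chi_integral_ratio[OF bounded_meas_kernel_iter[OF bounded_meas_kernel_op[OF bmw]] bounded_meas_kernel_iter[OF bounded_meas_kernel_op[OF bmv]] chi it])
      then show "0 \<le> C w" "C w \<le> (b - a) * C v" by auto
    qed
    have Cv: "0 < C v" using smooth_num_pos[OF chi, of r s t] unfolding smooth_num_def tilt_1 C_def v_def .
    have Cu: "C u = a * C v + C w" "A u = a * A v + A w" using lin[OF bmv bmw] uw by simp_all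
    have Cup: "0 < C u" using Cu(1) Cv a Cmono(1) by (simp add: add_pos_nonneg)
    have r1: "smooth_ratio lam \<kappa> chi r s t' h = A u / C u" "smooth_ratio lam \<kappa> chi r s t h = A v / C v"
      unfolding smooth_ratio_def smooth_num_def tilt_1 ue A_def C_def v_def by simp_all
    have vnn: "\<And>x. 0 \<le> v x" unfolding v_def by (rule less_imp_le[OF kernel_iter_one_pos])
    \<comment> \<open>The contribution of \<open>a\<close> to the numerator drops out: only the
      remainder \<open>w\<close> is left there.\<close>
    have "A u / C u - A v / C v = (A w * C v - A v * C w) / (C u * C v)"
      using Cv Cup by (simp add: field_simps Cu)
    also have "\<bar>\<dots>\<bar> \<le> (2 * c * C w * C v) / (C u * C v)"
    proof -
      have "\<bar>A w * C v - A v * C w\<bar> \<le> \<bar>A w\<bar> * C v + \<bar>A v\<bar> * C w"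
        using abs_triangle_ineq4[of "A w * C v" "A v * C w"] Cv Cmono by (simp add: abs_mult)
      also have "\<dots> \<le> (c * C w) * C v + (c * C v) * C w"
        using AC[OF bmw wb(1)] AC[OF bmv vnn] Cv Cmono by (intro add_mono mult_right_mono) auto
      also have "\<dots> = 2 * c * C w * C v" by simp
      finally have le: "\<bar>A w * C v - A v * C w\<bar> \<le> 2 * c * C w * C v" .
      have pos: "0 < C u * C v" using Cv Cup by simp
      show ?thesis unfolding abs_divide abs_of_pos[OF pos] by (rule divide_right_mono[OF le]) (use pos in simp)
    qed
    also have "\<dots> = 2 * c * (C w / C u)" using Cv by simp
    also have "C w / C u \<le> (b - a) * C v / (a * C v)"
      using Cmono Cv a by (intro frac_le) (auto simp: Cu intro: order_trans)
    also have "\<dots> = (b - a) / a" using Cv by simp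
    \<comment> \<open>Division by \<open>a\<close>, which is at least \<sigma>m \<beta>, is the
      origin of the factor (\<sigma>p - \<sigma>m) / \<sigma>m.\<close>
    also have "\<dots> \<le> (\<rho> ^ ?n * (\<sigma>p * \<beta> - \<sigma>m * \<beta>)) / (\<sigma>m * \<beta>)"
      using ab a \<sigma> \<beta> \<rho> by (intro frac_le) auto
    also have "\<dots> = (\<sigma>p - \<sigma>m) / \<sigma>m * \<rho> ^ ?n" using \<beta> \<sigma> by (simp add: field_simps)
    finally show ?thesis unfolding r1 using c by (simp add: mult_left_mono mult.assoc)
  qed
qed

end

section \<open>Comparison of the smoothing law with a product measure\<close>

context mixing_kernels
begin

text \<open>The joint smoothing law of the states at times \<open>s - 1\<close> and \<open>s\<close> is comparable, uniformly in all
  other data, to the normalised product of \<open>G (s - 1)\<close> and \<open>G s\<close>.\<close>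

definition pair_weight :: "int \<Rightarrow> ('a \<Rightarrow> 'a \<Rightarrow> real) \<Rightarrow> real" where
  "pair_weight s h = (\<integral>z. G (s - 1) (fst z) * (G s (snd z) * h (fst z) (snd z)) \<partial>(lam \<Otimes>\<^sub>M lam))"

lemma pair_weight_integrable:
  assumes h: "bounded_meas2 lam h c"
  shows "integrable (lam \<Otimes>\<^sub>M lam) (\<lambda>z. G (s - 1) (fst z) * (G s (snd z) * h (fst z) (snd z)))"
proof -
  interpret PP: pair_sigma_finite lam lam by unfold_locales
  interpret FP: finite_measure "lam \<Otimes>\<^sub>M lam" by (rule finite_measure_pair_measure) (rule finite_lam)+
  obtain c1 c2 where c: "\<And>x. \<bar>G (s - 1) x\<bar> \<le> c1" "\<And>x. \<bar>G s x\<bar> \<le> c2" using G_meas by (auto simp: bounded_meas_def) metis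
  have gm: "G i \<in> borel_measurable lam" for i using G_meas by (auto simp: bounded_meas_def)
  have hm: "(\<lambda>z. h (fst z) (snd z)) \<in> borel_measurable (lam \<Otimes>\<^sub>M lam)" and hc: "\<And>x x'. \<bar>h x x'\<bar> \<le> c"
    using h by (auto simp: bounded_meas2_def case_prod_beta')
  show ?thesis
  proof (rule FP.integrable_const_bound[where B = "c1 * (c2 * c)"])
    show "AE z in lam \<Otimes>\<^sub>M lam. norm (G (s - 1) (fst z) * (G s (snd z) * h (fst z) (snd z))) \<le> c1 * (c2 * c)"
      unfolding real_norm_def abs_mult using c hc order_trans[OF abs_ge_zero c(1)] order_trans[OF abs_ge_zero c(2)]
      by (intro AE_I2 mult_mono) auto
    show "(\<lambda>z. G (s - 1) (fst z) * (G s (snd z) * h (fst z) (snd z))) \<in> borel_measurable (lam \<Otimes>\<^sub>M lam)"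
      using measurable_compose[OF measurable_fst gm] measurable_compose[OF measurable_snd gm] hm by measurable
  qed
qed

lemma pair_weight_fubini:
  assumes h: "bounded_meas2 lam h c"
  shows "pair_weight s h = (\<integral>x. G (s - 1) x * (\<integral>x'. G s x' * h x x' \<partial>lam) \<partial>lam)"
proof -
  interpret PP: pair_sigma_finite lam lam by unfold_locales
  show ?thesis unfolding pair_weight_def
    using PP.integral_fst'[OF pair_weight_integrable[OF h, of s]] by simp
qed

text \<open>The kernels at the times \<open>s - 1\<close>, \<open>s\<close> and \<open>s + 1\<close>
  are replaced by their bounds, whence the third powers and the room required on either side of the
  pair. The factor \<open>d\<close> collects the rest of the path; being the same for
  \<open>h\<close> and for 1, it cancels in the smoothing ratio.\<close>

lemma pair_weight_bounds:
  assumes h: "bounded_meas2 lam h c" "\<And>x x'. 0 \<le> h x x'" and chi: "prob_on lam chi" and r: "r < s - 1" and t: "s < t"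
  shows "\<exists>d>0. \<sigma>m ^ 3 * d * pair_weight s h \<le> smooth_num lam \<kappa> chi r s t h \<and> smooth_num lam \<kappa> chi r s t h \<le> \<sigma>p ^ 3 * d * pair_weight s h
     \<and> \<sigma>m ^ 3 * d * pair_weight s (\<lambda>_ _. 1) \<le> smooth_num lam \<kappa> chi r s t (\<lambda>_ _. 1) \<and> smooth_num lam \<kappa> chi r s t (\<lambda>_ _. 1) \<le> \<sigma>p ^ 3 * d * pair_weight s (\<lambda>_ _. 1)"
proof -
  define k where "k = nat (t - s) - 1"
  define k2 where "k2 = nat (s - 1 - r) - 1"
  have k: "nat (t - s) = Suc k" "nat (s - 1 - r) = Suc k2" "r + 1 + int k2 = s - 1" using r t by (auto simp: k_def k2_def)
  define B where "B = kernel_iter lam \<kappa> (s + 1) (Suc k) (\<lambda>_. 1)"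
  define \<beta> where "\<beta> = (\<integral>x. G (s + 1) x * kernel_iter lam \<kappa> (s + 1 + 1) k (\<lambda>_. 1) x \<partial>lam)"
  have \<beta>: "0 < \<beta>" unfolding \<beta>_def
    by (rule integral_pos[OF bounded_meas_G_mult[OF bounded_meas_kernel_iter_one]]) (simp add: G_pos kernel_iter_one_pos)
  have B: "\<sigma>m * \<beta> \<le> B x" "B x \<le> \<sigma>p * \<beta>" for x
    unfolding B_def \<beta>_def kernel_iter.simps using kernel_op_bounds[OF bounded_meas_kernel_iter_one less_imp_le[OF kernel_iter_one_pos]] by auto
  have Bbm: "bounded_meas lam B" unfolding B_def by (rule bounded_meas_kernel_iter_one)
  have Bpos: "0 < B x" for x unfolding B_def by (rule kernel_iter_one_pos)
  define d where "d = \<beta> * (\<integral>x. kernel_iter lam \<kappa> (r + 1) k2 (\<lambda>_. 1) x \<partial>chi)"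
  have d: "0 < d" unfolding d_def using \<beta> chi_integral_pos[OF bounded_meas_kernel_iter_one kernel_iter_one_pos chi] by simp
  have main: "\<sigma>m ^ 3 * d * pair_weight s f \<le> smooth_num lam \<kappa> chi r s t f \<and> smooth_num lam \<kappa> chi r s t f \<le> \<sigma>p ^ 3 * d * pair_weight s f"
    if f: "bounded_meas2 lam f c'" "\<And>x x'. 0 \<le> f x x'" for f c'
  proof -
    define J where "J = (\<lambda>x. \<integral>x'. G s x' * f x x' \<partial>lam)"
    interpret GK: bounded_kernels lam "\<lambda>i x x'. G i x' * f x x'"
    proof -
      interpret G0: bounded_kernels lam "\<lambda>i x x'. G i x'"
      proof (rule bounded_kernels.intro[OF finite_lam space_lam])
        fix i
        have "G i \<in> borel_measurable lam" using G_meas by (auto simp: bounded_meas_def)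
        from measurable_compose[OF measurable_snd this]
        show "(\<lambda>(x, x'). G i x') \<in> borel_measurable (lam \<Otimes>\<^sub>M lam)" by (simp add: case_prod_beta')
        show "\<exists>c. \<forall>x x'. \<bar>G i x'\<bar> \<le> c" using G_meas by (auto simp: bounded_meas_def)
      qed
      show "bounded_kernels lam (\<lambda>i x x'. G i x' * f x x')" by (rule G0.bounded_kernels_tilt_all[OF f(1)])
    qed
    interpret T: bounded_kernels lam "tilt f" by (rule bounded_kernels_tilt_all[OF f(1)])
    have J_eq: "J = kernel_op lam (\<lambda>i x x'. G i x' * f x x') s (\<lambda>_. 1)" by (simp add: J_def kernel_op_def fun_eq_iff)
    have Jbm: "bounded_meas lam J" unfolding J_eq by (rule GK.bounded_meas_kernel_op[OF bounded_meas_const])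
    have Jint: "integrable lam (\<lambda>x'. G s x' * f x x')" for x
      using GK.kernel_mult_integrable[OF bounded_meas_const[of 1], of s x] by simp
    have Jnn: "0 \<le> J x" for x unfolding J_def
      by (rule Bochner_Integration.integral_nonneg) (use G_pos f(2) in \<open>simp add: less_imp_le\<close>)
    define u where "u = kernel_op lam (tilt f) s B"
    have ubm: "bounded_meas lam u" unfolding u_def by (rule T.bounded_meas_kernel_op[OF Bbm])
    have u: "\<sigma>m ^ 2 * \<beta> * J x \<le> u x \<and> u x \<le> \<sigma>p ^ 2 * \<beta> * J x" for x
    proof
      have "\<sigma>m ^ 2 * \<beta> * J x = (\<integral>x'. \<sigma>m ^ 2 * \<beta> * (G s x' * f x x') \<partial>lam)" by (simp add: J_def)
      also have "\<dots> \<le> u x" unfolding u_def kernel_op_def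
      proof (rule integral_mono[OF _ T.kernel_mult_integrable[OF Bbm]])
        fix x'
        have "(\<sigma>m * G s x') * (\<sigma>m * \<beta>) \<le> \<kappa> s x x' * B x'"
          using minor[of s x' x] B(1)[of x'] \<sigma> \<beta> kernel_pos[of s x x'] by (intro mult_mono) (auto simp: less_imp_le)
        then have "(\<sigma>m * G s x') * (\<sigma>m * \<beta>) * f x x' \<le> \<kappa> s x x' * B x' * f x x'" using f(2) by (rule mult_right_mono)
        then show "\<sigma>m ^ 2 * \<beta> * (G s x' * f x x') \<le> \<kappa> s x x' * f x x' * B x'" by (simp add: power2_eq_square mult_ac)
      qed (use Jint in auto)
      finally show "\<sigma>m ^ 2 * \<beta> * J x \<le> u x" .
      have "u x \<le> (\<integral>x'. \<sigma>p ^ 2 * \<beta> * (G s x' * f x x') \<partial>lam)" unfolding u_def kernel_op_def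
      proof (rule integral_mono[OF T.kernel_mult_integrable[OF Bbm]])
        fix x'
        have "\<kappa> s x x' * B x' \<le> (\<sigma>p * G s x') * (\<sigma>p * \<beta>)"
          using major[of s x x'] B(2)[of x'] \<sigma> G_pos[of s x'] Bpos[of x'] by (intro mult_mono) (auto simp: less_imp_le)
        then have "\<kappa> s x x' * B x' * f x x' \<le> (\<sigma>p * G s x') * (\<sigma>p * \<beta>) * f x x'" using f(2) by (rule mult_right_mono)
        then show "\<kappa> s x x' * f x x' * B x' \<le> \<sigma>p ^ 2 * \<beta> * (G s x' * f x x')" by (simp add: power2_eq_square mult_ac)
      qed (use Jint in auto)
      also have "\<dots> = \<sigma>p ^ 2 * \<beta> * J x" by (simp add: J_def)
      finally show "u x \<le> \<sigma>p ^ 2 * \<beta> * J x" .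
    qed
    have unn: "0 \<le> u x" for x 
    proof -
      have "0 \<le> \<sigma>m ^ 2 * \<beta> * J x" using Jnn[of x] \<beta> by simp
      then show ?thesis using u[of x] by linarith
    qed
    have Iu: "\<sigma>m ^ 2 * \<beta> * pair_weight s f \<le> (\<integral>x. G (s - 1) x * u x \<partial>lam)" "(\<integral>x. G (s - 1) x * u x \<partial>lam) \<le> \<sigma>p ^ 2 * \<beta> * pair_weight s f"
    proof -
      note i = bounded_meas_integrable[OF bounded_meas_G_mult[OF ubm, of "s - 1"]] bounded_meas_integrable[OF bounded_meas_G_mult[OF Jbm, of "s - 1"]]
      have pw: "pair_weight s f = (\<integral>x. G (s - 1) x * J x \<partial>lam)" unfolding J_def by (rule pair_weight_fubini[OF f(1)])
      have "(\<integral>x. \<sigma>m ^ 2 * \<beta> * (G (s - 1) x * J x) \<partial>lam) \<le> (\<integral>x. G (s - 1) x * u x \<partial>lam)"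
      proof (rule integral_mono[OF _ i(1)])
        fix x show "\<sigma>m ^ 2 * \<beta> * (G (s - 1) x * J x) \<le> G (s - 1) x * u x"
          using mult_left_mono[OF conjunct1[OF u[of x]] less_imp_le[OF G_pos[of "s - 1" x]]] by (simp add: mult_ac)
      qed (use i in auto)
      then show "\<sigma>m ^ 2 * \<beta> * pair_weight s f \<le> (\<integral>x. G (s - 1) x * u x \<partial>lam)" by (simp add: pw)
      have "(\<integral>x. G (s - 1) x * u x \<partial>lam) \<le> (\<integral>x. \<sigma>p ^ 2 * \<beta> * (G (s - 1) x * J x) \<partial>lam)"
      proof (rule integral_mono[OF i(1)])
        fix x show "G (s - 1) x * u x \<le> \<sigma>p ^ 2 * \<beta> * (G (s - 1) x * J x)"
          using mult_left_mono[OF conjunct2[OF u[of x]] less_imp_le[OF G_pos[of "s - 1" x]]] by (simp add: mult_ac)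
      qed (use i in auto)
      then show "(\<integral>x. G (s - 1) x * u x \<partial>lam) \<le> \<sigma>p ^ 2 * \<beta> * pair_weight s f" by (simp add: pw)
    qed
    define A1 where "A1 = \<sigma>m * (\<sigma>m ^ 2 * \<beta> * pair_weight s f)"
    define B1 where "B1 = \<sigma>p * (\<sigma>p ^ 2 * \<beta> * pair_weight s f)"
    have w: "A1 * (\<lambda>_. 1) x \<le> kernel_op lam \<kappa> (s - 1) u x \<and> kernel_op lam \<kappa> (s - 1) u x \<le> B1 * (\<lambda>_. 1) x" for x
    proof -
      have "A1 \<le> \<sigma>m * (\<integral>x. G (s - 1) x * u x \<partial>lam)" unfolding A1_def using Iu(1) \<sigma> by (intro mult_left_mono) auto
      moreover have "\<sigma>p * (\<integral>x. G (s - 1) x * u x \<partial>lam) \<le> B1" unfolding B1_def using Iu(2) \<sigma> by (intro mult_left_mono) auto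
      ultimately show ?thesis using kernel_op_bounds[OF ubm unn, of "s - 1" x] by simp
    qed
    note w2 = kernel_iter_ratio[OF bounded_meas_kernel_op[OF ubm] bounded_meas_const w, where i = "r + 1" and n = k2]
    have sn: "smooth_num lam \<kappa> chi r s t f = (\<integral>x. kernel_iter lam \<kappa> (r + 1) k2 (kernel_op lam \<kappa> (s - 1) u) x \<partial>chi)"
      using kernel_iter_snoc[of lam \<kappa> "r + 1" k2 u] unfolding smooth_num_def k B_def[symmetric] u_def[symmetric] by simp
    show ?thesis
      using chi_integral_ratio[OF bounded_meas_kernel_iter[OF bounded_meas_kernel_op[OF ubm]] bounded_meas_kernel_iter_one chi w2]
      unfolding sn A1_def B1_def d_def by (simp add: power3_eq_cube power2_eq_square mult_ac)
  qed
  show ?thesis using main[OF h] main[OF bounded_meas2_one] d by (intro exI[of _ d]) auto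
qed

lemma pair_weight_1_pos: "0 < pair_weight s (\<lambda>_ _. 1)"
  unfolding pair_weight_fubini[OF bounded_meas2_one]
proof (rule integral_pos[OF bounded_meas_G_mult])
  show "bounded_meas lam (\<lambda>x. \<integral>x'. G s x' * 1 \<partial>lam)" by (rule bounded_meas_const)
  have "0 < (\<integral>x'. G s x' \<partial>lam)" by (rule integral_pos[OF G_meas G_pos])
  then show "0 < G (s - 1) x * (\<integral>x'. G s x' * 1 \<partial>lam)" for x using G_pos by simp
qed

lemma smooth_ratio_pair_weight:
  assumes h: "bounded_meas2 lam h c" "\<And>x x'. 0 \<le> h x x'" and chi: "prob_on lam chi" and "r < s - 1" "s < t"
  shows "(\<sigma>m / \<sigma>p) ^ 3 * (pair_weight s h / pair_weight s (\<lambda>_ _. 1)) \<le> smooth_ratio lam \<kappa> chi r s t h"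
    "smooth_ratio lam \<kappa> chi r s t h \<le> (\<sigma>p / \<sigma>m) ^ 3 * (pair_weight s h / pair_weight s (\<lambda>_ _. 1))"
proof -
  define w where "w = pair_weight s h"
  define w1 where "w1 = pair_weight s (\<lambda>_ _. 1)"
  define N where "N = smooth_num lam \<kappa> chi r s t h"
  define D where "D = smooth_num lam \<kappa> chi r s t (\<lambda>_ _. 1)"
  obtain d where d: "0 < d" and b: "\<sigma>m ^ 3 * d * w \<le> N" "N \<le> \<sigma>p ^ 3 * d * w" "\<sigma>m ^ 3 * d * w1 \<le> D" "D \<le> \<sigma>p ^ 3 * d * w1"
    using pair_weight_bounds[OF assms] unfolding w_def w1_def N_def D_def by blast
  have w1: "0 < w1" unfolding w1_def by (rule pair_weight_1_pos)
  have w: "0 \<le> w" unfolding w_def pair_weight_def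
    by (rule Bochner_Integration.integral_nonneg) (use G_pos h(2) in \<open>simp add: less_imp_le\<close>)
  have D: "0 < D" unfolding D_def by (rule smooth_num_pos[OF chi])
  have "0 \<le> \<sigma>m ^ 3 * d * w" using d w \<sigma> by simp
  then have N: "0 \<le> N" using b(1) by linarith
  have "\<sigma>m ^ 3 * d * w / (\<sigma>p ^ 3 * d * w1) \<le> N / D"
    using b N w w1 D d \<sigma> by (intro frac_le) auto
  moreover have "N / D \<le> \<sigma>p ^ 3 * d * w / (\<sigma>m ^ 3 * d * w1)"
    using b N w w1 D d \<sigma> by (intro frac_le) auto
  moreover have "\<sigma>m ^ 3 * d * w / (\<sigma>p ^ 3 * d * w1) = (\<sigma>m / \<sigma>p) ^ 3 * (w / w1)"
    "\<sigma>p ^ 3 * d * w / (\<sigma>m ^ 3 * d * w1) = (\<sigma>p / \<sigma>m) ^ 3 * (w / w1)" using d by (simp_all add: power_divide)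
  ultimately show "(\<sigma>m / \<sigma>p) ^ 3 * (pair_weight s h / pair_weight s (\<lambda>_ _. 1)) \<le> smooth_ratio lam \<kappa> chi r s t h"
    "smooth_ratio lam \<kappa> chi r s t h \<le> (\<sigma>p / \<sigma>m) ^ 3 * (pair_weight s h / pair_weight s (\<lambda>_ _. 1))"
    unfolding smooth_ratio_def w_def w1_def N_def D_def by simp_all
qed

text \<open>Since \<open>G\<close> is positive, vanishing of the weight is decided by the null sets
  of \<open>lam \<Otimes>\<^sub>M lam\<close> alone, which depend neither on the observations nor on
  the parameter.\<close>

lemma pair_weight_zero_iff:
  assumes h: "bounded_meas2 lam h c" "\<And>x x'. 0 \<le> h x x'"
  shows "pair_weight s h = 0 \<longleftrightarrow> (AE z in lam \<Otimes>\<^sub>M lam. h (fst z) (snd z) = 0)"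
proof -
  have "pair_weight s h = 0 \<longleftrightarrow> (AE z in lam \<Otimes>\<^sub>M lam. G (s - 1) (fst z) * (G s (snd z) * h (fst z) (snd z)) = 0)"
    unfolding pair_weight_def
    by (rule integral_nonneg_eq_0_iff_AE[OF pair_weight_integrable[OF h(1)]]) (use G_pos h(2) in \<open>simp add: less_imp_le\<close>)
  also have "\<dots> \<longleftrightarrow> (AE z in lam \<Otimes>\<^sub>M lam. h (fst z) (snd z) = 0)"
    using G_pos by (simp add: less_imp_neq[symmetric])
  finally show ?thesis .
qed

end

section \<open>The hidden Markov model in exponential-family form\<close>

locale hmm =
  fixes \<Theta> :: "'p::euclidean_space set" and lam :: "'x measure" and mu :: "'y measure"
    and m :: "'p \<Rightarrow> 'x \<Rightarrow> 'x \<Rightarrow> real" and g :: "'p \<Rightarrow> 'x \<Rightarrow> 'y \<Rightarrow> real"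
    and \<phi> :: "'p \<Rightarrow> real" and \<psi> :: "'p \<Rightarrow> 'v::euclidean_space" and S :: "'x \<times> 'x \<times> 'y \<Rightarrow> 'v"
    and \<sigma>m \<sigma>p :: real
  assumes compact_\<Theta>: "compact \<Theta>" and fin_lam: "finite_measure lam" and sp_lam: "space lam = UNIV" and sp_mu: "space mu = UNIV"
    and trans_m: "\<And>u. u \<in> \<Theta> \<Longrightarrow> transition_density lam lam (m u)"
    and trans_g: "\<And>u. u \<in> \<Theta> \<Longrightarrow> transition_density lam mu (g u)"
    and cont_\<phi>: "continuous_on \<Theta> \<phi>" and cont_\<psi>: "continuous_on \<Theta> \<psi>"
    and S_meas: "S \<in> borel_measurable (lam \<Otimes>\<^sub>M (lam \<Otimes>\<^sub>M mu))"
    and exp_family: "\<And>u x x' y. u \<in> \<Theta> \<Longrightarrow> m u x x' > 0 \<and> g u x' y > 0 \<and>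
         ln (m u x x') + ln (g u x' y) = \<phi> u + inner (S (x, x', y)) (\<psi> u)"
    and \<sigma>_pos: "0 < \<sigma>m" "\<sigma>m < \<sigma>p"
    and strong_mixing: "\<And>u x x'. u \<in> \<Theta> \<Longrightarrow> \<sigma>m \<le> m u x x' \<and> m u x x' \<le> \<sigma>p"
begin

definition kern :: "'p \<Rightarrow> (int \<Rightarrow> 'y) \<Rightarrow> int \<Rightarrow> 'x \<Rightarrow> 'x \<Rightarrow> real" where
  "kern u y j x x' = m u x x' * g u x' (y j)"

text \<open>At such observation sequences \<open>S\<close> is bounded in the states at each time,
  which keeps the path densities bounded and the integrals over state paths finite. The moment
  assumption makes almost every observed sequence good.\<close>

definition good :: "(int \<Rightarrow> 'y) \<Rightarrow> bool" where
  "good y \<longleftrightarrow> (\<forall>k. \<exists>c. \<forall>x x'. norm (S (x, x', y k)) \<le> c)"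

text \<open>The exponential form gives positivity, continuity in the parameter and, by compactness
  of \<Theta>, bounds that are uniform in it.\<close>

lemma kern_exp:
  assumes "u \<in> \<Theta>" shows "kern u y j x x' = exp (\<phi> u + inner (S (x, x', y j)) (\<psi> u))"
proof -
  have p: "m u x x' > 0" "g u x' (y j) > 0" and e: "ln (m u x x') + ln (g u x' (y j)) = \<phi> u + inner (S (x, x', y j)) (\<psi> u)"
    using exp_family[OF assms, of x x' "y j"] by auto
  show ?thesis unfolding kern_def e[symmetric] using p by (simp add: exp_add)
qed

lemma kern_bounded:
  assumes "good y" shows "\<exists>c. \<forall>u\<in>\<Theta>. \<forall>x x'. kern u y j x x' \<le> c"
proof -
  obtain c where c: "\<And>x x'. norm (S (x, x', y j)) \<le> c" using assms unfolding good_def by blast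
  obtain c1 where c1: "\<And>u. u \<in> \<Theta> \<Longrightarrow> norm (\<phi> u) \<le> c1"
    using compact_imp_bounded[OF compact_continuous_image[OF cont_\<phi> compact_\<Theta>]] by (auto simp: bounded_iff)
  obtain c2 where c2: "\<And>u. u \<in> \<Theta> \<Longrightarrow> norm (\<psi> u) \<le> c2"
    using compact_imp_bounded[OF compact_continuous_image[OF cont_\<psi> compact_\<Theta>]] by (auto simp: bounded_iff)
  have "kern u y j x x' \<le> exp (c1 + c * c2)" if "u \<in> \<Theta>" for u x x'
  proof -
    have "inner (S (x, x', y j)) (\<psi> u) \<le> norm (S (x, x', y j)) * norm (\<psi> u)" by (rule norm_cauchy_schwarz)
    also have "\<dots> \<le> c * c2" using c c2[OF that] by (intro mult_mono) (auto intro: order_trans[OF norm_ge_zero])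
    finally show ?thesis unfolding kern_exp[OF that] using c1[OF that] by simp
  qed
  then show ?thesis by blast
qed

lemma g_section_meas:
  assumes "u \<in> \<Theta>" shows "(\<lambda>x. g u x b) \<in> borel_measurable lam"
proof -
  have "case_prod (g u) \<in> borel_measurable (lam \<Otimes>\<^sub>M mu)" using trans_g[OF assms] by (simp add: transition_density_def)
  from measurable_compose[OF measurable_Pair2'[of b mu lam] this] show ?thesis by (simp add: sp_mu)
qed

lemma mixing_kernels_kern:
  assumes u: "u \<in> \<Theta>" and y: "good y"
  shows "mixing_kernels lam (kern u y) (\<lambda>j x. g u x (y j)) \<sigma>m \<sigma>p"
proof (intro mixing_kernels.intro bounded_kernels.intro mixing_kernels_axioms.intro fin_lam sp_lam \<sigma>_pos)
  have gp: "0 < g u x b" and mp: "0 < m u x x'" for x x' b using exp_family[OF u] by auto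
  fix i
  have mm: "case_prod (m u) \<in> borel_measurable (lam \<Otimes>\<^sub>M lam)" using trans_m[OF u] by (simp add: transition_density_def)
  have "(\<lambda>z. case_prod (m u) z * g u (snd z) (y i)) \<in> borel_measurable (lam \<Otimes>\<^sub>M lam)"
    by (intro borel_measurable_times mm measurable_compose[OF measurable_snd g_section_meas[OF u]])
  then show "(\<lambda>(x, x'). kern u y i x x') \<in> borel_measurable (lam \<Otimes>\<^sub>M lam)" by (simp add: kern_def case_prod_beta')
  obtain c where c: "\<And>x x'. kern u y i x x' \<le> c" using kern_bounded[OF y, of i] u by blast
  then show "\<exists>c. \<forall>x x'. \<bar>kern u y i x x'\<bar> \<le> c" using gp mp by (auto simp: kern_def less_imp_le intro!: exI[of _ c])
  show "0 < g u x (y i)" for x by (rule gp)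
  \<comment> \<open>The exponential family only bounds the product of the two densities; the lower
    bound on \<open>m\<close> turns this into a bound on \<open>g\<close>.\<close>
  have "\<bar>g u x (y i)\<bar> \<le> c / \<sigma>m" for x
  proof -
    have "\<sigma>m * g u x (y i) \<le> kern u y i x x" using strong_mixing[OF u, of x x] gp[of x "y i"] by (simp add: kern_def)
    then have "\<sigma>m * g u x (y i) \<le> c" using c[of x x] by linarith
    then show ?thesis using gp[of x "y i"] \<sigma>_pos by (simp add: field_simps)
  qed
  then show "bounded_meas lam (\<lambda>x. g u x (y i))" using g_section_meas[OF u] by (auto simp: bounded_meas_def)
  fix x x'
  show "\<sigma>m * g u x' (y i) \<le> kern u y i x x'" "kern u y i x x' \<le> \<sigma>p * g u x' (y i)"
    using strong_mixing[OF u, of x x'] gp[of x' "y i"] by (auto simp: kern_def intro: mult_right_mono)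
next
  show "emeasure lam (space lam) \<noteq> 0"
  proof
    assume z: "emeasure lam (space lam) = 0"
    have "(\<integral>\<^sup>+x'. ennreal (m u x x') \<partial>lam) = 1" for x using trans_m[OF u] by (simp add: transition_density_def sp_lam)
    moreover have "(\<integral>\<^sup>+x'. ennreal (m u x x') \<partial>lam) = 0" for x
    proof -
      have "AE x' in lam. ennreal (m u x x') = 0" using z by (intro AE_I[of _ _ "space lam"]) auto
      then show ?thesis by (subst nn_integral_cong_AE[where v = "\<lambda>_. 0"]) auto
    qed
    ultimately show False by simp
  qed
qed

definition test_fun :: "('x \<times> 'x \<times> 'y \<Rightarrow> real) \<Rightarrow> bool" where
  "test_fun h \<longleftrightarrow> h \<in> borel_measurable (lam \<Otimes>\<^sub>M (lam \<Otimes>\<^sub>M mu))"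

lemma test_fun_bounded_meas2:
  assumes "test_fun h" "\<And>x x'. \<bar>h (x, x', b)\<bar> \<le> c"
  shows "bounded_meas2 lam (\<lambda>x x'. h (x, x', b)) c"
proof -
  have "(\<lambda>z. (fst z, snd z, b)) \<in> measurable (lam \<Otimes>\<^sub>M lam) (lam \<Otimes>\<^sub>M (lam \<Otimes>\<^sub>M mu))"
    by (intro measurable_Pair measurable_fst measurable_snd measurable_const) (simp add: sp_mu)
  from measurable_compose[OF this assms(1)[unfolded test_fun_def]] show ?thesis
    using assms(2) by (simp add: case_prod_beta' bounded_meas2_def)
qed

lemma path_density_kern: "path_density m g u r t y x = (\<Prod>i\<in>{r..t - 1}. kern u y (i + 1) (x i) (x (i + 1)))"
  by (simp add: path_density_def kern_def)

lemma smoothing_eq_ratio: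
  assumes u: "u \<in> \<Theta>" and y: "good y" and h: "test_fun h" "\<And>x x'. \<bar>h (x, x', y s)\<bar> \<le> c"
    and chi: "prob_on lam chi" and rst: "r < s" "s \<le> t"
  shows "smoothing m g lam chi r u s t h y = smooth_ratio lam (kern u y) chi r s t (\<lambda>x x'. h (x, x', y s))"
proof -
  interpret mixing_kernels lam "kern u y" "\<lambda>j x. g u x (y j)" \<sigma>m \<sigma>p by (rule mixing_kernels_kern[OF u y])
  show ?thesis
    using smooth_ratio_path[OF chi test_fun_bounded_meas2[OF h] rst]
    by (simp add: smoothing_def path_density_kern divide_inverse mult.commute)
qed

lemma path_measure_component:
  assumes chi: "prob_on lam chi" and "i \<in> {r..t}"
  shows "(\<lambda>x. x i) \<in> measurable (path_measure lam chi r t) lam"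
proof -
  have "sets chi = sets lam" using chi by (simp add: prob_on_def)
  then show ?thesis
    using measurable_component_singleton[OF assms(2), of "\<lambda>i. if i = r then chi else lam"]
    unfolding path_measure_def by (auto split: if_splits cong: measurable_cong_sets)
qed

lemma finite_path_measure:
  assumes chi: "prob_on lam chi" shows "finite_measure (path_measure lam chi r t)"
proof -
  interpret bounded_kernels lam "\<lambda>_ _ _. 0" by (rule bounded_kernels.intro[OF fin_lam sp_lam]) auto
  show ?thesis unfolding path_measure_def by (rule finite_PiM_chi_lam[OF chi]) simp
qed

lemma path_integrand_measurable:
  fixes f :: "'x \<times> 'x \<times> 'y \<Rightarrow> 'b::euclidean_space"
  assumes u: "u \<in> \<Theta>" and chi: "prob_on lam chi" and rst: "r < s" "s \<le> t"
    and Y: "\<And>k. k \<in> {r + 1..t} \<Longrightarrow> Y k \<in> measurable N mu"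
    and f: "f \<in> borel_measurable (lam \<Otimes>\<^sub>M (lam \<Otimes>\<^sub>M mu))"
  shows "(\<lambda>(\<omega>, x). path_density m g u r t (\<lambda>k. Y k \<omega>) x *\<^sub>R f (x (s - 1), x s, Y s \<omega>)) \<in> borel_measurable (N \<Otimes>\<^sub>M path_measure lam chi r t)"
proof -
  let ?Q = "N \<Otimes>\<^sub>M path_measure lam chi r t"
  have X: "(\<lambda>z. snd z i) \<in> measurable ?Q lam" if "i \<in> {r..t}" for i
    by (rule measurable_compose[OF measurable_snd path_measure_component[OF chi that]])
  have Yk: "(\<lambda>z. Y k (fst z)) \<in> measurable ?Q mu" if "k \<in> {r + 1..t}" for k
    by (rule measurable_compose[OF measurable_fst Y[OF that]])
  have mm: "case_prod (m u) \<in> borel_measurable (lam \<Otimes>\<^sub>M lam)" using trans_m[OF u] by (simp add: transition_density_def)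
  have gm: "case_prod (g u) \<in> borel_measurable (lam \<Otimes>\<^sub>M mu)" using trans_g[OF u] by (simp add: transition_density_def)
  have 1: "(\<lambda>z. path_density m g u r t (\<lambda>k. Y k (fst z)) (snd z)) \<in> borel_measurable ?Q"
    unfolding path_density_def
  proof (intro borel_measurable_prod borel_measurable_times)
    fix i assume i: "i \<in> {r..t - 1}"
    have "(\<lambda>z. (snd z i, snd z (i + 1))) \<in> measurable ?Q (lam \<Otimes>\<^sub>M lam)" using i by (intro measurable_Pair X) auto
    from measurable_compose[OF this mm] show "(\<lambda>z. m u (snd z i) (snd z (i + 1))) \<in> borel_measurable ?Q" by (simp only: split)
    have "(\<lambda>z. (snd z (i + 1), Y (i + 1) (fst z))) \<in> measurable ?Q (lam \<Otimes>\<^sub>M mu)" using i by (intro measurable_Pair X Yk) auto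
    from measurable_compose[OF this gm] show "(\<lambda>z. g u (snd z (i + 1)) (Y (i + 1) (fst z))) \<in> borel_measurable ?Q" by (simp only: split)
  qed
  have "(\<lambda>z. (snd z (s - 1), snd z s, Y s (fst z))) \<in> measurable ?Q (lam \<Otimes>\<^sub>M (lam \<Otimes>\<^sub>M mu))"
    using rst by (intro measurable_Pair X Yk) auto
  from measurable_compose[OF this f] have 2: "(\<lambda>z. f (snd z (s - 1), snd z s, Y s (fst z))) \<in> borel_measurable ?Q" .
  show ?thesis using borel_measurable_scaleR[OF 1 2] by (simp add: case_prod_beta')
qed

lemma smoothing_measurable:
  fixes f :: "'x \<times> 'x \<times> 'y \<Rightarrow> 'b::euclidean_space"
  assumes u: "u \<in> \<Theta>" and chi: "prob_on lam chi" and rst: "r < s" "s \<le> t"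
    and Y: "\<And>k. k \<in> {r + 1..t} \<Longrightarrow> Y k \<in> measurable N mu"
    and f: "f \<in> borel_measurable (lam \<Otimes>\<^sub>M (lam \<Otimes>\<^sub>M mu))"
  shows "(\<lambda>\<omega>. smoothing m g lam chi r u s t f (\<lambda>k. Y k \<omega>)) \<in> borel_measurable N"
proof -
  interpret F: finite_measure "path_measure lam chi r t" by (rule finite_path_measure[OF chi])
  have 1: "(\<lambda>\<omega>. \<integral>x. path_density m g u r t (\<lambda>k. Y k \<omega>) x *\<^sub>R f (x (s - 1), x s, Y s \<omega>) \<partial>path_measure lam chi r t) \<in> borel_measurable N"
    by (rule F.borel_measurable_lebesgue_integral[OF path_integrand_measurable[OF u chi rst Y f]])
  have "(\<lambda>(\<omega>, x). path_density m g u r t (\<lambda>k. Y k \<omega>) x *\<^sub>R (1::real)) \<in> borel_measurable (N \<Otimes>\<^sub>M path_measure lam chi r t)"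
    by (rule path_integrand_measurable[OF u chi rst Y, where f = "\<lambda>_. 1"]) auto
  then have 2: "(\<lambda>\<omega>. \<integral>x. path_density m g u r t (\<lambda>k. Y k \<omega>) x \<partial>path_measure lam chi r t) \<in> borel_measurable N"
    by (intro F.borel_measurable_lebesgue_integral) simp
  show ?thesis unfolding smoothing_def using 1 2 by measurable
qed

lemma path_integrand_sections:
  fixes f :: "'x \<times> 'x \<times> 'y \<Rightarrow> 'b::euclidean_space"
  assumes u: "u \<in> \<Theta>" and chi: "prob_on lam chi" and rst: "r < s" "s \<le> t"
    and f: "f \<in> borel_measurable (lam \<Otimes>\<^sub>M (lam \<Otimes>\<^sub>M mu))"
  shows "(\<lambda>x. path_density m g u r t y x *\<^sub>R f (x (s - 1), x s, y s)) \<in> borel_measurable (path_measure lam chi r t)"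
proof -
  have "(\<lambda>(\<omega>, x). path_density m g u r t (\<lambda>k. (\<lambda>_. y k) \<omega>) x *\<^sub>R f (x (s - 1), x s, (\<lambda>_. y s) \<omega>))
      \<in> borel_measurable (count_space (UNIV :: unit set) \<Otimes>\<^sub>M path_measure lam chi r t)"
    by (rule path_integrand_measurable[OF u chi rst _ f]) (simp add: sp_mu)
  from measurable_compose[OF measurable_Pair1'[of "()"] this] show ?thesis by simp
qed

lemma path_density_bounded:
  assumes y: "good y" shows "\<exists>c. \<forall>u\<in>\<Theta>. \<forall>x. \<bar>path_density m g u r t y x\<bar> \<le> c"
proof -
  have "\<forall>i. \<exists>c. \<forall>u\<in>\<Theta>. \<forall>x x'. kern u y i x x' \<le> c" using kern_bounded[OF y] by blast
  then obtain c where c: "\<And>i u x x'. u \<in> \<Theta> \<Longrightarrow> kern u y i x x' \<le> c i" by metis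
  have "\<bar>path_density m g u r t y x\<bar> \<le> (\<Prod>i\<in>{r..t - 1}. c (i + 1))" if u: "u \<in> \<Theta>" for u x
    unfolding path_density_kern abs_prod
  proof (rule prod_mono)
    fix i show "0 \<le> \<bar>kern u y (i + 1) (x i) (x (i + 1))\<bar> \<and> \<bar>kern u y (i + 1) (x i) (x (i + 1))\<bar> \<le> c (i + 1)"
      using c[OF u, of "i + 1"] kern_exp[OF u] by simp
  qed
  then show ?thesis by blast
qed

lemma path_integrable:
  fixes f :: "'x \<times> 'x \<times> 'y \<Rightarrow> 'b::euclidean_space"
  assumes u: "u \<in> \<Theta>" and chi: "prob_on lam chi" and rst: "r < s" "s \<le> t" and y: "good y"
    and f: "f \<in> borel_measurable (lam \<Otimes>\<^sub>M (lam \<Otimes>\<^sub>M mu))" "\<And>x x'. norm (f (x, x', y s)) \<le> c"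
  shows "integrable (path_measure lam chi r t) (\<lambda>x. path_density m g u r t y x *\<^sub>R f (x (s - 1), x s, y s))"
proof -
  interpret F: finite_measure "path_measure lam chi r t" by (rule finite_path_measure[OF chi])
  obtain d where d: "\<And>x. \<bar>path_density m g u r t y x\<bar> \<le> d" using path_density_bounded[OF y] u by blast
  show ?thesis
  proof (rule F.integrable_const_bound[where B = "d * c"])
    show "AE x in path_measure lam chi r t. norm (path_density m g u r t y x *\<^sub>R f (x (s - 1), x s, y s)) \<le> d * c"
      unfolding norm_scaleR using d f(2) order_trans[OF abs_ge_zero d] by (intro AE_I2 mult_mono) auto
  qed (rule path_integrand_sections[OF u chi rst f(1)])
qed

lemma smoothing_inner:
  assumes u: "u \<in> \<Theta>" and chi: "prob_on lam chi" and rst: "r < s" "s \<le> t" and y: "good y"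
  shows "inner (smoothing m g lam chi r u s t S y) v = smoothing m g lam chi r u s t (\<lambda>z. inner (S z) v) y"
proof -
  obtain c where c: "\<And>x x'. norm (S (x, x', y s)) \<le> c" using y unfolding good_def by blast
  note i = path_integrable[OF u chi rst y S_meas c]
  have "inner (\<integral>x. path_density m g u r t y x *\<^sub>R S (x (s - 1), x s, y s) \<partial>path_measure lam chi r t) v
     = (\<integral>x. path_density m g u r t y x *\<^sub>R inner (S (x (s - 1), x s, y s)) v \<partial>path_measure lam chi r t)"
    using integral_inner_left[OF i, of v] by simp
  then show ?thesis by (simp add: smoothing_def)
qed

text \<open>Dominated convergence: the exponential form makes the path density converge pointwise,
  its bound is uniform on \<Theta>, and the denominator has a positive limit. This continuity later
  removes the discretisation of the random parameter.\<close>

lemma smoothing_continuous: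
  assumes us: "\<And>n. us n \<in> \<Theta>" "us \<longlonglongrightarrow> u" "u \<in> \<Theta>" and chi: "prob_on lam chi" and rst: "r < s" "s \<le> t" and y: "good y"
  shows "(\<lambda>n. smoothing m g lam chi r (us n) s t S y) \<longlonglongrightarrow> smoothing m g lam chi r u s t S y"
proof -
  interpret F: finite_measure "path_measure lam chi r t" by (rule finite_path_measure[OF chi])
  obtain c where c: "\<And>x x'. norm (S (x, x', y s)) \<le> c" using y unfolding good_def by blast
  obtain d where d: "\<And>u x. u \<in> \<Theta> \<Longrightarrow> \<bar>path_density m g u r t y x\<bar> \<le> d" using path_density_bounded[OF y] by blast
  have lim_phi: "(\<lambda>n. \<phi> (us n)) \<longlonglongrightarrow> \<phi> u" and lim_psi: "(\<lambda>n. \<psi> (us n)) \<longlonglongrightarrow> \<psi> u"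
    using continuous_on_tendsto_compose[OF cont_\<phi> us(2,3)] continuous_on_tendsto_compose[OF cont_\<psi> us(2,3)] us(1) by auto
  have pt: "(\<lambda>n. path_density m g (us n) r t y x) \<longlonglongrightarrow> path_density m g u r t y x" for x
    unfolding path_density_kern kern_exp[OF us(1)] kern_exp[OF us(3)]
    by (intro tendsto_prod tendsto_exp tendsto_add tendsto_inner tendsto_const lim_phi lim_psi)
  have gen: "(\<lambda>n. \<integral>x. path_density m g (us n) r t y x *\<^sub>R f (x (s - 1), x s, y s) \<partial>path_measure lam chi r t)
     \<longlonglongrightarrow> (\<integral>x. path_density m g u r t y x *\<^sub>R f (x (s - 1), x s, y s) \<partial>path_measure lam chi r t)"
    if f: "f \<in> borel_measurable (lam \<Otimes>\<^sub>M (lam \<Otimes>\<^sub>M mu))" "\<And>x x'. norm (f (x, x', y s)) \<le> c'"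
    for f :: "'x \<times> 'x \<times> 'y \<Rightarrow> 'b::euclidean_space" and c'
  proof (rule integral_dominated_convergence[where w = "\<lambda>_. d * c'"])
    show "AE x in path_measure lam chi r t. (\<lambda>n. path_density m g (us n) r t y x *\<^sub>R f (x (s - 1), x s, y s)) \<longlonglongrightarrow> path_density m g u r t y x *\<^sub>R f (x (s - 1), x s, y s)"
      by (intro AE_I2 tendsto_scaleR pt tendsto_const)
    fix n
    show "AE x in path_measure lam chi r t. norm (path_density m g (us n) r t y x *\<^sub>R f (x (s - 1), x s, y s)) \<le> d * c'"
      unfolding norm_scaleR using d[OF us(1)] f(2) order_trans[OF abs_ge_zero d[OF us(1)]] by (intro AE_I2 mult_mono) auto
  qed (use path_integrand_sections[OF _ chi rst f(1)] us in auto)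
  have num: "(\<lambda>n. \<integral>x. path_density m g (us n) r t y x *\<^sub>R S (x (s - 1), x s, y s) \<partial>path_measure lam chi r t)
     \<longlonglongrightarrow> (\<integral>x. path_density m g u r t y x *\<^sub>R S (x (s - 1), x s, y s) \<partial>path_measure lam chi r t)"
    by (rule gen[OF S_meas c])
  have den: "(\<lambda>n. \<integral>x. path_density m g (us n) r t y x \<partial>path_measure lam chi r t)
     \<longlonglongrightarrow> (\<integral>x. path_density m g u r t y x \<partial>path_measure lam chi r t)"
    using gen[of "\<lambda>_. 1::real" 1] by simp
  interpret mixing_kernels lam "kern u y" "\<lambda>j x. g u x (y j)" \<sigma>m \<sigma>p by (rule mixing_kernels_kern[OF us(3) y])
  have "(\<integral>x. path_density m g u r t y x \<partial>path_measure lam chi r t) = smooth_num lam (kern u y) chi r s t (\<lambda>_ _. 1)"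
    using smooth_num_path[OF chi bounded_meas2_one rst] by (simp add: path_density_kern)
  then have "(\<integral>x. path_density m g u r t y x \<partial>path_measure lam chi r t) \<noteq> 0" using smooth_num_pos[OF chi, of r s t] by simp
  then show ?thesis unfolding smoothing_def by (intro tendsto_scaleR tendsto_inverse num den)
qed

end

section \<open>Perturbed contractions\<close>

text \<open>Take a subspace of least dimension that contains Z - s almost everywhere. If
  \<open>s\<close> were outside \<open>C\<close>, some \<open>a\<close> in that subspace would
  separate 0 from the part of C - s inside it; the hypothesis then puts Z - s into the hyperplane
  orthogonal to \<open>a\<close>, contrary to minimality. Separation within the span works for
  convex sets that are not closed.\<close>

lemma mem_convex_if_no_supporting_direction:
  fixes Z :: "'n \<Rightarrow> 'v::euclidean_space"
  assumes N: "emeasure N (space N) \<noteq> 0" and C: "convex C" and ZC: "\<And>z. z \<in> space N \<Longrightarrow> Z z \<in> C"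
    and H: "\<And>v. (AE z in N. 0 \<le> inner v (Z z - s)) \<Longrightarrow> (AE z in N. inner v (Z z - s) = 0)"
  shows "s \<in> C"
proof (rule ccontr)
  assume sC: "s \<notin> C"
  define Q where "Q = (\<lambda>K. Real_Vector_Spaces.subspace K \<and> (AE z in N. Z z - s \<in> K))"
  have "Q UNIV" by (auto simp: Q_def)
  then obtain K where K: "Q K" and min: "\<And>K'. Q K' \<Longrightarrow> Real_Vector_Spaces.dim K \<le> Real_Vector_Spaces.dim K'"
    using exists_least_iff[of "\<lambda>n. \<exists>K. Q K \<and> Real_Vector_Spaces.dim K = n"] by (metis not_le)
  define D where "D = (\<lambda>x. x - s) ` C \<inter> K"
  have subK: "Real_Vector_Spaces.subspace K" and AEK: "AE z in N. Z z - s \<in> K" using K by (auto simp: Q_def)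
  have cD: "convex D" unfolding D_def
    using convex_translation_subtract_eq[of s C] C subspace_imp_convex[OF subK] by (auto intro: convex_Int)
  have "D \<noteq> {}"
  proof
    assume "D = {}"
    have "AE z in N. False" using AEK AE_space
    proof eventually_elim
      case (elim z)
      then have "Z z - s \<in> D" using ZC by (auto simp: D_def)
      then show ?case using \<open>D = {}\<close> by auto
    qed
    then show False using N by (simp add: AE_iff_null_sets null_sets_def eventually_False trivial_limit_def[symmetric] ae_filter_eq_bot_iff)
  qed
  moreover have "0 \<notin> D" using sC by (auto simp: D_def)
  ultimately obtain a where a: "a \<in> Real_Vector_Spaces.span D" "a \<noteq> 0" "\<And>x. x \<in> D \<Longrightarrow> 0 \<le> inner a x"
    using separating_hyperplane_set_0_inspan[OF cD] by auto
  have aK: "a \<in> K" using a(1) span_minimal[OF _ subK, of D] by (auto simp: D_def)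
  have "AE z in N. 0 \<le> inner a (Z z - s)" using AEK AE_space
    by eventually_elim (auto intro!: a(3) simp: D_def ZC)
  then have z: "AE z in N. inner a (Z z - s) = 0" by (rule H)
  have "Q (K \<inter> {x. inner a x = 0})"
    unfolding Q_def using subspace_inter[OF subK subspace_hyperplane[of a]] AEK z by (auto elim: eventually_elim2)
  then have "Real_Vector_Spaces.dim K \<le> Real_Vector_Spaces.dim (K \<inter> {x. inner a x = 0})" by (rule min)
  moreover have "Real_Vector_Spaces.dim (K \<inter> {x. inner a x = 0}) < Real_Vector_Spaces.dim K"
  proof (rule dim_psubset)
    have sp: "Real_Vector_Spaces.span (K \<inter> {x. inner a x = 0}) = K \<inter> {x. inner a x = 0}" "Real_Vector_Spaces.span K = K"
      using subK subspace_inter[OF subK subspace_hyperplane[of a]] by (auto simp: span_eq_iff)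
    show "Real_Vector_Spaces.span (K \<inter> {x. inner a x = 0}) \<subset> Real_Vector_Spaces.span K"
    proof -
      have "a \<notin> {x. inner a x = 0}" using a(2) by simp
      then show ?thesis unfolding sp using aK by blast
    qed
  qed
  ultimately show False by simp
qed

section \<open>Spectral radius and powers of a real matrix\<close>

lemma from_nat_into_UNIV_bij: "bij_betw (from_nat_into (UNIV :: 'd::finite set)) {0..<CARD('d)} UNIV"
  using bij_betw_from_nat_into_finite[of "UNIV :: 'd set"] by (simp add: atLeast0LessThan)

lemma complex_mat_of_carrier: "complex_mat_of (A :: real^'d^'d) \<in> carrier_mat CARD('d) CARD('d)"
  by (simp add: complex_mat_of_def)

lemma complex_mat_of_mult:
  fixes A B :: "real^'d^'d"
  shows "complex_mat_of (A ** B) = complex_mat_of A * complex_mat_of B"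
proof (rule eq_matI)
  fix i j assume "i < dim_row (complex_mat_of A * complex_mat_of B)" "j < dim_col (complex_mat_of A * complex_mat_of B)"
  then have ij: "i < CARD('d)" "j < CARD('d)" by (auto simp: complex_mat_of_def)
  let ?f = "from_nat_into (UNIV :: 'd set)"
  have "(\<Sum>k\<in>{0..<CARD('d)}. complex_of_real (vec_nth (vec_nth A (?f i)) (?f k)) * complex_of_real (vec_nth (vec_nth B (?f k)) (?f j)))
     = (\<Sum>k\<in>UNIV. complex_of_real (vec_nth (vec_nth A (?f i)) k) * complex_of_real (vec_nth (vec_nth B k) (?f j)))"
    by (rule sum.reindex_bij_betw[OF from_nat_into_UNIV_bij])
  then show "index_mat (complex_mat_of (A ** B)) (i, j) = index_mat (complex_mat_of A * complex_mat_of B) (i, j)"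
    using ij by (simp add: complex_mat_of_def scalar_prod_def matrix_matrix_mult_def)
qed (auto simp: complex_mat_of_def)

lemma complex_mat_of_one: "complex_mat_of (Finite_Cartesian_Product.mat 1 :: real^'d^'d) = 1\<^sub>m CARD('d)"
proof (rule eq_matI)
  fix i j assume "i < dim_row (1\<^sub>m CARD('d) :: complex mat)" "j < dim_col (1\<^sub>m CARD('d) :: complex mat)"
  then have ij: "i < CARD('d)" "j < CARD('d)" by auto
  have "from_nat_into (UNIV :: 'd set) i = from_nat_into UNIV j \<longleftrightarrow> i = j"
    using from_nat_into_UNIV_bij[where 'd='d] ij by (auto simp: bij_betw_def inj_on_def)
  then show "index_mat (complex_mat_of (Finite_Cartesian_Product.mat 1 :: real^'d^'d)) (i, j) = index_mat (1\<^sub>m CARD('d)) (i, j)"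
    using ij by (simp add: complex_mat_of_def Finite_Cartesian_Product.mat_def)
qed (auto simp: complex_mat_of_def)

text \<open>An eigenvector of the scaled matrix is one of \<open>A\<close>, with the eigenvalue
  multiplied by \<gamma>.\<close>

lemma spectral_radius_smult_less_1:
  assumes A: "A \<in> carrier_mat n n" "0 < n" and r: "spectral_radius A < \<gamma>" "0 < \<gamma>"
  shows "spectral_radius (complex_of_real (1 / \<gamma>) \<cdot>\<^sub>m A) < 1"
proof -
  let ?B = "complex_of_real (1 / \<gamma>) \<cdot>\<^sub>m A"
  have B: "?B \<in> carrier_mat n n" using A by auto
  obtain e where e: "e \<in> spectrum ?B" "spectral_radius ?B = norm e"
    using spectral_radius_mem_max(1)[OF B A(2)] by auto
  obtain v where v: "eigenvector ?B v e" using e(1) by (auto simp: spectrum_def eigenvalue_def)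
  then have v': "v \<in> carrier_vec n" "v \<noteq> 0\<^sub>v n" "?B *\<^sub>v v = e \<cdot>\<^sub>v v" using A by (auto simp: eigenvector_def)
  have "A *\<^sub>v v = (complex_of_real \<gamma> * e) \<cdot>\<^sub>v v"
  proof -
    have "A = complex_of_real \<gamma> \<cdot>\<^sub>m ?B" using r(2) by (intro eq_matI) auto
    then have "A *\<^sub>v v = complex_of_real \<gamma> \<cdot>\<^sub>v (?B *\<^sub>v v)"
      using B v'(1) A r(2) by (subst \<open>A = _\<close>) (auto intro!: eq_vecI simp: scalar_prod_def sum_distrib_left intro!: sum.cong)
    then show ?thesis using v'(3) by (simp add: smult_smult_assoc)
  qed
  then have "eigenvector A v (complex_of_real \<gamma> * e)" using v' A by (auto simp: eigenvector_def)
  then have "complex_of_real \<gamma> * e \<in> spectrum A" by (auto simp: spectrum_def eigenvalue_def)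
  then have "norm (complex_of_real \<gamma> * e) \<le> spectral_radius A" by (intro spectral_radius_mem_max(2)[OF A]) auto
  moreover have "norm (complex_of_real \<gamma> * e) = \<gamma> * norm e" using r(2) by (simp add: norm_mult)
  ultimately have "\<gamma> * norm e < \<gamma> * 1" using r(1) by linarith
  then show ?thesis using e(2) r(2) mult_less_cancel_left_pos[of \<gamma> "norm e" 1] by simp
qed

text \<open>Scaling by 1 / \<gamma> brings the spectral radius below 1, and then the Jordan form
  bounds the entries of all powers by one constant. The room between the radius and \<gamma> absorbs
  the polynomial factors that Jordan blocks produce.\<close>

lemma matrix_power_bound:
  fixes A :: "real^'d^'d"
  assumes r: "spectral_radius (complex_mat_of A) < \<gamma>" "0 < \<gamma>"
  shows "\<exists>c\<ge>0. \<forall>k x. norm (((\<lambda>x. A *v x) ^^ k) x) \<le> c * \<gamma> ^ k * norm x"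
proof -
  define A' where "A' = (1 / \<gamma>) *\<^sub>R A"
  have cA: "complex_mat_of A' = complex_of_real (1 / \<gamma>) \<cdot>\<^sub>m complex_mat_of A"
    by (intro eq_matI) (auto simp: complex_mat_of_def A'_def)
  have "spectral_radius (complex_mat_of A') < 1"
    unfolding cA by (rule spectral_radius_smult_less_1[OF complex_mat_of_carrier _ r]) simp
  then obtain c where c: "\<And>k. norm_bound (complex_mat_of A' ^\<^sub>m k) c"
    using spectral_radius_jnf_norm_bound_less_1_upper_triangular[OF complex_mat_of_carrier] by blast
  \<comment> \<open>Multiplication on the right matches the recursion of
    \<open>^\<^sub>m\<close>.\<close>
  define Pw where "Pw = (\<lambda>k. ((\<lambda>M. M ** A') ^^ k) (Finite_Cartesian_Product.mat 1))"
  have P0: "Pw 0 = Finite_Cartesian_Product.mat 1" and PS: "Pw (Suc k) = Pw k ** A'" for k by (simp_all add: Pw_def)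
  have cP: "complex_mat_of (Pw k) = complex_mat_of A' ^\<^sub>m k" for k
  proof (induction k)
    case 0 then show ?case using complex_mat_of_carrier[of A'] by (simp add: P0 complex_mat_of_one)
  next
    case (Suc k) then show ?case by (simp add: PS complex_mat_of_mult)
  qed
  have entry: "\<bar>vec_nth (vec_nth (Pw k) i) j\<bar> \<le> c" for k i j
  proof -
    let ?f = "from_nat_into (UNIV :: 'd set)"
    have "i \<in> ?f ` {0..<CARD('d)}" "j \<in> ?f ` {0..<CARD('d)}" using from_nat_into_UNIV_bij[where 'd='d] by (auto simp: bij_betw_def)
    then obtain i' j' where ij: "i = ?f i'" "j = ?f j'" "i' < CARD('d)" "j' < CARD('d)" by auto
    have "norm (index_mat (complex_mat_of (Pw k)) (i', j')) \<le> c"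
      using c[of k] ij unfolding norm_bound_def cP[symmetric] by (simp add: complex_mat_of_def)
    then show ?thesis using ij by (simp add: complex_mat_of_def)
  qed
  have c0: "0 \<le> c" using entry[of 0 undefined undefined] by linarith
  have Pv: "norm (Pw k *v x) \<le> (real CARD('d) * (real CARD('d) * c)) * norm x" for k x
  proof -
    have "norm (Pw k *v x) \<le> (\<Sum>i\<in>UNIV. \<bar>vec_nth (Pw k *v x) i\<bar>)" by (rule norm_le_l1_cart)
    also have "\<dots> \<le> (\<Sum>i\<in>(UNIV::'d set). real CARD('d) * (c * norm x))"
    proof (rule sum_mono)
      fix i :: 'd
      have "\<bar>vec_nth (Pw k *v x) i\<bar> \<le> (\<Sum>j\<in>UNIV. \<bar>vec_nth (vec_nth (Pw k) i) j * vec_nth x j\<bar>)"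
        unfolding matrix_vector_mult_def by simp
      also have "\<dots> \<le> (\<Sum>j\<in>(UNIV::'d set). c * norm x)"
        unfolding abs_mult using entry c0 component_le_norm_cart[of x] by (intro sum_mono mult_mono) auto
      finally show "\<bar>vec_nth (Pw k *v x) i\<bar> \<le> real CARD('d) * (c * norm x)" by simp
    qed
    also have "\<dots> = (real CARD('d) * (real CARD('d) * c)) * norm x" by simp
    finally show ?thesis .
  qed
  have it: "((\<lambda>x. A *v x) ^^ k) x = \<gamma> ^ k *\<^sub>R (Pw k *v x)" for k x
  proof (induction k arbitrary: x)
    case 0 then show ?case by (simp add: P0)
  next
    case (Suc k)
    have "((\<lambda>x. A *v x) ^^ Suc k) x = \<gamma> ^ k *\<^sub>R (Pw k *v (A *v x))"
      unfolding funpow_Suc_right o_def by (rule Suc)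
    also have "A *v x = \<gamma> *\<^sub>R (A' *v x)" using r(2) by (simp add: A'_def scaleR_matrix_vector_assoc[symmetric])
    also have "Pw k *v (\<gamma> *\<^sub>R (A' *v x)) = \<gamma> *\<^sub>R (Pw (Suc k) *v x)"
      by (simp add: PS matrix_vector_mul_assoc[symmetric] matrix_vector_mult_scaleR)
    finally show ?case by simp
  qed
  show ?thesis
  proof (intro exI[of _ "real CARD('d) * (real CARD('d) * c)"] conjI allI)
    show "0 \<le> real CARD('d) * (real CARD('d) * c)" using c0 by simp
    show "norm (((\<lambda>x. A *v x) ^^ k) x) \<le> real CARD('d) * (real CARD('d) * c) * \<gamma> ^ k * norm x" for k x
      using mult_left_mono[OF Pv[of k x], of "\<gamma> ^ k"] r(2) unfolding it by (simp add: mult_ac)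
  qed
qed

text \<open>The adapted norm is \<open>\<Sum>k<N. norm (L^k x) / r^k\<close> for some \<open>r\<close> between \<open>\<gamma>\<close> and 1.\<close>

lemma local_contraction_in_adapted_norm:
  fixes G :: "'v::euclidean_space \<Rightarrow> 'v"
  assumes der: "(G has_derivative L) (at s)" and fix_pt: "G s = s"
    and pow: "\<And>k x. norm ((L ^^ k) x) \<le> c * \<gamma> ^ k * norm x" and \<gamma>: "0 < \<gamma>" "\<gamma> < 1" and c: "0 \<le> c"
  shows "\<exists>nrm \<delta> q C. 0 < \<delta> \<and> 0 < q \<and> q < 1 \<and> 0 < C \<and>
    (\<forall>x. norm x \<le> nrm x \<and> nrm x \<le> C * norm x) \<and> (\<forall>x y. nrm (x + y) \<le> nrm x + nrm y) \<and>
    (\<forall>x. norm (x - s) < \<delta> \<longrightarrow> nrm (G x - s) \<le> q * nrm (x - s))"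
proof -
  define r where "r = (1 + \<gamma>) / 2"
  have r: "0 < r" "\<gamma> < r" "r < 1" using \<gamma> by (auto simp: r_def)
  have lin: "linear L" using der by (rule has_derivative_linear)
  have "(\<lambda>N. c * (\<gamma> / r) ^ N) \<longlonglongrightarrow> c * 0"
    using r \<gamma> by (intro tendsto_mult tendsto_const LIMSEQ_power_zero) auto
  then have "eventually (\<lambda>N. c * (\<gamma> / r) ^ N < 1) sequentially" by (intro order_tendstoD(2)[of _ "c * 0"]) auto
  then have "eventually (\<lambda>N. c * (\<gamma> / r) ^ N < 1 \<and> 1 \<le> N) sequentially" using eventually_ge_at_top by (rule eventually_conj)
  \<comment> \<open>With this \<open>N\<close> the last term of the telescoped sum, norm (L^N x) /
    r^N, is at most its first term, norm x, so \<open>L\<close> contracts the adapted norm by the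
    factor \<open>r\<close> itself.\<close>
  then obtain N where N: "c * (\<gamma> / r) ^ N < 1" "1 \<le> N" by (auto simp: eventually_sequentially)
  define nrm where "nrm = (\<lambda>x. \<Sum>k<N. norm ((L ^^ k) x) / r ^ k)"
  define C where "C = (\<Sum>k<N. c * \<gamma> ^ k / r ^ k) + 1"
  have C: "0 < C" unfolding C_def using c \<gamma> r by (intro add_nonneg_pos sum_nonneg) auto
  have linp: "linear (L ^^ k)" for k 
  proof (induction k)
    case (Suc k)
    then show ?case using linear_compose[OF Suc lin] by (simp only: funpow.simps)
  qed (simp add: linear_id[unfolded id_def] linear_ident)
  have lower: "norm x \<le> nrm x" for x
  proof -
    have "norm ((L ^^ 0) x) / r ^ 0 \<le> nrm x" unfolding nrm_def
      using N(2) r by (intro member_le_sum) auto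
    then show ?thesis by simp
  qed
  have upper: "nrm x \<le> C * norm x" for x
  proof -
    have "nrm x \<le> (\<Sum>k<N. c * \<gamma> ^ k / r ^ k * norm x)" unfolding nrm_def
      using pow r by (intro sum_mono) (auto simp: divide_right_mono)
    also have "\<dots> \<le> C * norm x" by (simp add: C_def sum_distrib_right distrib_right)
    finally show ?thesis .
  qed
  have tri: "nrm (x + y) \<le> nrm x + nrm y" for x y
    unfolding nrm_def sum.distrib[symmetric] add_divide_distrib[symmetric]
    using r by (intro sum_mono divide_right_mono) (auto simp: linear_add[OF linp] norm_triangle_ineq)
  have nrmL: "nrm (L x) \<le> r * nrm x" for x
  proof -
    have "nrm (L x) = (\<Sum>k<N. norm ((L ^^ Suc k) x) / r ^ k)"
      unfolding nrm_def by (simp add: funpow_swap1)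
    also have "\<dots> = r * (\<Sum>k<N. norm ((L ^^ Suc k) x) / r ^ Suc k)"
      using r by (simp add: sum_distrib_left)
    also have "(\<Sum>k<N. norm ((L ^^ Suc k) x) / r ^ Suc k) = nrm x - norm x + norm ((L ^^ N) x) / r ^ N"
      unfolding nrm_def using sum.lessThan_Suc_shift[of "\<lambda>k. norm ((L ^^ k) x) / r ^ k" N]
        sum.lessThan_Suc[of "\<lambda>k. norm ((L ^^ k) x) / r ^ k" N] by simp
    also have "norm ((L ^^ N) x) / r ^ N \<le> norm x"
    proof -
      have "norm ((L ^^ N) x) / r ^ N \<le> c * \<gamma> ^ N * norm x / r ^ N" using pow r by (intro divide_right_mono) auto
      also have "\<dots> = c * (\<gamma> / r) ^ N * norm x" by (simp add: power_divide)
      also have "\<dots> \<le> 1 * norm x" using N by (intro mult_right_mono) auto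
      finally show ?thesis by simp
    qed
    finally show ?thesis using r by simp
  qed
  \<comment> \<open>The linearisation error may spend half of the gap 1 - r, which leaves the factor
    (1 + r) / 2. Dividing by \<open>C\<close> pays for bounding the adapted norm of the error by its
    Euclidean norm.\<close>
  define \<eta> where "\<eta> = (1 - r) / (2 * C)"
  have \<eta>: "0 < \<eta>" using r C by (simp add: \<eta>_def)
  obtain \<delta> where \<delta>: "0 < \<delta>" "\<And>x. norm (x - s) < \<delta> \<Longrightarrow> norm (G x - G s - L (x - s)) \<le> \<eta> * norm (x - s)"
    using der \<eta> unfolding has_derivative_at_alt by blast
  define q where "q = (1 + r) / 2"
  have "nrm (G x - s) \<le> q * nrm (x - s)" if x: "norm (x - s) < \<delta>" for x
  proof -
    have "nrm (G x - s) = nrm (L (x - s) + (G x - G s - L (x - s)))" by (simp add: fix_pt)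
    also have "\<dots> \<le> nrm (L (x - s)) + nrm (G x - G s - L (x - s))" by (rule tri)
    also have "\<dots> \<le> r * nrm (x - s) + C * (\<eta> * norm (x - s))"
      using nrmL upper[of "G x - G s - L (x - s)"] \<delta>(2)[OF x] C by (intro add_mono) (auto intro: order_trans mult_left_mono)
    also have "C * (\<eta> * norm (x - s)) = (1 - r) / 2 * norm (x - s)" using C by (simp add: \<eta>_def)
    also have "\<dots> \<le> (1 - r) / 2 * nrm (x - s)" using lower r by (intro mult_left_mono) auto
    finally show ?thesis by (simp add: q_def algebra_simps add_divide_distrib diff_divide_distrib)
  qed
  then show ?thesis using \<delta>(1) r C lower upper tri
    by (intro exI[of _ nrm] exI[of _ \<delta>] exI[of _ q] exI[of _ C]) (auto simp: q_def)
qed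

text \<open>Once the path stays in the ball of contraction, the recursion is iterated in the adapted
  norm. \<open>B\<close> and \<open>N\<close> depend on the path, but the sum is extended down to k
  = 0, so its moments can be bounded without regard to the random time at which contraction sets
  in.\<close>

lemma perturbed_contraction_bound:
  fixes G :: "'v::euclidean_space \<Rightarrow> 'v" and s e :: "nat \<Rightarrow> 'v"
  assumes q: "0 < q" "q < 1" and C: "0 < C" and \<delta>: "0 < \<delta>"
    and nrm: "\<And>x. norm x \<le> nrm x \<and> nrm x \<le> C * norm x" "\<And>x y. nrm (x + y) \<le> nrm x + nrm y"
    and contr: "\<And>x. norm (x - l) < \<delta> \<Longrightarrow> nrm (G x - l) \<le> q * nrm (x - l)"
    and rec: "\<And>n. 1 \<le> n \<Longrightarrow> s (Suc n) = G (s n) + e n" and lim: "s \<longlonglongrightarrow> l"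
  shows "\<exists>B N. \<forall>n\<ge>N. norm (s n - l) \<le> B * q ^ n + C * (\<Sum>k<n. q ^ (n - 1 - k) * norm (e k))"
proof -
  obtain N0 where N0: "\<And>n. N0 \<le> n \<Longrightarrow> norm (s n - l) < \<delta>"
    using lim \<delta> by (auto simp: LIMSEQ_iff)
  define N where "N = max N0 1"
  have step: "nrm (s (Suc n) - l) \<le> q * nrm (s n - l) + C * norm (e n)" if "N \<le> n" for n
  proof -
    have n: "1 \<le> n" "norm (s n - l) < \<delta>" using that N0 by (auto simp: N_def)
    have "nrm (s (Suc n) - l) = nrm ((G (s n) - l) + e n)" using rec[OF n(1)] by (simp add: algebra_simps)
    also have "\<dots> \<le> nrm (G (s n) - l) + nrm (e n)" by (rule nrm(2))
    also have "\<dots> \<le> q * nrm (s n - l) + C * norm (e n)" using contr[OF n(2)] nrm(1) by (intro add_mono) auto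
    finally show ?thesis .
  qed
  define B where "B = nrm (s N - l) / q ^ N"
  have "nrm (s n - l) \<le> B * q ^ n + C * (\<Sum>k\<in>{N..<n}. q ^ (n - 1 - k) * norm (e k))" if "N \<le> n" for n
    using that
  proof (induction n rule: dec_induct)
    case base then show ?case using q by (simp add: B_def)
  next
    case (step n)
    have "nrm (s (Suc n) - l) \<le> q * (B * q ^ n + C * (\<Sum>k\<in>{N..<n}. q ^ (n - 1 - k) * norm (e k))) + C * norm (e n)"
      using \<open>\<And>n. N \<le> n \<Longrightarrow> nrm (s (Suc n) - l) \<le> q * nrm (s n - l) + C * norm (e n)\<close>[OF step.hyps(1)] step.IH q
      by (meson add_right_mono less_imp_le mult_left_mono order_trans)
    also have "\<dots> = B * q ^ Suc n + C * (q * (\<Sum>k\<in>{N..<n}. q ^ (n - 1 - k) * norm (e k)) + norm (e n))"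
      by (simp add: algebra_simps)
    also have "q * (\<Sum>k\<in>{N..<n}. q ^ (n - 1 - k) * norm (e k)) = (\<Sum>k\<in>{N..<n}. q ^ (Suc n - 1 - k) * norm (e k))"
      unfolding sum_distrib_left
    proof (rule sum.cong)
      fix k assume "k \<in> {N..<n}"
      then have "Suc n - 1 - k = Suc (n - 1 - k)" by auto
      then show "q * (q ^ (n - 1 - k) * norm (e k)) = q ^ (Suc n - 1 - k) * norm (e k)" by simp
    qed simp
    also have "\<dots> + norm (e n) = (\<Sum>k\<in>{N..<Suc n}. q ^ (Suc n - 1 - k) * norm (e k))" using step.hyps(1) by simp
    finally show ?case .
  qed
  moreover have "(\<Sum>k\<in>{N..<n}. q ^ (n - 1 - k) * norm (e k)) \<le> (\<Sum>k<n. q ^ (n - 1 - k) * norm (e k))" for n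
    using q by (intro sum_mono2) auto
  ultimately have "norm (s n - l) \<le> B * q ^ n + C * (\<Sum>k<n. q ^ (n - 1 - k) * norm (e k))" if "N \<le> n" for n
    using that nrm(1)[of "s n - l"] C by (meson add_left_mono less_imp_le mult_left_mono order_trans)
  then show ?thesis by blast
qed

text \<open>\<open>X\<close> exceeds \<open>W\<close> only finitely often on almost every path. The factor \<open>A\<close> absorbs these terms, with no
  control on its moments, and \<open>V\<close> is a unit vector.\<close>

lemma (in prob_space) stochastic_decomposition:
  fixes X :: "nat \<Rightarrow> 'a \<Rightarrow> 'u::euclidean_space" and W :: "nat \<Rightarrow> 'a \<Rightarrow> real" and \<tau> :: "nat \<Rightarrow> nat"
  assumes X[measurable]: "\<And>n. X n \<in> borel_measurable M" and W: "\<And>n. 1 \<le> n \<Longrightarrow> Lp_le M p (W n) w"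
    and ev: "AE x in M. eventually (\<lambda>n. norm (X n x) \<le> W n x) sequentially" and \<tau>: "\<And>n. 1 \<le> n \<Longrightarrow> 0 < \<tau> n" and p: "0 < p"
  shows "\<exists>(U :: nat \<Rightarrow> 'a \<Rightarrow> 'u) (V :: nat \<Rightarrow> 'a \<Rightarrow> 'u) (A :: nat \<Rightarrow> 'a \<Rightarrow> real).
    bigO_Lp M p U \<and> bigO_Lp M (p / 2) V \<and> bigO_as M A \<and>
    (\<forall>n\<ge>1. \<forall>x\<in>space M. X n x = U n x + (1 / sqrt (real (\<tau> n)) * A n x) *\<^sub>R V n x)"
proof -
  define U where "U = (\<lambda>n x. if norm (X n x) \<le> W n x then X n x else 0)"
  \<comment> \<open>Division by zero gives 0, so \<open>V\<close> vanishes where \<open>X\<close>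
    and \<open>U\<close> agree and has norm at most 1 everywhere.\<close>
  define V where "V = (\<lambda>n x. (1 / norm (X n x - U n x)) *\<^sub>R (X n x - U n x))"
  define A where "A = (\<lambda>n x. sqrt (real (\<tau> n)) * norm (X n x - U n x))"
  have Wm[measurable]: "W n \<in> borel_measurable M" if "1 \<le> n" for n using Lp_leD(1)[OF W[OF that]] .
  have Um[measurable]: "U n \<in> borel_measurable M" if "1 \<le> n" for n using Wm[OF that] unfolding U_def by measurable
  have Vm: "V n \<in> borel_measurable M" if "1 \<le> n" for n using Um[OF that] unfolding V_def by measurable
  have Am: "A n \<in> borel_measurable M" if "1 \<le> n" for n using Um[OF that] unfolding A_def by measurable
  have "bigO_Lp M p U" unfolding bigO_Lp_def
  proof (intro conjI allI impI Um)
    have "(SUP n\<in>{1..}. \<integral>\<^sup>+x. ennreal (norm (U n x) powr p) \<partial>M) \<le> ennreal (w powr p)"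
    proof (rule SUP_least)
      fix n :: nat assume "n \<in> {1..}"
      then have n: "1 \<le> n" by simp
      have "(\<integral>\<^sup>+x. ennreal (norm (U n x) powr p) \<partial>M) \<le> (\<integral>\<^sup>+x. ennreal (\<bar>W n x\<bar> powr p) \<partial>M)"
        using p by (intro nn_integral_mono ennreal_leI powr_mono2) (auto simp: U_def)
      also have "\<dots> \<le> ennreal (w powr p)" using Lp_leD(3)[OF W[OF n]] .
      finally show "(\<integral>\<^sup>+x. ennreal (norm (U n x) powr p) \<partial>M) \<le> ennreal (w powr p)" .
    qed
    then show "(SUP n\<in>{1..}. \<integral>\<^sup>+x. ennreal (norm (U n x) powr p) \<partial>M) < \<infinity>" by (rule le_less_trans) simp
  qed
  moreover have "bigO_Lp M (p / 2) V" unfolding bigO_Lp_def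
  proof (intro conjI allI impI Vm)
    have "(SUP n\<in>{1..}. \<integral>\<^sup>+x. ennreal (norm (V n x) powr (p / 2)) \<partial>M) \<le> ennreal 1"
    proof (rule SUP_least)
      fix n :: nat
      have "norm (V n x) powr (p / 2) \<le> 1" for x using p by (auto simp: V_def)
      then have "(\<integral>\<^sup>+x. ennreal (norm (V n x) powr (p / 2)) \<partial>M) \<le> (\<integral>\<^sup>+x. ennreal 1 \<partial>M)" by (intro nn_integral_mono ennreal_leI)
      then show "(\<integral>\<^sup>+x. ennreal (norm (V n x) powr (p / 2)) \<partial>M) \<le> ennreal 1" by (simp add: emeasure_space_1)
    qed
    then show "(SUP n\<in>{1..}. \<integral>\<^sup>+x. ennreal (norm (V n x) powr (p / 2)) \<partial>M) < \<infinity>" by (rule le_less_trans) simp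
  qed
  moreover have "bigO_as M A" unfolding bigO_as_def
  proof (intro conjI allI impI Am)
    show "AE x in M. bdd_above ((\<lambda>n. norm (A n x)) ` {1..})" using ev
    proof eventually_elim
      case (elim x)
      then obtain N where N: "\<And>n. N \<le> n \<Longrightarrow> norm (X n x) \<le> W n x" by (auto simp: eventually_sequentially)
      have "norm (A n x) \<le> (\<Sum>k\<le>N. norm (A k x))" for n
      proof (cases "n \<le> N")
        case True then show ?thesis by (intro member_le_sum) auto
      next
        case False
        then have "A n x = 0" using N[of n] by (simp add: A_def U_def)
        then show ?thesis by (simp add: sum_nonneg)
      qed
      then show ?case by (intro bdd_aboveI2)
    qed
  qed
  moreover have "\<forall>n\<ge>1. \<forall>x\<in>space M. X n x = U n x + (1 / sqrt (real (\<tau> n)) * A n x) *\<^sub>R V n x"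
    using \<tau> by (auto simp: A_def V_def)
  ultimately show ?thesis by blast
qed

section \<open>Geometric forgetting for the model\<close>

context hmm
begin

definition \<rho> :: real where "\<rho> = 1 - \<sigma>m / \<sigma>p"

text \<open>One constant for both directions: 2 suffices for forgetting the past, and 2 (\<sigma>p -
  \<sigma>m) / \<sigma>m is the factor for the future.\<close>

definition K0 :: real where "K0 = 2 + 2 * ((\<sigma>p - \<sigma>m) / \<sigma>m)"

lemma \<rho>_bounds: "0 < \<rho>" "\<rho> < 1" using \<sigma>_pos by (auto simp: \<rho>_def)

lemma K0_ge: "2 \<le> K0" "0 < K0" "2 * ((\<sigma>p - \<sigma>m) / \<sigma>m) \<le> K0"
proof -
  have "0 \<le> (\<sigma>p - \<sigma>m) / \<sigma>m" using \<sigma>_pos by simp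
  then show "2 \<le> K0" "0 < K0" "2 * ((\<sigma>p - \<sigma>m) / \<sigma>m) \<le> K0" unfolding K0_def by linarith+
qed

context
  fixes u y h c s
  assumes u: "u \<in> \<Theta>" and y: "good y" and h: "test_fun h" "\<And>x x'. \<bar>h (x, x', y s)\<bar> \<le> c"
begin

interpretation MK: mixing_kernels lam "kern u y" "\<lambda>j x. g u x (y j)" \<sigma>m \<sigma>p by (rule mixing_kernels_kern[OF u y])

lemma smoothing_abs_le:
  assumes "prob_on lam chi" "r < s" "s \<le> t"
  shows "\<bar>smoothing m g lam chi r u s t h y\<bar> \<le> c"
  using MK.smooth_ratio_abs_le[OF test_fun_bounded_meas2[OF h] assms(1,2), of t]
  unfolding smoothing_eq_ratio[OF u y h assms] .

lemma c_nonneg: "0 \<le> c" using h(2)[of undefined undefined] by linarith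

lemma smoothing_past:
  assumes "prob_on lam chi" "prob_on lam chi'" "r \<le> r0" "r' \<le> r0" "r0 < s" "s \<le> t"
  shows "\<bar>smoothing m g lam chi r u s t h y - smoothing m g lam chi' r' u s t h y\<bar> \<le> K0 * c * \<rho> ^ nat (s - 1 - r0)"
proof -
  have "\<bar>smoothing m g lam chi r u s t h y - smoothing m g lam chi' r' u s t h y\<bar> \<le> 2 * c * \<rho> ^ nat (s - 1 - r0)"
    using MK.smooth_ratio_past[OF test_fun_bounded_meas2[OF h] assms(1-5), of t] assms
    by (simp add: smoothing_eq_ratio[OF u y h] \<rho>_def MK.\<rho>_def)
  also have "\<dots> \<le> K0 * c * \<rho> ^ nat (s - 1 - r0)"
    using K0_ge c_nonneg \<rho>_bounds by (intro mult_right_mono) auto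
  finally show ?thesis .
qed

lemma smoothing_future:
  assumes "prob_on lam chi" "r < s" "s \<le> t" "t \<le> t'"
  shows "\<bar>smoothing m g lam chi r u s t' h y - smoothing m g lam chi r u s t h y\<bar> \<le> K0 * c * \<rho> ^ nat (t - s)"
proof -
  have "\<bar>smoothing m g lam chi r u s t' h y - smoothing m g lam chi r u s t h y\<bar> \<le> 2 * c * ((\<sigma>p - \<sigma>m) / \<sigma>m) * \<rho> ^ nat (t - s)"
    using MK.smooth_ratio_future[OF test_fun_bounded_meas2[OF h] assms] assms
    by (simp add: smoothing_eq_ratio[OF u y h] \<rho>_def MK.\<rho>_def)
  also have "2 * c * ((\<sigma>p - \<sigma>m) / \<sigma>m) \<le> K0 * c"
    using mult_right_mono[OF K0_ge(3) c_nonneg] by (simp add: mult_ac)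
  finally show ?thesis using \<rho>_bounds by (simp add: mult_right_mono)
qed

lemma smoothing_two_sided:
  assumes "prob_on lam chi" "prob_on lam chi'" "r' \<le> r" "r < s" "s \<le> t" "t \<le> t'"
  shows "\<bar>smoothing m g lam chi r u s t h y - smoothing m g lam chi' r' u s t' h y\<bar> \<le> K0 * c * (\<rho> ^ nat (s - 1 - r) + \<rho> ^ nat (t - s))"
  using smoothing_past[of chi chi' r r r' t'] smoothing_future[of chi r t t'] assms
  by (simp add: distrib_left)

end

lemma good_shift: "good y \<Longrightarrow> good (\<lambda>k. y (k + d))"
  unfolding good_def by blast

lemma smoothing_shift:
  assumes u: "u \<in> \<Theta>" and y: "good y" and h: "test_fun h" "\<And>x x'. \<bar>h (x, x', y (s + d))\<bar> \<le> c"
    and chi: "prob_on lam chi" "r < s" "s \<le> t"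
  shows "smoothing m g lam chi (r + d) u (s + d) (t + d) h y = smoothing m g lam chi r u s t h (\<lambda>k. y (k + d))"
proof -
  have "kern u (\<lambda>k. y (k + d)) = (\<lambda>j. kern u y (j + d))" by (simp add: kern_def fun_eq_iff)
  then show ?thesis
    using smoothing_eq_ratio[OF u y h chi(1), of "r + d" "t + d"] smoothing_eq_ratio[OF u good_shift[OF y], of h s d c chi r t] assms
      smooth_ratio_shift[of lam "kern u y" chi r d s t]
    by simp
qed

end

section \<open>Stationary observations and block statistics\<close>

text \<open>\<open>chi0\<close> is a reference initial law, along which the limiting statistic is
  computed.\<close>

locale observed_hmm = hmm \<Theta> lam mu m g \<phi> \<psi> S \<sigma>m \<sigma>p + prob_space P
  for \<Theta> :: "'p::euclidean_space set" and lam :: "'x measure" and mu :: "'y measure"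
    and m g \<phi> and \<psi> :: "'p \<Rightarrow> 'v::euclidean_space" and S \<sigma>m \<sigma>p and P :: "'w measure" +
  fixes Y :: "int \<Rightarrow> 'w \<Rightarrow> 'y" and pbar p C0 \<beta> :: real and chi0 :: "'x measure"
  assumes Y_meas: "\<And>k. Y k \<in> measurable P mu" and stat: "stationary_process P mu Y"
    and mix: "\<And>n. beta_mixing P mu Y n \<le> ennreal (C0 * \<beta> ^ n)" and C0: "0 \<le> C0" and \<beta>: "0 < \<beta>" "\<beta> < 1"
    and env_meas: "(\<lambda>y. SUP (x, x')\<in>UNIV. ennreal (norm (S (x, x', y)) powr pbar)) \<in> borel_measurable mu"
    and env_fin: "(\<integral>\<^sup>+\<omega>. (SUP (x, x')\<in>UNIV. ennreal (norm (S (x, x', Y 0 \<omega>)) powr pbar)) \<partial>P) < \<infinity>"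
    and p: "2 < p" "p < pbar" and chi0: "prob_on lam chi0"
begin

definition env :: "'y \<Rightarrow> ennreal" where "env y = (SUP (x, x')\<in>UNIV. ennreal (norm (S (x, x', y)) powr pbar))"

text \<open>\<open>enn2real\<close> sends \<infinity> to 0, so \<open>V k\<close> dominates
  \<open>S\<close> only where the envelope is finite. \<open>\<Omega>0\<close> is the event, of full
  probability, on which this holds at all times.\<close>

definition V :: "int \<Rightarrow> 'w \<Rightarrow> real" where "V k \<omega> = enn2real (env (Y k \<omega>)) powr (1 / pbar)"

definition \<Omega>0 :: "'w set" where "\<Omega>0 = {\<omega> \<in> space P. \<forall>k. env (Y k \<omega>) < \<infinity>}"

lemma env_measurable: "env \<in> borel_measurable mu" using env_meas by (simp add: env_def[abs_def])

lemma S_le_V: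
  assumes "env (Y k \<omega>) < \<infinity>" shows "norm (S (x, x', Y k \<omega>)) \<le> V k \<omega>"
proof -
  have "ennreal (norm (S (x, x', Y k \<omega>)) powr pbar) \<le> env (Y k \<omega>)"
    unfolding env_def by (rule SUP_upper2[of "(x, x')"]) auto
  also have "env (Y k \<omega>) = ennreal (enn2real (env (Y k \<omega>)))" using assms by simp
  finally have "norm (S (x, x', Y k \<omega>)) powr pbar \<le> enn2real (env (Y k \<omega>))" by simp
  then have "(norm (S (x, x', Y k \<omega>)) powr pbar) powr (1 / pbar) \<le> V k \<omega>"
    unfolding V_def using p by (intro powr_mono2) auto
  then show ?thesis using p by (simp add: powr_powr)
qed

lemma V_nonneg: "0 \<le> V k \<omega>" by (simp add: V_def)

lemma good_\<Omega>0: "\<omega> \<in> \<Omega>0 \<Longrightarrow> good (\<lambda>k. Y k \<omega>)"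
  unfolding good_def \<Omega>0_def using S_le_V by blast

lemma S_le_V_\<Omega>0: "\<omega> \<in> \<Omega>0 \<Longrightarrow> norm (S (x, x', Y k \<omega>)) \<le> V k \<omega>"
  by (rule S_le_V) (simp add: \<Omega>0_def)

lemma path_measurable: "(\<lambda>\<omega> k. Y (k + d) \<omega>) \<in> measurable P (PiM UNIV (\<lambda>_. mu))"
proof (rule measurable_PiM_single')
  fix k :: int show "Y (k + d) \<in> measurable P mu" by (rule Y_meas)
next
  show "(\<lambda>\<omega> k. Y (k + d) \<omega>) \<in> space P \<rightarrow> (\<Pi>\<^sub>E i\<in>UNIV. space mu)" by (simp add: sp_mu)
qed

lemma stationary_nn_integral:
  assumes F: "F \<in> borel_measurable (PiM UNIV (\<lambda>_. mu))"
  shows "(\<integral>\<^sup>+\<omega>. F (\<lambda>k. Y (k + d) \<omega>) \<partial>P) = (\<integral>\<^sup>+\<omega>. F (\<lambda>k. Y k \<omega>) \<partial>P)"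
  using stat F nn_integral_distr[OF path_measurable[of d], of F] nn_integral_distr[OF path_measurable[of 0], of F]
  unfolding stationary_process_def by simp

lemma stationary_integral:
  fixes F :: "(int \<Rightarrow> 'y) \<Rightarrow> real"
  assumes F: "F \<in> borel_measurable (PiM UNIV (\<lambda>_. mu))"
  shows "(\<integral>\<omega>. F (\<lambda>k. Y (k + d) \<omega>) \<partial>P) = (\<integral>\<omega>. F (\<lambda>k. Y k \<omega>) \<partial>P)"
  using stat integral_distr[OF path_measurable[of d] F] integral_distr[OF path_measurable[of 0] F]
  unfolding stationary_process_def by simp

lemma env_nn_integral: "(\<integral>\<^sup>+\<omega>. env (Y k \<omega>) \<partial>P) = (\<integral>\<^sup>+\<omega>. env (Y 0 \<omega>) \<partial>P)"
proof -
  have "(\<lambda>y. env (y 0)) \<in> borel_measurable (PiM (UNIV :: int set) (\<lambda>_. mu))"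
    by (rule measurable_compose[OF measurable_component_singleton[of 0 UNIV "\<lambda>_. mu"] env_measurable]) simp
  from stationary_nn_integral[OF this, of k] show ?thesis by simp
qed

lemma env_Y_measurable: "(\<lambda>\<omega>. env (Y k \<omega>)) \<in> borel_measurable P"
  by (rule measurable_compose[OF Y_meas env_measurable])

lemma \<Omega>0_sets: "\<Omega>0 \<in> sets P"
  unfolding \<Omega>0_def using env_Y_measurable by measurable

lemma AE_\<Omega>0: "AE \<omega> in P. \<omega> \<in> \<Omega>0"
proof -
  have "AE \<omega> in P. env (Y k \<omega>) \<noteq> \<infinity>" for k
    by (rule nn_integral_noteq_infinite[OF env_Y_measurable])
      (use env_fin env_nn_integral[of k] in \<open>simp add: env_def[symmetric] less_top\<close>)
  then have "AE \<omega> in P. \<forall>k. env (Y k \<omega>) \<noteq> \<infinity>" by (simp add: AE_all_countable)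
  then show ?thesis using AE_space by eventually_elim (auto simp: \<Omega>0_def less_top)
qed

text \<open>By stationarity one bound serves the envelope at all times; the added 1 keeps it
  positive.\<close>

definition v :: real where "v = enn2real (\<integral>\<^sup>+\<omega>. env (Y 0 \<omega>) \<partial>P) powr (1 / pbar) + 1"

lemma v_pos: "1 \<le> v" by (simp add: v_def)

lemma V_measurable_obs:
  assumes "k \<in> K" shows "V k \<in> borel_measurable (sigma_obs P mu Y K)"
proof -
  have "Y k \<in> measurable (sigma_obs P mu Y K) mu" by (rule measurable_sigma_obs[OF assms]) (simp add: sp_mu)
  from measurable_compose[OF this env_measurable] show ?thesis unfolding V_def[abs_def] by measurable
qed

lemma V_measurable: "V k \<in> borel_measurable P"
  using env_Y_measurable unfolding V_def[abs_def] by measurable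

lemma V_Lp: "Lp_le P pbar (V k) v"
proof -
  have fin: "(\<integral>\<^sup>+\<omega>. env (Y 0 \<omega>) \<partial>P) < \<infinity>" using env_fin by (simp add: env_def)
  have "(\<integral>\<^sup>+\<omega>. ennreal (\<bar>V k \<omega>\<bar> powr pbar) \<partial>P) \<le> (\<integral>\<^sup>+\<omega>. env (Y k \<omega>) \<partial>P)"
  proof (rule nn_integral_mono)
    fix \<omega>
    have "ennreal (\<bar>V k \<omega>\<bar> powr pbar) = ennreal (enn2real (env (Y k \<omega>)))"
      using p by (simp add: V_def powr_powr)
    also have "\<dots> \<le> env (Y k \<omega>)" by (simp add: ennreal_enn2real_if)
    finally show "ennreal (\<bar>V k \<omega>\<bar> powr pbar) \<le> env (Y k \<omega>)" .
  qed
  also have "\<dots> = ennreal (enn2real (\<integral>\<^sup>+\<omega>. env (Y 0 \<omega>) \<partial>P))" unfolding env_nn_integral[of k] using fin by simp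
  also have "\<dots> = ennreal ((enn2real (\<integral>\<^sup>+\<omega>. env (Y 0 \<omega>) \<partial>P) powr (1 / pbar)) powr pbar)" using p by (simp add: powr_powr)
  also have "\<dots> \<le> ennreal (v powr pbar)" using p by (intro ennreal_leI powr_mono2) (auto simp: v_def)
  finally show ?thesis using V_measurable v_pos by (auto simp: Lp_le_def)
qed

lemma V_integrable: "integrable P (V k)"
  by (rule Lp_le_1_integrable[OF V_Lp]) (use p in auto)

text \<open>Jensen's inequality with exponent pbar / p, applied to the p-th power.\<close>

lemma Lp_le_mono_exponent:
  assumes "Lp_le P pbar f w" shows "Lp_le P p f w"
proof -
  note [measurable] = Lp_leD(1)[OF assms]
  have "\<bar>\<bar>f x\<bar> powr p\<bar> powr (pbar / p) = \<bar>f x\<bar> powr pbar" for x using p by (simp add: powr_powr)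
  then have "Lp_le P (pbar / p) (\<lambda>x. \<bar>f x\<bar> powr p) (w powr p)"
    using assms p by (auto simp: Lp_le_def powr_powr)
  then have "Lp_le P (pbar / p) (\<lambda>_. expectation (\<lambda>x. \<bar>f x\<bar> powr p)) (w powr p)" and i: "integrable P (\<lambda>x. \<bar>f x\<bar> powr p)"
    using p by (auto intro: Lp_le_expectation Lp_le_1_integrable)
  then have "\<bar>expectation (\<lambda>x. \<bar>f x\<bar> powr p)\<bar> powr (pbar / p) \<le> (w powr p) powr (pbar / p)"
    using Lp_le_integrable(2) by (fastforce simp: prob_space)
  moreover have "0 \<le> expectation (\<lambda>x. \<bar>f x\<bar> powr p)" by (rule Bochner_Integration.integral_nonneg) simp
  ultimately have "expectation (\<lambda>x. \<bar>f x\<bar> powr p) \<le> w powr p"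
    using powr_less_mono2[of "pbar / p" "w powr p" "expectation (\<lambda>x. \<bar>f x\<bar> powr p)"] p by (force simp: not_less[symmetric])
  then show ?thesis using i Lp_leD(1,2)[OF assms] by (intro Lp_leI_integral) auto
qed

lemma V_Lp_p: "Lp_le P p (V k) v" by (rule Lp_le_mono_exponent[OF V_Lp])

text \<open>Conditional expectations are available for real functions, so the vector statistic is
  handled through its inner products with vectors of norm at most 1.\<close>

definition dir_fun :: "'v \<Rightarrow> 'x \<times> 'x \<times> 'y \<Rightarrow> real" where "dir_fun b z = inner (S z) b"

lemma test_fun_dir: "test_fun (dir_fun b)"
  unfolding test_fun_def dir_fun_def[abs_def] using S_meas by measurable

lemma dir_fun_le:
  assumes "\<omega> \<in> \<Omega>0" "norm b \<le> 1" shows "\<bar>dir_fun b (x, x', Y s \<omega>)\<bar> \<le> V s \<omega>"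
proof -
  have "\<bar>dir_fun b (x, x', Y s \<omega>)\<bar> \<le> norm (S (x, x', Y s \<omega>)) * norm b"
    unfolding dir_fun_def by (rule Cauchy_Schwarz_ineq2)
  also have "\<dots> \<le> norm (S (x, x', Y s \<omega>)) * 1" using assms(2) by (intro mult_left_mono) auto
  also have "\<dots> \<le> V s \<omega>" using S_le_V_\<Omega>0[OF assms(1)] by simp
  finally show ?thesis .
qed

definition Phi :: "'v \<Rightarrow> 'x measure \<Rightarrow> int \<Rightarrow> 'p \<Rightarrow> int \<Rightarrow> int \<Rightarrow> 'w \<Rightarrow> real" where
  "Phi b chi r u s t \<omega> = smoothing m g lam chi r u s t (dir_fun b) (\<lambda>k. Y k \<omega>)"

lemma Phi_inner:
  assumes "u \<in> \<Theta>" "prob_on lam chi" "r < s" "s \<le> t" "\<omega> \<in> \<Omega>0"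
  shows "inner (smoothing m g lam chi r u s t S (\<lambda>k. Y k \<omega>)) b = Phi b chi r u s t \<omega>"
  using smoothing_inner[OF assms(1-4) good_\<Omega>0[OF assms(5)], of b] by (simp add: Phi_def dir_fun_def[abs_def])

lemma Phi_measurable_obs:
  assumes "u \<in> \<Theta>" "prob_on lam chi" "r < s" "s \<le> t" "{r + 1..t} \<subseteq> K"
  shows "Phi b chi r u s t \<in> borel_measurable (sigma_obs P mu Y K)"
  unfolding Phi_def[abs_def]
  by (rule smoothing_measurable[OF assms(1-4)])
    (use assms(5) test_fun_dir in \<open>auto simp: test_fun_def sp_mu intro!: measurable_sigma_obs\<close>)

lemma Phi_measurable:
  assumes "u \<in> \<Theta>" "prob_on lam chi" "r < s" "s \<le> t"
  shows "Phi b chi r u s t \<in> borel_measurable P"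
  unfolding Phi_def[abs_def]
  by (rule smoothing_measurable[OF assms(1-4)]) (use Y_meas test_fun_dir in \<open>auto simp: test_fun_def\<close>)

lemma Phi_le:
  assumes "u \<in> \<Theta>" "prob_on lam chi" "r < s" "s \<le> t" "\<omega> \<in> \<Omega>0" "norm b \<le> 1"
  shows "\<bar>Phi b chi r u s t \<omega>\<bar> \<le> V s \<omega>"
  unfolding Phi_def by (rule smoothing_abs_le[OF assms(1) good_\<Omega>0[OF assms(5)] test_fun_dir dir_fun_le[OF assms(5,6)] assms(2-4)])

lemma Phi_integrable:
  assumes "u \<in> \<Theta>" "prob_on lam chi" "r < s" "s \<le> t" "norm b \<le> 1"
  shows "integrable P (Phi b chi r u s t)"
proof (rule Bochner_Integration.integrable_bound[OF V_integrable[of s] Phi_measurable[OF assms(1-4)]])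
  show "AE \<omega> in P. norm (Phi b chi r u s t \<omega>) \<le> norm (V s \<omega>)"
    using AE_\<Omega>0 by eventually_elim (use Phi_le[OF assms(1-4) _ assms(5)] V_nonneg in simp)
qed

lemma Phi_past:
  assumes "u \<in> \<Theta>" "prob_on lam chi" "prob_on lam chi'" "r \<le> r0" "r' \<le> r0" "r0 < s" "s \<le> t" "\<omega> \<in> \<Omega>0" "norm b \<le> 1"
  shows "\<bar>Phi b chi r u s t \<omega> - Phi b chi' r' u s t \<omega>\<bar> \<le> K0 * V s \<omega> * \<rho> ^ nat (s - 1 - r0)"
  unfolding Phi_def by (rule smoothing_past[OF assms(1) good_\<Omega>0[OF assms(8)] test_fun_dir dir_fun_le[OF assms(8,9)] assms(2-7)])

lemma Phi_future:
  assumes "u \<in> \<Theta>" "prob_on lam chi" "r < s" "s \<le> t" "t \<le> t'" "\<omega> \<in> \<Omega>0" "norm b \<le> 1"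
  shows "\<bar>Phi b chi r u s t' \<omega> - Phi b chi r u s t \<omega>\<bar> \<le> K0 * V s \<omega> * \<rho> ^ nat (t - s)"
  unfolding Phi_def by (rule smoothing_future[OF assms(1) good_\<Omega>0[OF assms(6)] test_fun_dir dir_fun_le[OF assms(6,7)] assms(2-5)])

lemma Phi_two_sided:
  assumes "u \<in> \<Theta>" "prob_on lam chi" "prob_on lam chi'" "r' \<le> r" "r < s" "s \<le> t" "t \<le> t'" "\<omega> \<in> \<Omega>0" "norm b \<le> 1"
  shows "\<bar>Phi b chi r u s t \<omega> - Phi b chi' r' u s t' \<omega>\<bar> \<le> K0 * V s \<omega> * (\<rho> ^ nat (s - 1 - r) + \<rho> ^ nat (t - s))"
  unfolding Phi_def by (rule smoothing_two_sided[OF assms(1) good_\<Omega>0[OF assms(8)] test_fun_dir dir_fun_le[OF assms(8,9)] assms(2-7)])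

text \<open>Smoothing commutes with a shift of the observation sequence, and stationarity removes
  that shift under the expectation.\<close>

lemma Phi_expectation_shift:
  assumes u: "u \<in> \<Theta>" and chi: "prob_on lam chi" "r < s" "s \<le> t" and b: "norm b \<le> 1"
  shows "expectation (Phi b chi (r + d) u (s + d) (t + d)) = expectation (Phi b chi r u s t)"
proof -
  let ?F = "\<lambda>y. smoothing m g lam chi r u s t (dir_fun b) y"
  have F: "?F \<in> borel_measurable (PiM UNIV (\<lambda>_. mu))"
    using smoothing_measurable[OF u chi, where N = "PiM UNIV (\<lambda>_. mu)" and Y = "\<lambda>k y. y k" and f = "dir_fun b"] test_fun_dir
    by (simp add: test_fun_def measurable_component_singleton)
  have "expectation (Phi b chi (r + d) u (s + d) (t + d)) = (\<integral>\<omega>. ?F (\<lambda>k. Y (k + d) \<omega>) \<partial>P)"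
  proof (rule integral_cong_AE)
    show "Phi b chi (r + d) u (s + d) (t + d) \<in> borel_measurable P" by (rule Phi_measurable[OF u chi(1)]) (use chi in auto)
    show "(\<lambda>\<omega>. ?F (\<lambda>k. Y (k + d) \<omega>)) \<in> borel_measurable P" by (rule measurable_compose[OF path_measurable F])
    show "AE \<omega> in P. Phi b chi (r + d) u (s + d) (t + d) \<omega> = ?F (\<lambda>k. Y (k + d) \<omega>)"
      using AE_\<Omega>0
    proof eventually_elim
      case (elim \<omega>)
      show ?case unfolding Phi_def
        by (rule smoothing_shift[OF u good_\<Omega>0[OF elim] test_fun_dir dir_fun_le[OF elim b] chi])
    qed
  qed
  also have "\<dots> = (\<integral>\<omega>. ?F (\<lambda>k. Y k \<omega>) \<partial>P)" by (rule stationary_integral[OF F])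
  finally show ?thesis by (simp add: Phi_def[abs_def])
qed

end

lemma (in prob_space) Lp_le_constD:
  assumes "Lp_le M p (\<lambda>_. c) w" "0 < p" shows "\<bar>c\<bar> \<le> w"
proof -
  have "ennreal (\<bar>c\<bar> powr p) \<le> ennreal (w powr p)" using Lp_leD(3)[OF assms(1)] by (simp add: emeasure_space_1)
  then have "\<bar>c\<bar> powr p \<le> w powr p" by (simp add: ennreal_le_iff)
  then show ?thesis using powr_less_mono2[of p w "\<bar>c\<bar>"] Lp_leD(2)[OF assms(1)] assms(2) by (force simp: not_less[symmetric])
qed

section \<open>The limiting statistic and its mean\<close>

context observed_hmm
begin

lemma expectation_V_le: "expectation (V k) \<le> v"
  using Lp_le_constD[OF Lp_le_expectation[OF V_Lp_p[of k]]] p by auto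

abbreviation two_sided :: "'x measure \<Rightarrow> 'p \<Rightarrow> nat \<Rightarrow> 'w \<Rightarrow> 'v" where
  "two_sided chi u \<tau> \<omega> \<equiv> smoothing m g lam chi (- int \<tau> - 1) u 0 (int \<tau>) S (\<lambda>k. Y k \<omega>)"

lemma two_sided_inner:
  assumes "u \<in> \<Theta>" "prob_on lam chi" "\<omega> \<in> \<Omega>0"
  shows "inner (two_sided chi u \<tau> \<omega>) b = Phi b chi (- int \<tau> - 1) u 0 (int \<tau>) \<omega>"
  by (rule Phi_inner[OF assms(1,2) _ _ assms(3)]) auto

lemma two_sided_diff:
  assumes "u \<in> \<Theta>" "prob_on lam chi" "prob_on lam chi'" "\<omega> \<in> \<Omega>0" "norm b \<le> 1" "\<tau> \<le> \<tau>'"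
  shows "\<bar>inner (two_sided chi u \<tau> \<omega>) b - inner (two_sided chi' u \<tau>' \<omega>) b\<bar> \<le> K0 * V 0 \<omega> * (2 * \<rho> ^ \<tau>)"
proof -
  have "\<bar>Phi b chi (- int \<tau> - 1) u 0 (int \<tau>) \<omega> - Phi b chi' (- int \<tau>' - 1) u 0 (int \<tau>') \<omega>\<bar>
     \<le> K0 * V 0 \<omega> * (\<rho> ^ nat (0 - 1 - (- int \<tau> - 1)) + \<rho> ^ nat (int \<tau> - 0))"
    by (rule Phi_two_sided[OF assms(1-3) _ _ _ _ assms(4,5)]) (use assms(6) in auto)
  then show ?thesis by (simp add: two_sided_inner[OF assms(1,2,4)] two_sided_inner[OF assms(1,3,4)])
qed

lemma two_sided_rate_tendsto: "(\<lambda>\<tau>. K0 * V 0 \<omega> * (2 * \<rho> ^ \<tau>)) \<longlonglongrightarrow> 0"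
proof -
  have "(\<lambda>\<tau>. K0 * V 0 \<omega> * (2 * \<rho> ^ \<tau>)) \<longlonglongrightarrow> K0 * V 0 \<omega> * (2 * 0)"
    using \<rho>_bounds by (intro tendsto_mult tendsto_const LIMSEQ_power_zero) auto
  then show ?thesis by simp
qed

text \<open>Widening the window changes each coordinate by a geometrically small amount, so the
  sequence is Cauchy at every point of \<open>\<Omega>0\<close>. A change of the initial law costs
  the same amount, which forces a common limit.\<close>

lemma two_sided_converges:
  assumes u: "u \<in> \<Theta>" and \<omega>: "\<omega> \<in> \<Omega>0"
  shows "\<exists>l. \<forall>chi. prob_on lam chi \<longrightarrow> (\<lambda>\<tau>. two_sided chi u \<tau> \<omega>) \<longlonglongrightarrow> l"
proof -
  have "convergent (\<lambda>\<tau>. inner (two_sided chi0 u \<tau> \<omega>) b)" if b: "b \<in> Basis" for b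
  proof (rule Cauchy_convergent, rule metric_CauchyI)
    fix e :: real assume "0 < e"
    then have "eventually (\<lambda>\<tau>. K0 * V 0 \<omega> * (2 * \<rho> ^ \<tau>) < e) sequentially"
      using order_tendstoD(2)[OF two_sided_rate_tendsto[of \<omega>]] by simp
    then obtain N where N: "\<And>\<tau>. N \<le> \<tau> \<Longrightarrow> K0 * V 0 \<omega> * (2 * \<rho> ^ \<tau>) < e" by (auto simp: eventually_sequentially)
    have *: "dist (inner (two_sided chi0 u j \<omega>) b) (inner (two_sided chi0 u k \<omega>) b) < e" if "N \<le> j" "j \<le> k" for j k
      using two_sided_diff[OF u chi0 chi0 \<omega> _ that(2), of b] N[OF that(1)] b by (simp add: dist_real_def)
    show "\<exists>M. \<forall>j\<ge>M. \<forall>k\<ge>M. dist (inner (two_sided chi0 u j \<omega>) b) (inner (two_sided chi0 u k \<omega>) b) < e"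
    proof (intro exI[of _ N] allI impI)
      fix j k assume "N \<le> j" "N \<le> k"
      then show "dist (inner (two_sided chi0 u j \<omega>) b) (inner (two_sided chi0 u k \<omega>) b) < e"
        using *[of j k] *[of k j] by (cases "j \<le> k") (auto simp: dist_commute)
    qed
  qed
  then have "\<forall>b\<in>Basis. \<exists>l. (\<lambda>\<tau>. inner (two_sided chi0 u \<tau> \<omega>) b) \<longlonglongrightarrow> l" by (auto simp: convergent_def)
  from bchoice[OF this] obtain l where "\<forall>b\<in>Basis. (\<lambda>\<tau>. inner (two_sided chi0 u \<tau> \<omega>) b) \<longlonglongrightarrow> l b" ..
  then have l: "(\<lambda>\<tau>. inner (two_sided chi0 u \<tau> \<omega>) b) \<longlonglongrightarrow> l b" if "b \<in> Basis" for b using that by (rule bspec)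
  define L where "L = (\<Sum>b\<in>Basis. l b *\<^sub>R b)"
  show ?thesis
  proof (intro exI[of _ L] allI impI)
    fix chi assume chi: "prob_on lam chi"
    show "(\<lambda>\<tau>. two_sided chi u \<tau> \<omega>) \<longlonglongrightarrow> L"
    proof (subst tendsto_componentwise_iff, rule ballI)
      fix b :: 'v assume b: "b \<in> Basis"
      have "(\<lambda>\<tau>. inner (two_sided chi u \<tau> \<omega>) b - inner (two_sided chi0 u \<tau> \<omega>) b) \<longlonglongrightarrow> 0"
      proof (rule Lim_null_comparison[OF _ two_sided_rate_tendsto[of \<omega>]])
        show "\<forall>\<^sub>F \<tau> in sequentially. norm (inner (two_sided chi u \<tau> \<omega>) b - inner (two_sided chi0 u \<tau> \<omega>) b) \<le> K0 * V 0 \<omega> * (2 * \<rho> ^ \<tau>)"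
          using two_sided_diff[OF u chi chi0 \<omega>, of b] b by auto
      qed
      from tendsto_add[OF this l[OF b]] show "(\<lambda>\<tau>. inner (two_sided chi u \<tau> \<omega>) b) \<longlonglongrightarrow> inner L b"
        using b by (simp add: L_def inner_sum_left_Basis)
    qed
  qed
qed

lemma two_sided_measurable:
  assumes "u \<in> \<Theta>" "prob_on lam chi" shows "two_sided chi u \<tau> \<in> borel_measurable P"
  by (rule smoothing_measurable[OF assms]) (use Y_meas S_meas in auto)

abbreviation "lim_stat u \<equiv> limit_statistic m g lam S P Y u"
abbreviation "mean_stat u \<equiv> mean_statistic m g lam S P Y u"

text \<open>The pointwise limit along \<open>chi0\<close> is a measurable witness for the choice in
  \<open>limit_statistic\<close>, so the chosen variable has the required properties.\<close>

lemma limit_statistic_props: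
  assumes u: "u \<in> \<Theta>"
  shows "lim_stat u \<in> borel_measurable P"
    "\<And>chi. prob_on lam chi \<Longrightarrow> AE \<omega> in P. (\<lambda>\<tau>. two_sided chi u \<tau> \<omega>) \<longlonglongrightarrow> lim_stat u \<omega>"
proof -
  let ?Q = "\<lambda>Z. Z \<in> borel_measurable P \<and> (\<forall>chi. prob_on lam chi \<longrightarrow> (AE \<omega> in P. (\<lambda>\<tau>. two_sided chi u \<tau> \<omega>) \<longlonglongrightarrow> Z \<omega>))"
  have "?Q (\<lambda>\<omega>. lim (\<lambda>\<tau>. two_sided chi0 u \<tau> \<omega>))"
  proof (intro conjI allI impI)
    show "(\<lambda>\<omega>. lim (\<lambda>\<tau>. two_sided chi0 u \<tau> \<omega>)) \<in> borel_measurable P"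
      using two_sided_measurable[OF u chi0] by (intro borel_measurable_lim_metric) auto
    fix chi assume chi: "prob_on lam chi"
    show "AE \<omega> in P. (\<lambda>\<tau>. two_sided chi u \<tau> \<omega>) \<longlonglongrightarrow> lim (\<lambda>\<tau>. two_sided chi0 u \<tau> \<omega>)"
      using AE_\<Omega>0
    proof eventually_elim
      case (elim \<omega>)
      obtain l where l: "\<And>chi. prob_on lam chi \<Longrightarrow> (\<lambda>\<tau>. two_sided chi u \<tau> \<omega>) \<longlonglongrightarrow> l"
        using two_sided_converges[OF u elim] by blast
      show ?case using l[OF chi] limI[OF l[OF chi0]] by simp
    qed
  qed
  then have "?Q (lim_stat u)" unfolding limit_statistic_def by (rule someI[of ?Q])
  then show "lim_stat u \<in> borel_measurable P"
    "\<And>chi. prob_on lam chi \<Longrightarrow> AE \<omega> in P. (\<lambda>\<tau>. two_sided chi u \<tau> \<omega>) \<longlonglongrightarrow> lim_stat u \<omega>" by auto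
qed

lemma lim_stat_integrable:
  assumes u: "u \<in> \<Theta>" shows "integrable P (lim_stat u)"
proof (rule Bochner_Integration.integrable_bound[of P "\<lambda>\<omega>. real DIM('v) * V 0 \<omega>"])
  show "integrable P (\<lambda>\<omega>. real DIM('v) * V 0 \<omega>)" using V_integrable by auto
  show "lim_stat u \<in> borel_measurable P" by (rule limit_statistic_props[OF u])
  show "AE \<omega> in P. norm (lim_stat u \<omega>) \<le> norm (real DIM('v) * V 0 \<omega>)"
    using AE_\<Omega>0 limit_statistic_props(2)[OF u chi0]
  proof eventually_elim
    case (elim \<omega>)
    have "\<bar>inner (lim_stat u \<omega>) b\<bar> \<le> V 0 \<omega>" if b: "b \<in> Basis" for b
    proof (rule LIMSEQ_le_const2)
      show "(\<lambda>\<tau>. \<bar>inner (two_sided chi0 u \<tau> \<omega>) b\<bar>) \<longlonglongrightarrow> \<bar>inner (lim_stat u \<omega>) b\<bar>"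
        by (intro tendsto_intros elim)
      show "\<exists>N. \<forall>\<tau>\<ge>N. \<bar>inner (two_sided chi0 u \<tau> \<omega>) b\<bar> \<le> V 0 \<omega>"
        using Phi_le[OF u chi0 _ _ elim(1), of "- int \<tau> - 1" 0 "int \<tau>" b for \<tau>] b
        by (auto simp: two_sided_inner[OF u chi0 elim(1)])
    qed
    then have "(\<Sum>b\<in>Basis. \<bar>inner (lim_stat u \<omega>) b\<bar>) \<le> (\<Sum>b\<in>(Basis :: 'v set). V 0 \<omega>)" by (rule sum_mono)
    then show ?case using norm_le_l1[of "lim_stat u \<omega>"] V_nonneg[of 0 \<omega>] by simp
  qed
qed

lemma mean_statistic_limit:
  assumes u: "u \<in> \<Theta>" and b: "norm b \<le> 1"
  shows "(\<lambda>\<tau>. expectation (Phi b chi0 (- int \<tau> - 1) u 0 (int \<tau>))) \<longlonglongrightarrow> inner (mean_stat u) b"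
proof -
  have "(\<lambda>\<tau>. expectation (Phi b chi0 (- int \<tau> - 1) u 0 (int \<tau>))) \<longlonglongrightarrow> expectation (\<lambda>\<omega>. inner (lim_stat u \<omega>) b)"
  proof (rule integral_dominated_convergence[where w = "V 0"])
    show "(\<lambda>\<omega>. inner (lim_stat u \<omega>) b) \<in> borel_measurable P" using limit_statistic_props(1)[OF u] by measurable
    show "Phi b chi0 (- int \<tau> - 1) u 0 (int \<tau>) \<in> borel_measurable P" for \<tau> by (rule Phi_measurable[OF u chi0]) auto
    show "integrable P (V 0)" by (rule V_integrable)
    show "AE \<omega> in P. (\<lambda>\<tau>. Phi b chi0 (- int \<tau> - 1) u 0 (int \<tau>) \<omega>) \<longlonglongrightarrow> inner (lim_stat u \<omega>) b"
      using AE_\<Omega>0 limit_statistic_props(2)[OF u chi0]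
    proof eventually_elim
      case (elim \<omega>)
      show ?case unfolding two_sided_inner[OF u chi0 elim(1), symmetric] by (intro tendsto_intros elim)
    qed
    show "AE \<omega> in P. norm (Phi b chi0 (- int \<tau> - 1) u 0 (int \<tau>) \<omega>) \<le> V 0 \<omega>" for \<tau>
      using AE_\<Omega>0 by eventually_elim (use Phi_le[OF u chi0 _ _ _ b] in auto)
  qed
  also have "expectation (\<lambda>\<omega>. inner (lim_stat u \<omega>) b) = inner (mean_stat u) b"
    unfolding mean_statistic_def by (rule integral_inner_left) (rule lim_stat_integrable[OF u])
  finally show ?thesis .
qed

text \<open>Moved to time \<open>s\<close>, the two-sided window that defines the mean statistic
  eventually contains the times from \<open>r\<close> to \<open>t\<close>. Two-sided forgetting
  compares the two statistics, and stationarity keeps the expectation unchanged under the move. The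
  bias of a term is thus small away from both ends of its block.\<close>

lemma Phi_expectation_mean:
  assumes u: "u \<in> \<Theta>" and chi: "prob_on lam chi" and rst: "r < s" "s \<le> t" and b: "norm b \<le> 1"
  shows "\<bar>expectation (Phi b chi r u s t) - inner (mean_stat u) b\<bar> \<le> K0 * v * (\<rho> ^ nat (s - 1 - r) + \<rho> ^ nat (t - s))"
proof (rule LIMSEQ_le_const2)
  show "(\<lambda>\<tau>. \<bar>expectation (Phi b chi r u s t) - expectation (Phi b chi0 (- int \<tau> - 1) u 0 (int \<tau>))\<bar>) \<longlonglongrightarrow> \<bar>expectation (Phi b chi r u s t) - inner (mean_stat u) b\<bar>"
    by (intro tendsto_intros mean_statistic_limit[OF u b])
  show "\<exists>N. \<forall>\<tau>\<ge>N. \<bar>expectation (Phi b chi r u s t) - expectation (Phi b chi0 (- int \<tau> - 1) u 0 (int \<tau>))\<bar> \<le> K0 * v * (\<rho> ^ nat (s - 1 - r) + \<rho> ^ nat (t - s))"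
  \<comment> \<open>Large enough for the window around \<open>s\<close> to reach from
    \<open>r\<close> or earlier to \<open>t\<close> or later.\<close>
  proof (intro exI[of _ "nat (t - s) + nat (s - r)"] allI impI)
    fix \<tau> :: nat assume "nat (t - s) + nat (s - r) \<le> \<tau>"
    then have \<tau>: "- int \<tau> - 1 + s \<le> r" "t \<le> int \<tau> + s" by auto
    let ?A = "Phi b chi r u s t" and ?B = "Phi b chi0 (- int \<tau> - 1 + s) u (0 + s) (int \<tau> + s)"
    let ?c = "\<rho> ^ nat (s - 1 - r) + \<rho> ^ nat (t - s)"
    have iA: "integrable P ?A" by (rule Phi_integrable[OF u chi rst b])
    have iB: "integrable P ?B" by (rule Phi_integrable[OF u chi0 _ _ b]) auto
    have "expectation (Phi b chi0 (- int \<tau> - 1) u 0 (int \<tau>)) = expectation ?B"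
      by (rule Phi_expectation_shift[OF u chi0 _ _ b, symmetric]) auto
    then have "\<bar>expectation ?A - expectation (Phi b chi0 (- int \<tau> - 1) u 0 (int \<tau>))\<bar> = \<bar>expectation (\<lambda>\<omega>. ?A \<omega> - ?B \<omega>)\<bar>"
      using iA iB by simp
    also have "\<dots> \<le> expectation (\<lambda>\<omega>. \<bar>?A \<omega> - ?B \<omega>\<bar>)" by (rule integral_abs_bound)
    also have "\<dots> \<le> expectation (\<lambda>\<omega>. K0 * ?c * V s \<omega>)"
    proof (rule integral_mono_AE)
      show "integrable P (\<lambda>\<omega>. \<bar>?A \<omega> - ?B \<omega>\<bar>)" using iA iB by auto
      show "integrable P (\<lambda>\<omega>. K0 * ?c * V s \<omega>)" using V_integrable by auto
      show "AE \<omega> in P. \<bar>?A \<omega> - ?B \<omega>\<bar> \<le> K0 * ?c * V s \<omega>" using AE_\<Omega>0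
      proof eventually_elim
        case (elim \<omega>)
        have "\<bar>?A \<omega> - ?B \<omega>\<bar> \<le> K0 * V s \<omega> * ?c"
          using Phi_two_sided[OF u chi chi0 \<tau>(1) rst \<tau>(2) elim b] by simp
        then show ?case by (simp add: mult_ac)
      qed
    qed
    also have "\<dots> = K0 * ?c * expectation (V s)" by simp
    also have "\<dots> \<le> K0 * ?c * v" using K0_ge \<rho>_bounds expectation_V_le by (intro mult_left_mono) auto
    finally show "\<bar>expectation ?A - expectation (Phi b chi0 (- int \<tau> - 1) u 0 (int \<tau>))\<bar> \<le> K0 * v * ?c" by (simp add: mult_ac)
  qed
qed

text \<open>The noise stays fixed at \<open>Hm\<close> while \<open>k\<close> advances through a
  block that starts at time \<open>T\<close>. At k = 0 this is the filtration to which the algorithm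
  is adapted; the later \<sigma>-fields only serve the mixingale argument inside the block.\<close>

definition filt :: "'w measure \<Rightarrow> int \<Rightarrow> nat \<Rightarrow> 'w measure" where
  "filt Hm T k = sigma (space P) (sets (sigma_obs P mu Y {..T + int k}) \<union> sets Hm)"

definition indep_noise :: "'w measure \<Rightarrow> bool" where
  "indep_noise Hm \<longleftrightarrow> subalgebra P Hm \<and> indep_set (sets Hm) (sets (sigma_obs P mu Y UNIV))"

lemma subalgebra_obs: "subalgebra P (sigma_obs P mu Y K)"
  by (rule subalgebra_sigma_obs) (rule Y_meas)

lemma space_filt: "space (filt Hm T k) = space P" by (simp add: filt_def space_measure_of_conv)

lemma sets_filt:
  assumes "indep_noise Hm"
  shows "sets (filt Hm T k) = sigma_sets (space P) (sets (sigma_obs P mu Y {..T + int k}) \<union> sets Hm)"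
  unfolding filt_def
proof (rule sets_measure_of)
  have "sets Hm \<subseteq> sets P" "sets (sigma_obs P mu Y {..T + int k}) \<subseteq> sets P"
    using assms subalgebra_obs[of "{..T + int k}"] by (auto simp: indep_noise_def subalgebra_def)
  then show "sets (sigma_obs P mu Y {..T + int k}) \<union> sets Hm \<subseteq> Pow (space P)" using sets.space_closed by blast
qed

lemma subalgebra_filt:
  assumes "indep_noise Hm" shows "subalgebra P (filt Hm T k)"
proof -
  have "sets Hm \<subseteq> sets P" "sets (sigma_obs P mu Y {..T + int k}) \<subseteq> sets P"
    using assms subalgebra_obs[of "{..T + int k}"] by (auto simp: indep_noise_def subalgebra_def)
  then show ?thesis unfolding subalgebra_def space_filt sets_filt[OF assms]
    using sets.sigma_sets_subset[of "sets (sigma_obs P mu Y {..T + int k}) \<union> sets Hm" P] by simp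
qed

lemma filt_mono:
  assumes "indep_noise Hm" "j \<le> k" shows "sets (filt Hm T j) \<subseteq> sets (filt Hm T k)"
  unfolding sets_filt[OF assms(1)]
  using sets_sigma_obs_mono[of "{..T + int j}" "{..T + int k}" P mu Y] assms(2) by (intro sigma_sets_mono') auto

lemma obs_measurable_filt:
  assumes "indep_noise Hm" "f \<in> borel_measurable (sigma_obs P mu Y K)" "K \<subseteq> {..T + int k}"
  shows "f \<in> borel_measurable (filt Hm T k)"
proof -
  have "sets (sigma_obs P mu Y K) \<subseteq> sets (filt Hm T k)"
    using sets_sigma_obs_mono[OF assms(3), of P mu Y] unfolding sets_filt[OF assms(1)] by (auto intro: sigma_sets.Basic)
  moreover have "space (sigma_obs P mu Y K) = space (filt Hm T k)"
    using subalgebra_obs[of K] by (simp add: space_filt subalgebra_def)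
  ultimately show ?thesis using measurable_mono[of borel borel "sigma_obs P mu Y K" "filt Hm T k"] assms(2) by blast
qed

lemma finite_subalgebra_filt:
  assumes "indep_noise Hm" shows "finite_measure_subalgebra P (filt Hm T k)"
  by (intro finite_measure_subalgebra.intro finite_measure_subalgebra_axioms.intro subalgebra_filt[OF assms] finite_measure_axioms)

text \<open>Independent simulation noise leaves the conditional probabilities of observation events
  unchanged, so the dominating variable for the observations alone also serves the enlarged
  \<sigma>-field.\<close>

lemma filt_mixing:
  assumes H: "indep_noise Hm"
  shows "\<exists>Z. Z \<in> borel_measurable P \<and> (\<forall>x. 0 \<le> Z x \<and> Z x \<le> 1) \<and> (\<integral>\<^sup>+x. ennreal (Z x) \<partial>P) \<le> ennreal (C0 * \<beta> ^ n) \<and>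
    (\<forall>B\<in>sets (sigma_obs P mu Y {T + int k + int n..}). AE x in P. \<bar>real_cond_exp P (filt Hm T k) (indicat_real B) x - prob B\<bar> \<le> Z x)"
proof -
  obtain Z where Z: "Z \<in> borel_measurable P" "\<forall>x. 0 \<le> Z x \<and> Z x \<le> 1" "(\<integral>\<^sup>+x. ennreal (Z x) \<partial>P) \<le> ennreal (C0 * \<beta> ^ n)"
    and dom: "\<And>B. B \<in> sets (sigma_obs P mu Y {T + int k + int n..}) \<Longrightarrow>
       AE x in P. \<bar>real_cond_exp P (sigma_obs P mu Y {..T + int k}) (indicat_real B) x - prob B\<bar> \<le> Z x"
    using beta_mixing_dominating[OF Y_meas mix[of n], of "T + int k"] C0 \<beta> by auto
  have "AE x in P. \<bar>real_cond_exp P (filt Hm T k) (indicat_real B) x - prob B\<bar> \<le> Z x"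
    if B: "B \<in> sets (sigma_obs P mu Y {T + int k + int n..})" for B
  proof -
    have BU: "B \<in> sets (sigma_obs P mu Y UNIV)" using B sets_sigma_obs_mono[of "{T + int k + int n..}" UNIV P mu Y] by auto
    have "AE x in P. real_cond_exp P (sigma (space P) (sets (sigma_obs P mu Y {..T + int k}) \<union> sets Hm)) (indicat_real B) x
        = real_cond_exp P (sigma_obs P mu Y {..T + int k}) (indicat_real B) x"
    proof (rule real_cond_exp_indep_enlarge)
      show "indep_set (sets Hm) (sets (sigma_obs P mu Y UNIV))" "subalgebra P Hm" using H by (auto simp: indep_noise_def)
      show "subalgebra P (sigma_obs P mu Y UNIV)" by (rule subalgebra_obs)
      show "subalgebra (sigma_obs P mu Y UNIV) (sigma_obs P mu Y {..T + int k})"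
        using sets_sigma_obs_mono[of "{..T + int k}" UNIV P mu Y] subalgebra_obs[of UNIV] subalgebra_obs[of "{..T + int k}"]
        by (auto simp: subalgebra_def)
      show "indicat_real B \<in> borel_measurable (sigma_obs P mu Y UNIV)" using BU by simp
      have "B \<in> sets P" using BU subalgebra_obs[of UNIV] by (auto simp: subalgebra_def)
      then show "integrable P (indicat_real B)" by (simp add: integrable_real_indicator less_top[symmetric])
    qed
    with dom[OF B] show ?thesis unfolding filt_def by eventually_elim simp
  qed
  then show ?thesis using Z by blast
qed

end

lemma Lp_le_limit:
  assumes "\<And>n::nat. Lp_le M p (f n) w" "\<And>x. x \<in> space M \<Longrightarrow> (\<lambda>n. f n x) \<longlonglongrightarrow> g x" and p: "0 < p"
  shows "Lp_le M p g w"
proof -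
  have fm: "f n \<in> borel_measurable M" for n using Lp_leD(1)[OF assms(1)] .
  have gm: "g \<in> borel_measurable M" using borel_measurable_LIMSEQ_real[OF assms(2) fm] .
  have "(\<integral>\<^sup>+x. ennreal (\<bar>g x\<bar> powr p) \<partial>M) = (\<integral>\<^sup>+x. liminf (\<lambda>n. ennreal (\<bar>f n x\<bar> powr p)) \<partial>M)"
  proof (rule nn_integral_cong)
    fix x assume "x \<in> space M"
    then have "(\<lambda>n. \<bar>f n x\<bar> powr p) \<longlonglongrightarrow> \<bar>g x\<bar> powr p"
      using p by (intro tendsto_powr' tendsto_rabs assms(2) tendsto_const) auto
    then have "(\<lambda>n. ennreal (\<bar>f n x\<bar> powr p)) \<longlonglongrightarrow> ennreal (\<bar>g x\<bar> powr p)" by (rule tendsto_ennrealI)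
    then show "ennreal (\<bar>g x\<bar> powr p) = liminf (\<lambda>n. ennreal (\<bar>f n x\<bar> powr p))"
      using lim_imp_Liminf[OF sequentially_bot] by metis
  qed
  also have "\<dots> \<le> liminf (\<lambda>n. \<integral>\<^sup>+x. ennreal (\<bar>f n x\<bar> powr p) \<partial>M)"
    by (rule nn_integral_liminf) (use fm in measurable)
  also have "\<dots> \<le> limsup (\<lambda>n. \<integral>\<^sup>+x. ennreal (\<bar>f n x\<bar> powr p) \<partial>M)" by (rule Liminf_le_Limsup) simp
  also have "\<dots> \<le> ennreal (w powr p)"
    by (rule Limsup_bounded) (use Lp_leD(3)[OF assms(1)] in auto)
  finally show ?thesis using gm Lp_leD(2)[OF assms(1)] by (auto simp: Lp_le_def)
qed

text \<open>At each point at most one summand survives, so the bound does not grow with the number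
  of sets.\<close>

lemma disjoint_indicator_sum_abs_le:
  fixes f :: "'i \<Rightarrow> real"
  assumes "finite I" "disjoint_family_on A I" "\<And>i. i \<in> I \<Longrightarrow> \<bar>f i\<bar> \<le> B" "0 \<le> B"
  shows "\<bar>\<Sum>i\<in>I. indicator (A i) x * f i\<bar> \<le> B"
proof (cases "\<exists>i\<in>I. x \<in> A i")
  case True
  then obtain i where i: "i \<in> I" "x \<in> A i" by auto
  have "(\<Sum>j\<in>I. indicator (A j) x * f j) = (\<Sum>j\<in>{i}. indicator (A j) x * f j)"
    using i assms(1,2) by (intro sum.mono_neutral_right) (auto simp: disjoint_family_on_def indicator_def)
  then show ?thesis using i assms(3) by simp
next
  case False
  then have "(\<Sum>i\<in>I. indicator (A i) x * f i) = 0" by (intro sum.neutral) (auto simp: indicator_def)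
  then show ?thesis using assms(4) by simp
qed

section \<open>Fluctuation of a block for parameters with finitely many values\<close>

context observed_hmm
begin

text \<open>The slowest of three geometric rates: mixing across half of the lag after truncation has
  taken its share, decay of the envelope beyond the truncation level, and forgetting across half of
  the lag. The three summands of \<open>fluctuation_const\<close> belong to these in the same
  order.\<close>

definition \<kappa> :: real where
  "\<kappa> = max (\<beta> powr (1 / (4 * p))) (max (\<beta> powr ((pbar - p) / (4 * p * p))) (sqrt \<rho>))"

definition fluctuation_const :: real where "fluctuation_const = 2 * (C0 + 1) + 2 * v powr (pbar / p) + 2 * K0 * v / sqrt \<rho>"

lemma \<kappa>_bounds: "0 < \<kappa>" "\<kappa> < 1" and \<kappa>_ge: "\<beta> powr (1 / (4 * p)) \<le> \<kappa>" "\<beta> powr ((pbar - p) / (4 * p * p)) \<le> \<kappa>" "sqrt \<rho> \<le> \<kappa>"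
proof -
  have lt: "\<beta> powr a < 1" if "0 < a" for a using powr_less_mono2[of a \<beta> 1] that \<beta> by simp
  show "\<kappa> < 1" unfolding \<kappa>_def using p \<rho>_bounds lt[of "1 / (4 * p)"] lt[of "(pbar - p) / (4 * p * p)"] by simp
  show "0 < \<kappa>" unfolding \<kappa>_def using \<beta> by (simp add: less_max_iff_disj)
  show "\<beta> powr (1 / (4 * p)) \<le> \<kappa>" "\<beta> powr ((pbar - p) / (4 * p * p)) \<le> \<kappa>" "sqrt \<rho> \<le> \<kappa>" by (auto simp: \<kappa>_def)
qed

lemma fluctuation_const_pos: "0 < fluctuation_const"
  unfolding fluctuation_const_def using C0 K0_ge v_pos \<rho>_bounds by (intro add_pos_nonneg) auto

text \<open>The truncation level \<open>\<beta> powr (- l / (4 p))\<close> balances the mixing term against the tail of the envelope.\<close>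

lemma past_rate:
  fixes l :: nat
  defines "q \<equiv> l div 2" and "Kl \<equiv> \<beta> powr (- (real l / (4 * p)))"
  shows "2 * Kl * (C0 * \<beta> ^ (l - q)) powr (1 / p) + 2 * (v powr (pbar / p) * Kl powr ((p - pbar) / p)) + K0 * \<rho> ^ q * v + K0 * \<rho> ^ q * v
    \<le> fluctuation_const * \<kappa> ^ l"
proof -
  \<comment> \<open>Mixing over at least l / 2 steps yields \<beta>^(l / (2 p)); the truncation
    level costs \<beta>^(- l / (4 p)), so half of the exponent survives.\<close>
  have a: "2 * Kl * (C0 * \<beta> ^ (l - q)) powr (1 / p) \<le> 2 * (C0 + 1) * \<kappa> ^ l"
  proof -
    have "(C0 * \<beta> ^ (l - q)) powr (1 / p) = C0 powr (1 / p) * (\<beta> ^ (l - q)) powr (1 / p)"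
      using C0 \<beta> by (simp add: powr_mult)
    moreover have "C0 powr (1 / p) \<le> C0 + 1"
    proof (cases "C0 \<le> 1")
      case True
      then have "C0 powr (1 / p) \<le> 1 powr (1 / p)" using C0 p by (intro powr_mono2) auto
      then show ?thesis using C0 by simp
    next
      case False
      then have "C0 powr (1 / p) \<le> C0 powr 1" using p by (intro powr_mono) auto
      then show ?thesis using C0 by simp
    qed
    moreover have "(\<beta> ^ (l - q)) powr (1 / p) \<le> \<beta> powr (real l / (2 * p))"
    proof -
      have "(\<beta> ^ (l - q)) powr (1 / p) = \<beta> powr (real (l - q) / p)"
        using \<beta> by (simp add: powr_realpow[symmetric] powr_powr)
      also have "\<dots> \<le> \<beta> powr (real l / (2 * p))"
      proof (rule powr_mono')
        have "real l \<le> 2 * real (l - q)" unfolding q_def by linarith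
        then show "real l / (2 * p) \<le> real (l - q) / p" using p by (simp add: field_simps)
      qed (use \<beta> in auto)
      finally show ?thesis .
    qed
    ultimately have "(C0 * \<beta> ^ (l - q)) powr (1 / p) \<le> (C0 + 1) * \<beta> powr (real l / (2 * p))"
      using C0 by (simp add: mult_mono)
    then have "2 * Kl * (C0 * \<beta> ^ (l - q)) powr (1 / p) \<le> 2 * Kl * ((C0 + 1) * \<beta> powr (real l / (2 * p)))"
      unfolding Kl_def by (intro mult_left_mono) auto
    also have "\<dots> = 2 * (C0 + 1) * (\<beta> powr (- (real l / (4 * p))) * \<beta> powr (real l / (2 * p)))" by (simp add: Kl_def)
    also have "\<beta> powr (- (real l / (4 * p))) * \<beta> powr (real l / (2 * p)) = (\<beta> powr (1 / (4 * p))) ^ l"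
    proof -
      have "- (real l / (4 * p)) + real l / (2 * p) = real l * (1 / (4 * p))" using p by (simp add: field_simps)
      then show ?thesis using \<beta> by (simp add: powr_add[symmetric] powr_realpow[symmetric] powr_powr mult.commute)
    qed
    also have "2 * (C0 + 1) * (\<beta> powr (1 / (4 * p))) ^ l \<le> 2 * (C0 + 1) * \<kappa> ^ l"
      using \<kappa>_ge(1) C0 by (intro mult_left_mono power_mono) auto
    finally show ?thesis .
  qed
  have b: "2 * (v powr (pbar / p) * Kl powr ((p - pbar) / p)) \<le> 2 * v powr (pbar / p) * \<kappa> ^ l"
  proof -
    have "Kl powr ((p - pbar) / p) = \<beta> powr (real l * ((pbar - p) / (4 * p * p)))"
    proof -
      have "(p - pbar) / p = - ((pbar - p) / p)" by (simp add: diff_divide_distrib)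
      then have "- (real l / (4 * p)) * ((p - pbar) / p) = real l * ((pbar - p) / (4 * p * p))" by simp
      then show ?thesis by (simp only: Kl_def powr_powr)
    qed
    also have "\<dots> = (\<beta> powr ((pbar - p) / (4 * p * p))) ^ l"
      using \<beta> by (simp add: powr_realpow[symmetric] powr_powr mult.commute)
    also have "\<dots> \<le> \<kappa> ^ l" using \<kappa>_ge(2) by (intro power_mono) auto
    finally show ?thesis by (simp add: mult_left_mono)
  qed
  have c: "K0 * \<rho> ^ q * v \<le> K0 * v / sqrt \<rho> * \<kappa> ^ l"
  proof -
    have s: "0 < sqrt \<rho>" "sqrt \<rho> < 1" using \<rho>_bounds by auto
    \<comment> \<open>Rounding in \<open>l div 2\<close> loses at most half a step of \<rho>, which
      the extra factor sqrt \<rho> makes up for.\<close>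
    have "\<rho> ^ q * sqrt \<rho> = sqrt \<rho> ^ (2 * q + 1)" using \<rho>_bounds by (simp add: power_mult)
    also have "\<dots> \<le> sqrt \<rho> ^ l" using s unfolding q_def by (intro power_decreasing) auto
    also have "\<dots> \<le> \<kappa> ^ l" using \<kappa>_ge(3) s by (intro power_mono) auto
    finally have "\<rho> ^ q \<le> \<kappa> ^ l / sqrt \<rho>" using s by (simp add: field_simps)
    then have "K0 * v * \<rho> ^ q \<le> K0 * v * (\<kappa> ^ l / sqrt \<rho>)" using K0_ge v_pos by (intro mult_left_mono) auto
    then show ?thesis by (simp add: mult_ac)
  qed
  show ?thesis using a b c unfolding fluctuation_const_def by (simp add: algebra_simps)
qed

text \<open>The lag i - k is split in two. Over the part next to \<open>s\<close> the smoothing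
  forgets: restarted at \<open>s - q - 1\<close>, it sees only observations from
  \<open>s - q\<close> on. Over the rest these observations are separated from the conditioning
  \<sigma>-field, so mixing applies to the restarted statistic. Both errors are controlled through
  the envelope, hence by one \<open>R\<close> for all parameters.\<close>

lemma past_bound:
  assumes H: "indep_noise Hm" and chi: "prob_on lam chi" and b: "norm b \<le> 1" and ki: "k \<le> i" "1 \<le> i" "i \<le> n"
  shows "\<exists>R. Lp_le P p R (fluctuation_const * \<kappa> ^ (i - k)) \<and> (\<forall>u\<in>\<Theta>. AE \<omega> in P.
     \<bar>real_cond_exp P (filt Hm T k) (Phi b chi T u (T + int i) (T + int n)) \<omega> - expectation (Phi b chi T u (T + int i) (T + int n))\<bar> \<le> R \<omega>)"
proof -
  define l where "l = i - k"
  define q where "q = l div 2"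
  define Kl where "Kl = \<beta> powr (- (real l / (4 * p)))"
  define s where "s = T + int i"
  define t where "t = T + int n"
  let ?F = "filt Hm T k" and ?G = "sigma_obs P mu Y {T + int k + int (l - q)..}"
  interpret F: finite_measure_subalgebra P ?F by (rule finite_subalgebra_filt[OF H])
  have ql: "q \<le> l" "q < i" using ki by (auto simp: q_def l_def)
  have st: "s \<le> t" "T < s" using ki by (auto simp: s_def t_def)
  have sq: "T \<le> s - int q - 1" using ql by (simp add: s_def)
  have sk: "T + int k + int (l - q) = s - int q" using ql ki by (simp add: s_def l_def)
  obtain Z where Z: "Z \<in> borel_measurable P" "\<And>x. 0 \<le> Z x \<and> Z x \<le> 1" "(\<integral>\<^sup>+x. ennreal (Z x) \<partial>P) \<le> ennreal (C0 * \<beta> ^ (l - q))"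
    "\<And>B. B \<in> sets ?G \<Longrightarrow> AE x in P. \<bar>real_cond_exp P ?F (indicat_real B) x - prob B\<bar> \<le> Z x"
    using filt_mixing[OF H, where T = T and k = k and n = "l - q"] by blast
  have "0 < Kl" using \<beta> by (simp add: Kl_def)
  obtain R1 where R1: "Lp_le P p R1 (2 * Kl * (C0 * \<beta> ^ (l - q)) powr (1 / p) + 2 * (v powr (pbar / p) * Kl powr ((p - pbar) / p)))"
    and R1b: "\<And>W. W \<in> borel_measurable ?G \<Longrightarrow> (AE x in P. \<bar>W x\<bar> \<le> V s x) \<Longrightarrow> AE x in P. \<bar>real_cond_exp P ?F W x - expectation W\<bar> \<le> R1 x"
    using cond_exp_mixing_Lp[OF subalgebra_filt[OF H] subalgebra_obs Z(4,1,2,3) _ V_Lp[of s] _ p(2) \<open>0 < Kl\<close>] C0 \<beta> p by auto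
  define R where "R = (\<lambda>\<omega>. R1 \<omega> + (K0 * \<rho> ^ q) * real_cond_exp P ?F (V s) \<omega> + (K0 * \<rho> ^ q) * expectation (V s))"
  have Kq: "0 \<le> K0 * \<rho> ^ q" using K0_ge \<rho>_bounds by simp
  have "Lp_le P p R (2 * Kl * (C0 * \<beta> ^ (l - q)) powr (1 / p) + 2 * (v powr (pbar / p) * Kl powr ((p - pbar) / p)) + \<bar>K0 * \<rho> ^ q\<bar> * v + \<bar>K0 * \<rho> ^ q\<bar> * v)"
    unfolding R_def using p
    by (intro Lp_le_add[OF Lp_le_add[OF R1 Lp_le_cmult[OF Lp_le_cond_exp[OF subalgebra_filt[OF H] V_Lp_p]]] Lp_le_cmult[OF Lp_le_expectation[OF V_Lp_p]]]) auto
  then have RL: "Lp_le P p R (fluctuation_const * \<kappa> ^ l)"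
  proof (rule Lp_le_mono_AE)
    show "R \<in> borel_measurable P" using Lp_leD(1)[OF \<open>Lp_le P p R _\<close>] .
    show "2 * Kl * (C0 * \<beta> ^ (l - q)) powr (1 / p) + 2 * (v powr (pbar / p) * Kl powr ((p - pbar) / p)) + \<bar>K0 * \<rho> ^ q\<bar> * v + \<bar>K0 * \<rho> ^ q\<bar> * v \<le> fluctuation_const * \<kappa> ^ l"
      using past_rate[of l] Kq by (simp add: q_def Kl_def)
  qed (use p in auto)
  have "AE \<omega> in P. \<bar>real_cond_exp P ?F (Phi b chi T u s t) \<omega> - expectation (Phi b chi T u s t)\<bar> \<le> R \<omega>" if u: "u \<in> \<Theta>" for u
  proof -
    define W where "W = Phi b chi (s - int q - 1) u s t"
    have WG: "W \<in> borel_measurable ?G" unfolding W_def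
      by (rule Phi_measurable_obs[OF u chi _ st(1)]) (auto simp: sk)
    have W1: "s - int q - 1 < s" by simp
    have Wi: "integrable P W" unfolding W_def by (rule Phi_integrable[OF u chi W1 st(1) b])
    have Pi: "integrable P (Phi b chi T u s t)" by (rule Phi_integrable[OF u chi st(2,1) b])
    have WV: "AE x in P. \<bar>W x\<bar> \<le> V s x" using AE_\<Omega>0
      by eventually_elim (unfold W_def, rule Phi_le[OF u chi W1 st(1) _ b])
    have hi: "integrable P (\<lambda>\<omega>. (K0 * \<rho> ^ q) * V s \<omega>)" using V_integrable by auto
    have d: "AE \<omega> in P. \<bar>Phi b chi T u s t \<omega> - W \<omega>\<bar> \<le> (K0 * \<rho> ^ q) * V s \<omega>" using AE_\<Omega>0
    proof eventually_elim
      case (elim \<omega>)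
      show ?case unfolding W_def
        using Phi_past[OF u chi chi sq order.refl W1 st(1) elim b] by (simp add: mult_ac)
    qed
    have 1: "AE \<omega> in P. \<bar>real_cond_exp P ?F (Phi b chi T u s t) \<omega> - real_cond_exp P ?F W \<omega>\<bar> \<le> real_cond_exp P ?F (\<lambda>\<omega>. (K0 * \<rho> ^ q) * V s \<omega>) \<omega>"
      by (rule F.real_cond_exp_abs_diff_le[OF Pi Wi hi d])
    have 2: "AE \<omega> in P. real_cond_exp P ?F (\<lambda>\<omega>. (K0 * \<rho> ^ q) * V s \<omega>) \<omega> = (K0 * \<rho> ^ q) * real_cond_exp P ?F (V s) \<omega>"
      by (rule F.real_cond_exp_cmult[OF V_integrable])
    have "\<bar>expectation (Phi b chi T u s t) - expectation W\<bar> \<le> expectation (\<lambda>\<omega>. \<bar>Phi b chi T u s t \<omega> - W \<omega>\<bar>)"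
      using integral_abs_bound[of P "\<lambda>\<omega>. Phi b chi T u s t \<omega> - W \<omega>"] Pi Wi by simp
    also have "\<dots> \<le> expectation (\<lambda>\<omega>. (K0 * \<rho> ^ q) * V s \<omega>)"
      by (rule integral_mono_AE) (use Pi Wi hi d in auto)
    also have "\<dots> = (K0 * \<rho> ^ q) * expectation (V s)" by simp
    finally have 3: "\<bar>expectation (Phi b chi T u s t) - expectation W\<bar> \<le> (K0 * \<rho> ^ q) * expectation (V s)" .
    show ?thesis using 1 2 R1b[OF WG WV]
    proof eventually_elim
      case (elim \<omega>)
      then show ?case unfolding R_def using 3 by linarith
    qed
  qed
  then show ?thesis using RL unfolding s_def t_def l_def by blast
qed

text \<open>Cutting the horizon at T + k makes the statistic measurable for the conditioning
  \<sigma>-field, at the price of forgetting the future. The bound on this error is a multiple of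
  \<open>V s\<close>, which is itself measurable there, so it bounds the conditional expectation of
  the error as well; hence the factor 2.\<close>

lemma future_bound:
  assumes H: "indep_noise Hm" and chi: "prob_on lam chi" and b: "norm b \<le> 1" and ki: "1 \<le> i" "i \<le> k" "k \<le> n"
  shows "\<exists>R. Lp_le P p R (fluctuation_const * \<kappa> ^ (k - i)) \<and> (\<forall>u\<in>\<Theta>. AE \<omega> in P.
     \<bar>Phi b chi T u (T + int i) (T + int n) \<omega> - real_cond_exp P (filt Hm T k) (Phi b chi T u (T + int i) (T + int n)) \<omega>\<bar> \<le> R \<omega>)"
proof -
  define s where "s = T + int i"
  define t where "t = T + int n"
  define t1 where "t1 = T + int k"
  define c where "c = K0 * \<rho> ^ (k - i)"
  let ?F = "filt Hm T k"
  interpret F: finite_measure_subalgebra P ?F by (rule finite_subalgebra_filt[OF H])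
  have c: "0 \<le> c" using K0_ge \<rho>_bounds by (simp add: c_def)
  have st: "T < s" "s \<le> t1" "t1 \<le> t" "s \<le> t" using ki by (auto simp: s_def t_def t1_def)
  have ks: "nat (t1 - s) = k - i" using ki by (auto simp: s_def t1_def)
  have "Lp_le P p (\<lambda>\<omega>. (2 * c) * V s \<omega>) (\<bar>2 * c\<bar> * v)" by (rule Lp_le_cmult[OF V_Lp_p]) (use p in simp)
  then have RL: "Lp_le P p (\<lambda>\<omega>. (2 * c) * V s \<omega>) (fluctuation_const * \<kappa> ^ (k - i))"
  proof (rule Lp_le_mono_AE)
    have s: "0 < sqrt \<rho>" "sqrt \<rho> < 1" using \<rho>_bounds by auto
    have "\<rho> ^ (k - i) * sqrt \<rho> = sqrt \<rho> ^ (2 * (k - i) + 1)" using \<rho>_bounds by (simp add: power_mult)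
    also have "\<dots> \<le> sqrt \<rho> ^ (k - i)" using s by (intro power_decreasing) auto
    also have "\<dots> \<le> \<kappa> ^ (k - i)" using \<kappa>_ge(3) s by (intro power_mono) auto
    finally have "\<rho> ^ (k - i) \<le> \<kappa> ^ (k - i) / sqrt \<rho>" using s by (simp add: field_simps)
    then have "2 * K0 * v * \<rho> ^ (k - i) \<le> 2 * K0 * v * (\<kappa> ^ (k - i) / sqrt \<rho>)" using K0_ge v_pos by (intro mult_left_mono) auto
    then have "\<bar>2 * c\<bar> * v \<le> 2 * K0 * v / sqrt \<rho> * \<kappa> ^ (k - i)" using c by (simp add: c_def mult_ac)
    also have "\<dots> \<le> fluctuation_const * \<kappa> ^ (k - i)" unfolding fluctuation_const_def using C0 \<kappa>_bounds by (intro mult_right_mono) auto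
    finally show "\<bar>2 * c\<bar> * v \<le> fluctuation_const * \<kappa> ^ (k - i)" .
  qed (use p V_measurable in auto)
  have "AE \<omega> in P. \<bar>Phi b chi T u s t \<omega> - real_cond_exp P ?F (Phi b chi T u s t) \<omega>\<bar> \<le> 2 * c * V s \<omega>" if u: "u \<in> \<Theta>" for u
  proof -
    define W where "W = Phi b chi T u s t1"
    have WF: "W \<in> borel_measurable ?F" unfolding W_def
      by (rule obs_measurable_filt[OF H Phi_measurable_obs[OF u chi st(1,2) order.refl]]) (auto simp: t1_def)
    have Wi: "integrable P W" unfolding W_def by (rule Phi_integrable[OF u chi st(1,2) b])
    have Pi: "integrable P (Phi b chi T u s t)" by (rule Phi_integrable[OF u chi st(1,4) b])
    have hi: "integrable P (\<lambda>\<omega>. c * V s \<omega>)" using V_integrable by auto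
    have d: "AE \<omega> in P. \<bar>Phi b chi T u s t \<omega> - W \<omega>\<bar> \<le> c * V s \<omega>" using AE_\<Omega>0
    proof eventually_elim
      case (elim \<omega>)
      show ?case unfolding W_def
        using Phi_future[OF u chi st(1,2,3) elim b] by (simp add: c_def ks mult_ac)
    qed
    have 1: "AE \<omega> in P. \<bar>real_cond_exp P ?F (Phi b chi T u s t) \<omega> - real_cond_exp P ?F W \<omega>\<bar> \<le> real_cond_exp P ?F (\<lambda>\<omega>. c * V s \<omega>) \<omega>"
      by (rule F.real_cond_exp_abs_diff_le[OF Pi Wi hi d])
    have "(\<lambda>\<omega>. c * V s \<omega>) \<in> borel_measurable ?F"
      by (intro borel_measurable_times borel_measurable_const obs_measurable_filt[OF H V_measurable_obs[of s "{s}"]])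
        (use ki in \<open>auto simp: s_def\<close>)
    then have 2: "AE \<omega> in P. real_cond_exp P ?F (\<lambda>\<omega>. c * V s \<omega>) \<omega> = c * V s \<omega>"
      by (rule F.real_cond_exp_F_meas[OF hi])
    have 3: "AE \<omega> in P. real_cond_exp P ?F W \<omega> = W \<omega>" by (rule F.real_cond_exp_F_meas[OF Wi WF])
    show ?thesis using d 1 2 3 by eventually_elim auto
  qed
  then show ?thesis using RL unfolding s_def t_def by blast
qed

definition Dev :: "'v \<Rightarrow> 'x measure \<Rightarrow> int \<Rightarrow> nat \<Rightarrow> 'p \<Rightarrow> nat \<Rightarrow> 'w \<Rightarrow> real" where
  "Dev b chi T n u i \<omega> = Phi b chi T u (T + int i) (T + int n) \<omega> - expectation (Phi b chi T u (T + int i) (T + int n))"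

text \<open>Here the parameter equals \<open>us j\<close> on the past event \<open>A j\<close>.
  Indicators of past events come out of every conditional expectation, and disjointness together
  with a bound common to all parameters makes the mixingale coefficients independent of
  \<open>N\<close>. A single \<open>C\<close> therefore survives any refinement of the
  partition.\<close>

lemma block_deviation_finite_range:
  "\<exists>C>0. \<forall>Hm T (n::nat) chi b (N::nat) us A. indep_noise Hm \<longrightarrow> prob_on lam chi \<longrightarrow> norm b \<le> 1 \<longrightarrow>
     (\<forall>j<N. us j \<in> \<Theta>) \<longrightarrow> (\<forall>j<N. A j \<in> sets (filt Hm T 0)) \<longrightarrow> disjoint_family_on A {..<N} \<longrightarrow>
     Lp_le P p (\<lambda>\<omega>. \<Sum>i\<in>{1..n}. \<Sum>j<N. indicator (A j) \<omega> * Dev b chi T n (us j) i \<omega>) (C * sqrt (real n))"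
proof -
  obtain C where C: "C > 0" and mixingale: "\<And>(n::nat) F X K. 0 < K \<Longrightarrow> (\<forall>k. subalgebra P (F k)) \<Longrightarrow> (\<forall>k. sets (F k) \<subseteq> sets (F (Suc k))) \<Longrightarrow>
    (\<forall>i\<in>{1..n}. integrable P (X i) \<and> X i \<in> borel_measurable (F n)) \<Longrightarrow>
    (\<forall>i\<in>{1..n}. \<forall>k\<le>i. Lp_le P p (real_cond_exp P (F k) (X i)) (K * \<kappa> ^ (i - k))) \<Longrightarrow>
    (\<forall>i\<in>{1..n}. \<forall>k\<in>{i..n}. Lp_le P p (\<lambda>x. X i x - real_cond_exp P (F k) (X i) x) (K * \<kappa> ^ (k - i))) \<Longrightarrow>
    Lp_le P p (\<lambda>x. \<Sum>i\<in>{1..n}. X i x) (C * sqrt (real n) * K)"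
    using mixingale_Lp[OF p(1) \<kappa>_bounds] by blast
  show ?thesis
  proof (rule exI[of _ "C * fluctuation_const"], intro conjI allI impI)
    show "0 < C * fluctuation_const" using C fluctuation_const_pos by simp
    fix Hm T chi us A and n N :: nat and b :: 'v
    assume H: "indep_noise Hm" and chi: "prob_on lam chi" and b: "norm b \<le> 1" and us: "\<forall>j<N. us j \<in> \<Theta>"
      and A: "\<forall>j<N. A j \<in> sets (filt Hm T 0)" and disj: "disjoint_family_on A {..<N}"
    define D where "D = (\<lambda>j i \<omega>. Dev b chi T n (us j) i \<omega>)"
    define X where "X = (\<lambda>i \<omega>. \<Sum>j<N. indicator (A j) \<omega> * D j i \<omega>)"
    let ?F = "filt Hm T"
    have rst: "T < T + int i" "T + int i \<le> T + int n" if "i \<in> {1..n}" for i using that by auto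
    have AF: "A j \<in> sets (?F k)" if "j < N" for j k using A that filt_mono[OF H, of 0 k T] by auto
    have AP: "A j \<in> sets P" if "j < N" for j using AF[OF that, of 0] subalgebra_filt[OF H, of T 0] by (auto simp: subalgebra_def)
    have Pi: "integrable P (Phi b chi T (us j) (T + int i) (T + int n))" if "j < N" "i \<in> {1..n}" for j i
      using Phi_integrable[OF _ chi rst[OF that(2)] b] us that(1) by auto
    have Di: "integrable P (D j i)" if "j < N" "i \<in> {1..n}" for j i
      unfolding D_def Dev_def using Pi[OF that] by auto
    have ADi: "integrable P (\<lambda>\<omega>. indicator (A j) \<omega> * D j i \<omega>)" if "j < N" "i \<in> {1..n}" for j i
      using integrable_mult_indicator[OF AP[OF that(1)] Di[OF that]] by simp
    have Xi: "integrable P (X i)" if "i \<in> {1..n}" for i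
      unfolding X_def using ADi that by (intro Bochner_Integration.integrable_sum) auto
    have XF: "X i \<in> borel_measurable (?F n)" if "i \<in> {1..n}" for i
      unfolding X_def
    proof (intro borel_measurable_sum borel_measurable_times)
      fix j assume "j \<in> {..<N}"
      then have j: "j < N" by simp
      show "indicat_real (A j) \<in> borel_measurable (?F n)" using AF[OF j] by simp
      have "Phi b chi T (us j) (T + int i) (T + int n) \<in> borel_measurable (?F n)"
        by (rule obs_measurable_filt[OF H Phi_measurable_obs[OF _ chi rst[OF that] order.refl]]) (use us j in auto)
      then show "D j i \<in> borel_measurable (?F n)" unfolding D_def Dev_def by measurable
    qed
    have condX: "AE \<omega> in P. real_cond_exp P (?F k) (X i) \<omega> = (\<Sum>j<N. indicator (A j) \<omega> * real_cond_exp P (?F k) (D j i) \<omega>)"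
      if i: "i \<in> {1..n}" for i k
    proof -
      interpret F: finite_measure_subalgebra P "?F k" by (rule finite_subalgebra_filt[OF H])
      define f where "f = (\<lambda>j \<omega>. if j < N then indicator (A j) \<omega> * D j i \<omega> else 0)"
      have fi: "integrable P (f j)" for j unfolding f_def using ADi[OF _ i] by (cases "j < N") auto
      have Xf: "X i = (\<lambda>\<omega>. \<Sum>j<N. f j \<omega>)" by (simp add: X_def f_def)
      have "AE \<omega> in P. real_cond_exp P (?F k) (X i) \<omega> = (\<Sum>j<N. real_cond_exp P (?F k) (f j) \<omega>)"
        unfolding Xf by (rule F.real_cond_exp_sum[OF fi])
      moreover have "AE \<omega> in P. \<forall>j\<in>{..<N}. real_cond_exp P (?F k) (f j) \<omega> = indicator (A j) \<omega> * real_cond_exp P (?F k) (D j i) \<omega>"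
      proof (rule AE_ball_countable')
        fix j assume "j \<in> {..<N}"
        then have j: "j < N" by simp
        have "AE \<omega> in P. real_cond_exp P (?F k) (\<lambda>\<omega>. indicator (A j) \<omega> * D j i \<omega>) \<omega> = indicator (A j) \<omega> * real_cond_exp P (?F k) (D j i) \<omega>"
          by (rule F.real_cond_exp_mult) (use AF[OF j] Di[OF j i] ADi[OF j i] in auto)
        then show "AE \<omega> in P. real_cond_exp P (?F k) (f j) \<omega> = indicator (A j) \<omega> * real_cond_exp P (?F k) (D j i) \<omega>"
          using j by (simp add: f_def)
      qed simp
      ultimately show ?thesis
      proof eventually_elim
        case (elim \<omega>)
        show ?case unfolding elim(1) by (rule sum.cong) (use elim(2) in auto)
      qed
    qed
    have condD: "AE \<omega> in P. real_cond_exp P (?F k) (D j i) \<omega> = real_cond_exp P (?F k) (Phi b chi T (us j) (T + int i) (T + int n)) \<omega> - expectation (Phi b chi T (us j) (T + int i) (T + int n))"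
      if ji: "j < N" "i \<in> {1..n}" for j i k
    proof -
      interpret F: finite_measure_subalgebra P "?F k" by (rule finite_subalgebra_filt[OF H])
      let ?e = "expectation (Phi b chi T (us j) (T + int i) (T + int n))"
      have "AE \<omega> in P. real_cond_exp P (?F k) (D j i) \<omega> = real_cond_exp P (?F k) (Phi b chi T (us j) (T + int i) (T + int n)) \<omega> - real_cond_exp P (?F k) (\<lambda>_. ?e) \<omega>"
        unfolding D_def Dev_def by (rule F.real_cond_exp_diff[OF Pi[OF ji]]) auto
      moreover have "AE \<omega> in P. real_cond_exp P (?F k) (\<lambda>_. ?e) \<omega> = ?e" by (rule F.real_cond_exp_F_meas) auto
      ultimately show ?thesis by eventually_elim simp
    qed
    have "Lp_le P p (\<lambda>x. \<Sum>i\<in>{1..n}. X i x) (C * sqrt (real n) * fluctuation_const)"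
    proof (rule mixingale[of fluctuation_const ?F n X, OF fluctuation_const_pos])
      show "\<forall>k. subalgebra P (?F k)" using subalgebra_filt[OF H] by auto
      show "\<forall>k. sets (?F k) \<subseteq> sets (?F (Suc k))" using filt_mono[OF H] by auto
      show "\<forall>i\<in>{1..n}. integrable P (X i) \<and> X i \<in> borel_measurable (?F n)" using Xi XF by auto
      show "\<forall>i\<in>{1..n}. \<forall>k\<le>i. Lp_le P p (real_cond_exp P (?F k) (X i)) (fluctuation_const * \<kappa> ^ (i - k))"
      proof (intro ballI allI impI)
        fix i k assume i: "i \<in> {1..n}" and k: "k \<le> i"
        obtain R where R: "Lp_le P p R (fluctuation_const * \<kappa> ^ (i - k))" and Rb: "\<And>u. u \<in> \<Theta> \<Longrightarrow> AE \<omega> in P.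
          \<bar>real_cond_exp P (?F k) (Phi b chi T u (T + int i) (T + int n)) \<omega> - expectation (Phi b chi T u (T + int i) (T + int n))\<bar> \<le> R \<omega>"
          using past_bound[OF H chi b k, of n T] i by auto
        have "AE \<omega> in P. \<forall>j\<in>{..<N}. \<bar>real_cond_exp P (?F k) (D j i) \<omega>\<bar> \<le> R \<omega>"
        proof (rule AE_ball_countable')
          fix j assume "j \<in> {..<N}"
          then have j: "j < N" "us j \<in> \<Theta>" using us by auto
          show "AE \<omega> in P. \<bar>real_cond_exp P (?F k) (D j i) \<omega>\<bar> \<le> R \<omega>"
            using condD[OF j(1) i, of k] Rb[OF j(2)] by eventually_elim simp
        qed simp
        then have "AE \<omega> in P. \<bar>real_cond_exp P (?F k) (X i) \<omega>\<bar> \<le> \<bar>R \<omega>\<bar>"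
          using condX[OF i, of k]
        proof eventually_elim
          case (elim \<omega>)
          show ?case unfolding elim(2)
            by (rule disjoint_indicator_sum_abs_le[OF _ disj]) (use elim(1) in \<open>auto intro: order_trans[OF _ abs_ge_self]\<close>)
        qed
        then show "Lp_le P p (real_cond_exp P (?F k) (X i)) (fluctuation_const * \<kappa> ^ (i - k))"
          by (rule Lp_le_mono_AE[OF R, rotated]) (use p in auto)
      qed
      show "\<forall>i\<in>{1..n}. \<forall>k\<in>{i..n}. Lp_le P p (\<lambda>x. X i x - real_cond_exp P (?F k) (X i) x) (fluctuation_const * \<kappa> ^ (k - i))"
      proof (intro ballI)
        fix i k assume i: "i \<in> {1..n}" and k: "k \<in> {i..n}"
        obtain R where R: "Lp_le P p R (fluctuation_const * \<kappa> ^ (k - i))" and Rb: "\<And>u. u \<in> \<Theta> \<Longrightarrow> AE \<omega> in P.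
          \<bar>Phi b chi T u (T + int i) (T + int n) \<omega> - real_cond_exp P (?F k) (Phi b chi T u (T + int i) (T + int n)) \<omega>\<bar> \<le> R \<omega>"
          using future_bound[OF H chi b, of i k n T] i k by auto
        have "AE \<omega> in P. \<forall>j\<in>{..<N}. \<bar>D j i \<omega> - real_cond_exp P (?F k) (D j i) \<omega>\<bar> \<le> R \<omega>"
        proof (rule AE_ball_countable')
          fix j assume "j \<in> {..<N}"
          then have j: "j < N" "us j \<in> \<Theta>" using us by auto
          show "AE \<omega> in P. \<bar>D j i \<omega> - real_cond_exp P (?F k) (D j i) \<omega>\<bar> \<le> R \<omega>"
            using condD[OF j(1) i, of k] Rb[OF j(2)] by eventually_elim (simp add: D_def Dev_def)
        qed simp
        then have "AE \<omega> in P. \<bar>X i \<omega> - real_cond_exp P (?F k) (X i) \<omega>\<bar> \<le> \<bar>R \<omega>\<bar>"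
          using condX[OF i, of k]
        proof eventually_elim
          case (elim \<omega>)
          have "X i \<omega> - real_cond_exp P (?F k) (X i) \<omega> = (\<Sum>j<N. indicator (A j) \<omega> * (D j i \<omega> - real_cond_exp P (?F k) (D j i) \<omega>))"
            unfolding elim(2) right_diff_distrib sum_subtractf by (simp only: X_def)
          also have "\<bar>\<dots>\<bar> \<le> \<bar>R \<omega>\<bar>"
            by (rule disjoint_indicator_sum_abs_le[OF _ disj]) (use elim(1) in \<open>auto intro: order_trans[OF _ abs_ge_self]\<close>)
          finally show ?case .
        qed
        then show "Lp_le P p (\<lambda>x. X i x - real_cond_exp P (?F k) (X i) x) (fluctuation_const * \<kappa> ^ (k - i))"
          by (rule Lp_le_mono_AE[OF R, rotated]) (use p Xi[OF i] in auto)
      qed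
    qed
    then show "Lp_le P p (\<lambda>\<omega>. \<Sum>i\<in>{1..n}. \<Sum>j<N. indicator (A j) \<omega> * Dev b chi T n (us j) i \<omega>) (C * fluctuation_const * sqrt (real n))"
      by (simp add: X_def D_def mult_ac)
  qed
qed

end

text \<open>Preimages of a finite cover of \<Theta> by balls with centres in \<Theta>, made
  disjoint. The centres must be admissible parameters, because the statistics are evaluated
  there.\<close>

lemma measurable_compact_discretisation:
  fixes th :: "'w \<Rightarrow> 'p::euclidean_space"
  assumes th: "th \<in> borel_measurable F" and \<Theta>: "compact \<Theta>" "\<And>\<omega>. \<omega> \<in> space F \<Longrightarrow> th \<omega> \<in> \<Theta>" and e: "0 < e"
  shows "\<exists>(N::nat) us A. (\<forall>j<N. us j \<in> \<Theta>) \<and> (\<forall>j<N. A j \<in> sets F) \<and> disjoint_family_on A {..<N} \<and>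
    (\<forall>\<omega>\<in>space F. \<exists>j<N. \<omega> \<in> A j) \<and> (\<forall>j<N. \<forall>\<omega>\<in>A j. dist (us j) (th \<omega>) < e)"
proof -
  obtain k where k: "finite k" "k \<subseteq> \<Theta>" "\<Theta> \<subseteq> (\<Union>x\<in>k. ball x e)"
  proof (rule compactE_image[OF \<Theta>(1), of \<Theta> "\<lambda>x. ball x e"])
    show "\<Theta> \<subseteq> (\<Union>x\<in>\<Theta>. ball x e)" using e by auto
  qed auto
  obtain us :: "nat \<Rightarrow> 'p" and N where us: "k = us ` {i. i < N}"
    using finite_imp_nat_seg_image_inj_on[OF k(1)] by blast
  define B where "B = (\<lambda>j. th -` ball (us j) e \<inter> space F)"
  have B: "B j \<in> sets F" for j unfolding B_def using th by (intro measurable_sets) auto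
  define A where "A = disjointed B"
  show ?thesis
  proof (rule exI[of _ N], rule exI[of _ us], rule exI[of _ A], intro conjI allI impI ballI)
    show "us j \<in> \<Theta>" if "j < N" for j using k(2) us that by auto
    show "A j \<in> sets F" for j unfolding A_def using sets.range_disjointed_sets[of B F] B by auto
    show "disjoint_family_on A {..<N}" unfolding A_def using disjoint_family_disjointed[of B]
      by (auto simp: disjoint_family_on_def)
    show "dist (us j) (th \<omega>) < e" if "\<omega> \<in> A j" for j \<omega>
      using that disjointed_subset[of B j] by (auto simp: A_def B_def)
    fix \<omega> assume \<omega>: "\<omega> \<in> space F"
    then obtain j where "j < N" "\<omega> \<in> B j" using \<Theta>(2)[OF \<omega>] k(3) us by (auto simp: B_def)
    then have "\<omega> \<in> (\<Union>i\<in>{0..<N}. B i)" by auto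
    then have "\<omega> \<in> (\<Union>i\<in>{0..<N}. A i)" unfolding A_def finite_UN_disjointed_eq .
    then show "\<exists>j<N. \<omega> \<in> A j" by auto
  qed
qed

section \<open>Bias and deviation of a block at a random parameter\<close>

context observed_hmm
begin

lemma power_sum_le: "(\<Sum>i\<in>{1..n}. \<rho> ^ (i - 1)) \<le> 1 / (1 - \<rho>)" "(\<Sum>i\<in>{1..n}. \<rho> ^ (n - i)) \<le> 1 / (1 - \<rho>)"
proof -
  have g: "(\<Sum>i<n. \<rho> ^ i) \<le> 1 / (1 - \<rho>)"
    using \<rho>_bounds sum_le_suminf[of "\<lambda>i. \<rho> ^ i" "{..<n}"] by (simp add: suminf_geometric summable_geometric)
  have "(\<Sum>i\<in>{1..n}. \<rho> ^ (i - 1)) = (\<Sum>i<n. \<rho> ^ i)"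
    by (rule sum.reindex_bij_witness[of _ Suc "\<lambda>i. i - 1"]) auto
  then show "(\<Sum>i\<in>{1..n}. \<rho> ^ (i - 1)) \<le> 1 / (1 - \<rho>)" using g by simp
  have "(\<Sum>i\<in>{1..n}. \<rho> ^ (n - i)) = (\<Sum>i<n. \<rho> ^ i)"
    by (rule sum.reindex_bij_witness[of _ "\<lambda>i. n - i" "\<lambda>i. n - i"]) auto
  then show "(\<Sum>i\<in>{1..n}. \<rho> ^ (n - i)) \<le> 1 / (1 - \<rho>)" using g by simp
qed

text \<open>Two geometric series, one from each end of the block. The total does not depend on the
  block length, so after averaging it is of smaller order than the fluctuation.\<close>

definition bias :: real where "bias = K0 * v * (2 / (1 - \<rho>))"

lemma bias_bound:
  assumes u: "u \<in> \<Theta>" and chi: "prob_on lam chi" and b: "norm b \<le> 1"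
  shows "(\<Sum>i\<in>{1..n}. \<bar>expectation (Phi b chi T u (T + int i) (T + int n)) - inner (mean_stat u) b\<bar>) \<le> bias"
proof -
  have "(\<Sum>i\<in>{1..n}. \<bar>expectation (Phi b chi T u (T + int i) (T + int n)) - inner (mean_stat u) b\<bar>)
     \<le> (\<Sum>i\<in>{1..n}. K0 * v * (\<rho> ^ (i - 1) + \<rho> ^ (n - i)))"
  proof (rule sum_mono)
    fix i assume i: "i \<in> {1..n}"
    then have e: "nat (T + int i - 1 - T) = i - 1" "nat (T + int n - (T + int i)) = n - i" by auto
    show "\<bar>expectation (Phi b chi T u (T + int i) (T + int n)) - inner (mean_stat u) b\<bar> \<le> K0 * v * (\<rho> ^ (i - 1) + \<rho> ^ (n - i))"
      using Phi_expectation_mean[OF u chi _ _ b, of T "T + int i" "T + int n"] i unfolding e by auto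
  qed
  also have "\<dots> = K0 * v * ((\<Sum>i\<in>{1..n}. \<rho> ^ (i - 1)) + (\<Sum>i\<in>{1..n}. \<rho> ^ (n - i)))"
    unfolding sum_distrib_left[symmetric] sum.distrib ..
  also have "\<dots> \<le> K0 * v * (1 / (1 - \<rho>) + 1 / (1 - \<rho>))"
    using power_sum_le[of n] K0_ge v_pos by (intro mult_left_mono add_mono) auto
  finally show ?thesis by (simp add: bias_def)
qed

abbreviation "blk chi T n u \<omega> \<equiv> block_statistic m g lam S chi T n u (\<lambda>k. Y k \<omega>)"

lemma block_inner:
  assumes u: "u \<in> \<Theta>" and chi: "prob_on lam chi" and \<omega>: "\<omega> \<in> \<Omega>0"
  shows "inner (blk chi T n u \<omega>) b = (1 / real n) * (\<Sum>i\<in>{1..n}. Phi b chi (int T) u (int T + int i) (int T + int n) \<omega>)"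
proof -
  have "(\<Sum>t\<in>{int T + 1..int T + int n}. inner (smoothing m g lam chi (int T) u t (int T + int n) S (\<lambda>k. Y k \<omega>)) b)
    = (\<Sum>t\<in>{int T + 1..int T + int n}. Phi b chi (int T) u t (int T + int n) \<omega>)"
    by (rule sum.cong) (use Phi_inner[OF u chi _ _ \<omega>] in auto)
  also have "\<dots> = (\<Sum>i\<in>{1..n}. Phi b chi (int T) u (int T + int i) (int T + int n) \<omega>)"
    by (rule sum.reindex_bij_witness[of _ "\<lambda>i. int T + int i" "\<lambda>t. nat (t - int T)"]) auto
  finally show ?thesis by (simp add: block_statistic_def inner_sum_left)
qed

lemma block_measurable:
  assumes u: "u \<in> \<Theta>" and chi: "prob_on lam chi"
  shows "(\<lambda>\<omega>. blk chi T n u \<omega>) \<in> borel_measurable P"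
  unfolding block_statistic_def
  by (intro borel_measurable_scaleR borel_measurable_const borel_measurable_sum smoothing_measurable[OF u chi])
    (use Y_meas S_meas in auto)

lemma block_continuous:
  assumes "\<And>j. us j \<in> \<Theta>" "us \<longlonglongrightarrow> u" "u \<in> \<Theta>" and chi: "prob_on lam chi" and \<omega>: "\<omega> \<in> \<Omega>0"
  shows "(\<lambda>j. blk chi T n (us j) \<omega>) \<longlonglongrightarrow> blk chi T n u \<omega>"
  unfolding block_statistic_def
  by (intro tendsto_scaleR tendsto_const tendsto_sum smoothing_continuous[OF assms(1-3) chi _ _ good_\<Omega>0[OF \<omega>]]) auto

text \<open>The parameter is discretised along partitions of its range that are measurable with respect to the past;
  Fatou's lemma removes the discretisation.\<close>

lemma block_deviation:
  assumes cont: "continuous_on \<Theta> mean_stat"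
  shows "\<exists>C>0. \<forall>Hm T n chi th. indep_noise Hm \<longrightarrow> prob_on lam chi \<longrightarrow> 1 \<le> n \<longrightarrow> th \<in> borel_measurable (filt Hm (int T) 0) \<longrightarrow>
     (\<forall>\<omega>\<in>space P. th \<omega> \<in> \<Theta>) \<longrightarrow>
     Lp_le P p (\<lambda>\<omega>. indicator \<Omega>0 \<omega> * norm (blk chi T n (th \<omega>) \<omega> - mean_stat (th \<omega>))) (C / sqrt (real n))"
proof -
  obtain C where C: "C > 0" and simple: "\<And>Hm T (n::nat) chi b (N::nat) us A. indep_noise Hm \<Longrightarrow> prob_on lam chi \<Longrightarrow> norm b \<le> 1 \<Longrightarrow>
     (\<forall>j<N. us j \<in> \<Theta>) \<Longrightarrow> (\<forall>j<N. A j \<in> sets (filt Hm T 0)) \<Longrightarrow> disjoint_family_on A {..<N} \<Longrightarrow>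
     Lp_le P p (\<lambda>\<omega>. \<Sum>i\<in>{1..n}. \<Sum>j<N. indicator (A j) \<omega> * Dev b chi T n (us j) i \<omega>) (C * sqrt (real n))"
    using block_deviation_finite_range by blast
  have bias: "0 \<le> bias" unfolding bias_def using K0_ge v_pos \<rho>_bounds by simp
  \<comment> \<open>Coordinates are bounded separately and added, whence the dimension.\<close>
  define C' where "C' = real DIM('v) * (C + bias) + 1"
  have C': "0 < C'" unfolding C'_def using C bias by (simp add: add_nonneg_pos)
  show ?thesis
  proof (rule exI[of _ C'], intro conjI C' allI impI)
    fix Hm T chi th and n :: nat
    assume H: "indep_noise Hm" and chi: "prob_on lam chi" and n: "1 \<le> n" and th: "th \<in> borel_measurable (filt Hm (int T) 0)"
      and th\<Theta>: "\<forall>\<omega>\<in>space P. th \<omega> \<in> \<Theta>"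
    let ?w = "(C + bias) / sqrt (real n)"
    have comp: "Lp_le P p (\<lambda>\<omega>. indicator \<Omega>0 \<omega> * \<bar>inner (blk chi T n (th \<omega>) \<omega> - mean_stat (th \<omega>)) b\<bar>) ?w"
      if b: "norm b \<le> 1" for b
    proof -
      \<comment> \<open>The k-th discretisation has mesh 1 / (k + 1). Bundling its data into one
        predicate lets them be chosen for all k at once.\<close>
      define Q where "Q = (\<lambda>k (N::nat) us A. (\<forall>j<N. us j \<in> \<Theta>) \<and> (\<forall>j<N. A j \<in> sets (filt Hm (int T) 0)) \<and> disjoint_family_on A {..<N} \<and>
        (\<forall>\<omega>\<in>space P. \<exists>j<N. \<omega> \<in> A j) \<and> (\<forall>j<N. \<forall>\<omega>\<in>A j. dist (us j) (th \<omega>) < 1 / real (Suc k)))"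
      have "\<exists>N us A. Q k N us A" for k
        unfolding Q_def space_filt[of Hm "int T" 0, symmetric]
        by (rule measurable_compact_discretisation[OF th compact_\<Theta>]) (use th\<Theta> in \<open>auto simp: space_filt\<close>)
      then obtain N us A where "\<And>k. Q k (N k) (us k) (A k)" by metis
      then have d: "\<And>k j. j < N k \<Longrightarrow> us k j \<in> \<Theta>" "\<And>k j. j < N k \<Longrightarrow> A k j \<in> sets (filt Hm (int T) 0)"
        "\<And>k. disjoint_family_on (A k) {..<N k}" "\<And>k \<omega>. \<omega> \<in> space P \<Longrightarrow> \<exists>j<N k. \<omega> \<in> A k j"
        "\<And>k j \<omega>. j < N k \<Longrightarrow> \<omega> \<in> A k j \<Longrightarrow> dist (us k j) (th \<omega>) < 1 / real (Suc k)"
        unfolding Q_def by blast+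
      have AP: "A k j \<in> sets P" if "j < N k" for k j
        using d(2)[OF that] subalgebra_filt[OF H, of "int T" 0] by (auto simp: subalgebra_def)
      define h where "h = (\<lambda>u \<omega>. indicator \<Omega>0 \<omega> * \<bar>inner (blk chi T n u \<omega> - mean_stat u) b\<bar>)"
      define f where "f = (\<lambda>k \<omega>. \<Sum>j<N k. indicator (A k j) \<omega> * h (us k j) \<omega>)"
      have pick: "(\<Sum>j<N k. indicator (A k j) \<omega> * (F j :: real)) = F j0" if "j0 < N k" "\<omega> \<in> A k j0" for k \<omega> j0 F
      proof -
        have "(\<Sum>j<N k. indicator (A k j) \<omega> * F j) = (\<Sum>j\<in>{j0}. indicator (A k j) \<omega> * F j)"
          using that d(3)[of k] by (intro sum.mono_neutral_right) (auto simp: disjoint_family_on_def indicator_def)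
        then show ?thesis using that by simp
      qed
      have hm: "h u \<in> borel_measurable P" if "u \<in> \<Theta>" for u
        unfolding h_def using block_measurable[OF that chi] \<Omega>0_sets by measurable
      have fm: "f k \<in> borel_measurable P" for k
        unfolding f_def using hm d(1) AP by (intro borel_measurable_sum borel_measurable_times) auto
      let ?X = "\<lambda>k \<omega>. \<Sum>i\<in>{1..n}. \<Sum>j<N k. indicator (A k j) \<omega> * Dev b chi (int T) n (us k j) i \<omega>"
      have fL: "Lp_le P p (f k) ?w" for k
      proof -
        have X: "Lp_le P p (?X k) (C * sqrt (real n))"
          by (rule simple[OF H chi b _ _ d(3)]) (use d(1,2) in auto)
        have abs_L: "Lp_le P p (\<lambda>\<omega>. \<bar>?X k \<omega>\<bar>) (C * sqrt (real n))"
          by (rule Lp_le_mono_AE[OF X]) (use Lp_leD(1)[OF X] p in auto)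
        have biasL: "Lp_le P p (\<lambda>_. bias) bias"
          using bias by (auto simp: Lp_le_def emeasure_space_1)
        have "Lp_le P p (\<lambda>\<omega>. (1 / real n) * (\<bar>?X k \<omega>\<bar> + bias)) (\<bar>1 / real n\<bar> * (C * sqrt (real n) + bias))"
          by (intro Lp_le_cmult Lp_le_add abs_L biasL) (use p in auto)
        then show ?thesis
        proof (rule Lp_le_mono_AE[OF _ fm])
          have sn: "sqrt (real n) * sqrt (real n) = real n" "1 \<le> sqrt (real n)" using n by auto
          \<comment> \<open>Next to a fluctuation of order sqrt n the bounded bias only enlarges the
            constant.\<close>
          have "bias \<le> bias * sqrt (real n)" using mult_left_mono[OF sn(2) bias] by simp
          then have "C * sqrt (real n) + bias \<le> (C + bias) * sqrt (real n)" by (simp add: algebra_simps)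
          then have "(C * sqrt (real n) + bias) / real n \<le> (C + bias) * sqrt (real n) / real n" by (rule divide_right_mono) simp
          also have "\<dots> = ?w" using sn n by (simp add: real_div_sqrt field_simps)
          finally show "\<bar>1 / real n\<bar> * (C * sqrt (real n) + bias) \<le> ?w" by simp
          show "AE \<omega> in P. \<bar>f k \<omega>\<bar> \<le> \<bar>(1 / real n) * (\<bar>?X k \<omega>\<bar> + bias)\<bar>"
            using AE_\<Omega>0 AE_space
          proof eventually_elim
            case (elim \<omega>)
            obtain j0 where j0: "j0 < N k" "\<omega> \<in> A k j0" using d(4)[OF elim(2)] by auto
            let ?u = "us k j0"
            have u: "?u \<in> \<Theta>" using d(1)[OF j0(1)] .
            let ?ex = "\<lambda>i. expectation (Phi b chi (int T) ?u (int T + int i) (int T + int n))"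
            have "f k \<omega> = h ?u \<omega>" unfolding f_def by (rule pick[OF j0])
            also have "\<dots> = \<bar>inner (blk chi T n ?u \<omega>) b - inner (mean_stat ?u) b\<bar>" using elim(1) by (simp add: h_def inner_diff_left)
            \<comment> \<open>Fluctuation around the expectations plus the bias of these
              expectations.\<close>
            also have "inner (blk chi T n ?u \<omega>) b - inner (mean_stat ?u) b
               = (1 / real n) * ((\<Sum>i\<in>{1..n}. Dev b chi (int T) n ?u i \<omega>) + (\<Sum>i\<in>{1..n}. ?ex i - inner (mean_stat ?u) b))"
              unfolding block_inner[OF u chi elim(1)] Dev_def sum.distrib[symmetric] using n by (simp add: sum_subtractf field_simps)
            also have "\<bar>\<dots>\<bar> \<le> (1 / real n) * (\<bar>\<Sum>i\<in>{1..n}. Dev b chi (int T) n ?u i \<omega>\<bar> + bias)"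
              unfolding abs_mult
            proof (intro mult_mono order.trans[OF abs_triangle_ineq] add_left_mono)
              show "\<bar>\<Sum>i\<in>{1..n}. ?ex i - inner (mean_stat ?u) b\<bar> \<le> bias"
                by (rule order_trans[OF sum_abs bias_bound[OF u chi b]])
            qed auto
            also have "(\<Sum>i\<in>{1..n}. Dev b chi (int T) n ?u i \<omega>) = ?X k \<omega>"
              by (rule sum.cong) (use pick[OF j0] in auto)
            finally have "f k \<omega> \<le> (1 / real n) * (\<bar>?X k \<omega>\<bar> + bias)" .
            moreover have "0 \<le> f k \<omega>" unfolding f_def h_def by (intro sum_nonneg) auto
            ultimately show ?case by linarith
          qed
        qed (use p in auto)
      qed
      have lim: "(\<lambda>k. f k \<omega>) \<longlonglongrightarrow> h (th \<omega>) \<omega>" if \<omega>: "\<omega> \<in> space P" for \<omega>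
      proof (cases "\<omega> \<in> \<Omega>0")
        case True
        obtain J where J: "\<And>k. J k < N k" "\<And>k. \<omega> \<in> A k (J k)" using d(4)[OF \<omega>] by metis
        have fk: "f k \<omega> = h (us k (J k)) \<omega>" for k unfolding f_def by (rule pick[OF J])
        have us\<Theta>: "us k (J k) \<in> \<Theta>" for k using d(1)[OF J(1)] .
        have usl: "(\<lambda>k. us k (J k)) \<longlonglongrightarrow> th \<omega>"
        proof (rule metric_tendsto_imp_tendsto[of "\<lambda>k. 1 / real (Suc k)" 0])
          show "(\<lambda>k. 1 / real (Suc k)) \<longlonglongrightarrow> 0" using LIMSEQ_inverse_real_of_nat by (simp add: inverse_eq_divide)
          show "\<forall>\<^sub>F k in sequentially. dist (us k (J k)) (th \<omega>) \<le> dist (1 / real (Suc k)) 0"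
            using d(5)[OF J] by (intro always_eventually allI) (simp add: less_imp_le dist_real_def)
        qed
        have t: "th \<omega> \<in> \<Theta>" using th\<Theta> \<omega> by auto
        have "(\<lambda>k. mean_stat (us k (J k))) \<longlonglongrightarrow> mean_stat (th \<omega>)"
          using continuous_on_tendsto_compose[OF cont usl t] us\<Theta> by auto
        then show ?thesis unfolding fk h_def
          by (intro tendsto_mult tendsto_const tendsto_rabs tendsto_inner tendsto_diff block_continuous[OF us\<Theta> usl t chi True])
      next
        case False
        then show ?thesis by (simp add: f_def h_def)
      qed
      have "Lp_le P p (\<lambda>\<omega>. h (th \<omega>) \<omega>) ?w" by (rule Lp_le_limit[OF fL lim]) (use p in auto)
      then show ?thesis by (simp add: h_def)
    qed
    have sumL: "Lp_le P p (\<lambda>\<omega>. \<Sum>b\<in>Basis. indicator \<Omega>0 \<omega> * \<bar>inner (blk chi T n (th \<omega>) \<omega> - mean_stat (th \<omega>)) b\<bar>) (\<Sum>b\<in>(Basis :: 'v set). ?w)"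
      by (rule Lp_le_sum) (use comp p in auto)
    \<comment> \<open>Measurability at the random parameter was obtained coordinate by coordinate,
      as a limit of discretised statistics; the norm is rebuilt from these coordinates.\<close>
    have meas: "(\<lambda>\<omega>. indicator \<Omega>0 \<omega> * norm (blk chi T n (th \<omega>) \<omega> - mean_stat (th \<omega>))) \<in> borel_measurable P"
    proof -
      have e: "indicator \<Omega>0 \<omega> * norm x = sqrt (\<Sum>b\<in>Basis. (indicator \<Omega>0 \<omega> * \<bar>inner x b\<bar>)\<^sup>2)" for \<omega> and x :: 'v
        by (auto simp: indicator_def norm_eq_sqrt_inner euclidean_inner[of x x] power2_eq_square)
      have "(\<lambda>\<omega>. \<Sum>b\<in>Basis. (indicator \<Omega>0 \<omega> * \<bar>inner (blk chi T n (th \<omega>) \<omega> - mean_stat (th \<omega>)) b\<bar>)\<^sup>2) \<in> borel_measurable P"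
        using Lp_leD(1)[OF comp] by (intro borel_measurable_sum borel_measurable_power) auto
      then show ?thesis unfolding e by measurable
    qed
    show "Lp_le P p (\<lambda>\<omega>. indicator \<Omega>0 \<omega> * norm (blk chi T n (th \<omega>) \<omega> - mean_stat (th \<omega>))) (C' / sqrt (real n))"
    proof (rule Lp_le_mono_AE[OF sumL meas])
      show "AE \<omega> in P. \<bar>indicator \<Omega>0 \<omega> * norm (blk chi T n (th \<omega>) \<omega> - mean_stat (th \<omega>))\<bar>
        \<le> \<bar>\<Sum>b\<in>Basis. indicator \<Omega>0 \<omega> * \<bar>inner (blk chi T n (th \<omega>) \<omega> - mean_stat (th \<omega>)) b\<bar>\<bar>"
      proof (rule AE_I2)
        fix \<omega>
        let ?x = "blk chi T n (th \<omega>) \<omega> - mean_stat (th \<omega>)"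
        have "indicator \<Omega>0 \<omega> * norm ?x \<le> indicator \<Omega>0 \<omega> * (\<Sum>b\<in>Basis. \<bar>inner ?x b\<bar>)"
          by (intro mult_left_mono norm_le_l1) auto
        then show "\<bar>indicator \<Omega>0 \<omega> * norm ?x\<bar> \<le> \<bar>\<Sum>b\<in>Basis. indicator \<Omega>0 \<omega> * \<bar>inner ?x b\<bar>\<bar>"
          unfolding sum_distrib_left by (simp add: sum_nonneg)
      qed
      have "real DIM('v) * ?w = real DIM('v) * (C + bias) / sqrt (real n)" by simp
      also have "\<dots> \<le> C' / sqrt (real n)" unfolding C'_def by (intro divide_right_mono) auto
      finally show "(\<Sum>b\<in>(Basis :: 'v set). ?w) \<le> C' / sqrt (real n)" by simp
    qed (use p in auto)
  qed
qed

end

section \<open>Membership of the mean statistic in the convex hull\<close>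

context hmm
begin

lemma path_mass_nonzero:
  assumes u: "u \<in> \<Theta>" and chi: "prob_on lam chi" and rst: "r < s" "s \<le> t" and y: "good y"
  shows "(\<integral>x. path_density m g u r t y x \<partial>path_measure lam chi r t) \<noteq> 0"
proof -
  interpret MK: mixing_kernels lam "kern u y" "\<lambda>j x. g u x (y j)" \<sigma>m \<sigma>p by (rule mixing_kernels_kern[OF u y])
  have "(\<integral>x. path_density m g u r t y x \<partial>path_measure lam chi r t) = smooth_num lam (kern u y) chi r s t (\<lambda>_ _. 1)"
    using MK.smooth_num_path[OF chi bounded_meas2_one rst] by (simp add: path_density_kern)
  then show ?thesis using MK.smooth_num_pos[OF chi, of r s t] by simp
qed

lemma smoothing_diff:
  assumes u: "u \<in> \<Theta>" and chi: "prob_on lam chi" and rst: "r < s" "s \<le> t" and y: "good y"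
    and h: "test_fun h" "\<And>x x'. \<bar>h (x, x', y s)\<bar> \<le> c" and k: "test_fun k" "\<And>x x'. \<bar>k (x, x', y s)\<bar> \<le> d"
  shows "smoothing m g lam chi r u s t (\<lambda>z. h z - k z) y = smoothing m g lam chi r u s t h y - smoothing m g lam chi r u s t k y"
proof -
  have ih: "integrable (path_measure lam chi r t) (\<lambda>x. path_density m g u r t y x *\<^sub>R h (x (s - 1), x s, y s))"
    by (rule path_integrable[OF u chi rst y]) (use h in \<open>auto simp: test_fun_def\<close>)
  have ik: "integrable (path_measure lam chi r t) (\<lambda>x. path_density m g u r t y x *\<^sub>R k (x (s - 1), x s, y s))"
    by (rule path_integrable[OF u chi rst y]) (use k in \<open>auto simp: test_fun_def\<close>)
  have "(\<integral>x. path_density m g u r t y x *\<^sub>R (h (x (s - 1), x s, y s) - k (x (s - 1), x s, y s)) \<partial>path_measure lam chi r t)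
     = (\<integral>x. path_density m g u r t y x *\<^sub>R h (x (s - 1), x s, y s) \<partial>path_measure lam chi r t) - (\<integral>x. path_density m g u r t y x *\<^sub>R k (x (s - 1), x s, y s) \<partial>path_measure lam chi r t)"
    unfolding scaleR_diff_right by (rule Bochner_Integration.integral_diff[OF ih ik])
  then show ?thesis unfolding smoothing_def by (simp only: scaleR_diff_right)
qed

lemma smoothing_const:
  assumes u: "u \<in> \<Theta>" and chi: "prob_on lam chi" and rst: "r < s" "s \<le> t" and y: "good y"
  shows "smoothing m g lam chi r u s t (\<lambda>_. c :: real) y = c"
  using path_mass_nonzero[OF assms] by (simp add: smoothing_def)

end

context observed_hmm
begin

lemma \<Omega>0_nonempty: "\<exists>\<omega>. \<omega> \<in> \<Omega>0"
proof (rule ccontr)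
  assume "\<nexists>\<omega>. \<omega> \<in> \<Omega>0"
  then have "AE \<omega> in P. False" using AE_\<Omega>0 by simp
  then show False by simp
qed

text \<open>\<open>C\<close> need not be closed, so a limit argument is not enough: if \<open>w\<close> supports \<open>C\<close> at the mean statistic,
  comparing the smoothing law with a product measure forces \<open>inner w (S - mean_stat u) = 0\<close> almost everywhere.\<close>

lemma mean_statistic_in_convex:
  assumes u: "u \<in> \<Theta>" and C: "convex C" "range S \<subseteq> C"
  shows "mean_stat u \<in> C"
proof -
  interpret LL: pair_sigma_finite lam lam
    using fin_lam by (intro pair_sigma_finite.intro) (auto simp: finite_measure_def)
  have fLL: "finite_measure (lam \<Otimes>\<^sub>M lam)" by (rule finite_measure_pair_measure[OF fin_lam fin_lam])
  interpret PL: pair_sigma_finite P "lam \<Otimes>\<^sub>M lam"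
    using fLL sigma_finite_measure_axioms by (intro pair_sigma_finite.intro) (auto simp: finite_measure_def)
  let ?N = "P \<Otimes>\<^sub>M (lam \<Otimes>\<^sub>M lam)"
  \<comment> \<open>The statistic at time 0 with both states integrated against \<open>lam\<close>,
    independently of the observations: the reference that takes the place of the smoothing
    law.\<close>
  define Z where "Z = (\<lambda>z. S (fst (snd z), snd (snd z), Y 0 (fst z)))"
  have Zm: "Z \<in> borel_measurable ?N"
  proof -
    have "(\<lambda>z. (fst (snd z), snd (snd z), Y 0 (fst z))) \<in> measurable ?N (lam \<Otimes>\<^sub>M (lam \<Otimes>\<^sub>M mu))"
      by (intro measurable_Pair measurable_compose[OF measurable_snd measurable_fst] measurable_compose[OF measurable_snd measurable_snd]
        measurable_compose[OF measurable_fst Y_meas])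
    from measurable_compose[OF this S_meas] show ?thesis by (simp add: Z_def)
  qed
  obtain \<omega>1 where "\<omega>1 \<in> \<Omega>0" using \<Omega>0_nonempty by auto
  then have "mixing_kernels lam (kern u (\<lambda>k. Y k \<omega>1)) (\<lambda>j x. g u x (Y j \<omega>1)) \<sigma>m \<sigma>p"
    by (intro mixing_kernels_kern[OF u] good_\<Omega>0)
  then have lam_nz: "emeasure lam (space lam) \<noteq> 0" by (rule mixing_kernels.lam_nonzero)
  have Nnz: "emeasure ?N (space ?N) \<noteq> 0"
  proof -
    have "emeasure (lam \<Otimes>\<^sub>M lam) (space lam \<times> space lam) = emeasure lam (space lam) * emeasure lam (space lam)"
      using fin_lam by (intro sigma_finite_measure.emeasure_pair_measure_Times) (auto simp: finite_measure_def)
    moreover have "emeasure ?N (space P \<times> (space lam \<times> space lam)) = emeasure P (space P) * emeasure (lam \<Otimes>\<^sub>M lam) (space lam \<times> space lam)"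
      using fLL by (intro sigma_finite_measure.emeasure_pair_measure_Times) (auto simp: finite_measure_def)
    ultimately show ?thesis using lam_nz by (simp add: space_pair_measure emeasure_space_1)
  qed
  show ?thesis
  proof (rule mem_convex_if_no_supporting_direction[OF Nnz C(1), where Z = Z])
    show "Z z \<in> C" for z using C(2) by (auto simp: Z_def)
    fix w :: 'v
    assume nn: "AE z in ?N. 0 \<le> inner w (Z z - mean_stat u)"
    define s where "s = mean_stat u"
    \<comment> \<open>Positive and negative parts of the height above the supporting hyperplane. The
      comparison with the product measure is available for nonnegative functions, so the parts are
      treated separately; the negative part vanishes almost everywhere by assumption.\<close>
    define h1 where "h1 = (\<lambda>z. max 0 (inner (S z) w - inner s w))"
    define h2 where "h2 = (\<lambda>z. max 0 (inner s w - inner (S z) w))"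
    have t1: "test_fun h1" and t2: "test_fun h2" unfolding test_fun_def h1_def h2_def using S_meas by measurable
    define c where "c = (\<lambda>\<omega>. norm w * (V 0 \<omega> + norm s))"
    have hb: "\<bar>h1 (x, x', Y 0 \<omega>)\<bar> \<le> c \<omega>" "\<bar>h2 (x, x', Y 0 \<omega>)\<bar> \<le> c \<omega>" if "\<omega> \<in> \<Omega>0" for \<omega> x x'
    proof -
      have "\<bar>inner (S (x, x', Y 0 \<omega>) - s) w\<bar> \<le> norm (S (x, x', Y 0 \<omega>) - s) * norm w" by (rule Cauchy_Schwarz_ineq2)
      also have "\<dots> \<le> (V 0 \<omega> + norm s) * norm w"
        using S_le_V_\<Omega>0[OF that, of x x' 0] norm_triangle_ineq4[of "S (x, x', Y 0 \<omega>)" s] by (intro mult_right_mono) auto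
      finally have "\<bar>inner (S (x, x', Y 0 \<omega>)) w - inner s w\<bar> \<le> c \<omega>" by (simp add: c_def inner_diff_left mult.commute)
      then show "\<bar>h1 (x, x', Y 0 \<omega>)\<bar> \<le> c \<omega>" "\<bar>h2 (x, x', Y 0 \<omega>)\<bar> \<le> c \<omega>" unfolding h1_def h2_def by auto
    qed
    have nn2: "AE \<omega> in P. AE z in lam \<Otimes>\<^sub>M lam. h2 (fst z, snd z, Y 0 \<omega>) = 0"
    proof -
      have "AE \<omega> in P. AE z in lam \<Otimes>\<^sub>M lam. 0 \<le> inner w (Z (\<omega>, z) - mean_stat u)" by (rule PL.AE_pair[OF nn])
      then show ?thesis
      proof eventually_elim
        case (elim \<omega>)
        then show ?case by eventually_elim (simp add: h2_def Z_def s_def inner_diff_right inner_commute)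
      qed
    qed
    define L where "L = (\<lambda>\<omega>. inner (lim_stat u \<omega> - s) w)"
    have Li: "integrable P L" unfolding L_def using lim_stat_integrable[OF u] by auto
    have EL: "expectation L = 0"
      unfolding L_def using lim_stat_integrable[OF u] by (simp add: inner_diff_left s_def mean_statistic_def prob_space)
    \<comment> \<open>On almost every path \<open>L\<close> is at least \<open>a\<close>, a positive
      multiple of the pair weight of the positive part. As \<open>L\<close> has mean zero, it
      vanishes almost surely; then so does \<open>a\<close>, and the positive part is zero almost
      everywhere.\<close>
    have key: "AE \<omega> in P. 0 \<le> L \<omega> \<and> (L \<omega> = 0 \<longrightarrow> (AE z in lam \<Otimes>\<^sub>M lam. inner w (Z (\<omega>, z) - s) = 0))"
      using AE_\<Omega>0 nn2 limit_statistic_props(2)[OF u chi0]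
    proof eventually_elim
      case (elim \<omega>)
      let ?y = "\<lambda>k. Y k \<omega>"
      interpret MK: mixing_kernels lam "kern u ?y" "\<lambda>j x. g u x (?y j)" \<sigma>m \<sigma>p
        by (rule mixing_kernels_kern[OF u good_\<Omega>0[OF elim(1)]])
      let ?h1 = "\<lambda>x x'. h1 (x, x', Y 0 \<omega>)" and ?h2 = "\<lambda>x x'. h2 (x, x', Y 0 \<omega>)"
      have b1: "bounded_meas2 lam ?h1 (c \<omega>)" and b2: "bounded_meas2 lam ?h2 (c \<omega>)"
        using test_fun_bounded_meas2[OF t1] test_fun_bounded_meas2[OF t2] hb[OF elim(1)] by blast+
      have p1: "0 \<le> ?h1 x x'" and p2: "0 \<le> ?h2 x x'" for x x' by (auto simp: h1_def h2_def)
      have w2: "MK.pair_weight 0 ?h2 = 0" using MK.pair_weight_zero_iff[OF b2 p2] elim(2) by simp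
      define a where "a = (\<sigma>m / \<sigma>p) ^ 3 * (MK.pair_weight 0 ?h1 / MK.pair_weight 0 (\<lambda>_ _. 1))"
      have pw1: "0 \<le> MK.pair_weight 0 ?h1" unfolding MK.pair_weight_def
        by (rule Bochner_Integration.integral_nonneg) (use MK.G_pos p1 in \<open>simp add: less_imp_le\<close>)
      have a0: "0 \<le> a" unfolding a_def using pw1 MK.pair_weight_1_pos[of 0] \<sigma>_pos by simp
      \<comment> \<open>The comparison uses one further step on each side of the pair of times -1
        and 0, which the window with \<tau> = 0 does not offer.\<close>
      have ge: "a \<le> inner (two_sided chi0 u \<tau> \<omega>) w - inner s w" if \<tau>: "1 \<le> \<tau>" for \<tau> :: nat
      proof -
        have rst: "- int \<tau> - 1 < (0::int)" "0 \<le> int \<tau>" "- int \<tau> - 1 < (0::int) - 1" "0 < int \<tau>" using \<tau> by auto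
        have sr: "smoothing m g lam chi0 (- int \<tau> - 1) u 0 (int \<tau>) h1 ?y = smooth_ratio lam (kern u ?y) chi0 (- int \<tau> - 1) 0 (int \<tau>) ?h1"
          "smoothing m g lam chi0 (- int \<tau> - 1) u 0 (int \<tau>) h2 ?y = smooth_ratio lam (kern u ?y) chi0 (- int \<tau> - 1) 0 (int \<tau>) ?h2"
          using smoothing_eq_ratio[OF u good_\<Omega>0[OF elim(1)] t1 hb(1)[OF elim(1)] chi0 rst(1,2)]
            smoothing_eq_ratio[OF u good_\<Omega>0[OF elim(1)] t2 hb(2)[OF elim(1)] chi0 rst(1,2)] by auto
        have "smooth_ratio lam (kern u ?y) chi0 (- int \<tau> - 1) 0 (int \<tau>) ?h2 \<le> 0"
          using MK.smooth_ratio_pair_weight(2)[OF b2 p2 chi0 rst(3,4)] w2 by simp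
        moreover have "a \<le> smooth_ratio lam (kern u ?y) chi0 (- int \<tau> - 1) 0 (int \<tau>) ?h1"
          unfolding a_def by (rule MK.smooth_ratio_pair_weight(1)[OF b1 p1 chi0 rst(3,4)])
        ultimately have "a \<le> smoothing m g lam chi0 (- int \<tau> - 1) u 0 (int \<tau>) h1 ?y - smoothing m g lam chi0 (- int \<tau> - 1) u 0 (int \<tau>) h2 ?y"
          unfolding sr by linarith
        also have "\<dots> = smoothing m g lam chi0 (- int \<tau> - 1) u 0 (int \<tau>) (\<lambda>z. h1 z - h2 z) ?y"
          by (rule smoothing_diff[OF u chi0 rst(1,2) good_\<Omega>0[OF elim(1)] t1 hb(1)[OF elim(1)] t2 hb(2)[OF elim(1)], symmetric])
        also have "(\<lambda>z. h1 z - h2 z) = (\<lambda>z. inner (S z) w - inner s w)" by (auto simp: h1_def h2_def)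
        also have "smoothing m g lam chi0 (- int \<tau> - 1) u 0 (int \<tau>) \<dots> ?y
           = smoothing m g lam chi0 (- int \<tau> - 1) u 0 (int \<tau>) (\<lambda>z. inner (S z) w) ?y - smoothing m g lam chi0 (- int \<tau> - 1) u 0 (int \<tau>) (\<lambda>_. inner s w) ?y"
        proof (rule smoothing_diff[OF u chi0 rst(1,2) good_\<Omega>0[OF elim(1)], where c = "V 0 \<omega> * norm w" and d = "\<bar>inner s w\<bar>"])
          show "test_fun (\<lambda>z. inner (S z) w)" "test_fun (\<lambda>_. inner s w)" unfolding test_fun_def using S_meas by measurable
          show "\<bar>inner (S (x, x', Y 0 \<omega>)) w\<bar> \<le> V 0 \<omega> * norm w" for x x'
            using Cauchy_Schwarz_ineq2[of "S (x, x', Y 0 \<omega>)" w] S_le_V_\<Omega>0[OF elim(1), of x x' 0]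
            by (meson mult_right_mono norm_ge_zero order_trans)
        qed simp
        also have "\<dots> = inner (two_sided chi0 u \<tau> \<omega>) w - inner s w"
          using smoothing_inner[OF u chi0 rst(1,2) good_\<Omega>0[OF elim(1)], of w] smoothing_const[OF u chi0 rst(1,2) good_\<Omega>0[OF elim(1)]] by simp
        finally show ?thesis .
      qed
      have "a \<le> L \<omega>"
      proof (rule LIMSEQ_le_const)
        show "(\<lambda>\<tau>. inner (two_sided chi0 u \<tau> \<omega>) w - inner s w) \<longlonglongrightarrow> L \<omega>"
          unfolding L_def inner_diff_left by (intro tendsto_intros elim(3))
        show "\<exists>N. \<forall>n\<ge>N. a \<le> inner (two_sided chi0 u n \<omega>) w - inner s w" using ge by blast
      qed
      moreover have "AE z in lam \<Otimes>\<^sub>M lam. inner w (Z (\<omega>, z) - s) = 0" if "L \<omega> = 0"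
      proof -
        have "a = 0" using \<open>a \<le> L \<omega>\<close> a0 that by simp
        then have "MK.pair_weight 0 ?h1 = 0" unfolding a_def using MK.pair_weight_1_pos[of 0] \<sigma>_pos by simp
        then have "AE z in lam \<Otimes>\<^sub>M lam. ?h1 (fst z) (snd z) = 0" using MK.pair_weight_zero_iff[OF b1 p1] by simp
        then show ?thesis using elim(2)
        proof eventually_elim
          case (elim z)
          then have "inner (Z (\<omega>, z)) w = inner s w" by (simp add: h1_def h2_def Z_def max_def split: if_splits)
          then show ?case by (simp add: inner_diff_right inner_commute)
        qed
      qed
      ultimately show ?case using a0 by auto
    qed
    have "AE \<omega> in P. L \<omega> = 0"
      using integral_nonneg_eq_0_iff_AE[OF Li] EL key by (auto elim: eventually_mono)
    then have "AE \<omega> in P. AE z in lam \<Otimes>\<^sub>M lam. inner w (Z (\<omega>, z) - s) = 0"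
      using key by eventually_elim auto
    then show "AE z in ?N. inner w (Z z - mean_stat u) = 0"
      unfolding s_def
    proof (subst (asm) PL.AE_pair_iff)
      show "{x \<in> space ?N. inner w (Z (fst x, snd x) - mean_stat u) = 0} \<in> sets ?N"
        using Zm by measurable
    qed simp
  qed
qed

end

section \<open>Convergence rate\<close>

lemma geometric_times_powr_tendsto:
  fixes q c :: real
  assumes "0 < q" "q < 1"
  shows "(\<lambda>n. q ^ n * real (Suc n) powr c) \<longlonglongrightarrow> 0"
proof -
  define d where "d = - ln q"
  have d: "0 < d" using assms by (simp add: d_def)
  have "(\<lambda>n::nat. exp (- (d * real n)) * real (Suc n) powr c) \<longlonglongrightarrow> 0"
    using d by real_asymp
  moreover have "exp (- (d * real n)) = q ^ n" for n
    using assms by (simp add: d_def powr_realpow[symmetric] powr_def mult.commute)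
  ultimately show ?thesis by simp
qed

text \<open>With q split into two factors sqrt q, one of them keeps the polynomial bounded and the
  other provides a convergent geometric majorant.\<close>

lemma geometric_times_powr_summable:
  fixes q c :: real
  assumes q: "0 < q" "q < 1"
  shows "summable (\<lambda>n. q ^ n * real (Suc n) powr c)"
proof -
  have s: "0 < sqrt q" "sqrt q < 1" using q by auto
  have "Bseq (\<lambda>n. sqrt q ^ n * real (Suc n) powr c)"
    by (rule convergent_imp_Bseq) (use geometric_times_powr_tendsto[OF s, of c] in \<open>auto simp: convergent_def\<close>)
  then obtain B where B: "\<And>n. norm (sqrt q ^ n * real (Suc n) powr c) \<le> B" by (auto simp: Bseq_def)
  have "summable (\<lambda>n. B * sqrt q ^ n)" using s by (intro summable_mult summable_geometric) auto
  then show ?thesis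
  proof (rule summable_comparison_test')
    fix n :: nat
    have "q ^ n = sqrt q ^ n * sqrt q ^ n" using q by (simp add: power_mult_distrib[symmetric])
    then have "norm (q ^ n * real (Suc n) powr c) = sqrt q ^ n * norm (sqrt q ^ n * real (Suc n) powr c)"
      using s by (simp add: abs_mult)
    also have "\<dots> \<le> sqrt q ^ n * B" using B s by (intro mult_left_mono) auto
    finally show "norm (q ^ n * real (Suc n) powr c) \<le> B * sqrt q ^ n" by (simp add: mult.commute)
  qed
qed

text \<open>The sum of the p-th powers has finite expectation, hence is finite almost surely, and
  its terms tend to 0.\<close>

lemma Lp_le_summable_AE_tendsto:
  assumes L: "\<And>n::nat. Lp_le M p (f n) (w n)" and s: "summable (\<lambda>n. w n powr p)" and p: "0 < p"
  shows "AE x in M. (\<lambda>n. f n x) \<longlonglongrightarrow> 0"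
proof -
  have fm[measurable]: "f n \<in> borel_measurable M" for n using Lp_leD(1)[OF L] .
  have "(\<integral>\<^sup>+x. (\<Sum>n. ennreal (\<bar>f n x\<bar> powr p)) \<partial>M) = (\<Sum>n. \<integral>\<^sup>+x. ennreal (\<bar>f n x\<bar> powr p) \<partial>M)"
    by (rule nn_integral_suminf) measurable
  also have "\<dots> \<le> (\<Sum>n. ennreal (w n powr p))"
    by (rule suminf_le) (use Lp_leD(3)[OF L] in auto)
  also have "\<dots> = ennreal (\<Sum>n. w n powr p)" by (rule suminf_ennreal2[OF _ s]) simp
  finally have "(\<integral>\<^sup>+x. (\<Sum>n. ennreal (\<bar>f n x\<bar> powr p)) \<partial>M) \<le> ennreal (\<Sum>n. w n powr p)" .
  from le_less_trans[OF this ennreal_less_top]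
  have "AE x in M. (\<Sum>n. ennreal (\<bar>f n x\<bar> powr p)) \<noteq> \<infinity>"
    by (intro nn_integral_noteq_infinite) auto
  then show ?thesis
  proof eventually_elim
    case (elim x)
    then have "summable (\<lambda>n. \<bar>f n x\<bar> powr p)" by (intro summable_suminf_not_top) auto
    then have "(\<lambda>n. \<bar>f n x\<bar> powr p) \<longlonglongrightarrow> 0" by (rule summable_LIMSEQ_zero)
    then have "(\<lambda>n. (\<bar>f n x\<bar> powr p) powr (1 / p)) \<longlonglongrightarrow> 0 powr (1 / p)"
      using p by (intro tendsto_powr' tendsto_const) auto
    then have "(\<lambda>n. \<bar>f n x\<bar>) \<longlonglongrightarrow> 0" using p by (simp add: powr_powr)
    then show ?case by (simp add: tendsto_rabs_zero_iff)
  qed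
qed

lemma tendsto_const_sets:
  fixes f :: "nat \<Rightarrow> 'a \<Rightarrow> 'b::euclidean_space"
  assumes f[measurable]: "\<And>n. f n \<in> borel_measurable M"
  shows "{x \<in> space M. (\<lambda>n. f n x) \<longlonglongrightarrow> l} \<in> sets M"
proof -
  have e: "(\<lambda>n. f n x) \<longlonglongrightarrow> l \<longleftrightarrow> (\<forall>k::nat. \<exists>N::nat. \<forall>n\<ge>N. dist (f n x) l < 1 / real (Suc k))" for x
  proof
    assume "(\<lambda>n. f n x) \<longlonglongrightarrow> l"
    then show "\<forall>k::nat. \<exists>N::nat. \<forall>n\<ge>N. dist (f n x) l < 1 / real (Suc k)" unfolding lim_sequentially by auto
  next
    assume *: "\<forall>k::nat. \<exists>N::nat. \<forall>n\<ge>N. dist (f n x) l < 1 / real (Suc k)"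
    show "(\<lambda>n. f n x) \<longlonglongrightarrow> l" unfolding lim_sequentially
    proof (intro allI impI)
      fix r :: real assume "0 < r"
      then obtain k where "1 / real (Suc k) < r" by (rule nat_approx_posE)
      with * show "\<exists>N. \<forall>n\<ge>N. dist (f n x) l < r" by (meson less_trans)
    qed
  qed
  show ?thesis unfolding e by measurable
qed

lemma twice_continuously_differentiable_onD:
  assumes "twice_continuously_differentiable_on f A"
  shows "continuous_on A f" and "\<exists>U F F'. open U \<and> A \<subseteq> U \<and> (\<forall>x\<in>A. F x = f x) \<and> (\<forall>x\<in>U. (F has_derivative F' x) (at x))"
proof -
  obtain U F F' where *: "open U" "A \<subseteq> U" "\<forall>x\<in>A. F x = f x" "\<forall>x\<in>U. (F has_derivative blinfun_apply (F' x)) (at x)"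
    using assms unfolding twice_continuously_differentiable_on_def by blast
  then show "\<exists>U F F'. open U \<and> A \<subseteq> U \<and> (\<forall>x\<in>A. F x = f x) \<and> (\<forall>x\<in>U. (F has_derivative F' x) (at x))"
    by (intro exI[of _ U] exI[of _ F] exI[of _ "\<lambda>x. blinfun_apply (F' x)"]) auto
  have "continuous_on A F"
    using * by (intro continuous_at_imp_continuous_on ballI has_derivative_continuous) auto
  then show "continuous_on A f" using *(3) by (simp cong: continuous_on_cong)
qed

text \<open>On the set \<open>A\<close>, which may have empty interior, smoothness of
  \<open>f\<close> refers to an extension. On the open set \<open>B\<close> the composition agrees
  with that of the extension, because \<open>k\<close> maps into \<open>A\<close>; the chain rule
  therefore gives a genuine derivative of \<open>f \<circ> k\<close>, and
  \<open>frechet_derivative\<close> returns it.\<close>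

lemma composition_derivative:
  fixes f :: "'a::euclidean_space \<Rightarrow> 'b::euclidean_space" and k :: "'b \<Rightarrow> 'a"
  assumes f: "twice_continuously_differentiable_on f A" and k: "twice_continuously_differentiable_on k B"
    and B: "open B" "s \<in> B" and kA: "\<And>x. x \<in> B \<Longrightarrow> k x \<in> A"
  shows "\<exists>D. (k has_derivative D) (at s)" "(f \<circ> k has_derivative frechet_derivative (f \<circ> k) (at s)) (at s)"
proof -
  obtain U F F' where F: "open U" "A \<subseteq> U" "\<And>x. x \<in> A \<Longrightarrow> F x = f x" "\<And>x. x \<in> U \<Longrightarrow> (F has_derivative F' x) (at x)"
    using twice_continuously_differentiable_onD(2)[OF f] by blast
  obtain U2 K K' where K: "open U2" "B \<subseteq> U2" "\<And>x. x \<in> B \<Longrightarrow> K x = k x" "\<And>x. x \<in> U2 \<Longrightarrow> (K has_derivative K' x) (at x)"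
    using twice_continuously_differentiable_onD(2)[OF k] by blast
  have dk: "(k has_derivative K' s) (at s)"
    by (rule has_derivative_transform_within_open[OF K(4) B(1,2) K(3)]) (use B K(2) in auto)
  then show "\<exists>D. (k has_derivative D) (at s)" by blast
  have "k s \<in> U" using kA[OF B(2)] F(2) by auto
  then have "(F \<circ> k has_derivative F' (k s) \<circ> K' s) (at s)"
    by (intro diff_chain_at dk F(4))
  then have "(f \<circ> k has_derivative F' (k s) \<circ> K' s) (at s)"
    by (rule has_derivative_transform_within_open[OF _ B]) (use F(3) kA in auto)
  then have "f \<circ> k differentiable (at s)" by (auto simp: differentiable_def)
  then show "(f \<circ> k has_derivative frechet_derivative (f \<circ> k) (at s)) (at s)" using frechet_derivative_works by blast
qed

lemma derivative_local_lipschitz: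
  fixes k :: "'b::euclidean_space \<Rightarrow> 'a::euclidean_space"
  assumes "(k has_derivative D) (at s)"
  shows "\<exists>\<delta>>0. \<exists>L>0. \<forall>x. norm (x - s) < \<delta> \<longrightarrow> norm (k x - k s) \<le> L * norm (x - s)"
proof -
  have "bounded_linear D" using assms by (rule has_derivative_bounded_linear)
  from bounded_linear.pos_bounded[OF this] obtain K where K: "0 < K" "\<And>x. norm (D x) \<le> norm x * K" by blast
  have "\<forall>e>0::real. \<exists>d>0. \<forall>x. norm (x - s) < d \<longrightarrow> norm (k x - k s - D (x - s)) \<le> e * norm (x - s)"
    using assms unfolding has_derivative_at_alt by blast
  from spec[OF this, of 1]
  obtain \<delta> where \<delta>: "0 < \<delta>" "\<And>x. norm (x - s) < \<delta> \<Longrightarrow> norm (k x - k s - D (x - s)) \<le> norm (x - s)" by auto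
  have "norm (k x - k s) \<le> (K + 1) * norm (x - s)" if "norm (x - s) < \<delta>" for x
  proof -
    have "norm (k x - k s) \<le> norm (k x - k s - D (x - s)) + norm (D (x - s))"
      using norm_triangle_sub[of "k x - k s" "D (x - s)"] by simp
    then show ?thesis using \<delta>(2)[OF that] K(2)[of "x - s"] by (simp add: algebra_simps)
  qed
  then show ?thesis using \<delta>(1) K(1) by (intro exI[of _ \<delta>] conjI exI[of _ "K + 1"]) auto
qed

text \<open>Rounding down loses less than 1, and a positive block size is at least 1, so the
  unrounded value is below twice the block size.\<close>

lemma block_size_bounds:
  fixes \<tau> :: "nat \<Rightarrow> nat" and c a :: real
  assumes \<tau>: "\<And>n. n \<ge> 1 \<Longrightarrow> int (\<tau> n) = \<lfloor>c * real n powr a\<rfloor>" "\<And>n. n \<ge> 1 \<Longrightarrow> \<tau> n > 0" and c: "0 < c" and n: "1 \<le> n"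
  shows "c / 2 * real n powr a \<le> real (\<tau> n)" "real (\<tau> n) \<le> c * real n powr a"
proof -
  let ?x = "c * real n powr a"
  have "real (\<tau> n) = of_int \<lfloor>?x\<rfloor>" using \<tau>(1)[OF n] by (metis of_int_of_nat_eq)
  then have *: "real (\<tau> n) \<le> ?x" "?x < real (\<tau> n) + 1" by linarith+
  then show "real (\<tau> n) \<le> ?x" by simp
  have "1 \<le> real (\<tau> n)" using \<tau>(2)[OF n] by simp
  then show "c / 2 * real n powr a \<le> real (\<tau> n)" using * by (simp add: field_simps)
qed

text \<open>The inequality n \<le> (k + 1) (n - k) bounds the ratio by a power of the lag n - k
  alone. Geometric discounting of these ratios can then be summed uniformly in n.\<close>

lemma block_size_ratio:
  fixes \<tau> :: "nat \<Rightarrow> nat" and c a :: real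
  assumes \<tau>: "\<And>n. n \<ge> 1 \<Longrightarrow> int (\<tau> n) = \<lfloor>c * real n powr a\<rfloor>" "\<And>n. n \<ge> 1 \<Longrightarrow> \<tau> n > 0" and c: "0 < c" and a: "0 < a" and k: "k < n"
  shows "sqrt (real (\<tau> n)) / sqrt (real (\<tau> (Suc k))) \<le> sqrt 2 * real (Suc (n - 1 - k)) powr (a / 2)"
proof -
  have n: "1 \<le> n" using k by simp
  have pos: "0 < real (Suc k) powr a" by simp
  have "real n \<le> real (Suc k) * real (n - k)"
  proof -
    have "n \<le> Suc k * (n - k)"
    proof -
      obtain d where "n = Suc (k + d)" using k less_iff_Suc_add by auto
      then show ?thesis by simp
    qed
    then show ?thesis by (metis of_nat_le_iff of_nat_mult)
  qed
  then have "real n powr a \<le> (real (Suc k) * real (n - k)) powr a" using a by (intro powr_mono2) auto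
  also have "\<dots> = real (Suc k) powr a * real (n - k) powr a" by (rule powr_mult)
  finally have 1: "real n powr a \<le> real (Suc k) powr a * real (n - k) powr a" .
  have "real (\<tau> n) / real (\<tau> (Suc k)) \<le> (c * real n powr a) / (c / 2 * real (Suc k) powr a)"
    using block_size_bounds[OF \<tau> c n] block_size_bounds[OF \<tau> c, of "Suc k"] c by (intro frac_le) auto
  also have "\<dots> = 2 * (real n powr a / real (Suc k) powr a)" using c by simp
  also have "\<dots> \<le> 2 * real (n - k) powr a" using 1 pos by (simp add: pos_divide_le_eq mult.commute)
  finally have "sqrt (real (\<tau> n) / real (\<tau> (Suc k))) \<le> sqrt (2 * real (n - k) powr a)" by (rule real_sqrt_le_mono)
  moreover have "sqrt (real (n - k) powr a) = real (n - k) powr (a / 2)"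
    by (simp add: powr_half_sqrt[symmetric] powr_powr)
  moreover have "n - k = Suc (n - 1 - k)" using k by simp
  ultimately show ?thesis by (simp add: real_sqrt_divide real_sqrt_mult)
qed

text \<open>On paths converging to the fixed point, this sum eventually dominates the rescaled parameter error.\<close>

lemma (in prob_space) discounted_sum_Lp:
  fixes \<tau> :: "nat \<Rightarrow> nat" and c a :: real
  assumes \<tau>: "\<And>n. n \<ge> 1 \<Longrightarrow> int (\<tau> n) = \<lfloor>c * real n powr a\<rfloor>" "\<And>n. n \<ge> 1 \<Longrightarrow> \<tau> n > 0" and c: "0 < c" and a: "0 < a"
    and q: "0 < q" "q < 1" and p: "1 \<le> p" and K: "0 \<le> K" and C: "0 \<le> C"
    and f: "\<And>k. Lp_le M p (f k) (C / sqrt (real (\<tau> (Suc k))))"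
  shows "\<exists>w. \<forall>n\<ge>1. Lp_le M p (\<lambda>x. 1 + (K * sqrt (real (\<tau> n))) * (\<Sum>k<n. q ^ (n - 1 - k) * f k x)) w"
proof -
  \<comment> \<open>The leading 1 makes room for the transient. The series runs over j = n - 1 - k
    and converges, so \<open>w\<close> does not depend on n.\<close>
  define w where "w = 1 + K * C * sqrt 2 * (\<Sum>j. q ^ j * real (Suc j) powr (a / 2))"
  have "Lp_le M p (\<lambda>x. 1 + (K * sqrt (real (\<tau> n))) * (\<Sum>k<n. q ^ (n - 1 - k) * f k x)) w" if n: "1 \<le> n" for n
  proof -
    have one: "Lp_le M p (\<lambda>_. 1) 1" by (auto simp: Lp_le_def emeasure_space_1)
    have "Lp_le M p (\<lambda>x. 1 + (K * sqrt (real (\<tau> n))) * (\<Sum>k<n. q ^ (n - 1 - k) * f k x))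
       (1 + \<bar>K * sqrt (real (\<tau> n))\<bar> * (\<Sum>k<n. \<bar>q ^ (n - 1 - k)\<bar> * (C / sqrt (real (\<tau> (Suc k))))))"
      by (intro Lp_le_add one Lp_le_cmult Lp_le_sum f) (use p in auto)
    then show ?thesis
    proof (rule Lp_le_mono_AE)
      have "\<bar>K * sqrt (real (\<tau> n))\<bar> * (\<Sum>k<n. \<bar>q ^ (n - 1 - k)\<bar> * (C / sqrt (real (\<tau> (Suc k)))))
         = K * C * (\<Sum>k<n. q ^ (n - 1 - k) * (sqrt (real (\<tau> n)) / sqrt (real (\<tau> (Suc k)))))"
        using K q by (simp add: sum_distrib_left abs_mult mult_ac)
      also have "\<dots> \<le> K * C * (sqrt 2 * (\<Sum>j. q ^ j * real (Suc j) powr (a / 2)))"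
      proof (rule mult_left_mono)
      have "(\<Sum>k<n. q ^ (n - 1 - k) * (sqrt (real (\<tau> n)) / sqrt (real (\<tau> (Suc k)))))
         \<le> (\<Sum>k<n. q ^ (n - 1 - k) * (sqrt 2 * real (Suc (n - 1 - k)) powr (a / 2)))"
        using q block_size_ratio[OF \<tau> c a] by (intro sum_mono mult_left_mono) auto
      also have "(\<Sum>k<n. q ^ (n - 1 - k) * (sqrt 2 * real (Suc (n - 1 - k)) powr (a / 2)))
         = (\<Sum>j<n. q ^ j * (sqrt 2 * real (Suc j) powr (a / 2)))"
        by (rule sum.reindex_bij_witness[of _ "\<lambda>j. n - 1 - j" "\<lambda>k. n - 1 - k"]) auto
      also have "\<dots> = sqrt 2 * (\<Sum>j<n. q ^ j * real (Suc j) powr (a / 2))" by (simp add: sum_distrib_left mult_ac)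
      also have "\<dots> \<le> sqrt 2 * (\<Sum>j. q ^ j * real (Suc j) powr (a / 2))"
        using q by (intro mult_left_mono sum_le_suminf geometric_times_powr_summable) auto
      finally show "(\<Sum>k<n. q ^ (n - 1 - k) * (sqrt (real (\<tau> n)) / sqrt (real (\<tau> (Suc k)))))
         \<le> sqrt 2 * (\<Sum>j. q ^ j * real (Suc j) powr (a / 2))" .
      qed (use K C in simp)
      finally show "1 + \<bar>K * sqrt (real (\<tau> n))\<bar> * (\<Sum>k<n. \<bar>q ^ (n - 1 - k)\<bar> * (C / sqrt (real (\<tau> (Suc k))))) \<le> w"
        unfolding w_def by (simp only: mult.assoc add_le_cancel_left)
      show "(\<lambda>x. 1 + (K * sqrt (real (\<tau> n))) * (\<Sum>k<n. q ^ (n - 1 - k) * f k x)) \<in> borel_measurable M"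
        using Lp_leD(1)[OF f] by measurable
    qed (use p in auto)
  qed
  then show ?thesis by blast
qed

theorem theorem5p1:
  fixes \<Theta> :: "(real^'q) set"
    and lam :: "'x::topological_space measure"
    and mu :: "'y::topological_space measure"
    and m :: "real^'q \<Rightarrow> 'x \<Rightarrow> 'x \<Rightarrow> real"
    and g :: "real^'q \<Rightarrow> 'x \<Rightarrow> 'y \<Rightarrow> real"
    and P :: "'w measure"
    and Y :: "int \<Rightarrow> 'w \<Rightarrow> 'y"
    and \<phi> :: "real^'q \<Rightarrow> real"
    and \<psi> :: "real^'q \<Rightarrow> real^'d"
    and S :: "'x \<times> 'x \<times> 'y \<Rightarrow> real^'d"
    and \<S> :: "(real^'d) set"
    and \<theta>bar :: "real^'d \<Rightarrow> real^'q"
    and \<tau> :: "nat \<Rightarrow> nat"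
    and chi :: "nat \<Rightarrow> 'x measure"
    and \<theta>0 \<theta>star :: "real^'q"
    and \<theta> :: "nat \<Rightarrow> 'w \<Rightarrow> real^'q"
    and Sn St :: "nat \<Rightarrow> 'w \<Rightarrow> real^'d"
    and H :: "nat \<Rightarrow> 'w measure"
    and pbar p c a b \<gamma> :: real
  assumes pbar: "pbar > 2"
    \<comment> \<open>model\<close>
    and \<Theta>: "compact \<Theta>"
    and lam: "finite_measure lam" "space lam = UNIV"
    and mu: "sigma_finite_measure mu" "space mu = UNIV"
    and m: "\<And>u. u \<in> \<Theta> \<Longrightarrow> transition_density lam lam (m u)"
    and g: "\<And>u. u \<in> \<Theta> \<Longrightarrow> transition_density lam mu (g u)"
    \<comment> \<open>observations\<close>
    and P: "prob_space P"
    and Y: "\<And>k. Y k \<in> measurable P mu"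
    \<comment> \<open>algorithm\<close>
    and \<tau>_pos: "\<And>n. n \<ge> 1 \<Longrightarrow> \<tau> n > 0"
    and chi: "\<And>n. prob_on lam (chi n)"
    and \<theta>0: "\<theta>0 \<in> \<Theta>" "\<And>\<omega>. \<omega> \<in> space P \<Longrightarrow> \<theta> 0 \<omega> = \<theta>0"
    and Sn: "\<And>n \<omega>. \<omega> \<in> space P \<Longrightarrow>
      Sn n \<omega> = block_statistic m g lam S (chi n) (block_end \<tau> n) (\<tau> (n + 1)) (\<theta> n \<omega>) (\<lambda>k. Y k \<omega>)"
    and St: "\<And>n \<omega>. \<omega> \<in> space P \<Longrightarrow> St n \<omega> \<in> \<S>"
    and \<theta>: "\<And>n \<omega>. \<omega> \<in> space P \<Longrightarrow> \<theta> (n + 1) \<omega> = \<theta>bar (St n \<omega>)"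
    and H: "\<And>n. subalgebra P (H n)" "\<And>n. sets (H n) \<subseteq> sets (H (n + 1))"
      "\<And>n. prob_space.indep_set P (sets (H n)) (sets (sigma_obs P mu Y UNIV))"
    and \<theta>_adapted: "\<And>n. \<theta> n \<in> borel_measurable (mc_filtration P mu Y H \<tau> n)"
    and St_adapted: "\<And>n. St n \<in> borel_measurable (mc_filtration P mu Y H \<tau> (n + 1))"
    \<comment> \<open>(1) exponential family\<close>
    and A1a: "continuous_on \<Theta> \<phi>" "continuous_on \<Theta> \<psi>" "continuous_on UNIV S"
      "S \<in> borel_measurable (lam \<Otimes>\<^sub>M (lam \<Otimes>\<^sub>M mu))"
      "\<And>u x x' y. u \<in> \<Theta> \<Longrightarrow> m u x x' > 0 \<and> g u x' y > 0 \<and>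
         ln (m u x x') + ln (g u x' y) = \<phi> u + inner (S (x, x', y)) (\<psi> u)"
    and A1b: "open \<S>" "convex hull (range S) \<subseteq> \<S>"
    and A1c: "continuous_on \<S> \<theta>bar"
      "\<And>s. s \<in> \<S> \<Longrightarrow> is_arg_max (\<lambda>u. \<phi> u + inner s (\<psi> u)) (\<lambda>u. u \<in> \<Theta>) (\<theta>bar s)"
      "\<And>s u'. s \<in> \<S> \<Longrightarrow> is_arg_max (\<lambda>u. \<phi> u + inner s (\<psi> u)) (\<lambda>u. u \<in> \<Theta>) u'
         \<Longrightarrow> u' = \<theta>bar s"
    \<comment> \<open>(2) strong mixing\<close>
    and A2: "\<exists>\<sigma>minus \<sigma>plus. 0 < \<sigma>minus \<and>
      (\<forall>u\<in>\<Theta>. \<forall>x x'. \<sigma>minus \<le> m u x x' \<and> m u x x' \<le> \<sigma>plus)"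
    \<comment> \<open>(3) moments\<close>
    and A3: "(\<lambda>y. SUP (x, x')\<in>UNIV. ennreal (norm (S (x, x', y)) powr pbar)) \<in> borel_measurable mu"
      "(\<integral>\<^sup>+\<omega>. (SUP (x, x')\<in>UNIV. ennreal (norm (S (x, x', Y 0 \<omega>)) powr pbar)) \<partial>P) < \<infinity>"
    \<comment> \<open>(4) observations\<close>
    and A4a: "stationary_process P mu Y"
      "\<exists>C0 \<beta>::real. 0 \<le> C0 \<and> C0 < 1 \<and> 0 < \<beta> \<and> \<beta> < 1 \<and>
         (\<forall>n. beta_mixing P mu Y n \<le> ennreal (C0 * \<beta> ^ n))"
    and A4b: "b_minus \<Theta> g lam \<in> borel_measurable mu" "b_plus \<Theta> g lam \<in> borel_measurable mu"
      "(\<integral>\<^sup>+\<omega>. e2ennreal (\<bar>ln_ennreal (b_minus \<Theta> g lam (Y 0 \<omega>))\<bar> +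
                       \<bar>ln_ennreal (b_plus \<Theta> g lam (Y 0 \<omega>))\<bar>) \<partial>P) < \<infinity>"
    \<comment> \<open>(5) block sizes\<close>
    and A5: "c > 0" "a > 1" "\<And>n. n \<ge> 1 \<Longrightarrow> int (\<tau> n) = \<lfloor>c * real n powr a\<rfloor>"
    \<comment> \<open>(6) Monte Carlo error\<close>
    and A6: "b \<ge> (a + 1) / (2 * a)"
      "\<And>n. integrable P (\<lambda>\<omega>. norm (Sn n \<omega> - St n \<omega>) powr pbar)"
      "(\<lambda>n. Lp_norm P pbar (\<lambda>\<omega>. Sn n \<omega> - St n \<omega>)) \<in> O(\<lambda>n. real (\<tau> (n + 1)) powr (- b))"
    \<comment> \<open>(7) stable fixed point\<close>
    and A7: "\<theta>star \<in> \<Theta>" "\<theta>bar (mean_statistic m g lam S P Y \<theta>star) = \<theta>star"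
      "twice_continuously_differentiable_on (mean_statistic m g lam S P Y) \<Theta>"
      "twice_continuously_differentiable_on \<theta>bar \<S>"
      "0 < \<gamma>" "\<gamma> < 1"
      "spectral_radius (complex_mat_of (jacobian_matrix (mean_statistic m g lam S P Y \<circ> \<theta>bar)
         (mean_statistic m g lam S P Y \<theta>star))) < \<gamma>"
    and p: "2 < p" "p < pbar"
  shows "\<exists>(U :: nat \<Rightarrow> 'w \<Rightarrow> real^'q) (V :: nat \<Rightarrow> 'w \<Rightarrow> real^'q) (A :: nat \<Rightarrow> 'w \<Rightarrow> real).
    bigO_Lp P p U \<and> bigO_Lp P (p / 2) V \<and> bigO_as P A \<and>
    (\<forall>n\<ge>1. \<forall>\<omega>\<in>space P.
       (sqrt (real (\<tau> n)) * indicator {\<omega>. (\<lambda>n. \<theta> n \<omega>) \<longlonglongrightarrow> \<theta>star} \<omega>) *\<^sub>R (\<theta> n \<omega> - \<theta>star)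
       = U n \<omega> + (1 / sqrt (real (\<tau> n)) * A n \<omega>) *\<^sub>R V n \<omega>)"
proof -
  obtain \<sigma>m \<sigma>p0 where \<sigma>: "0 < \<sigma>m" "\<And>u x x'. u \<in> \<Theta> \<Longrightarrow> \<sigma>m \<le> m u x x' \<and> m u x x' \<le> \<sigma>p0" using A2 by blast
  obtain C0 \<beta> where mixing: "0 \<le> C0" "0 < \<beta>" "\<beta> < 1" "\<And>n. beta_mixing P mu Y n \<le> ennreal (C0 * \<beta> ^ n)" using A4a(2) by blast
  \<comment> \<open>The upper mixing bound is enlarged so that it strictly exceeds the lower one,
    which keeps the contraction factor away from 0.\<close>
  define \<sigma>p where "\<sigma>p = \<sigma>p0 + 1"
  have \<sigma>': "\<sigma>m < \<sigma>p" using \<sigma>(2)[OF A7(1), of undefined undefined] unfolding \<sigma>p_def by linarith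
  have \<sigma>'': "\<sigma>m \<le> m u x x' \<and> m u x x' \<le> \<sigma>p" if "u \<in> \<Theta>" for u x x'
    using \<sigma>(2)[OF that, of x x'] unfolding \<sigma>p_def by linarith
  interpret P: prob_space P by (rule P)
  interpret OH: observed_hmm \<Theta> lam mu m g \<phi> \<psi> S \<sigma>m \<sigma>p P Y pbar p C0 \<beta> "chi 0"
    by (intro observed_hmm.intro hmm.intro observed_hmm_axioms.intro \<Theta> lam mu m g A1a \<sigma>(1) \<sigma>' \<sigma>'' P Y A4a(1) mixing A3 p chi)
  let ?M = "mean_statistic m g lam S P Y"
  define l where "l = ?M \<theta>star"
  define G where "G = ?M \<circ> \<theta>bar"
  have \<theta>\<Theta>: "\<theta> n \<omega> \<in> \<Theta>" if "\<omega> \<in> space P" for n \<omega>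
  proof (cases n)
    case 0 then show ?thesis using \<theta>0 that by simp
  next
    case (Suc k) then show ?thesis using \<theta>[OF that, of k] A1c(2)[OF St[OF that, of k]] by (simp add: is_arg_max_def)
  qed
  have \<theta>bar\<Theta>: "\<theta>bar x \<in> \<Theta>" if "x \<in> \<S>" for x using A1c(2)[OF that] by (simp add: is_arg_max_def)
  have filt: "mc_filtration P mu Y H \<tau> n = OH.filt (H n) (int (block_end \<tau> n)) 0" for n
    by (simp add: mc_filtration_def OH.filt_def)
  have noise: "OH.indep_noise (H n)" for n using H(1,3) by (simp add: OH.indep_noise_def)
  have \<theta>m: "\<theta> n \<in> borel_measurable P" and Stm: "St n \<in> borel_measurable P" for n
    using measurable_from_subalg[OF OH.subalgebra_filt[OF noise]] \<theta>_adapted[of n] St_adapted[of n] unfolding filt by blast+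
  have cont: "continuous_on \<Theta> ?M" by (rule twice_continuously_differentiable_onD(1)[OF A7(3)])
  \<comment> \<open>The mean statistic is continuous only on \<Theta>; extended by 0 it is Borel,
    because \<Theta> is closed.\<close>
  have Mm: "(\<lambda>\<omega>. ?M (\<theta> n \<omega>)) \<in> borel_measurable P" for n
  proof -
    have "(\<lambda>x. indicator \<Theta> x *\<^sub>R ?M x) \<in> borel_measurable borel"
      using cont compact_imp_closed[OF \<Theta>] by (intro borel_measurable_continuous_on_indicator) auto
    from measurable_compose[OF \<theta>m this] show ?thesis
      by (rule measurable_cong[THEN iffD1, rotated]) (use \<theta>\<Theta> in simp)
  qed
  \<comment> \<open>Puts the fixed point into the open set where the maximiser is
    differentiable.\<close>
  have lS: "l \<in> \<S>"
    unfolding l_def using OH.mean_statistic_in_convex[OF A7(1) convex_convex_hull[of "range S"] hull_subset] A1b(2) by blast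
  define e where "e = (\<lambda>n \<omega>. St n \<omega> - ?M (\<theta> n \<omega>))"
  have em: "(\<lambda>\<omega>. norm (e n \<omega>)) \<in> borel_measurable P" for n unfolding e_def using Stm Mm by measurable
  have \<tau>1: "1 \<le> real (\<tau> (Suc n))" for n using \<tau>_pos[of "Suc n"] by simp

  \<comment> \<open>The Landau bound holds eventually. The finitely many earlier ratios are added to
    the constant, which is possible because the block sizes are positive.\<close>
  have "\<exists>K1\<ge>0. \<forall>n. Lp_norm P pbar (\<lambda>\<omega>. Sn n \<omega> - St n \<omega>) \<le> K1 * real (\<tau> (n + 1)) powr (- b)"
  proof -
    let ?f = "\<lambda>n. Lp_norm P pbar (\<lambda>\<omega>. Sn n \<omega> - St n \<omega>)" and ?g = "\<lambda>n. real (\<tau> (n + 1)) powr (- b)"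
    obtain c1 where c1: "c1 > 0" "eventually (\<lambda>n. norm (?f n) \<le> c1 * norm (?g n)) sequentially"
      using landau_o.bigE[OF A6(3)] by auto
    then obtain N where N: "\<And>n. N \<le> n \<Longrightarrow> norm (?f n) \<le> c1 * norm (?g n)" by (auto simp: eventually_sequentially)
    have g0: "0 < ?g n" for n using \<tau>1[of n] by simp
    have f0: "0 \<le> ?f n" for n by (simp add: Lp_norm_def)
    define K1 where "K1 = c1 + (\<Sum>n<N. ?f n / ?g n)"
    have s0: "0 \<le> (\<Sum>n<N. ?f n / ?g n)" using f0 g0 by (intro sum_nonneg) (auto simp: less_imp_le)
    have "?f n \<le> K1 * ?g n" for n
    proof (cases "n < N")
      case True
      then have "?f n / ?g n \<le> (\<Sum>n<N. ?f n / ?g n)" using f0 g0 by (intro member_le_sum) (auto simp: less_imp_le)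
      then have "?f n / ?g n \<le> K1" using c1(1) by (simp add: K1_def)
      then show ?thesis using g0[of n] by (simp only: pos_divide_le_eq)
    next
      case False
      then have "?f n \<le> c1 * ?g n" using N[of n] f0[of n] g0[of n] by simp
      also have "\<dots> \<le> K1 * ?g n" using s0 g0[of n] by (intro mult_right_mono) (auto simp: K1_def)
      finally show ?thesis .
    qed
    moreover have "0 \<le> K1" using c1(1) s0 by (simp add: K1_def)
    ultimately show ?thesis by blast
  qed
  then obtain K1 where K1: "0 \<le> K1" "\<And>n. Lp_norm P pbar (\<lambda>\<omega>. Sn n \<omega> - St n \<omega>) \<le> K1 * real (\<tau> (n + 1)) powr (- b)" by blast
  have mc: "Lp_le P p (\<lambda>\<omega>. norm (Sn n \<omega> - St n \<omega>)) (K1 / sqrt (real (\<tau> (Suc n))))" for n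
  proof (rule OH.Lp_le_mono_exponent, rule Lp_leI_integral)
    \<comment> \<open>The exponent \<open>b\<close> is at least 1/2, so the Monte Carlo error is of
      no larger order than the fluctuation of a block.\<close>
    have "1 / 2 \<le> (a + 1) / (2 * a)" using A5(2) by (simp add: field_simps)
    with A6(1) have b2: "1 / 2 \<le> b" by linarith
    let ?I = "\<integral>\<omega>. norm (Sn n \<omega> - St n \<omega>) powr pbar \<partial>P"
    have I0: "0 \<le> ?I" by (rule Bochner_Integration.integral_nonneg) simp
    \<comment> \<open>Measurability of the norm is read off from its integrable power by taking the
      root.\<close>
    have "(\<lambda>\<omega>. (norm (Sn n \<omega> - St n \<omega>) powr pbar) powr (1 / pbar)) \<in> borel_measurable P"
      using borel_measurable_integrable[OF A6(2)[of n]] by measurable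
    then show "(\<lambda>\<omega>. norm (Sn n \<omega> - St n \<omega>)) \<in> borel_measurable P" using pbar by (simp add: powr_powr)
    show "0 \<le> K1 / sqrt (real (\<tau> (Suc n)))" using K1(1) by simp
    show "integrable P (\<lambda>\<omega>. \<bar>norm (Sn n \<omega> - St n \<omega>)\<bar> powr pbar)" using A6(2)[of n] by simp
    have "real (\<tau> (Suc n)) powr (- b) \<le> real (\<tau> (Suc n)) powr (- (1 / 2))"
      using \<tau>1[of n] b2 by (intro powr_mono) auto
    also have "\<dots> = 1 / sqrt (real (\<tau> (Suc n)))" by (simp add: powr_minus powr_half_sqrt inverse_eq_divide)
    finally have "K1 * real (\<tau> (Suc n)) powr (- b) \<le> K1 / sqrt (real (\<tau> (Suc n)))" using mult_left_mono[OF _ K1(1)] by fastforce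
    then have "?I powr (1 / pbar) \<le> K1 / sqrt (real (\<tau> (Suc n)))"
      using K1(2)[of n] unfolding Lp_norm_def by simp
    then have "(?I powr (1 / pbar)) powr pbar \<le> (K1 / sqrt (real (\<tau> (Suc n)))) powr pbar"
      using pbar by (intro powr_mono2) auto
    then show "(\<integral>\<omega>. \<bar>norm (Sn n \<omega> - St n \<omega>)\<bar> powr pbar \<partial>P) \<le> (K1 / sqrt (real (\<tau> (Suc n)))) powr pbar"
      using pbar I0 by (simp add: powr_powr)
  qed
  obtain C2 where C2: "C2 > 0" and blk: "\<And>Hm T n chi th. OH.indep_noise Hm \<Longrightarrow> prob_on lam chi \<Longrightarrow> 1 \<le> n \<Longrightarrow> th \<in> borel_measurable (OH.filt Hm (int T) 0) \<Longrightarrow>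
     (\<forall>\<omega>\<in>space P. th \<omega> \<in> \<Theta>) \<Longrightarrow>
     Lp_le P p (\<lambda>\<omega>. indicator OH.\<Omega>0 \<omega> * norm (block_statistic m g lam S chi T n (th \<omega>) (\<lambda>k. Y k \<omega>) - ?M (th \<omega>))) (C2 / sqrt (real n))"
    using OH.block_deviation[OF cont] by blast
  define C where "C = K1 + C2"
  have C0: "0 \<le> C" using K1(1) C2 by (simp add: C_def)
  \<comment> \<open>Monte Carlo error plus deviation of the exact block statistic, both of order
    \<tau>^(-1/2). The indicator of \<open>\<Omega>0\<close> disappears because that event has
    probability 1.\<close>
  have eL: "Lp_le P p (\<lambda>\<omega>. norm (e n \<omega>)) (C / sqrt (real (\<tau> (Suc n))))" for n
  proof -
    let ?B = "\<lambda>\<omega>. indicator OH.\<Omega>0 \<omega> * norm (block_statistic m g lam S (chi n) (block_end \<tau> n) (\<tau> (Suc n)) (\<theta> n \<omega>) (\<lambda>k. Y k \<omega>) - ?M (\<theta> n \<omega>))"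
    have "Lp_le P p ?B (C2 / sqrt (real (\<tau> (Suc n))))"
      by (rule blk[OF noise[of n] chi]) (use \<tau>_pos[of "Suc n"] \<theta>_adapted[of n] \<theta>\<Theta> in \<open>auto simp: filt\<close>)
    then have "Lp_le P p (\<lambda>\<omega>. norm (Sn n \<omega> - St n \<omega>) + ?B \<omega>) (K1 / sqrt (real (\<tau> (Suc n))) + C2 / sqrt (real (\<tau> (Suc n))))"
      by (intro Lp_le_add mc) (use p in auto)
    then show ?thesis
    proof (rule Lp_le_mono_AE[OF _ em])
      show "AE \<omega> in P. \<bar>norm (e n \<omega>)\<bar> \<le> \<bar>norm (Sn n \<omega> - St n \<omega>) + ?B \<omega>\<bar>"
        using OH.AE_\<Omega>0 AE_space
      proof eventually_elim
        case (elim \<omega>)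
        have "e n \<omega> = (Sn n \<omega> - ?M (\<theta> n \<omega>)) - (Sn n \<omega> - St n \<omega>)" by (simp add: e_def)
        then have "norm (e n \<omega>) \<le> norm (Sn n \<omega> - ?M (\<theta> n \<omega>)) + norm (Sn n \<omega> - St n \<omega>)" using norm_triangle_ineq4 by metis
        then show ?case using elim(1) Sn[OF elim(2), of n] by simp
      qed
    qed (use p in \<open>auto simp: C_def add_divide_distrib\<close>)
  qed
  have e0: "AE \<omega> in P. (\<lambda>n. norm (e n \<omega>)) \<longlonglongrightarrow> 0"
  proof (rule Lp_le_summable_AE_tendsto[where w = "\<lambda>n. C / sqrt (real (\<tau> (Suc n)))" and p = p, OF eL])
    \<comment> \<open>The p-th powers of the norm bounds decay like n^(- a p / 2), with exponent
      beyond 1 since a > 1 and p > 2. So the errors tend to 0 almost surely.\<close>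
    have ap: "1 < a * (p / 2)" using mult_strict_mono[of 1 a 1 "p / 2"] A5(2) p(1) by simp
    have "summable (\<lambda>n. real n powr (- (a * (p / 2))))" using ap by (simp add: summable_real_powr_iff)
    then have "summable (\<lambda>n. real (Suc n) powr (- (a * (p / 2))))" by (simp only: summable_Suc_iff[where f = "\<lambda>n. real n powr (- (a * (p / 2)))"])
    from summable_mult[OF this, of "C powr p * (c / 2) powr (- (p / 2))"] show "summable (\<lambda>n. (C / sqrt (real (\<tau> (Suc n)))) powr p)"
    proof (rule summable_comparison_test')
      fix n :: nat
      have "sqrt (real (\<tau> (Suc n))) powr p = real (\<tau> (Suc n)) powr (p / 2)"
        unfolding powr_half_sqrt[symmetric, OF of_nat_0_le_iff] powr_powr by simp
      then have "(C / sqrt (real (\<tau> (Suc n)))) powr p = C powr p * real (\<tau> (Suc n)) powr (- (p / 2))"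
        using C0 by (simp add: powr_divide powr_minus_divide)
      also have "\<dots> \<le> C powr p * (c / 2 * real (Suc n) powr a) powr (- (p / 2))"
        using block_size_bounds(1)[OF A5(3) \<tau>_pos A5(1), of "Suc n"] A5(1) p by (intro mult_left_mono powr_mono2') auto
      also have "\<dots> = C powr p * (c / 2) powr (- (p / 2)) * real (Suc n) powr (- (a * (p / 2)))"
        using A5(1) by (simp only: powr_mult powr_powr mult.assoc mult_minus_right)
      finally show "norm ((C / sqrt (real (\<tau> (Suc n)))) powr p) \<le> C powr p * (c / 2) powr (- (p / 2)) * real (Suc n) powr (- (a * (p / 2)))" by simp
    qed
  qed (use p in auto)

  have dG: "(G has_derivative frechet_derivative G (at l)) (at l)" and "\<exists>D. (\<theta>bar has_derivative D) (at l)"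
    unfolding G_def using composition_derivative[OF A7(3,4) A1b(1) lS \<theta>bar\<Theta>] by auto
  then obtain \<delta>2 L\<theta> where lip: "0 < \<delta>2" "0 < L\<theta>" "\<And>x. norm (x - l) < \<delta>2 \<Longrightarrow> norm (\<theta>bar x - \<theta>bar l) \<le> L\<theta> * norm (x - l)"
    using derivative_local_lipschitz by blast
  have fixl: "\<theta>bar l = \<theta>star" using A7(2) by (simp add: l_def)
  have Gl: "G l = l" by (simp add: G_def fixl) (simp add: l_def)
  let ?J = "jacobian_matrix G l"
  have J: "(\<lambda>x. ?J *v x) = frechet_derivative G (at l)"
    unfolding jacobian_matrix_def by (rule matrix_vector_mul(2)[OF has_derivative_linear[OF dG]])
  have "spectral_radius (complex_mat_of ?J) < \<gamma>" using A7(7) by (simp add: G_def l_def)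
  from matrix_power_bound[OF this A7(5)] obtain c3 where c3: "0 \<le> c3" "\<And>k x. norm ((frechet_derivative G (at l) ^^ k) x) \<le> c3 * \<gamma> ^ k * norm x"
    unfolding J by blast
  obtain nrm \<delta> q Cn where ct: "0 < \<delta>" "0 < q" "q < 1" "0 < Cn" "\<And>x. norm x \<le> nrm x \<and> nrm x \<le> Cn * norm x"
    "\<And>x y. nrm (x + y) \<le> nrm x + nrm y" "\<And>x. norm (x - l) < \<delta> \<Longrightarrow> nrm (G x - l) \<le> q * nrm (x - l)"
    using local_contraction_in_adapted_norm[OF dG Gl c3(2) A7(5,6) c3(1)] by blast

  define E where "E = {\<omega>. (\<lambda>n. \<theta> n \<omega>) \<longlonglongrightarrow> \<theta>star}"
  define X where "X = (\<lambda>n \<omega>. (sqrt (real (\<tau> n)) * indicator E \<omega>) *\<^sub>R (\<theta> n \<omega> - \<theta>star))"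
  \<comment> \<open>The 1 is reserved for the rescaled transient, which is eventually below it;
    L\<theta> carries errors of the statistics over to the parameters, and Cn compares the adapted
    norm with the Euclidean one.\<close>
  define W where "W = (\<lambda>n \<omega>. 1 + (L\<theta> * Cn * sqrt (real (\<tau> n))) * (\<Sum>k<n. q ^ (n - 1 - k) * norm (e k \<omega>)))"
  have Xm: "X n \<in> borel_measurable P" for n
  proof -
    have "{\<omega> \<in> space P. \<omega> \<in> E} \<in> sets P" unfolding E_def mem_Collect_eq by (rule tendsto_const_sets[OF \<theta>m])
    then have "indicat_real {\<omega> \<in> space P. \<omega> \<in> E} \<in> borel_measurable P" by simp
    then have "(indicator E :: _ \<Rightarrow> real) \<in> borel_measurable P"
      by (rule measurable_cong[THEN iffD1, rotated]) (simp add: indicator_def)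
    then show ?thesis unfolding X_def using \<theta>m by measurable
  qed
  have "0 < a" using A5(2) by simp
  obtain w where WL: "\<And>n. 1 \<le> n \<Longrightarrow> Lp_le P p (W n) w"
    using P.discounted_sum_Lp[OF A5(3) \<tau>_pos A5(1) \<open>0 < a\<close> ct(2,3) _ _ C0 eL, of "L\<theta> * Cn"] p lip(2) ct(4) unfolding W_def by auto
  have ev: "AE \<omega> in P. eventually (\<lambda>n. norm (X n \<omega>) \<le> W n \<omega>) sequentially"
    using e0 AE_space
  proof eventually_elim
    case (elim \<omega>)
    have W0: "0 \<le> W n \<omega>" for n
      unfolding W_def using lip(2) ct by (intro add_nonneg_nonneg mult_nonneg_nonneg sum_nonneg) auto
    show ?case
    proof (cases "\<omega> \<in> E")
      case False
      then show ?thesis using W0 by (simp add: X_def)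
    next
      case True
      \<comment> \<open>The shift makes the parameter of index n the image of \<open>s n\<close>.
        This holds from n = 1 on, because the initial parameter is prescribed.\<close>
      define s where "s = (\<lambda>n. St (n - 1) \<omega>)"
      have \<theta>s: "\<theta> n \<omega> = \<theta>bar (s n)" if "1 \<le> n" for n using \<theta>[OF elim(2), of "n - 1"] that by (simp add: s_def)
      have ss: "s (Suc n) = G (s n) + e n \<omega>" if "1 \<le> n" for n
        using \<theta>s[OF that] by (simp add: s_def e_def G_def)
      \<comment> \<open>The event speaks of the parameters, whereas contraction takes place in the
        space of statistics: continuity of the mean statistic and vanishing errors transfer the
        convergence.\<close>
      have "(\<lambda>n. ?M (\<theta> n \<omega>)) \<longlonglongrightarrow> l"
        unfolding l_def using True \<theta>\<Theta>[OF elim(2)] A7(1) by (intro continuous_on_tendsto_compose[OF cont]) (auto simp: E_def)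
      from tendsto_add[OF this tendsto_norm_zero_cancel[OF elim(1)]] have "(\<lambda>n. s (Suc n)) \<longlonglongrightarrow> l" by (simp add: s_def e_def)
      then have lim: "s \<longlonglongrightarrow> l" by (rule LIMSEQ_imp_Suc)
      obtain B N where BN: "\<And>n. N \<le> n \<Longrightarrow> norm (s n - l) \<le> B * q ^ n + Cn * (\<Sum>k<n. q ^ (n - 1 - k) * norm (e k \<omega>))"
        using perturbed_contraction_bound[OF ct(2,3,4,1,5,6,7) ss lim] by blast
      have "eventually (\<lambda>n. norm (s n - l) < \<delta>2) sequentially"
        using tendstoD[OF lim lip(1)] by (simp add: dist_norm)
      \<comment> \<open>The transient B q^n beats the rescaling, which grows only like n^(a/2). As
        \<open>B\<close> depends on the path, so does the index from which this holds.\<close>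
      moreover have "eventually (\<lambda>n. sqrt c * L\<theta> * B * (q ^ n * real (Suc n) powr (a / 2)) < 1) sequentially"
      proof (rule order_tendstoD(2))
        show "(\<lambda>n. sqrt c * L\<theta> * B * (q ^ n * real (Suc n) powr (a / 2))) \<longlonglongrightarrow> sqrt c * L\<theta> * B * 0"
          by (intro tendsto_mult tendsto_const geometric_times_powr_tendsto ct)
      qed simp
      moreover have "eventually (\<lambda>n. max N 1 \<le> n) sequentially" by (rule eventually_ge_at_top)
      ultimately show ?thesis
      proof eventually_elim
        case (elim n)
        then have n: "N \<le> n" "1 \<le> n" by auto
        let ?\<Sigma> = "\<Sum>k<n. q ^ (n - 1 - k) * norm (e k \<omega>)"
        have "norm (X n \<omega>) = sqrt (real (\<tau> n)) * norm (\<theta>bar (s n) - \<theta>bar l)"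
          using True by (simp add: X_def \<theta>s[OF n(2)] fixl)
        also have "\<dots> \<le> sqrt (real (\<tau> n)) * (L\<theta> * (B * q ^ n + Cn * ?\<Sigma>))"
          using lip(3)[OF elim(1)] BN[OF n(1)] lip(2) by (intro mult_left_mono) (auto intro: order_trans mult_left_mono)
        also have "\<dots> = sqrt (real (\<tau> n)) * (L\<theta> * B * q ^ n) + (L\<theta> * Cn * sqrt (real (\<tau> n))) * ?\<Sigma>" by (simp add: algebra_simps)
        also have "sqrt (real (\<tau> n)) * (L\<theta> * B * q ^ n) \<le> 1"
        \<comment> \<open>The bound obtained above does not fix the sign of \<open>B\<close>, and
          the estimate of the block size can only be multiplied by a nonnegative factor.\<close>
        proof (cases "0 \<le> B")
          case True
          have "real (\<tau> n) \<le> c * real n powr a" by (rule block_size_bounds(2)[OF A5(3) \<tau>_pos A5(1) n(2)])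
          also have "\<dots> \<le> c * real (Suc n) powr a" using A5 by (intro mult_left_mono powr_mono2) auto
          finally have "sqrt (real (\<tau> n)) \<le> sqrt (c * real (Suc n) powr a)" by (rule real_sqrt_le_mono)
          also have "\<dots> = sqrt c * real (Suc n) powr (a / 2)" by (simp add: real_sqrt_mult powr_half_sqrt[symmetric] powr_powr)
          finally have "sqrt (real (\<tau> n)) * (L\<theta> * B * q ^ n) \<le> sqrt c * real (Suc n) powr (a / 2) * (L\<theta> * B * q ^ n)"
            using True lip(2) ct(2) by (intro mult_right_mono) auto
          also have "\<dots> = sqrt c * L\<theta> * B * (q ^ n * real (Suc n) powr (a / 2))" by (simp only: mult_ac)
          also have "\<dots> < 1" by (rule elim(2))
          finally show ?thesis by simp
        next
          case False
          then have "L\<theta> * B * q ^ n \<le> 0" using lip(2) ct(2) by (simp add: mult_le_0_iff)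
          then have "sqrt (real (\<tau> n)) * (L\<theta> * B * q ^ n) \<le> 0" by (rule mult_nonneg_nonpos[rotated]) simp
          then show ?thesis by simp
        qed
        finally show ?case by (simp add: W_def)
      qed
    qed
  qed
  have "0 < p" using p by simp
  show ?thesis using P.stochastic_decomposition[OF Xm WL ev \<tau>_pos \<open>0 < p\<close>] unfolding X_def E_def .
qed

end
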